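(* Let $D\subset\mathbb{C}^m$ be a bounded taut domain with boundary of class $\mathcal{C}^{1,1}$. Let $(D_n)_{n\in\mathbb{N}}$ be a sequence of bounded domains in $\mathbb{C}^m$ such that $$\lim_{n\rightarrow\infty}\mathfrak{H}(\overline{D}_n,\overline{D})=0.$$ Assume that for each compact $K\subset D$ there exists an $n_0\in\mathbb{N}$ such that $K\subset D_n$ for every $n\geq n_0$. Then for any $z,w\in D$ $$\lim_{n\rightarrow\infty}\boldsymbol{k}_{D_n}(z,w)=\boldsymbol{k}_D(z,w)$$ and $$\lim_{n\rightarrow\infty}\boldsymbol{l}_{D_n}(z,w)=\boldsymbol{l}_D(z,w).$$
   Context: A domain is a nonempty connected open subset of some $\mathbb{C}^n$. $\mathbb{D}$ is the open unit disc in $\mathbb{C}$, and $\boldsymbol{p}$ is the hyperbolic distance on $\mathbb{D}$, normalized by $\tanh\boldsymbol{p}(a,b)=\left|\frac{a-b}{1-\overline{a}b}\right|$. $\mathcal{O}(D,G)$ is the set of holomorphic mappings $D\to G$. A domain $D$ is taut if $\mathcal{O}(\mathbb{D},D)$ is a normal family: every sequence in it has a subsequence that either converges locally uniformly to an element of $\mathcal{O}(\mathbb{D},D)$ or diverges locally uniformly (i.e. is compactly divergent). Lempert function of a domain $D$: for $z,w\in D$, $$\boldsymbol{l}_D(z,w):=\inf\{\boldsymbol{p}(0,\lambda):\lambda\in\mathbb{D},\ \text{there exists }\varphi\in\mathcal{O}(\mathbb{D},D)\text{ with }\varphi(0)=z,\ \varphi(\lambda)=w\}.$$ Kobayashi pseudodistance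 of a domain $D$: for $z,w\in D$, $$\boldsymbol{k}_D(z,w):=\inf\Big\{\sum_{j=1}^N\boldsymbol{l}_D(z_{j-1},z_j):N\in\mathbb{N},\ z_0,z_1,\ldots,z_N\in D,\ z_0=z,\ z_N=w\Big\}.$$ Hausdorff distance: for nonempty bounded sets $A,B\subset\mathbb{C}^m$, $\mathfrak{H}(A,B):=\inf\{\delta>0: A\subset B^{(\delta)}\text{ and }B\subset A^{(\delta)}\}$, where $S^{(\varepsilon)}:=\bigcup_{s\in S}\mathbb{B}(s,\varepsilon)$ and $\mathbb{B}(x,r)$ is the open Euclidean ball of center $x$ and radius $r$. The limits are taken over those $n$ large enough that $z,w\in D_n$ (which by the hypotheses holds for all sufficiently large $n$). *)

theory Defs
  imports "HOL-Analysis.Analysis"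
begin

abbreviation unit_disc :: "complex set" where
  "unit_disc \<equiv> ball 0 1"

definition domain :: "(complex ^ 'm) set \<Rightarrow> bool" where
  "domain D \<longleftrightarrow> open D \<and> connected D \<and> D \<noteq> {}"

definition hyp_dist :: "complex \<Rightarrow> complex \<Rightarrow> real" where
  "hyp_dist a b = artanh (cmod ((a - b) / (1 - cnj a * b)))"

(* Maps are total functions; only their values on the disc matter. *)
definition discs_in :: "(complex ^ 'm) set \<Rightarrow> (complex \<Rightarrow> complex ^ 'm) set" where
  "discs_in D = {f. (\<forall>i. (\<lambda>t. f t $ i) holomorphic_on unit_disc) \<and> f ` unit_disc \<subseteq> D}"

(* Locally uniform convergence and divergence on the disc are expressed through compact subsets. *)
definition taut :: "(complex ^ 'm) set \<Rightarrow> bool" where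
  "taut D \<longleftrightarrow>
    (\<forall>f :: nat \<Rightarrow> complex \<Rightarrow> complex ^ 'm. (\<forall>n. f n \<in> discs_in D) \<longrightarrow>
      (\<exists>s :: nat \<Rightarrow> nat. strict_mono s \<and>
        ((\<exists>g \<in> discs_in D. \<forall>K. compact K \<and> K \<subseteq> unit_disc \<longrightarrow>
            uniform_limit K (\<lambda>n. f (s n)) g sequentially) \<or>
         (\<forall>K L. compact K \<and> K \<subseteq> unit_disc \<and> compact L \<and> L \<subseteq> D \<longrightarrow>
            (\<forall>\<^sub>F n in sequentially. f (s n) ` K \<inter> L = {})))))"

(* For a domain D and points z, w of D the set below is nonempty and bounded below by 0,
   so the real infimum is the genuine one.  For other arguments the value carries no meaning. *)
definition lempert :: "(complex ^ 'm) set \<Rightarrow> complex ^ 'm \<Rightarrow> complex ^ 'm \<Rightarrow> real" where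
  "lempert D z w =
    Inf {hyp_dist 0 t | t. t \<in> unit_disc \<and> (\<exists>\<phi> \<in> discs_in D. \<phi> 0 = z \<and> \<phi> t = w)}"

definition kobayashi :: "(complex ^ 'm) set \<Rightarrow> complex ^ 'm \<Rightarrow> complex ^ 'm \<Rightarrow> real" where
  "kobayashi D z w =
    Inf {(\<Sum>j=1..N. lempert D (p (j - 1)) (p j)) | (N :: nat) (p :: nat \<Rightarrow> complex ^ 'm).
      N \<ge> 1 \<and> (\<forall>j\<le>N. p j \<in> D) \<and> p 0 = z \<and> p N = w}"

definition hausdorff_dist :: "'a::metric_space set \<Rightarrow> 'a set \<Rightarrow> real" where
  "hausdorff_dist A B =
    Inf {\<delta>. \<delta> > 0 \<and> A \<subseteq> (\<Union>b\<in>B. ball b \<delta>) \<and> B \<subseteq> (\<Union>a\<in>A. ball a \<delta>)}"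

(* Near each boundary point D has a local defining function r with Lipschitz gradient g
   (in the sense of the underlying real inner product) that does not vanish on the boundary;
   the condition on r > 0 puts D locally on one side of its boundary. *)
definition C11_boundary :: "'a::euclidean_space set \<Rightarrow> bool" where
  "C11_boundary D \<longleftrightarrow>
    (\<forall>a \<in> frontier D. \<exists>U r g L. open U \<and> a \<in> U \<and>
      (\<forall>x\<in>U. GDERIV r x :> g x) \<and> L-lipschitz_on U g \<and>
      (\<forall>x \<in> U \<inter> frontier D. g x \<noteq> 0) \<and>
      D \<inter> U = {x \<in> U. r x < 0} \<and> U - closure D = {x \<in> U. r x > 0})"

end

theory Submission
 imports Defs "HOL-Complex_Analysis.Riemann_Mapping" "HOL-Complex_Analysis.Great_Picard"
  "HOL-Real_Asymp.Real_Asymp" "HOL-Computational_Algebra.Polynomial"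
begin

text \<open>
  The Lempert half rests on normal families. A disc in D shrinks into a compact subset of D and so
  lies in D_n for large n; this bounds the limit superior. For the limit inferior, discs in the D_n
  subconverge to a disc in the closure of D. Since the boundary is of class C^{1,1}, the closure can
  be pushed into D locally by a constant vector, and tautness then forces such a limit disc to lie
  either in D or in the boundary (lemma taut_cl_disc_dichotomy). A limit disc through z lies in D.

  For the Kobayashi distance the chains may have more and more links, so there is no limit chain.
  A chain in D_n of length less than L is instead read as a path parametrised by hyperbolic length
  (disc_path_kobayashi). These paths are uniformly Lipschitz and subconverge to a path on [0, L] in
  the closure of D whose velocities are convex combinations of derivatives of discs in the closure
  (limit_path_exists). Inside D such a path bounds the Kobayashi distance by its parameter length,
  because infinitesimal rates of the Kobayashi distance are convex. The path may, however, run along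
  the boundary, and it has to be lifted into D without becoming longer.

  Let phi be a disc in the boundary and N the inward unit normal. The continuity principle, valid by
  tautness, shows that N \<circ> phi has a holomorphic conormal: some positive multiple of its conjugate is
  holomorphic (bdisc_local_conormal, conormal_lift_global). Solving a Bezout equation for this
  conormal yields, for every vector u at phi 0, a holomorphic field psi along phi with psi 0 = u whose
  normal component is a positive multiple of that of u (boundary_lift). If u points inwards, the disc
  phi + s psi lies in D for small s > 0. So a boundary path displaced by s u can be
  followed inside D at the speed of the original path, provided that u moves along with psi.

  The danger is that the complex normal component of u rotates until u no longer points inwards. Along a single
  boundary disc its phase is constant, but the velocities are convex combinations, and N is only
  Lipschitz, so phase changes along different discs cannot be added directly. The remedy is second
  order flatness: for a tangential field psi along phi the defining function along phi + y psi has
  derivative o(y) (second_order_flatness). It is proved by a blow-up at scale y, whose limit is a bounded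
  function on the plane with the sub-mean value property, hence constant. For fixed y this derivative is linear in
  the pair of derivatives of phi and psi, so the estimate passes to convex combinations and controls
  the phase (transport_along_frontier). The tangential part of u costs nothing as s tends to 0
  (tangential_reset), and a change of its modulus is absorbed in s. Up to arbitrarily small errors the
  phase changes only where the path enters the boundary, and there by as little as the time step allows.
  Concatenating short steps gives
  kobayashi_le_path_length, and with it the limit inferior.
\<close>

section \<open>Lempert functions and limits of discs\<close>

abbreviation scl (infixr "*R" 75) where "c *R x \<equiv> c *\<^sub>R x"

abbreviation seq_lim (infix "---->" 60) where "f ----> l \<equiv> f \<longlonglongrightarrow> l"

abbreviation eventually_seq (binder "EVS " 10) where "eventually_seq P \<equiv> eventually P sequentially"

lemmas scaleR_complex = scaleR_conv_of_real[where 'a = complex]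

lemma artanh_real_mono:
 fixes x y :: real
 assumes "0 <= x" "x <= y" "y < 1"
 shows "artanh x <= artanh y"
proof -
 have "(1 + x) / (1 - x) <= (1 + y) / (1 - y)"
  using assms by (intro frac_le) auto
 moreover have "0 < (1 + x) / (1 - x)"
  using assms by (intro divide_pos_pos) auto
 ultimately show ?thesis
  unfolding artanh_def by simp
qed

lemma hyp_dist_zero_left: "hyp_dist 0 t = artanh (cmod t)"
 by (simp add: hyp_dist_def)

lemma hyp_dist_zero_nonneg: "t : unit_disc ==> 0 <= hyp_dist 0 t"
 using artanh_real_mono[of 0 "cmod t"] by (simp add: hyp_dist_zero_left)

lemma lempert_bdd_below:
 "bdd_below {hyp_dist 0 t | t. t : unit_disc & (EX phi : discs_in D. phi 0 = z & phi t = w)}"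
 using hyp_dist_zero_nonneg by (intro bdd_belowI[of _ 0]) blast

lemma lempert_le:
 assumes "phi : discs_in D" "phi 0 = z" "phi t = w" "t : unit_disc"
 shows "lempert D z w <= hyp_dist 0 t"
 unfolding lempert_def
 by (rule cInf_lower[OF _ lempert_bdd_below]) (use assms in blast)

lemma lempert_approx:
 assumes "psi : discs_in D" "psi 0 = z" "psi s = w" "s : unit_disc" "lempert D z w < c"
 obtains phi t where "phi : discs_in D" "phi 0 = z" "phi t = w" "t : unit_disc" "hyp_dist 0 t < c"
proof -
 have "{hyp_dist 0 t | t. t : unit_disc & (EX phi : discs_in D. phi 0 = z & phi t = w)} ~= {}"
  using assms by blast
 from cInf_lessD[OF this] assms(5) show ?thesis
  unfolding lempert_def using that by blast
qed

text \<open>Complexifying a real polynomial path makes it a holomorphic curve; this is what turns paths into discs.\<close>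
lemma polynomial_function_complexification:
 fixes g :: "real => complex ^ 'm"
 assumes "polynomial_function g"
 obtains h where "!!i. (%t. h t $ i) holomorphic_on UNIV" "!!x. h (of_real x) = g x"
proof -
 have "EX p. p holomorphic_on UNIV & (ALL x. p (of_real x) = g x $ i)" for i
 proof -
  have "real_polynomial_function (%x. Re (g x $ i))" "real_polynomial_function (%x. Im (g x $ i))"
   using assms unfolding polynomial_function_def o_def
   by (auto intro!: bounded_linear_compose[OF bounded_linear_Re bounded_linear_vec_nth]
     bounded_linear_compose[OF bounded_linear_Im bounded_linear_vec_nth])
  then obtain a n b k where a: "(%x. Re (g x $ i)) = (%x. \<Sum>j\<le>n. a j * x ^ j)"
   and b: "(%x. Im (g x $ i)) = (%x. \<Sum>j\<le>k. b j * x ^ j)"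
   using real_polynomial_function_imp_sum by (metis (no_types))
  define p where "p t = (\<Sum>j\<le>n. of_real (a j) * t ^ j) + \<i> * (\<Sum>j\<le>k. of_real (b j) * t ^ j)" for t :: complex
  have "p holomorphic_on UNIV"
   unfolding p_def by (intro holomorphic_intros)
  moreover have "p (of_real x) = g x $ i" for x
   using fun_cong[OF a, of x] fun_cong[OF b, of x]
   by (simp add: p_def complex_eq_iff flip: of_real_power of_real_mult of_real_sum)
  ultimately show ?thesis by blast
 qed
 then obtain p where p: "!!i. p i holomorphic_on UNIV" "!!i x. p i (of_real x) = g x $ i"
  by metis
 show ?thesis
  by (rule that[of "%t. \<chi> i. p i t"]) (use p in \<open>auto simp: vec_eq_iff\<close>)
qed

lemma holomorphic_vec_imp_continuous_on:
 fixes f :: "complex => complex ^ 'm"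
 assumes "!!i. (%t. f t $ i) holomorphic_on S"
 shows "continuous_on S f"
proof -
 have "continuous_on S (%t. \<chi> i. f t $ i)"
  by (intro continuous_intros holomorphic_on_imp_continuous_on assms)
 thus ?thesis by simp
qed

text \<open>A polynomial path joins the points. Its complexification maps a convex neighbourhood of the segment [0,1] into D, and the Riemann map of that neighbourhood turns it into a disc.\<close>
lemma domain_disc_through:
 assumes "domain D" "z : D" "w : D"
 obtains phi t where "phi : discs_in D" "phi 0 = z" "phi t = w" "t : unit_disc"
proof -
 have D: "open D" "connected D" using assms(1) by (auto simp: domain_def)
 obtain g where g: "polynomial_function g" "path_image g <= D" "pathstart g = z" "pathfinish g = w"
  using connected_open_polynomial_connected[OF D assms(2,3)] by blast
 obtain h where h: "!!i. (%t. h t $ i) holomorphic_on UNIV" "!!x. h (of_real x) = g x"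
  using polynomial_function_complexification[OF g(1)] by blast
 define I where "I = closed_segment (0::complex) 1"
 have I: "compact I" "convex I" by (auto simp: I_def)
 have hI: "h ` I <= D"
 proof -
  have "h (of_real x) : D" if "x : {0..1}" for x
   using g(2) that h(2) by (auto simp: path_image_def)
  thus ?thesis by (auto simp: I_def closed_segment_def scaleR_conv_of_real)
 qed
 have ch: "continuous_on UNIV h" using holomorphic_vec_imp_continuous_on h(1) by blast
 have "open (h -` D)" using ch D(1) by (simp add: open_vimage continuous_on_eq_continuous_at)
 moreover have "I <= h -` D" using hI by blast
 ultimately obtain e where e: "e > 0" "(\<Union>x\<in>I. ball x e) <= h -` D"
  using compact_subset_open_imp_ball_epsilon_subset[OF I(1)] by metis
 define V where "V = (\<Union>x\<in>I. ball x e)"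
 have V_sum: "V = {x + y | x y. x : I & y : ball 0 e}"
 proof -
  have vV: "v : V \<longleftrightarrow> (EX x:I. v - x : ball 0 e)" for v
   by (simp add: V_def dist_norm norm_minus_commute)
  show ?thesis
  proof (intro set_eqI iffI)
   fix v assume "v : V"
   then obtain x where "x : I" "v - x : ball 0 e" using vV by blast
   thus "v : {x + y | x y. x : I & y : ball 0 e}"
    by (intro CollectI exI[of _ x] exI[of _ "v - x"]) simp
  next
   fix v assume "v : {x + y | x y. x : I & y : ball 0 e}"
   then obtain x y where "v = x + y" "x : I" "y : ball 0 e" by blast
   thus "v : V" unfolding vV by (intro bexI[of _ x]) simp_all
  qed
 qed
 have "convex V"
  using convex_sums[OF I(2) convex_ball[of 0 e]] unfolding V_sum
  by (rule back_subst[of convex]) blast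
 moreover have "open V" by (auto simp: V_def)
 moreover have "V ~= UNIV"
 proof -
  obtain B where B: "!!x. x : I ==> norm x <= B" using compact_imp_bounded[OF I(1)] bounded_iff by metis
  have "norm v <= B + e" if vV: "v : V" for v
  proof -
   obtain x where "x : I" "dist x v < e" using vV by (auto simp: V_def)
   thus ?thesis using B[of x] norm_triangle_ineq2[of v x] by (simp add: dist_norm norm_minus_commute)
  qed
  hence "bounded V" unfolding bounded_iff by blast
  thus ?thesis using not_bounded_UNIV by metis
 qed
 moreover have V01: "0 : V" "1 : V"
  using e(1) unfolding V_def I_def by (auto intro: bexI[of _ 0] bexI[of _ 1])
 ultimately obtain F G where FG: "G holomorphic_on ball 0 1"
  "!!z. z : V ==> F z : ball 0 1 & G (F z) = z" "!!z. z : ball 0 1 ==> G z : V"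
  using Riemann_mapping_theorem[of V] convex_imp_simply_connected by blast
 define a b where "a = F 0" and "b = F 1"
 have ab: "norm a < 1" "norm b < 1" "G a = 0" "G b = 1"
  using FG(2) V01 by (auto simp: a_def b_def)
 define M where "M = Moebius_function 0 (-a)"
 have M: "M holomorphic_on ball 0 1" "M ` ball 0 1 <= ball 0 1" "M 0 = a"
  using ab by (auto simp: M_def Moebius_function_holomorphic Moebius_function_norm_lt_1
    Moebius_function_of_zero)
 define t where "t = Moebius_function 0 a b"
 have t: "t : unit_disc" using ab by (simp add: t_def Moebius_function_norm_lt_1)
 have Mt: "M t = b"
  unfolding M_def t_def using ab by (intro Moebius_function_compose) auto
 define phi where "phi = (%t. h (G (M t)))"
 have "(%t. phi t $ i) holomorphic_on unit_disc" for i
 proof -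
  have "(%t. G (M t)) holomorphic_on unit_disc"
   using holomorphic_on_compose_gen[OF M(1) FG(1) M(2)] by (simp add: o_def)
  from holomorphic_on_compose_gen[OF this h(1)[of i]] show ?thesis
   by (simp add: o_def phi_def)
 qed
 moreover have "phi ` unit_disc <= D"
  using M(2) FG(3) e(2) by (fastforce simp: phi_def V_def[symmetric])
 ultimately have "phi : discs_in D" by (simp add: discs_in_def)
 moreover have "phi 0 = z" "phi t = w"
  using h(2)[of 0] h(2)[of 1] g(3,4) M(3) Mt ab by (auto simp: phi_def pathstart_def pathfinish_def)
 ultimately show ?thesis using that t by blast
qed

text \<open>A nearly optimal disc, slightly shrunk, has compact image in D and is therefore a disc in D_n; the parameter of w grows only slightly.\<close>
lemma lempert_eventually_less:
 assumes "domain D" "z : D" "w : D" "lempert D z w < c"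
  and exh: "!!K. compact K ==> K <= D ==> EX n0. ALL n>=n0. K <= Dn n"
 shows "EVS n. lempert (Dn n) z w < c"
proof -
 obtain psi s where "psi : discs_in D" "psi 0 = z" "psi s = w" "s : unit_disc"
  using domain_disc_through[OF assms(1-3)] .
 then obtain phi t where phi: "phi : discs_in D" "phi 0 = z" "phi t = w" "t : unit_disc" "hyp_dist 0 t < c"
  using lempert_approx assms(4) by metis
 have t1: "cmod t < 1" using phi(4) by simp
 have "((%r. artanh (cmod t / r)) \<longlongrightarrow> artanh (cmod t / 1)) (at_left 1)"
  using t1 by (intro tendsto_intros) (auto intro: less_le_trans[of _ 0])
 hence "\<forall>\<^sub>F r in at_left 1. artanh (cmod t / r) < c"
  using phi(5) by (intro order_tendstoD(2)) (auto simp: hyp_dist_zero_left)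
 moreover have "\<forall>\<^sub>F r in at_left (1::real). r : {cmod t<..<1}"
  using t1 by (rule eventually_at_left_real)
 ultimately have "\<forall>\<^sub>F r in at_left (1::real). artanh (cmod t / r) < c & r : {cmod t<..<1}"
  by eventually_elim auto
 then obtain r where r: "artanh (cmod t / r) < c" "cmod t < r" "r < 1"
  using eventually_happens'[of "at_left (1::real)"] by auto
 have r0: "r > 0" using r(2) by (smt (verit) norm_ge_zero)
 have hol: "!!i. (%t. phi t $ i) holomorphic_on unit_disc" and im: "phi ` unit_disc <= D"
  using phi(1) by (auto simp: discs_in_def)
 have cr: "cball 0 r <= unit_disc" using r(3) by auto
 have "compact (phi ` cball 0 r)"
  using continuous_on_subset[OF holomorphic_vec_imp_continuous_on[OF hol] cr]
  by (rule compact_continuous_image) auto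
 moreover have "phi ` cball 0 r <= D" using cr im by blast
 ultimately obtain n0 where n0: "ALL n>=n0. phi ` cball 0 r <= Dn n" using exh by blast
 define \<eta> where "\<eta> = (%u. phi (of_real r * u))"
 have sc: "(%u. of_real r * u) ` unit_disc <= cball 0 r"
  using r0 by (auto simp: norm_mult mult_left_le)
 have "lempert (Dn n) z w < c" if "n >= n0" for n
 proof -
  have "(%u. \<eta> u $ i) holomorphic_on unit_disc" for i
   using holomorphic_on_compose_gen[of "%u. of_real r * u" unit_disc "%t. phi t $ i" unit_disc]
    hol sc cr by (force simp: o_def \<eta>_def intro: holomorphic_intros)
  moreover have "\<eta> ` unit_disc <= Dn n"
   using sc n0 that by (force simp: \<eta>_def)
  ultimately have "\<eta> : discs_in (Dn n)" by (simp add: discs_in_def)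
  moreover have "\<eta> 0 = z" "\<eta> (t / of_real r) = w" using phi r0 by (auto simp: \<eta>_def)
  moreover have "t / of_real r : unit_disc" using r0 r(2) by (simp add: norm_divide)
  ultimately have "lempert (Dn n) z w <= hyp_dist 0 (t / of_real r)" by (rule lempert_le)
  also have "... < c" using r(1) r0 by (simp add: hyp_dist_zero_left norm_divide)
  finally show ?thesis .
 qed
 thus ?thesis by (auto simp: eventually_sequentially)
qed

lemma norm_vec_le_sum:
 fixes x :: "'a::real_normed_vector ^ 'm"
 shows "norm x <= (\<Sum>i\<in>UNIV. norm (x $ i))"
 unfolding norm_vec_def by (rule L2_set_le_sum) auto

lemma uniform_limit_vec:
 fixes f :: "nat => 'b => 'a::real_normed_vector ^ 'm"
 assumes "!!i. uniform_limit K (%n t. f n t $ i) (%t. g t $ i) sequentially"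
 shows "uniform_limit K f g sequentially"
proof (rule uniform_limitI)
 fix e :: real assume "e > 0"
 hence e': "e / CARD('m) > 0" by simp
 have "EVS n. ALL i:UNIV. ALL t:K. dist (f n t $ i) (g t $ i) < e / CARD('m)"
  using uniform_limitD[OF assms e'] by (intro eventually_ball_finite) auto
 thus "EVS n. ALL t:K. dist (f n t) (g t) < e"
 proof eventually_elim
  case (elim n)
  show ?case
  proof
   fix t assume "t : K"
   have "dist (f n t) (g t) <= (\<Sum>i\<in>UNIV. norm (f n t $ i - g t $ i))"
    unfolding dist_norm using norm_vec_le_sum[of "f n t - g t"] by simp
   also have "... < (\<Sum>i\<in>(UNIV::'m set). e / CARD('m))"
    using elim \<open>t : K\<close> by (intro sum_strict_mono) (auto simp: dist_norm)
   finally show "dist (f n t) (g t) < e" by simp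
  qed
 qed
qed

lemma Montel_vec:
 fixes f :: "nat => complex => complex ^ 'm"
 assumes "open S" and hol: "!!n i. (%t. f n t $ i) holomorphic_on S"
  and bnd: "!!n t. t : S ==> norm (f n t) <= B"
 obtains g s where "!!i. (%t. g t $ i) holomorphic_on S" "strict_mono (s :: nat => nat)"
  "!!K. compact K ==> K <= S ==> uniform_limit K (%n. f (s n)) g sequentially"
proof -
 have "EX g s. strict_mono (s :: nat => nat) & (ALL i:J. g i holomorphic_on S &
   (ALL K. compact K --> K <= S --> uniform_limit K (%n t. f (s n) t $ i) (g i) sequentially))"
  if "finite J" for J :: "'m set"
  using that
 proof induction
  case empty
  show ?case by (auto intro: exI[of _ id] strict_mono_id)
 next
  case (insert j J)
  then obtain g s where s: "strict_mono (s :: nat => nat)" and g: "!!i. i : J ==> g i holomorphic_on S"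
   "!!i K. i : J ==> compact K ==> K <= S ==> uniform_limit K (%n t. f (s n) t $ i) (g i) sequentially"
   by metis
  define H where "H = range (%n t. f (s n) t $ j)"
  have bndH: "EX C. ALL h:H. ALL z:K. norm (h z) <= C" if "compact K" "K <= S" for K
  proof (intro exI[of _ B] ballI)
   fix h z assume "h : H" "z : K"
   then obtain n where "h = (%t. f (s n) t $ j)" by (auto simp: H_def)
   moreover have "norm (f (s n) z $ j) <= norm (f (s n) z)" by (rule Finite_Cartesian_Product.norm_nth_le)
   ultimately show "norm (h z) <= B" using bnd[of z "s n"] that \<open>z : K\<close> by fastforce
  qed
  obtain k r where k: "k holomorphic_on S" "strict_mono (r :: nat => nat)"
   "!!K. compact K ==> K <= S ==> uniform_limit K ((%n t. f (s n) t $ j) \<circ> r) k sequentially"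
   by (rule Montel[OF assms(1), of H "%n t. f (s n) t $ j"]) (use hol bndH in \<open>auto simp: H_def\<close>)
  have "uniform_limit K (%n t. f (s (r n)) t $ i) (g i) sequentially"
   if "i : J" "compact K" "K <= S" for i K
   using filterlim_compose[OF g(2)[OF that] filterlim_subseq[OF k(2)]] by simp
  thus ?case
   using insert.hyps g(1) k(1,3) strict_mono_o[OF s k(2)]
   by (intro exI[of _ "g(j := k)"] exI[of _ "s \<circ> r"]) (auto simp: o_def)
 qed
 from this[of UNIV] obtain g s where s: "strict_mono (s :: nat => nat)" and g: "!!i. g i holomorphic_on S"
  "!!i K. compact K ==> K <= S ==> uniform_limit K (%n t. f (s n) t $ i) (g i) sequentially"
  by (metis UNIV_I finite_class.finite_UNIV)
 show ?thesis
 proof (rule that[of "%t. \<chi> i. g i t" s])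
  fix K assume "compact K" "K <= S"
  thus "uniform_limit K (%n. f (s n)) (%t. \<chi> i. g i t) sequentially"
   by (intro uniform_limit_vec) (use g(2) in auto)
 qed (use g s in auto)
qed

text \<open>One constant vector, minus the gradient at the boundary point, moves all nearby points of the closure into D. This turns discs in the closure into limits of discs in D, to which tautness applies.\<close>
lemma C11_boundary_inward_shift:
 fixes D :: "'a::euclidean_space set"
 assumes "C11_boundary D" "a : frontier D"
 obtains v e where "e > 0" "!!x s. x : closure D ==> dist x a < e ==> 0 < s ==> s < e ==> x + s *R v : D"
proof -
 obtain U r g L where U: "open U" "a : U" and r': "ALL x:U. GDERIV r x :> g x"
  and L: "L-lipschitz_on U g" and nz': "ALL x:U \<inter> frontier D. g x ~= 0"
  and D: "D \<inter> U = {x : U. r x < 0}" "U - closure D = {x : U. r x > 0}"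
  using bspec[OF assms(1)[unfolded C11_boundary_def] assms(2)]
  by (elim exE conjE) (rule that; assumption)
 note r = bspec[OF r'] and nz = bspec[OF nz']
 define v where "v = - g a"
 have ga: "g a ~= 0" using nz U(2) assms(2) by blast
 have "isCont g a"
  using lipschitz_on_continuous_on[OF L] U continuous_on_eq_continuous_at by blast
 hence "((%x. v \<bullet> g x) \<longlongrightarrow> v \<bullet> g a) (at a)"
  by (intro tendsto_intros) (simp add: isCont_def)
 moreover have "v \<bullet> g a < 0" using ga by (simp add: v_def)
 ultimately have "\<forall>\<^sub>F x in at a. v \<bullet> g x < 0" by (rule order_tendstoD(2))
 hence "\<forall>\<^sub>F x in nhds a. v \<bullet> g x < 0"
  using \<open>v \<bullet> g a < 0\<close> by (simp add: eventually_nhds_conv_at)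
 then obtain d where d: "d > 0" "!!x. dist x a < d ==> v \<bullet> g x < 0"
  by (auto simp: eventually_nhds_metric)
 obtain d' where d': "d' > 0" "ball a d' <= U" using U openE by blast
 define m where "m = min d d'"
 define e where "e = m / (2 + norm v)"
 have m: "m > 0" using d d' by (simp add: m_def)
 have e: "e > 0" using m by (auto simp: e_def intro!: divide_pos_pos add_pos_nonneg)
 have em: "e + e * norm v < m"
 proof -
  have "e * (2 + norm v) = m" by (simp add: e_def) (smt (verit) norm_ge_zero)
  thus ?thesis using e by (simp add: algebra_simps)
 qed
 show ?thesis
 proof (rule that[OF e])
  fix x s assume x: "x : closure D" "dist x a < e" and s: "0 < s" "s < e"
  have near: "dist (x + t *R v) a < m" if "0 <= t" "t <= s" for t
  proof -
   have "dist (x + t *R v) a <= dist (x + t *R v) x + dist x a" by (rule dist_triangle)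
   also have "dist (x + t *R v) x = t * norm v" using that by (simp add: dist_norm)
   also have "... <= e * norm v" using that s by (intro mult_right_mono) auto
   finally show ?thesis using em x by linarith
  qed
  have inU: "x + t *R v : U" if "0 <= t" "t <= s" for t
   using near[OF that] d'(2) by (auto simp: m_def dist_commute)
  have "r x <= 0" using D(2) x(1) inU[of 0] s by force
  have der: "((%t. r (x + t *R v)) has_real_derivative (v \<bullet> g (x + t *R v))) (at t)"
   if "0 <= t" "t <= s" for t
  proof -
   have "(r has_derivative (%h. h \<bullet> g (x + t *R v))) (at (x + t *R v))"
    using r[OF inU[OF that]] by (simp add: gderiv_def)
   moreover have "((%t. x + t *R v) has_derivative (%h. h *R v)) (at t)"
    by (auto intro!: derivative_eq_intros)
   ultimately have "((%t. r (x + t *R v)) has_derivative (%h. (h *R v) \<bullet> g (x + t *R v))) (at t)"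
    by (rule has_derivative_compose[rotated])
   thus ?thesis by (simp add: has_field_derivative_def mult.commute[of _ "v \<bullet> _"])
  qed
  have "r (x + s *R v) < r (x + 0 *R v)"
   by (rule DERIV_neg_imp_decreasing[OF s(1)]) (use der near d(2) in \<open>force simp: m_def\<close>)
  hence "x + s *R v : {x : U. r x < 0}" using \<open>r x <= 0\<close> inU[of s] s by simp
  thus "x + s *R v : D" using D(1) by blast
 qed
qed

lemma uniform_limit_imp_tendsto_at:
 assumes "uniform_limit K f g F" "x : K"
 shows "((%n. f n x) \<longlongrightarrow> g x) F"
 using assms by (rule tendsto_uniform_limitI)

text \<open>Discs in the closure are the limits that discs in the approximating domains can have.\<close>
abbreviation hol :: "(complex => complex ^ 'm) => 'm => complex set => bool" where
 "hol f i S \<equiv> (%z. f z $ i) holomorphic_on S"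

definition cl_discs :: "(complex ^ 'm) set => (complex => complex ^ 'm) set" where
 "cl_discs D = {f. (ALL i. hol f i unit_disc) & f ` unit_disc <= closure D}"

lemma cl_discsD:
 assumes "phi : cl_discs D"
 shows "hol phi i unit_disc" "t : unit_disc ==> phi t : closure D"
  "continuous_on unit_disc phi"
 using assms holomorphic_vec_imp_continuous_on[of phi unit_disc] unfolding cl_discs_def by blast+

lemma discs_inD:
 assumes "phi : discs_in D"
 shows "hol phi i unit_disc" "t : unit_disc ==> phi t : D"
  "continuous_on unit_disc phi"
 using assms holomorphic_vec_imp_continuous_on[of phi unit_disc] unfolding discs_in_def by blast+

lemma cl_discs_affine:
 assumes "phi : cl_discs D" "cball c rho <= unit_disc" "rho >= 0"
 shows "(%u. phi (c + of_real rho * u)) : cl_discs D"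
proof -
 have sub: "(%u. c + of_real rho * u) ` unit_disc <= unit_disc"
 proof (rule order_trans[OF _ assms(2)], clarify)
  fix u :: complex assume "u : unit_disc"
  hence "rho * cmod u <= rho" using assms(3) by (simp add: mult_left_le)
  thus "c + of_real rho * u : cball c rho"
   using assms(3) by (simp add: dist_norm norm_mult)
 qed
 have aff: "(%u. c + of_real rho * u) holomorphic_on unit_disc"
  by (intro holomorphic_intros)
 have "(%u. phi (c + of_real rho * u) $ i) holomorphic_on unit_disc" for i
  using aff holomorphic_on_compose_gen[of "%u. c + of_real rho * u" unit_disc "%t. phi t $ i" unit_disc]
   assms(1) sub by (auto simp: cl_discs_def o_def intro: holomorphic_intros)
 moreover have "(%u. phi (c + of_real rho * u)) ` unit_disc <= closure D"
  using cl_discsD(2)[OF assms(1)] sub by blast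
 ultimately show ?thesis unfolding cl_discs_def by blast
qed

text \<open>The parameters with value in D form an open set. It is also closed: near a limit point with value in the boundary, the disc is a uniform limit of inward shifts, which are discs in D, and by tautness a limit of such discs that meets D lies in D. The unit disc is connected.\<close>
lemma taut_cl_disc_dichotomy:
 fixes D :: "(complex ^ 'm) set"
 assumes "open D" "taut D" "C11_boundary D" and phi: "phi : cl_discs D"
 shows "phi ` unit_disc <= D \<or> phi ` unit_disc <= frontier D"
proof -
 have cont: "continuous_on unit_disc phi"
  using phi by (intro holomorphic_vec_imp_continuous_on) (auto simp: cl_discs_def)
 define E where "E = unit_disc \<inter> phi -` D"
 have "open E"
  unfolding E_def using cont assms(1) by (intro continuous_open_preimage) auto
 have clos: "t : E" if t: "t : unit_disc" "t : closure E" for t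
 proof (rule ccontr)
  assume "t \<notin> E"
  hence "phi t \<notin> D" using t by (auto simp: E_def)
  moreover have "phi t : closure D" using phi t by (auto simp: cl_discs_def)
  ultimately have fr: "phi t : frontier D"
   using assms(1) by (simp add: frontier_def interior_open)
  obtain v e where v: "e > 0" "!!x s. x : closure D ==> dist x (phi t) < e ==> 0 < s ==> s < e ==> x + s *R v : D"
   using C11_boundary_inward_shift[OF assms(3) fr] by metis
  obtain d1 where d1: "d1 > 0" "!!u. u : unit_disc ==> dist u t < d1 ==> dist (phi u) (phi t) < e"
   using cont t(1) v(1) unfolding continuous_on_iff by metis
  obtain d2 where d2: "d2 > 0" "cball t d2 <= unit_disc"
   using t(1) open_contains_cball_eq[OF open_ball] by blast
  define rho where "rho = min (d1/2) d2"
  have rho: "rho > 0" "rho < d1" "cball t rho <= unit_disc"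
   using d1 d2 by (auto simp: rho_def)
  define f where "f = (%u. phi (t + of_real rho * u))"
  have f: "f : cl_discs D" unfolding f_def using cl_discs_affine[OF phi] rho by auto
  have fnear: "dist (f u) (phi t) < e" if "u : unit_disc" for u
  proof -
   have "rho * cmod u <= rho" using that rho(1) by (simp add: mult_left_le)
   hence "dist (t + of_real rho * u) t <= rho" using rho(1) by (simp add: dist_norm norm_mult)
   moreover from this have "t + of_real rho * u : unit_disc" using rho(3) by (auto simp: dist_commute)
   ultimately show ?thesis using d1(2) rho(2) by (auto simp: f_def)
  qed
  define s where "s n = e / (real n + 2)" for n
  have s: "0 < s n" "s n < e" for n
  proof -
   have "e * 1 < e * (real n + 2)" using v(1) by (intro mult_strict_left_mono) auto
   thus "0 < s n" "s n < e" using v(1) by (auto simp: s_def divide_less_eq)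
  qed
  have s0: "s ----> 0"
   unfolding s_def by real_asymp
  define F where "F n u = f u + s n *R v" for n u
  have FD: "F n : discs_in D" for n
  proof -
   have "hol (F n) i unit_disc" for i
    unfolding F_def using f by (auto simp: cl_discs_def intro!: holomorphic_intros)
   moreover have "F n u : D" if "u : unit_disc" for u
    unfolding F_def using v(2)[OF cl_discsD(2)[OF f that] fnear[OF that] s] .
   ultimately show ?thesis unfolding discs_in_def by blast
  qed
  have Flim: "(%n. F n u) ----> f u" for u
   unfolding F_def using tendsto_add[OF tendsto_const[of "f u"] tendsto_scaleR[OF s0 tendsto_const[of v]]] by simp
  obtain r where r: "strict_mono r" and
   alt: "(EX g : discs_in D. ALL K. compact K & K <= unit_disc -->
      uniform_limit K (%n. F (r n)) g sequentially) \<or>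
     (ALL K L. compact K & K <= unit_disc & compact L & L <= D -->
      (EVS n. F (r n) ` K \<inter> L = {}))"
   using assms(2) FD unfolding taut_def by metis
  have Frlim: "(%n. F (r n) u) ----> f u" for u
   using LIMSEQ_subseq_LIMSEQ[OF Flim r] by (simp add: o_def)
  have "E \<inter> ball t rho ~= {}"
   using t(2) rho(1) by (metis open_ball open_Int_closure_eq_empty centre_in_ball Int_commute disjoint_iff)
  then obtain p where p: "p : E" "dist t p < rho" by auto
  define u where "u = (p - t) / of_real rho"
  have u: "u : unit_disc" "f u = phi p"
   using p(2) rho(1) by (auto simp: u_def f_def norm_divide dist_norm norm_minus_commute)
  have "f u : D" using p(1) u(2) by (simp add: E_def)
  then obtain q where q: "q > 0" "cball (f u) q <= D" using assms(1) open_contains_cball by metis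
  have "EVS n. dist (F (r n) u) (f u) < q"
   using Frlim q(1) by (rule tendstoD)
  hence "\<not> (EVS n. F (r n) ` {u} \<inter> cball (f u) q = {})"
  proof (rule contrapos_pn)
   assume "EVS n. F (r n) ` {u} \<inter> cball (f u) q = {}"
   with \<open>EVS n. dist (F (r n) u) (f u) < q\<close>
   have "EVS n. False"
    by eventually_elim (auto simp: dist_commute)
   thus "\<not> (EVS n. dist (F (r n) u) (f u) < q)" by simp
  qed
  hence "\<not> (ALL K L. compact K & K <= unit_disc & compact L & L <= D -->
      (EVS n. F (r n) ` K \<inter> L = {}))"
   using u(1) q(2) by (intro notI) (drule spec[of _ "{u}"], drule spec[of _ "cball (f u) q"], simp)
  with alt obtain g where g: "g : discs_in D"
   and g': "ALL K. compact K & K <= unit_disc --> uniform_limit K (%n. F (r n)) g sequentially"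
   by blast
  have "g 0 = f 0"
   using uniform_limit_imp_tendsto_at[OF mp[OF spec[OF g', of "{0}"]]] Frlim[of 0]
   by (intro LIMSEQ_unique) auto
  moreover have "g 0 : D" using g(1) by (auto simp: discs_in_def)
  ultimately show False using \<open>phi t \<notin> D\<close> by (simp add: f_def)
 qed
 have "E = {} \<or> E = unit_disc"
 proof -
  have "openin (top_of_set unit_disc) E" using \<open>open E\<close> by (intro open_subset) (auto simp: E_def)
  moreover have "closedin (top_of_set unit_disc) E"
   unfolding closedin_closed using clos closure_subset[of E]
   by (intro exI[of _ "closure E"]) (auto simp: E_def)
  ultimately show ?thesis
   using connected_clopen[of unit_disc] connected_ball by (metis convex_ball convex_connected)
 qed
 thus ?thesis
 proof
  assume "E = {}"
  hence "phi ` unit_disc <= closure D - D" using phi by (auto simp: E_def cl_discs_def)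
  thus ?thesis using assms(1) by (auto simp: frontier_def interior_open)
 next
  assume "E = unit_disc"
  thus ?thesis by (auto simp: E_def)
 qed
qed

lemma hausdorff_dist_lessD:
 fixes A B :: "'a::metric_space set"
 assumes "hausdorff_dist A B < \<delta>" "A ~= {}" "B ~= {}" "bounded A" "bounded B" "x : A"
 obtains y where "y : B" "dist x y < \<delta>"
proof -
 define S where "S = {\<delta>. \<delta> > 0 & A <= (\<Union>b\<in>B. ball b \<delta>) & B <= (\<Union>a\<in>A. ball a \<delta>)}"
 obtain a b where ab: "a : A" "b : B" using assms by blast
 obtain M where M: "!!x y. x : A \<union> B ==> y : A \<union> B ==> dist x y <= M"
  using bounded_two_points[of "A \<union> B"] assms(4,5) by auto
 have "0 <= M" using M[of a a] ab by simp
 hence "M + 1 : S" using M ab by (force simp: S_def)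
 hence "S ~= {}" by blast
 moreover have "Inf S < \<delta>" using assms(1) by (simp add: hausdorff_dist_def S_def)
 ultimately obtain d where d: "d : S" "d < \<delta>" using cInf_lessD by metis
 then obtain y where "y : B" "dist y x < d" using assms(6) by (auto simp: S_def)
 thus ?thesis using that d(2) by (metis dist_commute less_trans)
qed

text \<open>Montel applies because Hausdorff convergence bounds the domains uniformly, and it also places the limit in the closure of D.\<close>
lemma limit_of_discs:
 fixes D :: "(complex ^ 'm) set" and Dn :: "nat => (complex ^ 'm) set"
 assumes "domain D" "bounded D" "!!n. domain (Dn n)" "!!n. bounded (Dn n)"
  and haus: "(%n. hausdorff_dist (closure (Dn n)) (closure D)) ----> 0"
  and q: "strict_mono (q :: nat => nat)" and f: "!!n. f n : cl_discs (Dn (q n))"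
 obtains g s where "g : cl_discs D" "strict_mono (s :: nat => nat)"
  "!!K. compact K ==> K <= unit_disc ==> uniform_limit K (%n. f (s n)) g sequentially"
proof -
 have ne: "closure D ~= {}" "closure (Dn n) ~= {}" for n
  using assms(1,3) by (auto simp: domain_def)
 have hq: "(%n. hausdorff_dist (closure (Dn (q n))) (closure D)) ----> 0"
  using LIMSEQ_subseq_LIMSEQ[OF haus q] by (simp add: o_def)
 have near: "EVS n. ALL x:closure (Dn (q n)). EX y:closure D. dist x y < e" if "e > 0" for e
 proof -
  have "EVS n. hausdorff_dist (closure (Dn (q n))) (closure D) < e"
   using order_tendstoD(2)[OF hq that] .
  thus ?thesis
  proof eventually_elim
   case (elim n)
   show ?case
    using hausdorff_dist_lessD[OF elim ne(2) ne(1)] assms(2,4) bounded_closure by metis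
  qed
 qed
 obtain B where B: "!!y. y : closure D ==> norm y <= B"
  using bounded_closure[OF assms(2)] bounded_iff by metis
 obtain n1 where n1: "!!n. n >= n1 ==> ALL x:closure (Dn (q n)). EX y:closure D. dist x y < 1"
  using near[of 1] by (auto simp: eventually_sequentially)
 have bnd: "norm (f (n + n1) t) <= B + 1" if "t : unit_disc" for n t
 proof -
  have "f (n + n1) t : closure (Dn (q (n + n1)))" using cl_discsD(2)[OF f that] .
  then obtain y where "y : closure D" "dist (f (n + n1) t) y < 1" using n1[of "n + n1"] by auto
  thus ?thesis using B[of y] norm_triangle_ineq2[of "f (n + n1) t" y] by (simp add: dist_norm)
 qed
 obtain g s where gs: "!!i. hol g i unit_disc" "strict_mono (s :: nat => nat)"
  "!!K. compact K ==> K <= unit_disc ==> uniform_limit K (%n. f (s n + n1)) g sequentially"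
  by (rule Montel_vec[of unit_disc "%n. f (n + n1)" "B + 1"]) (use f bnd in \<open>auto simp: cl_discs_def\<close>)
 have "g t : closure D" if t: "t : unit_disc" for t
 proof -
  have lim: "(%n. f (s n + n1) t) ----> g t"
   using uniform_limit_imp_tendsto_at[OF gs(3)[of "{t}"]] t by auto
  have "EX y:closure D. dist y (g t) < e" if "e > 0" for e
  proof -
   have "EVS n. dist (f (s n + n1) t) (g t) < e / 2"
    using lim that by (intro tendstoD) auto
   moreover have "EVS n. ALL x:closure (Dn (q (s n + n1))). EX y:closure D. dist x y < e / 2"
    using eventually_subseq[OF strict_monoI, of "%n. s n + n1", OF _ near[of "e/2"]] gs(2) that
    by (simp add: strict_mono_less)
   ultimately have "EVS n. EX y:closure D. dist y (g t) < e"
   proof eventually_elim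
    case (elim n)
    have "f (s n + n1) t : closure (Dn (q (s n + n1)))" using cl_discsD(2)[OF f t] .
    then obtain y where "y : closure D" "dist (f (s n + n1) t) y < e / 2" using elim(2) by blast
    thus ?case using elim(1) dist_triangle_half_r[of "f (s n + n1) t" y e "g t"] by blast
   qed
   thus ?thesis using eventually_happens' sequentially_bot by blast
  qed
  thus ?thesis using closure_approachable[of "g t" "closure D"] by simp
 qed
 hence "g : cl_discs D" using gs(1) by (auto simp: cl_discs_def)
 moreover have "strict_mono (%n. s n + n1)" using gs(2) by (simp add: strict_mono_def)
 ultimately show ?thesis using that gs(3) by metis
qed

lemma discs_in_subset_cl_discs: "discs_in D <= cl_discs D"
 using closure_subset by (fastforce simp: discs_in_def cl_discs_def)

lemma limit_of_discs_at:
 fixes g :: "complex => complex ^ 'm"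
 assumes lim: "!!K. compact K ==> K <= unit_disc ==> uniform_limit K f g sequentially"
  and cont: "continuous_on unit_disc g" and "a ----> l" "l : unit_disc"
 shows "(%n. f n (a n)) ----> g l"
proof -
 obtain d where d: "d > 0" "cball l d <= unit_disc"
  using assms(4) open_contains_cball_eq[OF open_ball] by blast
 have "EVS n. dist (a n) l < d" using assms(3) d(1) by (rule tendstoD)
 hence ev: "EVS n. a n : cball l d"
  by eventually_elim (simp add: dist_commute)
 have ul: "uniform_limit (cball l d) f g sequentially" using lim d by simp
 have "(%n. g (a n)) ----> g l"
 proof (rule continuous_on_tendsto_compose[OF cont assms(3,4)])
  show "EVS n. a n : unit_disc" using ev by eventually_elim (use d in blast)
 qed
 moreover have "(%n. f n (a n) - g (a n)) ----> 0"
 proof (rule tendstoI)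
  fix e :: real assume "e > 0"
  from ev uniform_limitD[OF ul this]
  show "EVS n. dist (f n (a n) - g (a n)) 0 < e"
   by eventually_elim (auto simp: dist_norm)
 qed
 ultimately show ?thesis using tendsto_add by fastforce
qed

text \<open>Nearly optimal discs in D_n subconverge to a disc in the closure of D through z and w; by the dichotomy it lies in D and competes in the definition of the Lempert function.\<close>
lemma lempert_eventually_greater:
 fixes D :: "(complex ^ 'm) set" and Dn :: "nat => (complex ^ 'm) set"
 assumes "domain D" "bounded D" "taut D" "C11_boundary D" "!!n. domain (Dn n)" "!!n. bounded (Dn n)"
  and haus: "(%n. hausdorff_dist (closure (Dn n)) (closure D)) ----> 0"
  and exh: "!!K. compact K ==> K <= D ==> EX n0. ALL n>=n0. K <= Dn n"
  and zw: "z : D" "w : D" and c: "c < lempert D z w"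
 shows "EVS n. c < lempert (Dn n) z w"
proof (rule ccontr)
 assume "\<not> ?thesis"
 hence fr: "\<exists>\<^sub>F n in sequentially. lempert (Dn n) z w <= c"
  by (simp add: not_eventually not_less)
 define c' where "c' = (c + lempert D z w) / 2"
 have c': "c < c'" "c' < lempert D z w" using c by (auto simp: c'_def)
 obtain n0 where n0: "ALL n>=n0. {z, w} <= Dn n" using exh[of "{z, w}"] zw by auto
 have fr2: "\<exists>\<^sub>F n in sequentially. n0 <= n & lempert (Dn n) z w <= c"
  using frequently_eventually_conj[OF fr eventually_ge_at_top[of n0]] .
 hence "infinite {n. n0 <= n & lempert (Dn n) z w <= c}"
  unfolding cofinite_eq_sequentially[symmetric] frequently_cofinite .
 then obtain q where q: "strict_mono (q :: nat => nat)" "!!n. lempert (Dn (q n)) z w <= c" "!!n. q n >= n0"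
  using infinite_enumerate by (metis (no_types, lifting) mem_Collect_eq)
 have "EX phi t. phi : discs_in (Dn (q n)) & phi 0 = z & phi t = w & t : unit_disc & hyp_dist 0 t < c'" for n
 proof -
  have "{z, w} <= Dn (q n)" using n0 q(3) by blast
  then obtain psi s where "psi : discs_in (Dn (q n))" "psi 0 = z" "psi s = w" "s : unit_disc"
   using domain_disc_through[OF assms(5)] by (metis insert_subset)
  thus ?thesis using lempert_approx[of psi "Dn (q n)" z s w c'] q(2)[of n] c'(1) by (metis le_less_trans)
 qed
 then obtain phi t where phi: "!!n. phi n : discs_in (Dn (q n))" "!!n. phi n 0 = z" "!!n. phi n (t n) = w"
  "!!n. t n : unit_disc" "!!n. hyp_dist 0 (t n) < c'" by metis
 have "phi n : cl_discs (Dn (q n))" for n using phi(1) discs_in_subset_cl_discs by blast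
 then obtain g s where g: "g : cl_discs D" and s: "strict_mono (s :: nat => nat)" and
  ul: "!!K. compact K ==> K <= unit_disc ==> uniform_limit K (%n. phi (s n)) g sequentially"
  using limit_of_discs[OF assms(1,2,5,6) haus q(1)] by metis
 have cont: "continuous_on unit_disc g"
  using g by (intro holomorphic_vec_imp_continuous_on) (auto simp: cl_discs_def)
 have g0: "g 0 = z"
  using uniform_limit_imp_tendsto_at[OF ul[of "{0}"]] phi(2) by (simp add: LIMSEQ_const_iff)
 have "open D" using assms(1) by (simp add: domain_def)
 hence "z \<notin> frontier D" using zw(1) by (simp add: frontier_def interior_open)
 hence "\<not> g ` unit_disc <= frontier D" using g0 by (metis centre_in_ball image_subset_iff zero_less_one)
 hence gD: "g ` unit_disc <= D"
  using taut_cl_disc_dichotomy[OF \<open>open D\<close> assms(3,4) g] by blast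
 define b where "b = tanh c'"
 have tb: "cmod (t n) <= b" for n
 proof (rule ccontr)
  assume "\<not> cmod (t n) <= b"
  moreover have "0 < c'" using hyp_dist_zero_nonneg[OF phi(4)[of n]] phi(5)[of n] by simp
  ultimately have "artanh (tanh c') <= artanh (cmod (t n))"
   using phi(4)[of n] by (intro artanh_real_mono) (auto simp: b_def)
  thus False using phi(5)[of n] by (simp add: hyp_dist_zero_left artanh_tanh_real)
 qed
 have b1: "b < 1" using tanh_real_lt_1 by (simp add: b_def)
 have "!!n. t (s n) : cball 0 b" using tb by simp
 then obtain l r where l: "l : cball 0 b" and r: "strict_mono (r :: nat => nat)" and
  tl: "((%n. t (s n)) \<circ> r) ----> l"
  using compact_cball[of "0::complex" b] unfolding compact_def by (metis o_def)
 have lu: "l : unit_disc" using l b1 by simp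
 have "(%n. phi (s (r n)) (t (s (r n)))) ----> g l"
 proof (rule limit_of_discs_at[OF _ cont _ lu])
  show "uniform_limit K (%n. phi (s (r n))) g sequentially" if "compact K" "K <= unit_disc" for K
   using filterlim_compose[OF ul[OF that] filterlim_subseq[OF r]] by simp
  show "(%n. t (s (r n))) ----> l" using tl by (simp add: o_def)
 qed
 hence gl: "g l = w" using phi(3) by (simp add: LIMSEQ_const_iff)
 have "g : discs_in D" using g gD by (simp add: discs_in_def cl_discs_def)
 hence "lempert D z w <= hyp_dist 0 l" using lempert_le g0 gl lu by blast
 also have "... <= artanh b"
  using l b1 unfolding hyp_dist_zero_left by (intro artanh_real_mono) auto
 also have "... = c'" by (simp add: b_def artanh_tanh_real)
 finally show False using c'(2) by simp
qed

section \<open>Real parts of holomorphic functions and conormal fields\<close>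

text \<open>On the unit circle cnj z = 1 / z, so conjugate powers can be traded for holomorphic ones inside the real part.\<close>
lemma Re_mult_cnj_poly_on_circle:
 fixes P Q :: "complex poly"
 shows "EX R. ALL z:sphere 0 1. Re (poly P z * cnj (poly Q z)) = Re (poly R z)"
proof (induction P Q rule: poly_induct2)
 case 0
 show ?case by (intro exI[of _ 0]) simp
next
 case (pCons a P b Q)
 then obtain R where R: "!!z. z : sphere 0 1 ==> Re (poly P z * cnj (poly Q z)) = Re (poly R z)" by blast
 have "Re (poly (pCons a P) z * cnj (poly (pCons b Q) z)) =
   Re (poly ([:a * cnj b:] + smult (cnj a) (pCons 0 Q) + smult (cnj b) (pCons 0 P) + R) z)"
  if z: "z : sphere 0 1" for z
 proof -
  have zz: "z * cnj z = 1" using z by (simp add: complex_norm_square[symmetric])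
  have "(a + z * poly P z) * cnj (b + z * poly Q z) =
    a * cnj b + cnj (cnj a * (z * poly Q z)) + cnj b * (z * poly P z) + (z * cnj z) * (poly P z * cnj (poly Q z))"
   by (simp add: algebra_simps)
  hence "Re ((a + z * poly P z) * cnj (b + z * poly Q z)) =
    Re (a * cnj b) + Re (cnj (cnj a * (z * poly Q z))) + Re (cnj b * (z * poly P z)) + Re (poly P z * cnj (poly Q z))"
   unfolding zz by simp
  also have "Re (cnj (cnj a * (z * poly Q z))) = Re (cnj a * (z * poly Q z))" by (rule cnj.sel(1))
  finally have fin: "Re ((a + z * poly P z) * cnj (b + z * poly Q z)) =
    Re (a * cnj b) + Re (cnj a * (z * poly Q z)) + Re (cnj b * (z * poly P z)) + Re (poly P z * cnj (poly Q z))" .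
  have "poly ([:a * cnj b:] + smult (cnj a) (pCons 0 Q) + smult (cnj b) (pCons 0 P) + R) z =
    a * cnj b + cnj a * (z * poly Q z) + cnj b * (z * poly P z) + poly R z" by (simp add: algebra_simps)
  thus ?thesis by (simp only: poly_pCons fin R[OF z] plus_complex.sel)
 qed
 thus ?case by blast
qed

lemma real_polynomial_on_circle:
 fixes q :: "complex => real"
 assumes "real_polynomial_function q"
 shows "EX P. ALL z:sphere 0 1. q z = Re (poly P z)"
 using assms
proof induction
 case (linear f)
 interpret bounded_linear f by (rule linear)
 have "f z = Re (poly [:0, of_real (f 1) - \<i> * of_real (f \<i>):] z)" for z
 proof -
  have "f z = f (Re z *R 1 + Im z *R \<i>)"
   by (rule arg_cong[of _ _ f]) (simp add: complex_eq_iff)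
  also have "... = Re z * f 1 + Im z * f \<i>" by (simp add: add scaleR)
  finally show ?thesis by (simp add: algebra_simps)
 qed
 thus ?case by blast
next
 case (const c)
 show ?case by (intro exI[of _ "[:of_real c:]"]) simp
next
 case (add f g)
 then obtain P Q where "ALL z:sphere 0 1. f z = Re (poly P z)" "ALL z:sphere 0 1. g z = Re (poly Q z)" by blast
 thus ?case by (intro exI[of _ "P + Q"]) simp
next
 case (mult f g)
 then obtain P Q where PQ: "!!z. z : sphere 0 1 ==> f z = Re (poly P z)" "!!z. z : sphere 0 1 ==> g z = Re (poly Q z)"
  by blast
 obtain R where R: "!!z. z : sphere 0 1 ==> Re (poly P z * cnj (poly Q z)) = Re (poly R z)"
  using Re_mult_cnj_poly_on_circle by blast
 have "f z * g z = Re (poly (smult (1/2) (P * Q + R)) z)" if z: "z : sphere 0 1" for z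
  using R[OF z] PQ[OF z] by (simp add: field_simps)
 thus ?case by blast
qed

text \<open>Weierstrass approximation by real polynomials in the coordinates, each of which agrees on the circle with the real part of a complex polynomial. It replaces the solution of the Dirichlet problem.\<close>
lemma real_function_on_circle_approx:
 fixes b :: "complex => real"
 assumes "continuous_on (sphere c r) b" "r > 0" "e > 0"
 obtains p where "p holomorphic_on UNIV" "!!z. z : sphere c r ==> \<bar>Re (p z) - b z\<bar> < e"
proof -
 have im: "(%z. c + of_real r * z) ` sphere 0 1 <= sphere c r"
  using assms(2) by (auto simp: dist_norm norm_mult)
 have "continuous_on (sphere 0 1) (b \<circ> (%z. c + of_real r * z))"
  by (intro continuous_on_compose continuous_on_subset[OF assms(1) im]) (intro continuous_intros)
 then obtain g where g: "real_polynomial_function g"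
  "!!z. z : sphere 0 1 ==> \<bar>(b \<circ> (%z. c + of_real r * z)) z - g z\<bar> < e"
  using Stone_Weierstrass_real_polynomial_function[OF compact_sphere _ assms(3)] by metis
 obtain P where P: "!!z. z : sphere 0 1 ==> g z = Re (poly P z)" using real_polynomial_on_circle[OF g(1)] by blast
 define p where "p z = poly P ((z - c) / of_real r)" for z
 have "p holomorphic_on UNIV" unfolding p_def using assms(2)
  by (intro holomorphic_on_compose[of "%z. (z - c) / of_real r" UNIV "poly P", unfolded o_def] holomorphic_intros) auto
 moreover have "\<bar>Re (p z) - b z\<bar> < e" if "z : sphere c r" for z
 proof -
  have "(z - c) / of_real r : sphere 0 1" using that assms(2)
   by (simp add: norm_divide dist_norm norm_minus_commute)
  thus ?thesis using g(2)[of "(z - c) / of_real r"] P assms(2) by (simp add: p_def abs_minus_commute)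
 qed
 ultimately show ?thesis using that by blast
qed

definition re_hol :: "complex set => (complex => real) => bool" where
 "re_hol S b \<longleftrightarrow> (EX F. F holomorphic_on S & (ALL z:S. b z = Re (F z)))"

text \<open>The exponentials of the approximating functions are bounded, so Montel applies to them; the logarithm of a limit exists on a convex set.\<close>
lemma re_hol_uniform_limit:
 assumes "open S" "convex S"
  and "!!e. e > 0 ==> EX p. p holomorphic_on S & (ALL z:S. \<bar>Re (p z) - b z\<bar> <= e)"
 shows "re_hol S b"
proof (cases "S = {}")
 case True
 thus ?thesis by (auto simp: re_hol_def holomorphic_on_empty)
next
 case False
 then obtain z0 where z0: "z0 : S" by blast
 have "EX p. p holomorphic_on S & (ALL z:S. \<bar>Re (p z) - b z\<bar> <= 1 / (real n + 1))" for n
  using assms(3) by simp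
 then obtain p where p: "!!n. p n holomorphic_on S" "!!n z. z : S ==> \<bar>Re (p n z) - b z\<bar> <= 1 / (real n + 1)"
  by metis
 have blim: "(%n. Re (p n z)) ----> b z" if "z : S" for z
 proof (rule LIM_zero_cancel, rule Lim_null_comparison)
  show "EVS n. norm (Re (p n z) - b z) <= 1 / (real n + 1)" using p(2)[OF that] by simp
  show "(%n. 1 / (real n + 1)) ----> 0" by real_asymp
 qed
 define f where "f n z = exp (p n z)" for n z
 have bnd: "EX B. ALL h:range f. ALL z:K. norm (h z) <= B" if K: "compact K" "K <= S" for K
 proof -
  have "compact ((%z. Re (p 0 z)) ` K)"
   using K p(1)[of 0] by (intro compact_continuous_image continuous_intros)
    (auto intro: continuous_on_subset[OF holomorphic_on_imp_continuous_on])
  then obtain C where C: "!!z. z : K ==> \<bar>Re (p 0 z)\<bar> <= C"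
   using compact_imp_bounded bounded_iff by (metis imageI real_norm_def)
  have "norm (f n z) <= exp (C + 2)" if "z : K" for n z
  proof -
   have "Re (p n z) <= b z + 1 / (real n + 1)" using p(2)[of z n] that K by force
   moreover have "1 / (real n + 1) <= 1" by simp
   moreover have "b z <= Re (p 0 z) + 1" using p(2)[of z 0] that K by force
   ultimately have "Re (p n z) <= C + 2" using C[OF that] by linarith
   thus ?thesis by (simp add: f_def)
  qed
  thus ?thesis by blast
 qed
 obtain g r where g: "g holomorphic_on S" "strict_mono (r :: nat => nat)"
  "!!z. z : S ==> (%n. f (r n) z) ----> g z"
 proof (rule Montel[OF assms(1), of "range f" f])
  show "h holomorphic_on S" if "h : range f" for h
   using that p(1) by (auto simp: f_def[abs_def] intro!: holomorphic_intros)
 qed (use bnd in auto)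
 have ng: "norm (g z) = exp (b z)" if "z : S" for z
 proof -
  have "(%n. norm (f (r n) z)) ----> norm (g z)" using g(3)[OF that] by (rule tendsto_norm)
  moreover have "(%n. norm (f (r n) z)) ----> exp (b z)"
   using tendsto_exp[OF LIMSEQ_subseq_LIMSEQ[OF blim[OF that] g(2)]] by (simp add: f_def o_def)
  ultimately show ?thesis by (rule LIMSEQ_unique)
 qed
 have "g z ~= 0" if "z : S" for z using ng[OF that] by force
 then obtain F where F: "F holomorphic_on S" "!!z. z : S ==> exp (F z) = g z"
  using holomorphic_logarithm_exists[OF assms(2,1) g(1) _ z0] by metis
 have "b z = Re (F z)" if "z : S" for z
  using ng[OF that] F(2)[OF that] by (metis exp_inj_iff norm_exp_eq_Re)
 thus ?thesis using F(1) by (auto simp: re_hol_def)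
qed

text \<open>Second derivatives of real parts of holomorphic functions come from complex linear maps; differentiating both identities twice and comparing leaves only F' = 0.\<close>
lemma holomorphic_real_times_coordinates_const:
 assumes "open S" "F holomorphic_on S" "H1 holomorphic_on S" "H2 holomorphic_on S"
  and "!!z. z : S ==> Re (F z) * Re z = Re (H1 z)"
  and "!!z. z : S ==> Re (F z) * Im z = Re (H2 z)" and z: "z : S"
 shows "deriv F z = 0"
proof -
 have dF: "(F has_field_derivative deriv F z) (at z)" if "z : S" for z
  using assms(1,2) that holomorphic_derivI by blast
 have dH: "(H1 has_field_derivative deriv H1 z) (at z)" "(H2 has_field_derivative deriv H2 z) (at z)" if "z : S" for z
  using assms(1,3,4) that holomorphic_derivI by blast+
 have eqs: "deriv H1 z = of_real (Re z) * deriv F z + of_real (Re (F z))"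
  "deriv H2 z = of_real (Im z) * deriv F z - \<i> * of_real (Re (F z))" if z: "z : S" for z
 proof -
  note D = dF[OF z, unfolded has_field_derivative_def]
  note D1 = dH(1)[OF z, unfolded has_field_derivative_def] and D2 = dH(2)[OF z, unfolded has_field_derivative_def]
  have "((%z. Re (F z) * Re z) has_derivative (%v. Re (F z) * Re v + Re (deriv F z * v) * Re z)) (at z)"
   by (intro has_derivative_mult has_derivative_Re D has_derivative_ident)
  moreover have "((%z. Re (F z) * Re z) has_derivative (%v. Re (deriv H1 z * v))) (at z)"
   by (rule has_derivative_transform_within_open[OF has_derivative_Re[OF D1] assms(1) z]) (simp add: assms(5))
  ultimately have e1: "Re (F z) * Re v + Re (deriv F z * v) * Re z = Re (deriv H1 z * v)" for v
   using has_derivative_unique by metis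
  have "((%z. Re (F z) * Im z) has_derivative (%v. Re (F z) * Im v + Re (deriv F z * v) * Im z)) (at z)"
   by (intro has_derivative_mult has_derivative_Re has_derivative_Im D has_derivative_ident)
  moreover have "((%z. Re (F z) * Im z) has_derivative (%v. Re (deriv H2 z * v))) (at z)"
   by (rule has_derivative_transform_within_open[OF has_derivative_Re[OF D2] assms(1) z]) (simp add: assms(6))
  ultimately have e2: "Re (F z) * Im v + Re (deriv F z * v) * Im z = Re (deriv H2 z * v)" for v
   using has_derivative_unique by metis
  show "deriv H1 z = of_real (Re z) * deriv F z + of_real (Re (F z))"
   using e1[of 1] e1[of \<i>] by (simp add: complex_eq_iff algebra_simps)
  show "deriv H2 z = of_real (Im z) * deriv F z - \<i> * of_real (Re (F z))"
   using e2[of 1] e2[of \<i>] by (simp add: complex_eq_iff algebra_simps)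
 qed
 define F' where "F' = deriv F"
 have "F' holomorphic_on S" unfolding F'_def using assms(1,2) holomorphic_deriv by blast
 hence D': "(F' has_derivative (%v. deriv F' z * v)) (at z)"
  using holomorphic_derivI[OF _ assms(1) z] by (simp add: has_field_derivative_def)
 note D = dF[OF z, unfolded has_field_derivative_def]
 have dd: "(deriv H1 has_derivative (%v. deriv (deriv H1) z * v)) (at z)"
  "(deriv H2 has_derivative (%v. deriv (deriv H2) z * v)) (at z)"
  using holomorphic_derivI[OF holomorphic_deriv[OF assms(3,1)] assms(1) z]
   holomorphic_derivI[OF holomorphic_deriv[OF assms(4,1)] assms(1) z]
  by (simp_all add: has_field_derivative_def)
 have u1: "((%z. of_real (Re z) * F' z + of_real (Re (F z))) has_derivative
   (%v. of_real (Re z) * (deriv F' z * v) + of_real (Re v) * F' z + of_real (Re (deriv F z * v)))) (at z)"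
  by (intro has_derivative_add has_derivative_mult has_derivative_of_real has_derivative_Re D D' has_derivative_ident)
 have u2: "((%z. of_real (Re z) * F' z + of_real (Re (F z))) has_derivative (%v. deriv (deriv H1) z * v)) (at z)"
  by (rule has_derivative_transform_within_open[OF dd(1) assms(1) z]) (simp add: eqs F'_def)
 have f1: "of_real (Re z) * (deriv F' z * v) + of_real (Re v) * F' z + of_real (Re (F' z * v)) =
   deriv (deriv H1) z * v" for v
  using fun_cong[OF has_derivative_unique[OF u1 u2], of v] by (simp add: F'_def)
 have w1: "((%z. of_real (Im z) * F' z - \<i> * of_real (Re (F z))) has_derivative
   (%v. of_real (Im z) * (deriv F' z * v) + of_real (Im v) * F' z - \<i> * of_real (Re (deriv F z * v)))) (at z)"
  by (intro has_derivative_diff has_derivative_mult has_derivative_mult_right has_derivative_of_real has_derivative_Re has_derivative_Im D D' has_derivative_ident)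
 have w2: "((%z. of_real (Im z) * F' z - \<i> * of_real (Re (F z))) has_derivative (%v. deriv (deriv H2) z * v)) (at z)"
  by (rule has_derivative_transform_within_open[OF dd(2) assms(1) z]) (simp add: eqs F'_def)
 have f2: "of_real (Im z) * (deriv F' z * v) + of_real (Im v) * F' z - \<i> * of_real (Re (F' z * v)) =
   deriv (deriv H2) z * v" for v
  using fun_cong[OF has_derivative_unique[OF w1 w2], of v] by (simp add: F'_def)
 have "Re (F' z) = 0"
  using arg_cong[OF f1[of 1], of Re] arg_cong[OF f1[of \<i>], of Im] by simp
 moreover have "Im (F' z) = 0"
  using arg_cong[OF f2[of 1], of Re] arg_cong[OF f2[of \<i>], of Im] by simp
 ultimately show ?thesis by (simp add: F'_def complex_eq_iff)
qed

text \<open>Re a and Im a are real parts of holomorphic functions, so a = F1 + i Re F3 with F3 holomorphic. The multiples by z and by -i z show that F3 has derivative 0.\<close>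
lemma holomorphic_if_re_hol_multiples:
 assumes S: "open S" "convex S"
  and re: "!!\<chi>'. \<chi>' holomorphic_on UNIV ==> re_hol S (%z. Re (a z * \<chi>' z))"
 shows "a holomorphic_on S"
proof -
 obtain F1 where F1: "F1 holomorphic_on S" "!!z. z : S ==> Re (a z) = Re (F1 z)"
  using re[of "%_. 1"] by (auto simp: re_hol_def)
 obtain F2 where F2: "F2 holomorphic_on S" "!!z. z : S ==> Im (a z) = Re (F2 z)"
  using re[of "%_. - \<i>"] by (auto simp: re_hol_def)
 obtain F4 where F4: "F4 holomorphic_on S" "!!z. z : S ==> Re (a z * z) = Re (F4 z)"
  using re[of "%z. z"] by (auto simp: re_hol_def)
 have "(%z. - \<i> * z) holomorphic_on UNIV" by (intro holomorphic_intros)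
 from re[OF this] obtain F5 where F5: "F5 holomorphic_on S" "!!z. z : S ==> Re (a z * (- \<i> * z)) = Re (F5 z)"
  unfolding re_hol_def by blast
 define F3 where "F3 z = F2 z + \<i> * F1 z" for z
 have F3: "F3 holomorphic_on S" unfolding F3_def by (intro holomorphic_intros F1 F2)
 have aF: "a z = F1 z + \<i> * of_real (Re (F3 z))" if "z : S" for z
  using F1(2) F2(2) that by (simp add: complex_eq_iff F3_def)
 have "deriv F3 z = 0" if z: "z : S" for z
 proof (rule holomorphic_real_times_coordinates_const[OF S(1) F3 _ _ _ _ z])
  show "(%z. F5 z + \<i> * F1 z * z) holomorphic_on S" "(%z. F1 z * z - F4 z) holomorphic_on S"
   by (intro holomorphic_intros F1 F4 F5)+
  show "Re (F3 z) * Re z = Re (F5 z + \<i> * F1 z * z)" if "z : S" for z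
   using F5(2)[OF that] aF[OF that] by (simp add: algebra_simps)
  show "Re (F3 z) * Im z = Re (F1 z * z - F4 z)" if "z : S" for z
   using F4(2)[OF that] aF[OF that] by (simp add: algebra_simps)
 qed
 hence "(F3 has_field_derivative 0) (at z within S)" if "z : S" for z
  using holomorphic_derivI[OF F3 S(1) that] that by (metis has_field_derivative_at_within)
 then obtain c where c: "!!z. z : S ==> F3 z = c"
  using has_field_derivative_zero_constant[OF S(2)] by metis
 have "(%z. F1 z + \<i> * of_real (Re c)) holomorphic_on S" by (intro holomorphic_intros F1)
 thus ?thesis by (rule holomorphic_transform) (simp add: aF c)
qed

text \<open>The complex normal component: its real part is the real inner product, and it is complex linear in the second argument.\<close>
definition herm :: "complex ^ 'm => complex ^ 'm => complex" where
 "herm v w = (\<Sum>i\<in>UNIV. cnj (v $ i) * w $ i)"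

lemma herm_add_right: "herm v (w + w') = herm v w + herm v w'"
 by (simp add: herm_def algebra_simps sum.distrib)

lemma herm_diff_right: "herm v (w - w') = herm v w - herm v w'"
 by (simp add: herm_def algebra_simps sum_subtractf)

lemma herm_smult_right: "herm v (c *s w) = c * herm v w"
 by (simp add: herm_def sum_distrib_left algebra_simps)

lemma herm_scaleR_right: "herm v (c *R w) = of_real c * herm v w"
 by (simp add: herm_def sum_distrib_left scaleR_complex mult_ac)

lemma Re_herm: "Re (herm v w) = v \<bullet> w"
 by (simp add: herm_def inner_vec_def inner_complex_def Re_sum)

lemma herm_axis: "herm v (axis j 1) = cnj (v $ j)"
proof -
 have "herm v (axis j 1) = (\<Sum>i\<in>UNIV. if i = j then cnj (v $ j) else 0)"
  unfolding herm_def by (rule sum.cong) (auto simp: axis_def)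
 thus ?thesis by simp
qed

lemma herm_self: "herm v v = of_real ((norm v)\<^sup>2)"
proof -
 have "Im (herm v v) = 0" by (simp add: herm_def Im_sum)
 moreover have "Re (herm v v) = (norm v)\<^sup>2" by (simp add: Re_herm power2_norm_eq_inner)
 ultimately show ?thesis by (simp add: complex_eq_iff)
qed

lemma smult_nth [simp]: "(c *s v) $ i = c * v $ i"
 by (simp add: vector_scalar_mult_def)

lemma continuous_on_herm [continuous_intros]:
 assumes "continuous_on S f" "continuous_on S g"
 shows "continuous_on S (%z. herm (f z) (g z))"
 unfolding herm_def using assms by (intro continuous_intros)

text \<open>Two half-plane conditions rotated by nearly a right angle to either side pin the angle down.\<close>
lemma phase_window:
 fixes x e :: real
 assumes "0 < e" "e < 1" "\<bar>x\<bar> < pi + e" "cos (x + (pi/2 - e)) >= 0" "cos (x - (pi/2 - e)) >= 0"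
 shows "\<bar>x\<bar> <= e"
proof -
 have a: "sin (x - e) <= 0"
  using assms(4) cos_add[of "x - e" "pi/2"] by (simp add: algebra_simps)
 have b: "sin (x + e) >= 0"
  using assms(5) cos_diff[of "x + e" "pi/2"] by (simp add: algebra_simps)
 have "x <= e"
 proof (rule ccontr)
  assume "\<not> x <= e"
  hence "sin (x - e) > 0" using assms by (intro sin_gt_zero) auto
  thus False using a by simp
 qed
 moreover have "- e <= x"
 proof (rule ccontr)
  assume "\<not> - e <= x"
  hence "sin (- (x + e)) > 0" using assms by (intro sin_gt_zero) auto
  hence "sin (x + e) < 0" by (simp only: sin_minus)
  thus False using b by simp
 qed
 ultimately show ?thesis by simp
qed

text \<open>Testing the cone property with the fields exp(p) e, for p holomorphic with real part prescribed on the circle, shows that the argument of the component of N along e is the real part of a holomorphic function; testing with perturbations in other directions does the same for the quotients of components. Together they make a positive multiple of the conjugate of N holomorphic.\<close>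
lemma conormal_holomorphic_local:
 fixes N :: "complex => complex ^ 'm"
 assumes cont: "continuous_on (cball 0 1) N"
  and e: "!!z. z : cball 0 1 ==> N z \<bullet> e > 0"
  and cone: "!!r S psi. 0 < r ==> r < 1 ==> open S ==> cball 0 r <= S ==>
   (!!i. hol psi i S) ==> (!!z. z : sphere 0 r ==> N z \<bullet> psi z > 0) ==>
   (!!z. z : cball 0 r ==> N z \<bullet> psi z >= 0)"
 obtains M k where "!!i. hol M i (ball 0 (1/2))"
  "!!z. z : ball 0 (1/2) ==> k z > (0::real)"
  "!!z i. z : ball 0 (1/2) ==> M z $ i = of_real (k z) * cnj (N z $ i)"
proof -
 define c where "c z = herm (N z) e" for z
 have cpos: "Re (c z) > 0" if "z : cball 0 1" for z using e[OF that] by (simp add: c_def Re_herm)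
 have ccont: "continuous_on (cball 0 1) c" unfolding c_def by (intro continuous_intros cont)
 define al where "al z = Arg (c z)" for z
 have c_polar: "c z = of_real (cmod (c z)) * exp (\<i> * of_real (al z))" for z
  using Arg_eq[of "c z"] by (cases "c z = 0") (auto simp: al_def)
 have al_bound: "\<bar>al z\<bar> < pi/2" if "z : cball 0 1" for z
  using cpos[OF that] Arg_Re_pos unfolding al_def by blast
 have alcont: "continuous_on (cball 0 1) al"
  unfolding al_def
 proof (rule continuous_on_compose2[OF continuous_on_Arg ccont])
  show "c ` cball 0 1 <= - \<real>\<^sub>\<le>\<^sub>0" using cpos by (force simp: complex_nonpos_Reals_iff)
 qed
 have "re_hol (ball 0 (3/4)) al"
 proof (rule re_hol_uniform_limit)
  fix d :: real assume "d > 0"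
  define d' where "d' = min d (1/2)"
  have d': "0 < d'" "d' < 1" "d' <= d" using \<open>d > 0\<close> by (auto simp: d'_def)
  have s34: "sphere 0 (3/4) <= cball (0::complex) 1" by auto
  obtain p where p: "p holomorphic_on UNIV" "!!z. z : sphere 0 (3/4) ==> \<bar>Re (p z) - al z\<bar> < d'"
   using real_function_on_circle_approx[OF continuous_on_subset[OF alcont s34] _ d'(1)] by (metis zero_less_divide_iff zero_less_numeral)
  have herm_psi: "herm (N z) (exp (- \<i> * p z + \<i> * of_real t) *s e) =
    of_real (exp (Im (p z)) * cmod (c z)) * exp (\<i> * of_real (al z - Re (p z) + t))" for z t
  proof -
   have "herm (N z) (exp (- \<i> * p z + \<i> * of_real t) *s e) = exp (- \<i> * p z + \<i> * of_real t) * c z"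
    by (simp add: herm_smult_right c_def)
   also have "... = of_real (cmod (c z)) * exp (- \<i> * p z + \<i> * of_real t + \<i> * of_real (al z))"
    by (subst c_polar) (simp add: exp_add)
   also have "- \<i> * p z + \<i> * of_real t + \<i> * of_real (al z) = of_real (Im (p z)) + \<i> * of_real (al z - Re (p z) + t)"
    by (simp add: complex_eq_iff)
   finally show ?thesis by (simp add: exp_add exp_of_real mult_ac)
  qed
  have inner_psi: "N z \<bullet> (exp (- \<i> * p z + \<i> * of_real t) *s e) = exp (Im (p z)) * cmod (c z) * cos (al z - Re (p z) + t)" for z t
   unfolding Re_herm[symmetric] herm_psi by (simp add: Re_exp)
  have cz: "cmod (c z) > 0" if "z : cball 0 1" for z using cpos[OF that] by auto
  have inside: "cos (al z - Re (p z) + t) >= 0" if z: "z : cball 0 (3/4)" and t: "\<bar>t\<bar> = pi/2 - d'" for z t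
  proof -
   have "N z \<bullet> (exp (- \<i> * p z + \<i> * of_real t) *s e) >= 0"
   proof (rule cone[OF _ _ open_UNIV _ _ _ z])
    show "(%z. (exp (- \<i> * p z + \<i> * of_real t) *s e) $ i) holomorphic_on UNIV" for i
     using p(1) by (auto intro!: holomorphic_intros)
    fix z :: complex assume z: "z : sphere 0 (3/4)"
    have "\<bar>al z - Re (p z) + t\<bar> < pi / 2" using p(2)[OF z] t by linarith
    hence "cos (al z - Re (p z) + t) > 0" by (intro cos_gt_zero_pi; linarith)
    moreover have "cmod (c z) > 0" using cz z by auto
    ultimately show "N z \<bullet> (exp (- \<i> * p z + \<i> * of_real t) *s e) > 0" unfolding inner_psi by simp
   qed auto
   moreover have "exp (Im (p z)) * cmod (c z) > 0" using cz z by auto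
   ultimately show ?thesis unfolding inner_psi by (meson mult_pos_neg not_le)
  qed
  have Rep: "\<bar>Re (p z)\<bar> <= pi/2 + d'" if z: "z : ball 0 (3/4)" for z
  proof -
   have "norm (exp (of_real t * p z)) <= exp (pi/2 + d')" if t: "\<bar>t\<bar> = 1" for t :: real
   proof (rule maximum_modulus_frontier[of "%z. exp (of_real t * p z)" "ball 0 (3/4)"])
    show "continuous_on (closure (ball 0 (3/4))) (%z. exp (of_real t * p z))"
     using p(1) by (intro continuous_intros) (auto intro: continuous_on_subset[OF holomorphic_on_imp_continuous_on])
    fix z :: complex assume "z : frontier (ball 0 (3/4))"
    hence z: "z : sphere 0 (3/4)" by (simp add: frontier_ball)
    hence "\<bar>al z\<bar> < pi/2" using al_bound s34 by blast
    hence "\<bar>Re (p z)\<bar> <= pi/2 + d'" using p(2)[OF z] by linarith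
    hence "t * Re (p z) <= pi/2 + d'" using t by (metis abs_le_D1 abs_mult mult_1 order_trans)
    thus "norm (exp (of_real t * p z)) <= exp (pi/2 + d')" by simp
   qed (use p(1) z in \<open>auto intro!: holomorphic_intros intro: holomorphic_on_subset\<close>)
   from this[of 1] this[of "-1"] show ?thesis by simp
  qed
  have "\<bar>Re (p z) - al z\<bar> <= d" if z: "z : ball 0 (3/4)" for z
  proof -
   have zc: "z : cball 0 (3/4)" "z : cball 0 1" using z by auto
   have "\<bar>al z - Re (p z)\<bar> < pi + d'" using Rep[OF z] al_bound[OF zc(2)] by linarith
   moreover have "cos (al z - Re (p z) + (pi/2 - d')) >= 0" using d'(2) pi_gt3 by (intro inside[OF zc(1)]) auto
   moreover have "cos (al z - Re (p z) - (pi/2 - d')) >= 0"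
    using inside[OF zc(1), of "- (pi/2 - d')"] d'(2) pi_gt3 by (simp add: algebra_simps)
   ultimately have "\<bar>al z - Re (p z)\<bar> <= d'" using phase_window d' by blast
   thus ?thesis using d'(3) by linarith
  qed
  thus "EX p. p holomorphic_on ball 0 (3/4) & (ALL z:ball 0 (3/4). \<bar>Re (p z) - al z\<bar> <= d)"
   using p(1) holomorphic_on_subset by blast
 qed auto
 then obtain G where G: "G holomorphic_on ball 0 (3/4)" "!!z. z : ball 0 (3/4) ==> al z = Re (G z)"
  unfolding re_hol_def by blast
 define E where "E z = exp (- \<i> * G z)" for z
 have Ehol: "E holomorphic_on ball 0 (3/4)" unfolding E_def by (intro holomorphic_intros G)
 define P where "P z = cmod (c z) * exp (Im (G z))" for z
 have Ppos: "P z > 0" if "z : cball 0 1" for z using cpos[OF that] unfolding P_def by (intro mult_pos_pos) auto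
 have Ec: "E z * c z = of_real (P z)" if z: "z : ball 0 (3/4)" for z
 proof -
  have "E z * c z = of_real (cmod (c z)) * exp (- \<i> * G z + \<i> * of_real (al z))"
   unfolding E_def exp_add by (subst c_polar) simp
  also have "- \<i> * G z + \<i> * of_real (al z) = of_real (Im (G z))"
   using G(2)[OF z] by (simp add: complex_eq_iff)
  finally show ?thesis by (simp add: P_def exp_of_real)
 qed
 define a where "a j z = cnj (N z $ j) / c z" for j z
 have c0: "c z ~= 0" if "z : cball 0 1" for z using cpos[OF that] by auto
 have acont: "continuous_on (cball 0 1) (a j)" for j
  unfolding a_def using c0 by (intro continuous_intros cont ccont) auto
 have ahol: "a j holomorphic_on ball 0 (1/2)" for j
 proof (rule holomorphic_if_re_hol_multiples)
  fix \<eta> :: "complex => complex" assume eta: "\<eta> holomorphic_on UNIV"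
  show "re_hol (ball 0 (1/2)) (%z. Re (a j z * \<eta> z))"
  proof (rule re_hol_uniform_limit)
   fix d :: real assume "d > 0"
   hence d3: "d/3 > 0" by simp
   have s12: "sphere 0 (1/2) <= cball (0::complex) 1" by auto
   have "continuous_on (sphere 0 (1/2)) (%z. Re (a j z * \<eta> z))"
    by (intro continuous_intros continuous_on_subset[OF acont s12]
      continuous_on_subset[OF holomorphic_on_imp_continuous_on[OF eta]]) auto
   from real_function_on_circle_approx[OF this _ d3]
   obtain p where p: "p holomorphic_on UNIV" "!!z. z : sphere 0 (1/2) ==> \<bar>Re (p z) - Re (a j z * \<eta> z)\<bar> < d/3"
    by auto
   define psi where "psi t z = E z *s ((of_real d - of_real t * p z) *s e + (of_real t * \<eta> z) *s axis j 1)" for t :: real and z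
   have ipsi: "N z \<bullet> psi t z = P z * (d - t * (Re (p z) - Re (a j z * \<eta> z)))" if z: "z : ball 0 (3/4)" for z t
   proof -
    have zc: "z : cball 0 1" using z by auto
    have "herm (N z) (psi t z) = E z * ((of_real d - of_real t * p z) * c z + of_real t * \<eta> z * cnj (N z $ j))"
     by (simp only: psi_def herm_smult_right herm_add_right herm_axis c_def)
    also have "cnj (N z $ j) = a j z * c z" using c0[OF zc] by (simp add: a_def)
    also have "E z * ((of_real d - of_real t * p z) * c z + of_real t * \<eta> z * (a j z * c z)) =
     (E z * c z) * (of_real d - of_real t * (p z - a j z * \<eta> z))" by (simp add: algebra_simps)
    finally show ?thesis unfolding Re_herm[symmetric] Ec[OF z] by simp
   qed
   have inside: "t * (Re (p z) - Re (a j z * \<eta> z)) <= d" if z: "z : cball 0 (1/2)" and t: "\<bar>t\<bar> = 1" for z t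
   proof -
    have "N z \<bullet> psi t z >= 0"
    proof (rule cone[OF _ _ open_ball[of 0 "3/4"] _ _ _ z])
     show "hol (psi t) i (ball 0 (3/4))" for i
      unfolding psi_def using p(1) eta by (auto intro!: holomorphic_intros Ehol intro: holomorphic_on_subset)
     fix z :: complex assume z: "z : sphere 0 (1/2)"
     have "\<bar>t * (Re (p z) - Re (a j z * \<eta> z))\<bar> < d / 3" using p(2)[OF z] t by (simp add: abs_mult)
     hence "0 < d - t * (Re (p z) - Re (a j z * \<eta> z))" using \<open>d > 0\<close> by linarith
     moreover have "z : ball 0 (3/4)" "z : cball 0 1" using z by auto
     ultimately show "N z \<bullet> psi t z > 0" using ipsi Ppos by simp
    qed auto
    moreover have "z : ball 0 (3/4)" "P z > 0" using z Ppos by auto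
    ultimately have "\<not> d - t * (Re (p z) - Re (a j z * \<eta> z)) < 0"
     unfolding ipsi[OF \<open>z : ball 0 (3/4)\<close>] by (meson mult_pos_neg not_le)
    thus ?thesis by linarith
   qed
   have "\<bar>Re (p z) - Re (a j z * \<eta> z)\<bar> <= d" if "z : ball 0 (1/2)" for z
    using inside[of z 1] inside[of z "-1"] that by auto
   thus "EX p. p holomorphic_on ball 0 (1/2) & (ALL z:ball 0 (1/2). \<bar>Re (p z) - Re (a j z * \<eta> z)\<bar> <= d)"
    using p(1) holomorphic_on_subset by blast
  qed auto
 qed auto
 have sub: "ball 0 (1/2) <= ball (0::complex) (3/4)" by auto
 show ?thesis
 proof (rule that[of "%z. \<chi> j. a j z / E z" "%z. 1 / P z"])
  have "E z ~= 0" for z by (simp add: E_def)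
  thus "!!i. (%z. (\<chi> j. a j z / E z) $ i) holomorphic_on ball 0 (1/2)"
   by (auto intro!: holomorphic_intros ahol holomorphic_on_subset[OF Ehol sub])
  fix z :: complex and i assume "z : ball 0 (1/2)"
  hence z: "z : ball 0 (3/4)" "z : cball 0 1" by auto
  show "(\<chi> j. a j z / E z) $ i = of_real (1 / P z) * cnj (N z $ i)"
   using Ec[OF z(1), symmetric] c0[OF z(2)] \<open>!!z. E z ~= 0\<close> by (simp add: a_def field_simps)
 next
  fix z :: complex assume "z : ball 0 (1/2)"
  thus "1 / P z > 0" using Ppos by simp
 qed
qed

section \<open>The continuity principle and boundary charts\<close>

text \<open>The Kontinuitaetssatz. The parameters whose closed disc lies in D form an open set by compactness. They form a closed set by tautness: the circles stay in D, so the discs cannot diverge in D, and a limit of them is again a disc in D.\<close>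
lemma taut_continuity_principle:
 fixes F :: "real => complex => complex ^ 'm"
 assumes D: "open D" "taut D"
  and cont: "continuous_on ({0..1} \<times> cball 0 1) (%(t, z). F t z)"
  and hol: "!!t i. t : {0..1} ==> hol (F t) i (ball 0 1)"
  and bd: "!!t z. t : {0..1} ==> z : sphere 0 1 ==> F t z : D"
  and start: "!!z. z : cball 0 1 ==> F 1 z : D"
  and z: "z : cball 0 1"
 shows "F 0 z : D"
proof -
 define A where "A = {t:{0..1}. ALL z:cball 0 1. F t z : D}"
 have cF: "continuous_on {0..1} (%t. F t z)" if "z : cball 0 1" for z
 proof -
  have im: "(%t. (t, z)) ` {0..1} <= {0..1} \<times> cball 0 1" using that by blast
  have "continuous_on {0..1} (%t::real. (t, z))" by (intro continuous_intros)
  from continuous_on_compose2[OF cont this im] show ?thesis by simp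
 qed
 have cz: "continuous_on (cball 0 1) (F t)" if "t : {0..1}" for t
 proof -
  have im: "(%z. (t, z)) ` cball 0 1 <= {0..1} \<times> cball 0 1" using that by blast
  have "continuous_on (cball 0 1) (%z::complex. (t, z))" by (intro continuous_intros)
  from continuous_on_compose2[OF cont this im] show ?thesis by simp
 qed
 define Q where "Q = ({0..1} \<times> cball 0 1) \<inter> (%(t, z). F t z) -` (- D)"
 have "compact Q"
 proof -
  have "closedin (top_of_set ({0..1} \<times> cball 0 1)) Q"
   unfolding Q_def using cont D(1) by (intro continuous_closedin_preimage) auto
  thus ?thesis by (rule closedin_compact[rotated]) (intro compact_Times; simp)
 qed
 hence "compact (fst ` Q)" by (intro compact_continuous_image continuous_intros)
 moreover have A_eq: "A = {0..1} - fst ` Q" by (force simp: A_def Q_def)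
 ultimately have "openin (top_of_set {0..1}) A"
  by (metis Diff_eq closed_def compact_imp_closed openin_open)
 moreover have "closedin (top_of_set {0..1}) A"
  unfolding closedin_limpt
 proof (intro conjI allI impI)
  show "A <= {0..1}" by (auto simp: A_def)
  fix t assume "t islimpt A & t : {0..1}"
  then obtain T where T: "!!n. T n : A" "T ----> t" and t: "t : {0..1}"
   unfolding islimpt_sequential by blast
  have T01: "T n : {0..1}" for n using T(1) by (auto simp: A_def)
  have lim: "(%n. F (T n) z) ----> F t z" if "z : cball 0 1" for z
   using continuous_on_tendsto_compose[OF cF[OF that] T(2) t] T01 by simp
  have FT: "F (T n) : discs_in D" for n
   using hol[OF T01] T(1)[of n] unfolding discs_in_def A_def by (fastforce simp: image_subset_iff)
  have y: "F t 1 : D" using bd[OF t, of 1] by simp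
  obtain q where q: "q > 0" "ball (F t 1) q <= D" using D(1) y openE by blast
  obtain d where d: "d > 0" "!!u. u : cball 0 1 ==> dist u 1 < d ==> dist (F t u) (F t 1) < q"
   using cz[OF t] q(1) unfolding continuous_on_iff by (metis mem_cball_0 norm_one order_refl)
  define u :: complex where "u = of_real (1 - min d 1 / 2)"
  have u: "u : unit_disc" "dist u 1 < d"
  proof -
   have "u - 1 = of_real (- (min d 1 / 2))" by (simp add: u_def)
   hence "norm (u - 1) = min d 1 / 2" using d(1) by (simp only: norm_of_real)
   thus "dist u 1 < d" using d(1) by (simp add: dist_norm)
   have "norm u = \<bar>1 - min d 1 / 2\<bar>" unfolding u_def by (rule norm_of_real)
   thus "u : unit_disc" using d(1) by (simp add: abs_if)
  qed
  hence Ftu: "F t u : D" using d(2)[of u] q(2) by (auto simp: dist_commute)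
  obtain q' where q': "q' > 0" "cball (F t u) q' <= D" using D(1) Ftu open_contains_cball by metis
  obtain s where s: "strict_mono (s :: nat => nat)" and
   alt: "(EX g : discs_in D. ALL K. compact K & K <= unit_disc -->
      uniform_limit K (%n. F (T (s n))) g sequentially) \<or>
     (ALL K L. compact K & K <= unit_disc & compact L & L <= D -->
      (EVS n. F (T (s n)) ` K \<inter> L = {}))"
   using D(2)[unfolded taut_def, rule_format, of "%n. F (T n)"] FT by blast
  have slim: "(%n. F (T (s n)) z) ----> F t z" if "z : cball 0 1" for z
   using LIMSEQ_subseq_LIMSEQ[OF lim[OF that] s] by (simp add: o_def)
  have uc: "u : cball 0 1" using u(1) by simp
  have "\<not> (EVS n. F (T (s n)) ` {u} \<inter> cball (F t u) q' = {})"
  proof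
   assume "EVS n. F (T (s n)) ` {u} \<inter> cball (F t u) q' = {}"
   moreover have "EVS n. dist (F (T (s n)) u) (F t u) < q'"
    using slim[OF uc] q'(1) by (rule tendstoD)
   ultimately have "EVS n. False"
    by eventually_elim (auto simp: dist_commute)
   thus False by simp
  qed
  hence "\<not> (ALL K L. compact K & K <= unit_disc & compact L & L <= D -->
      (EVS n. F (T (s n)) ` K \<inter> L = {}))"
   using u(1) q'(2) by (intro notI) (drule spec[of _ "{u}"], drule spec[of _ "cball (F t u) q'"], simp)
  with alt obtain g where g: "g : discs_in D"
   and g': "ALL K. compact K & K <= unit_disc --> uniform_limit K (%n. F (T (s n))) g sequentially"
   by blast
  have "F t z : D" if z: "z : cball 0 1" for z
  proof (cases "z : sphere 0 1")
   case True
   thus ?thesis using bd t by blast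
  next
   case False
   hence zu: "z : unit_disc" using z by simp
   have "(%n. F (T (s n)) z) ----> g z"
    using uniform_limit_imp_tendsto_at[OF mp[OF spec[OF g', of "{z}"]], of z] zu by auto
   hence "F t z = g z" using slim[OF z] LIMSEQ_unique by blast
   thus ?thesis using discs_inD(2)[OF g zu] by simp
  qed
  thus "t : A" using t by (simp add: A_def)
 qed
 ultimately have "A = {} \<or> A = {0..1}"
  using connected_clopen[of "{0..1::real}"] by (metis connected_Icc)
 moreover have "1 : A" using start by (simp add: A_def)
 ultimately have "0 : A" by auto
 thus ?thesis using z by (simp add: A_def)
qed

text \<open>A local defining function with Lipschitz gradient on a ball. The gradient is required to be nonzero on the whole ball, which a smaller radius achieves.\<close>
definition chart :: "'a::euclidean_space set => 'a => real => ('a => real) => ('a => 'a) => real => bool" where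
 "chart D a d r g L \<longleftrightarrow> 0 < d & 0 <= L & (ALL x:ball a d. GDERIV r x :> g x) &
   (ALL x:ball a d. ALL y:ball a d. norm (g x - g y) <= L * norm (x - y)) &
   (ALL x:ball a d. g x ~= 0) &
   (ALL x:ball a d. (x : D \<longleftrightarrow> r x < 0) & (x : closure D \<longleftrightarrow> r x <= 0))"

lemma chart_mono:
 assumes "chart D a d r g L" "ball b e <= ball a d" "0 < e"
 shows "chart D b e r g L"
 using assms unfolding chart_def by blast

lemma chartD:
 assumes "chart D a d r g L"
 shows "0 < d" "0 <= L" "x : ball a d ==> GDERIV r x :> g x"
  "x : ball a d ==> y : ball a d ==> norm (g x - g y) <= L * norm (x - y)"
  "x : ball a d ==> g x ~= 0"
  "x : ball a d ==> x : D \<longleftrightarrow> r x < 0"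
  "x : ball a d ==> x : closure D \<longleftrightarrow> r x <= 0"
 using assms unfolding chart_def by blast+

lemma chart_frontier:
 assumes "chart D a d r g L" "open D" "x : ball a d"
 shows "x : frontier D \<longleftrightarrow> r x = 0"
 using chartD(6,7)[OF assms(1,3)] assms(2) by (auto simp: frontier_def interior_open)

lemma chart_continuous: 
 assumes "chart D a d r g L"
 shows "continuous_on (ball a d) g"
proof -
 have "L-lipschitz_on (ball a d) g"
  using chartD(2,4)[OF assms] by (intro lipschitz_onI) (auto simp: dist_norm)
 thus ?thesis by (rule lipschitz_on_continuous_on)
qed

lemma C11_boundary_chart:
 assumes "C11_boundary D" "a : frontier D"
 obtains d r g L where "chart D a d r g L"
proof -
 obtain U r g L where U: "open U" "a : U" and r: "ALL x:U. GDERIV r x :> g x"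
  and L: "L-lipschitz_on U g" and nz: "ALL x:U \<inter> frontier D. g x ~= 0"
  and D: "D \<inter> U = {x : U. r x < 0}" "U - closure D = {x : U. r x > 0}"
  using bspec[OF assms(1)[unfolded C11_boundary_def] assms(2)]
  by (elim exE conjE) (rule that; assumption)
 have "continuous_on U g" using L by (rule lipschitz_on_continuous_on)
 hence "open (U \<inter> g -` (- {0}))" using U(1) by (intro continuous_open_preimage) auto
 moreover have "a : U \<inter> g -` (- {0})" using nz U(2) assms(2) by auto
 ultimately obtain d where d: "d > 0" "ball a d <= U \<inter> g -` (- {0})" using openE by blast
 have "chart D a d r g L"
  unfolding chart_def
 proof (intro conjI ballI)
  fix x assume x: "x : ball a d"
  hence xU: "x : U" using d(2) by blast
  show "GDERIV r x :> g x" using r xU by blast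
  show "g x ~= 0" using d(2) x by blast
  show "x : D \<longleftrightarrow> r x < 0" using D(1) xU by blast
  have "x \<notin> closure D \<longleftrightarrow> r x > 0" using D(2) xU by blast
  thus "x : closure D \<longleftrightarrow> r x <= 0" by auto
  fix y assume y: "y : ball a d"
  hence yU: "y : U" using d(2) by blast
  show "norm (g x - g y) <= L * norm (x - y)" using lipschitz_onD[OF L xU yU] by (simp add: dist_norm)
 qed (use d(1) lipschitz_on_nonneg[OF L] in auto)
 thus ?thesis using that by blast
qed

text \<open>The gradient is Lipschitz, so the first order expansion has a quadratic error.\<close>
lemma chart_taylor:
 assumes ch: "chart D a d r g L" and xy: "x : ball a d" "y : ball a d"
 shows "\<bar>r y - r x - (y - x) \<bullet> g x\<bar> <= L * (norm (y - x))\<^sup>2"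
proof -
 define p where "p t = x + t *R (y - x)" for t
 have p: "p t : ball a d" if "0 <= t" "t <= 1" for t
 proof -
  have "p t = (1 - t) *R x + t *R y" by (simp add: p_def algebra_simps)
  thus ?thesis using convexD[OF convex_ball xy, of "1 - t" t] that by simp
 qed
 have der: "((%t. r (p t)) has_derivative (%h. h * ((y - x) \<bullet> g (p t)))) (at t)" if "0 <= t" "t <= 1" for t
 proof -
  have "(r has_derivative (%h. h \<bullet> g (p t))) (at (p t))"
   using chartD(3)[OF ch p[OF that]] by (simp add: gderiv_def)
  moreover have "(p has_derivative (%h. h *R (y - x))) (at t)"
   unfolding p_def by (auto intro!: derivative_eq_intros)
  ultimately have "((%t. r (p t)) has_derivative (%h. (h *R (y - x)) \<bullet> g (p t))) (at t)"
   by (rule has_derivative_compose[rotated])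
  thus ?thesis by simp
 qed
 have "continuous_on {0..1} (%t. r (p t))"
  by (rule continuous_at_imp_continuous_on) (use der has_derivative_continuous in force)
 then obtain t where t: "0 < t" "t < 1" "r (p 1) - r (p 0) = (1 - 0) * ((y - x) \<bullet> g (p t))"
  using mvt[of 0 1 "%t. r (p t)" "%t h. h * ((y - x) \<bullet> g (p t))"] der
  by (metis less_eq_real_def zero_less_one)
 have "norm (g (p t) - g x) <= L * norm (p t - x)" using chartD(4)[OF ch p xy(1)] t by simp
 also have "norm (p t - x) = t * norm (y - x)" using t by (simp add: p_def)
 also have "L * (t * norm (y - x)) <= L * norm (y - x)"
  using t chartD(2)[OF ch] by (intro mult_left_mono mult_left_le_one_le) auto
 finally have b: "norm (g (p t) - g x) <= L * norm (y - x)" .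
 have "r y - r x - (y - x) \<bullet> g x = (y - x) \<bullet> (g (p t) - g x)"
  using t(3) by (simp add: p_def inner_diff_right)
 also have "\<bar>...\<bar> <= norm (y - x) * norm (g (p t) - g x)" by (rule Cauchy_Schwarz_ineq2)
 also have "... <= norm (y - x) * (L * norm (y - x))" using b by (intro mult_left_mono) auto
 finally show ?thesis by (simp add: power2_eq_square mult_ac)
qed

text \<open>The choice of the chart does not matter, by the uniqueness of the normal below.\<close>
definition inward :: "'a::euclidean_space set => 'a => 'a" where
 "inward D a = (SOME N. EX d r g L. chart D a d r g L & N = - (g a /\<^sub>R norm (g a)))"

lemma chart_inside:
 assumes ch: "chart D a d r g L" and w: "w \<bullet> g a < 0"
 obtains e where "e > 0" "!!x w' s. x : closure D ==> dist x a < e ==> dist w' w < e ==> 0 < s ==> s < e ==> x + s *R w' : D"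
proof -
 have d: "0 < d" using chartD(1)[OF ch] .
 have "isCont g a"
  using chart_continuous[OF ch] d by (metis centre_in_ball continuous_on_eq_continuous_at open_ball)
 hence g: "(g \<longlongrightarrow> g a) (nhds a)" by (simp add: isCont_def tendsto_nhds_iff)
 have "((%p. snd p \<bullet> g (fst p)) \<longlongrightarrow> w \<bullet> g a) (nhds a \<times>\<^sub>F nhds w)"
  by (intro tendsto_intros filterlim_snd filterlim_compose[OF g filterlim_fst])
 hence "\<forall>\<^sub>F p in nhds a \<times>\<^sub>F nhds w. snd p \<bullet> g (fst p) < w \<bullet> g a / 2"
  using w by (intro order_tendstoD(2)) auto
 then obtain P Q where PQ: "eventually P (nhds a)" "eventually Q (nhds w)"
  "!!x y. P x ==> Q y ==> y \<bullet> g x < w \<bullet> g a / 2"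
  unfolding eventually_prod_filter by auto
 obtain e1 where e1: "e1 > 0" "!!x. dist x a < e1 ==> P x" using PQ(1) by (auto simp: eventually_nhds_metric)
 obtain e2 where e2: "e2 > 0" "!!x. dist x w < e2 ==> Q x" using PQ(2) by (auto simp: eventually_nhds_metric)
 define W where "W = norm w + 1"
 define c where "c = - (w \<bullet> g a) / 2"
 have c: "c > 0" using w by (simp add: c_def)
 have W: "W > 0" by (simp add: W_def add_nonneg_pos)
 define S where "S = {e1, e2, 1, d / 2, d / (2 * W), c / (2 * (L * W\<^sup>2 + 1))}"
 define e where "e = Min S"
 have LW: "L * W\<^sup>2 + 1 > 0" using chartD(2)[OF ch] by (simp add: add_nonneg_pos)
 have e: "e > 0" "e <= e1" "e <= e2" "e <= 1" "e <= d / 2" "e <= d / (2 * W)" "e <= c / (2 * (L * W\<^sup>2 + 1))"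
 proof -
  have S: "finite S" "S ~= {}" "!!v. v : S ==> v > 0" using e1 e2 d c W LW by (auto simp: S_def)
  thus "e > 0" by (simp add: e_def)
  have le: "e <= v" if "v : S" for v using S that by (simp add: e_def)
  show "e <= e1" "e <= e2" "e <= 1" "e <= d / 2" "e <= d / (2 * W)" "e <= c / (2 * (L * W\<^sup>2 + 1))"
   by (rule le, simp add: S_def)+
 qed
 show ?thesis
 proof (rule that[OF e(1)])
  fix x w' s assume x: "x : closure D" "dist x a < e" and w': "dist w' w < e" and s: "0 < s" "s < e"
  have nw: "norm w' <= W" using w' e(4) norm_triangle_ineq2[of w' w] by (simp add: W_def dist_norm)
  have xb: "x : ball a d" using x(2) e(5) d by (simp add: dist_commute)
  have sW: "s * norm w' <= e * W" using s nw by (intro mult_mono) auto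
  also have "... <= d / (2 * W) * W" using e(6) W by (intro mult_right_mono) auto
  also have "... = d / 2" using W by simp
  finally have sd: "s * norm w' <= d / 2" .
  have "dist (x + s *R w') a <= dist (x + s *R w') x + dist x a" by (rule dist_triangle)
  also have "dist (x + s *R w') x = s * norm w'" using s by (simp add: dist_norm)
  finally have yb: "x + s *R w' : ball a d" using sd x(2) e(5) by (simp add: dist_commute)
  have "r (x + s *R w') <= r x + (s *R w') \<bullet> g x + L * (norm (s *R w'))\<^sup>2"
   using chart_taylor[OF ch xb yb] by simp
  also have "... = r x + s * (w' \<bullet> g x) + s * (s * (L * (norm w')\<^sup>2))"
   using s by (simp add: power_mult_distrib power2_eq_square mult_ac)
  finally have up: "r (x + s *R w') <= r x + s * (w' \<bullet> g x) + s * (s * (L * (norm w')\<^sup>2))" .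
  have "w' \<bullet> g x <= - c"
   using PQ(3)[OF e1(2) e2(2), of x w'] x(2) w' e(2,3) by (simp add: c_def)
  hence u1: "s * (w' \<bullet> g x) <= s * (- c)" using s by (intro mult_left_mono) auto
  have u2: "r x <= 0" using chartD(7)[OF ch xb] x(1) by simp
  have "(norm w')\<^sup>2 <= W\<^sup>2" using nw by (intro power_mono) auto
  hence "L * (norm w')\<^sup>2 <= L * W\<^sup>2 + 1"
   using mult_left_mono[of "(norm w')\<^sup>2" "W\<^sup>2" L] chartD(2)[OF ch] by linarith
  hence "s * (L * (norm w')\<^sup>2) <= s * (L * W\<^sup>2 + 1)" using s by (intro mult_left_mono) auto
  also have "... <= c / (2 * (L * W\<^sup>2 + 1)) * (L * W\<^sup>2 + 1)"
   using s e(7) LW by (intro mult_right_mono) auto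
  also have "... = c / 2" using LW by (simp add: field_simps)
  finally have "s * (s * (L * (norm w')\<^sup>2)) <= s * (c / 2)" using s by (intro mult_left_mono) auto
  hence "r (x + s *R w') <= s * (- c) + s * (c / 2)" using up u1 u2 by linarith
  also have "... < 0" using s c by (simp add: algebra_simps)
  finally show "x + s *R w' : D" using chartD(6)[OF ch yb] by simp
 qed
qed

lemma chart_outside:
 assumes ch: "chart D a d r g L" and w: "w \<bullet> g a > 0" and a: "a : frontier D" and D: "open D"
 obtains e where "e > 0" "!!s. 0 < s ==> s < e ==> a + s *R w \<notin> closure D"
proof -
 have d: "0 < d" using chartD(1)[OF ch] .
 have w0: "norm w > 0" using w by auto
 define e where "e = min (d / norm w) ((w \<bullet> g a) / (L * (norm w)\<^sup>2 + 1))"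
 have LW: "L * (norm w)\<^sup>2 + 1 > 0" using chartD(2)[OF ch] by (simp add: add_nonneg_pos)
 have e: "e > 0" "e <= d / norm w" "e <= (w \<bullet> g a) / (L * (norm w)\<^sup>2 + 1)"
  using d w w0 LW by (auto simp: e_def)
 show ?thesis
 proof (rule that[OF e(1)])
  fix s assume s: "0 < s" "s < e"
  have "s * norm w < d" using s e(2) w0 by (simp add: pos_less_divide_eq[symmetric])
  hence yb: "a + s *R w : ball a d" using s by (simp add: dist_norm)
  have ab: "a : ball a d" using d by simp
  have "r a = 0" using chart_frontier[OF ch D ab] a by simp
  have "s * (L * (norm w)\<^sup>2 + 1) < w \<bullet> g a" using s e(3) LW by (simp add: pos_less_divide_eq[symmetric])
  hence "s * (L * (norm w)\<^sup>2) < w \<bullet> g a" using s by (simp add: algebra_simps)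
  hence "s * (s * (L * (norm w)\<^sup>2)) < s * (w \<bullet> g a)" using s by simp
  moreover have "s * (w \<bullet> g a) - s * (s * (L * (norm w)\<^sup>2)) <= r (a + s *R w)"
   using chart_taylor[OF ch ab yb] \<open>r a = 0\<close> s by (simp add: power_mult_distrib power2_eq_square mult_ac)
  ultimately have "r (a + s *R w) > 0" by linarith
  thus "a + s *R w \<notin> closure D" using chartD(7)[OF ch yb] by simp
 qed
qed

text \<open>If two charts gave different normals, some direction would point into D for one and out of the closure for the other.\<close>
lemma chart_normal_unique:
 assumes ch: "chart D a d r g L" "chart D a d' r' g' L'" and a: "a : frontier D" and D: "open D"
 shows "g a /\<^sub>R norm (g a) = g' a /\<^sub>R norm (g' a)"
proof (rule ccontr)
 define n n' where "n = g a /\<^sub>R norm (g a)" and "n' = g' a /\<^sub>R norm (g' a)"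
 assume "\<not> ?thesis"
 hence ne: "n ~= n'" by (simp add: n_def n'_def)
 have g0: "g a ~= 0" "g' a ~= 0" using chartD(5)[OF ch(1), of a] chartD(5)[OF ch(2), of a] chartD(1)[OF ch(1)] chartD(1)[OF ch(2)] by simp_all
 hence u: "norm n = 1" "norm n' = 1" by (simp_all add: n_def n'_def)
 have "0 < (norm (n - n'))\<^sup>2" using ne by simp
 also have "(norm (n - n'))\<^sup>2 = 2 - 2 * (n \<bullet> n')"
  using u by (simp add: power2_norm_eq_inner inner_diff inner_commute norm_eq_1)
 finally have lt: "n \<bullet> n' < 1" by simp
 define w where "w = n' - n"
 have "w \<bullet> n = n' \<bullet> n - 1" "w \<bullet> n' = 1 - n \<bullet> n'"
  using u by (simp_all add: w_def inner_diff_left norm_eq_1)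
 hence "w \<bullet> n < 0" "w \<bullet> n' > 0" using lt by (simp_all add: inner_commute)
 moreover have "w \<bullet> g a = norm (g a) * (w \<bullet> n)" "w \<bullet> g' a = norm (g' a) * (w \<bullet> n')"
  using g0 by (simp_all add: n_def n'_def)
 ultimately have w: "w \<bullet> g a < 0" "w \<bullet> g' a > 0"
  using g0 by (simp_all add: mult_pos_neg)
 obtain e where e: "e > 0" "!!x w' s. x : closure D ==> dist x a < e ==> dist w' w < e ==> 0 < s ==> s < e ==> x + s *R w' : D"
  using chart_inside[OF ch(1) w(1)] by metis
 obtain e' where e': "e' > 0" "!!s. 0 < s ==> s < e' ==> a + s *R w \<notin> closure D"
  using chart_outside[OF ch(2) w(2) a D] by metis
 define s where "s = min e e' / 2"
 have "a : closure D" using a by (simp add: frontier_def)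
 hence "a + s *R w : D" using e e' by (intro e(2)) (auto simp: s_def)
 moreover have "a + s *R w \<notin> closure D" using e e' by (intro e'(2)) (auto simp: s_def)
 ultimately show False using closure_subset by blast
qed

lemma inward_chart:
 assumes "chart D a d r g L" "open D" "x : frontier D" "x : ball a d"
 shows "inward D x = - (g x /\<^sub>R norm (g x))"
proof -
 obtain e where e: "e > 0" "ball x e <= ball a d" using assms(4) openE open_ball by metis
 have ch: "chart D x e r g L" using chart_mono[OF assms(1) e(2,1)] .
 have "EX d r g L. chart D x d r g L & inward D x = - (g x /\<^sub>R norm (g x))"
  unfolding inward_def by (rule someI_ex) (use ch in blast)
 thus ?thesis using chart_normal_unique[OF ch _ assms(3,2)] by metis
qed

section \<open>A Bezout equation and holomorphic conormal lifts\<close>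

text \<open>The complex bilinear pairing, which unlike the Hermitian one is holomorphic in both arguments.\<close>
definition bil :: "complex ^ 'm => complex ^ 'm => complex" where
 "bil v w = (\<Sum>i\<in>UNIV. v $ i * w $ i)"

lemma bil_simps:
 "bil v (w + w') = bil v w + bil v w'" "bil v (w - w') = bil v w - bil v w'" "bil v (c *s w) = c * bil v w"
 "bil v (axis j 1) = v $ j"
proof -
 show "bil v (axis j 1) = v $ j"
 proof -
  have "bil v (axis j 1) = (\<Sum>i\<in>UNIV. if i = j then v $ j else 0)"
   unfolding bil_def by (rule sum.cong) (auto simp: axis_def)
  thus ?thesis by simp
 qed
qed (simp_all add: bil_def algebra_simps sum.distrib sum_subtractf sum_distrib_left)

lemma holomorphic_on_bil [holomorphic_intros]:
 assumes "!!i. hol f i S" "!!i. hol g i S"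
 shows "(%z. bil (f z) (g z)) holomorphic_on S"
 unfolding bil_def using assms by (intro holomorphic_intros)

lemma holomorphic_divide_zero_factor:
 assumes f: "f holomorphic_on S" "open S" "connected S" and a: "a : S" "f a = 0" and b: "b : S" "f b ~= 0"
 obtains g n where "g holomorphic_on S" "!!z. z : S ==> f z = (z - a) ^ n * g z" "g a ~= 0"
proof -
 have "\<not> f constant_on S" using a b unfolding constant_on_def by metis
 from holomorphic_factor_zero_nonconstant[OF f a this] obtain g0 r n where
  g0: "0 < n" "0 < r" "ball a r <= S" "g0 holomorphic_on ball a r"
   "!!w. w : ball a r ==> f w = (w - a) ^ n * g0 w" "!!w. w : ball a r ==> g0 w ~= 0" by metis
 define g where "g z = (if z : ball a r then g0 z else f z / (z - a) ^ n)" for z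
 have "g holomorphic_on ball a r \<union> (S - {a})"
 proof (rule holomorphic_on_Un)
  show "g holomorphic_on ball a r" by (rule holomorphic_transform[OF g0(4)]) (simp add: g_def)
  have "(%z. f z / (z - a) ^ n) holomorphic_on S - {a}"
   by (intro holomorphic_intros holomorphic_on_subset[OF f(1)]) auto
  thus "g holomorphic_on S - {a}"
   by (rule holomorphic_transform) (use g0(5) in \<open>auto simp: g_def\<close>)
 qed (use f(2) in auto)
 moreover have "ball a r \<union> (S - {a}) = S" using g0(2,3) by auto
 moreover have "f z = (z - a) ^ n * g z" if "z : S" for z
  using g0(2,5) by (auto simp: g_def)
 moreover have "g a ~= 0" using g0(2) g0(6)[of a] by (simp add: g_def) 
 ultimately show ?thesis using that by metis
qed

text \<open>Zeros in a compact set are finite in number; they are divided out one after the other.\<close>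
lemma holomorphic_finite_factorization:
 assumes "open S" "connected S" "compact K" "K <= S"
  and "f holomorphic_on S" "b : S" "f b ~= 0"
 obtains xs u where "set xs <= K" "u holomorphic_on S" "!!z. z : K ==> u z ~= 0"
  "!!z. z : S ==> f z = (\<Prod>a\<leftarrow>xs. z - a) * u z"
proof -
 have "EX xs u. set xs <= K & u holomorphic_on S & (ALL z:K. u z ~= 0) & (ALL z:S. f z = (\<Prod>a\<leftarrow>xs. z - a) * u z)"
  if "card {z:K. f z = 0} = n" "f holomorphic_on S" "EX b:S. f b ~= 0" for n f
  using that
 proof (induction n arbitrary: f rule: less_induct)
  case (less n f)
  show ?case
  proof (cases "{z:K. f z = 0} = {}")
   case True
   thus ?thesis using less.prems(2) by (intro exI[of _ "[]"] exI[of _ f]) auto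
  next
   case False
   then obtain a where a: "a : K" "f a = 0" by blast
   obtain b where b: "b : S" "f b ~= 0" using less.prems(3) by blast
   have aS: "a : S" using a assms(4) by blast
   have "\<not> f constant_on S" using aS a b by (metis constant_on_def)
   hence fin: "finite {z:K. f z = 0}"
    using holomorphic_compact_finite_zeros[OF less.prems(2) assms(1,2,3,4)] by blast
   obtain g k where g: "g holomorphic_on S" "!!z. z : S ==> f z = (z - a) ^ k * g z" "g a ~= 0"
    using holomorphic_divide_zero_factor[OF less.prems(2) assms(1,2) aS a(2) b] by metis
   have "{z:K. g z = 0} \<subset> {z:K. f z = 0}"
    using g(2,3) a assms(4) by auto
   hence "card {z:K. g z = 0} < n" using less.prems(1) fin psubset_card_mono by blast
   from less.IH[OF this refl g(1)] g(3) aS obtain xs u where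
    xs: "set xs <= K" "u holomorphic_on S" "ALL z:K. u z ~= 0" "ALL z:S. g z = (\<Prod>a\<leftarrow>xs. z - a) * u z" by blast
   have "(\<Prod>b\<leftarrow>replicate k a @ xs. z - b) = (z - a) ^ k * (\<Prod>a\<leftarrow>xs. z - a)" for z
    by (induction k) auto
   thus ?thesis using xs g(2) a(1)
    by (intro exI[of _ "replicate k a @ xs"] exI[of _ u]) (auto simp: mult.assoc)
  qed
 qed
 from this[OF refl assms(5)] assms(6,7) show ?thesis using that by blast
qed

lemma bil_cnj_self: "bil v (\<chi> i. cnj (v $ i)) = of_real ((norm v)\<^sup>2)"
proof -
 have "bil v (\<chi> i. cnj (v $ i)) = herm v v" by (simp add: bil_def herm_def mult.commute)
 thus ?thesis by (simp add: herm_self)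
qed

text \<open>The error 1 - M . psi is made to vanish at the listed points one at a time: at each step a constant multiple of the current product corrects the value at the new point, where M does not vanish.\<close>
lemma bezout_modulo_product:
 fixes M :: "complex => complex ^ 'm"
 assumes "open S" "!!i. hol M i S" "!!z. z : S ==> M z ~= 0" "set xs <= S"
 shows "EX psi h. (ALL i. hol psi i S) & h holomorphic_on S &
  (ALL z:S. 1 - bil (M z) (psi z) = (\<Prod>a\<leftarrow>xs. z - a) * h z)"
 using assms(4)
proof (induction xs)
 case Nil
 show ?case by (intro exI[of _ "%_. 0"] exI[of _ "%_. 1"]) (auto simp: bil_def)
next
 case (Cons a xs)
 have "set xs <= S" using Cons.prems by simp
 from Cons.IH[OF this] obtain psi h where psi': "ALL i. hol psi i S" "h holomorphic_on S"
  "ALL z:S. 1 - bil (M z) (psi z) = (\<Prod>a\<leftarrow>xs. z - a) * h z" by blast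
 note psi = psi'(1)[rule_format] psi'(2) psi'(3)[rule_format]
 have a: "a : S" using Cons.prems by simp
 define c where "c = (h a / of_real ((norm (M a))\<^sup>2)) *s (\<chi> i. cnj (M a $ i))"
 have Mc: "bil (M a) c = h a" using assms(3)[OF a] by (simp add: c_def bil_simps bil_cnj_self)
 define k where "k z = h z - bil (M z) c" for z
 have khol: "k holomorphic_on S" unfolding k_def by (intro holomorphic_intros psi assms(2))
 define h' where "h' z = (if z = a then deriv k a else (k z - k a) / (z - a))" for z
 have h'hol: "h' holomorphic_on S" unfolding h'_def using pole_lemma_open[OF khol assms(1)] .
 have kz: "k z = (z - a) * h' z" for z using Mc by (simp add: h'_def k_def)
 define psi' where "psi' z = psi z + (\<Prod>a\<leftarrow>xs. z - a) *s c" for z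
 have prhol: "(%z. \<Prod>a\<leftarrow>xs. z - a) holomorphic_on S" for xs :: "complex list"
  by (induction xs) (auto intro!: holomorphic_intros)
 have "hol psi' i S" for i
  unfolding psi'_def by (auto intro!: holomorphic_intros psi prhol)
 moreover have "1 - bil (M z) (psi' z) = (\<Prod>a\<leftarrow>a # xs. z - a) * h' z" if "z : S" for z
 proof -
  have "1 - bil (M z) (psi' z) = (\<Prod>a\<leftarrow>xs. z - a) * k z"
   using psi(3)[OF that] by (simp add: psi'_def bil_simps k_def algebra_simps)
  thus ?thesis by (simp add: kz mult_ac)
 qed
 ultimately show ?case using h'hol by blast
qed

text \<open>Choose the list as the zeros of one component M_j on a compact disc. The remaining error is then divisible by M_j and is absorbed by the j-th component.\<close>
lemma bezout_holomorphic:
 fixes M :: "complex => complex ^ 'm"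
 assumes hol: "!!i. hol M i unit_disc" and nz: "!!z. z : unit_disc ==> M z ~= 0" and r: "0 < r" "r < 1"
 obtains psi where "!!i. hol psi i (ball 0 r)" "!!z. z : ball 0 r ==> bil (M z) (psi z) = 1"
proof -
 have "M 0 ~= 0" using nz by simp
 then obtain j where j: "M 0 $ j ~= 0" by (auto simp: vec_eq_iff)
 have K: "cball 0 r <= unit_disc" using r by auto
 obtain xs u where xs: "set xs <= cball 0 r" "u holomorphic_on unit_disc" "!!z. z : cball 0 r ==> u z ~= 0"
  "!!z. z : unit_disc ==> M z $ j = (\<Prod>a\<leftarrow>xs. z - a) * u z"
  using holomorphic_finite_factorization[OF open_ball connected_ball compact_cball K hol[of j] _ j]
  by (metis centre_in_ball zero_less_one)
 obtain psi h where psi: "!!i. hol psi i unit_disc" "h holomorphic_on unit_disc"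
  "!!z. z : unit_disc ==> 1 - bil (M z) (psi z) = (\<Prod>a\<leftarrow>xs. z - a) * h z"
  using bezout_modulo_product[OF open_ball hol nz, of xs] xs(1) K by blast
 have sub: "ball 0 r <= unit_disc" using K by auto
 show ?thesis
 proof (rule that[of "%z. psi z + (h z / u z) *s axis j 1"])
  show "(%z. (psi z + (h z / u z) *s axis j 1) $ i) holomorphic_on ball 0 r" for i
   using xs(3) by (auto intro!: holomorphic_intros holomorphic_on_subset[OF psi(1) sub]
     holomorphic_on_subset[OF psi(2) sub] holomorphic_on_subset[OF xs(2) sub])
  fix z :: complex assume z: "z : ball 0 r"
  hence "u z ~= 0" "z : unit_disc" using xs(3) sub by auto
  thus "bil (M z) (psi z + (h z / u z) *s axis j 1) = 1"
   using psi(3)[of z] xs(4)[of z] by (simp add: bil_simps algebra_simps)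
 qed
qed

lemma holomorphic_real_valued_const:
 assumes "f holomorphic_on S" "open S" "convex S" "!!z. z : S ==> Im (f z) = 0" "z : S" "w : S"
 shows "f z = f w"
proof -
 have "(f has_field_derivative 0) (at z within S)" if z: "z : S" for z
 proof -
  have D: "(f has_field_derivative deriv f z) (at z)" using assms(1,2) z holomorphic_derivI by blast
  have "((%z. Im (f z)) has_derivative (%v. Im (deriv f z * v))) (at z)"
   using has_derivative_Im[OF D[unfolded has_field_derivative_def]] .
  moreover have "((%z. Im (f z)) has_derivative (%v. 0)) (at z)"
   by (rule has_derivative_transform_within_open[OF has_derivative_const assms(2) z]) (simp add: assms(4))
  ultimately have "Im (deriv f z * v) = 0" for v using has_derivative_unique by metis
  from this[of 1] this[of \<i>] have "deriv f z = 0" by (simp add: complex_eq_iff)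
  thus ?thesis using D has_field_derivative_at_within by metis
 qed
 then obtain c where "!!z. z : S ==> f z = c" using has_field_derivative_zero_constant[OF assms(3)] by metis
 thus ?thesis using assms(5,6) by simp
qed

text \<open>A holomorphic field that is everywhere a positive multiple of the conjugate of N. It is unique up to one positive constant, which is what allows local lifts to be glued.\<close>
definition conormal_lift :: "complex set => (complex => complex ^ 'm) => (complex => complex ^ 'm) => bool" where
 "conormal_lift U N M \<longleftrightarrow> (ALL i. hol M i U) &
   (ALL z:U. EX k::real. k > 0 & (ALL i. M z $ i = of_real k * cnj (N z $ i)))"

lemma conormal_lift_subset: "conormal_lift U N M ==> V <= U ==> conormal_lift V N M"
 unfolding conormal_lift_def using holomorphic_on_subset by blast

lemma conormal_lift_smult:
 assumes "conormal_lift U N M" "c > 0"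
 shows "conormal_lift U N (%z. of_real c *s M z)"
 unfolding conormal_lift_def
proof (intro conjI allI ballI)
 show "(%z. (of_real c *s M z) $ i) holomorphic_on U" for i
  using assms(1) by (auto simp: conormal_lift_def intro!: holomorphic_intros)
 fix z assume "z : U"
 then obtain k :: real where "k > 0" "ALL i. M z $ i = of_real k * cnj (N z $ i)"
  using assms(1) unfolding conormal_lift_def by blast
 thus "EX k>0. ALL i. (of_real c *s M z) $ i = of_real k * cnj (N z $ i)"
  using assms(2) by (intro exI[of _ "c * k"]) auto
qed

lemma conormal_lift_ratio:
 assumes "conormal_lift U N M" "conormal_lift U N M'" "z : U"
 obtains c :: real where "c > 0" "M' z = of_real c *s M z"
proof -
 obtain k :: real where k: "k > 0" "ALL i. M z $ i = of_real k * cnj (N z $ i)"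
  using assms(1,3) unfolding conormal_lift_def by blast
 obtain k' :: real where k': "k' > 0" "ALL i. M' z $ i = of_real k' * cnj (N z $ i)"
  using assms(2,3) unfolding conormal_lift_def by blast
 have "M' z = of_real (k' / k) *s M z" using k k' by (auto simp: vec_eq_iff)
 thus ?thesis using that k(1) k'(1) by (metis divide_pos_pos)
qed

text \<open>The quotient of two lifts is holomorphic and positive, hence constant.\<close>
lemma conormal_lift_unique:
 assumes lift: "conormal_lift U N M" "conormal_lift U N M'" and U: "open U" "connected U"
  and N: "!!z. z : U ==> N z ~= 0" and z0: "z0 : U" "M z0 = M' z0" and z: "z : U"
 shows "M z = M' z"
proof -
 have "ALL z:U. EX c::real. c > 0 & M' z = of_real c *s M z"
 proof
  fix z assume "z : U"
  from conormal_lift_ratio[OF lift this] show "EX c::real. c > 0 & M' z = of_real c *s M z" by blast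
 qed
 from bchoice[OF this] obtain f :: "complex => real" where f': "ALL z:U. f z > 0 & M' z = of_real (f z) *s M z" by blast
 hence f: "!!z. z : U ==> f z > 0" "!!z. z : U ==> M' z = of_real (f z) *s M z" by blast+
 have Mnz: "M z ~= 0" if "z : U" for z
 proof -
  obtain k :: real where "k > 0" "ALL i. M z $ i = of_real k * cnj (N z $ i)"
   using lift(1) \<open>z : U\<close> unfolding conormal_lift_def by blast
  thus ?thesis using N[OF that] by (auto simp: vec_eq_iff)
 qed
 have hol: "hol M i U" "hol M' i U" for i
  using lift by (auto simp: conormal_lift_def)
 have "f constant_on U"
 proof (rule locally_constant_imp_constant[OF U(2)])
  fix a assume a: "a : U"
  obtain i where i: "M a $ i ~= 0" using Mnz[OF a] by (auto simp: vec_eq_iff)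
  have "open (U \<inter> (%z. M z $ i) -` (- {0}))"
   using holomorphic_on_imp_continuous_on[OF hol(1)] U(1) by (intro continuous_open_preimage) auto
  then obtain d where d: "d > 0" "ball a d <= U \<inter> (%z. M z $ i) -` (- {0})"
   using openE[of _ a] a i by (metis (no_types, lifting) ComplI IntI singletonD vimageI)
  have sub: "ball a d <= U" and nz: "!!z. z : ball a d ==> M z $ i ~= 0" using d(2) by auto
  have q: "M' z $ i / M z $ i = of_real (f z)" if "z : ball a d" for z
   using f(2) nz[OF that] sub that by (auto simp: subset_iff)
  have "(%z. M' z $ i / M z $ i) holomorphic_on ball a d"
   using nz by (intro holomorphic_intros holomorphic_on_subset[OF hol(1) sub] holomorphic_on_subset[OF hol(2) sub])
  hence "M' z $ i / M z $ i = M' a $ i / M a $ i" if "z : ball a d" for z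
   using d(1) that q by (intro holomorphic_real_valued_const[of _ "ball a d"]) auto
  hence ff: "f z = f a" if "z : ball a d" for z using q[OF that] q[of a] that d(1) by (metis centre_in_ball of_real_eq_iff)
  show "EX T. openin (top_of_set U) T & a : T & (ALL x:T. f x = f a)"
  proof (intro exI[of _ "ball a d"] conjI ballI)
   show "openin (top_of_set U) (ball a d)" using sub by (intro open_subset) auto
   show "a : ball a d" using d(1) by simp
   show "f x = f a" if "x : ball a d" for x using that by (rule ff)
  qed
 qed
 then obtain c where c: "!!z. z : U ==> f z = c" by (auto simp: constant_on_def)
 have "M z0 = of_real c *s M z0" using f(2)[OF z0(1)] c[OF z0(1)] z0(2) by simp
 hence "c = 1" using Mnz[OF z0(1)] by (auto simp: vec_eq_iff)
 thus ?thesis using f(2)[OF z] c[OF z] by (simp add: vec_eq_iff)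
qed

text \<open>Local lifts on discs centred on the boundary circle are rescaled to agree with M. Two of them that overlap also overlap inside the circle, at the midpoint of their centres, so they agree with each other.\<close>
lemma conormal_lift_extend:
 fixes N :: "complex => complex ^ 'm"
 assumes lift: "conormal_lift (ball 0 t) N M" and t: "t > 0" "rho > 0"
  and loc: "!!z. z : sphere 0 t ==> EX M. conormal_lift (ball z rho) N M"
  and N: "!!z. z : ball 0 (t + rho) ==> N z ~= 0"
 shows "EX M. conormal_lift (ball 0 (t + rho)) N M"
proof -
 have sub: "ball z rho <= ball 0 (t + rho)" if "z : sphere 0 t" for z :: complex
 proof
  fix x assume "x : ball z rho"
  hence "norm x < norm z + rho" using norm_triangle_ineq2[of x z] by (simp add: dist_norm norm_minus_commute)
  thus "x : ball 0 (t + rho)" using that by simp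
 qed
 have "EX M'. conormal_lift (ball z rho) N M' & (ALL x:ball z rho \<inter> ball 0 t. M' x = M x)" if z: "z : sphere 0 t" for z
 proof -
  obtain M1 where M1: "conormal_lift (ball z rho) N M1" using loc[OF z] by blast
  define s where "s = max (1 - rho / (2 * t)) (1/2)"
  have s: "1/2 <= s" "s < 1" "t * (1 - s) < rho" using t by (auto simp: s_def max_def field_simps)
  define p where "p = of_real s * z"
  have "norm (z - p) = (1 - s) * norm z"
  proof -
   have "z - p = of_real (1 - s) * z" by (simp add: p_def algebra_simps)
   thus ?thesis using s by (simp only: norm_mult norm_of_real)
  qed
  hence p: "p : ball z rho" "p : ball 0 t" using s z t by (auto simp: dist_norm p_def norm_mult mult.commute)
  let ?W = "ball z rho \<inter> ball 0 t"
  have W: "conormal_lift ?W N M" "conormal_lift ?W N M1"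
   using conormal_lift_subset[OF lift] conormal_lift_subset[OF M1] by blast+
  obtain c :: real where c: "c > 0" "M p = of_real c *s M1 p" using conormal_lift_ratio[OF W(2,1)] p by blast
  have W': "conormal_lift ?W N (%z. of_real c *s M1 z)" by (rule conormal_lift_smult[OF W(2) c(1)])
  have oW: "open ?W" and cW: "connected ?W" by (auto intro: convex_connected convex_Int)
  have NW: "N x ~= 0" if "x : ?W" for x using N[of x] sub[OF z] that by blast
  have pW: "p : ?W" using p by blast
  have oW: "open ?W" and cW: "connected ?W" by (auto intro: convex_connected convex_Int)
  have NW: "N x ~= 0" if "x : ?W" for x using N[of x] sub[OF z] that by blast
  have pW: "p : ?W" using p by blast
  have "of_real c *s M1 x = M x" if "x : ?W" for x
   using conormal_lift_unique[OF W' W(1) oW cW NW pW c(2)[symmetric] that] .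
  thus ?thesis using conormal_lift_smult[OF M1 c(1)] by blast
 qed
 then obtain Mz where Mz: "!!z. z : sphere 0 t ==> conormal_lift (ball z rho) N (Mz z)"
  "!!z x. z : sphere 0 t ==> x : ball z rho ==> x : ball 0 t ==> Mz z x = M x" by (metis IntI)
 have agree: "Mz z1 x = Mz z2 x" if z: "z1 : sphere 0 t" "z2 : sphere 0 t" and x: "x : ball z1 rho" "x : ball z2 rho" for z1 z2 x
 proof (cases "z1 = z2")
  case False
  define m where "m = (z1 + z2) / 2"
  have "dist z1 z2 < 2 * rho" using x dist_triangle_less_add[of z1 x rho z2 rho] by (simp add: dist_commute)
  hence m: "m : ball z1 rho" "m : ball z2 rho"
   unfolding m_def by (auto simp: dist_norm field_simps norm_divide norm_minus_commute[of z2 z1])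
  have "m : ball 0 t"
  proof -
   have "(norm (z1 + z2))\<^sup>2 + (norm (z1 - z2))\<^sup>2 = 2 * (norm z1)\<^sup>2 + 2 * (norm z2)\<^sup>2"
    by (simp add: power2_norm_eq_inner inner_simps inner_commute)
   moreover have "(norm (z1 - z2))\<^sup>2 > 0" using False by simp
   moreover have "2 * (norm z1)\<^sup>2 + 2 * (norm z2)\<^sup>2 = (2 * t)\<^sup>2" using z by (simp add: power_mult_distrib)
   ultimately have "(norm (z1 + z2))\<^sup>2 < (2 * t)\<^sup>2" by linarith
   hence "norm (z1 + z2) < 2 * t" by (rule power2_less_imp_less) (use t(1) in simp)
   moreover have "norm m = norm (z1 + z2) / 2" unfolding m_def by (simp only: norm_divide norm_numeral)
   ultimately show ?thesis by simp
  qed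
  let ?W = "ball z1 rho \<inter> ball z2 rho"
  show ?thesis
  proof (rule conormal_lift_unique[of ?W N "Mz z1" "Mz z2" m])
   show "conormal_lift ?W N (Mz z1)" "conormal_lift ?W N (Mz z2)"
    using conormal_lift_subset[OF Mz(1)] z by blast+
   show "connected ?W" by (intro convex_connected convex_Int convex_ball)
   show "N x ~= 0" if "x : ?W" for x using N[of x] sub[OF z(1)] that by blast
   show "Mz z1 m = Mz z2 m" using Mz(2) z m \<open>m : ball 0 t\<close> by simp
  qed (use m x in auto)
 qed simp
 define c where "c x = of_real t * sgn x" for x :: complex
 have c: "c x : sphere 0 t" "x : ball (c x) rho" if x: "x : ball 0 (t + rho)" "x \<notin> ball 0 t" for x
 proof -
  have x0: "norm x >= t" "norm x < t + rho" "x ~= 0" using x t by auto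
  thus "c x : sphere 0 t" using t by (simp add: c_def norm_mult norm_sgn)
  have "c x - x = of_real (t - norm x) * sgn x"
   using x0 by (simp add: c_def sgn_eq field_simps)
  hence "norm (c x - x) = \<bar>t - norm x\<bar>" using x0 by (simp only: norm_mult norm_of_real norm_sgn) simp
  thus "x : ball (c x) rho" using x0 by (simp add: dist_norm)
 qed
 define M' where "M' x = (if x : ball 0 t then M x else Mz (c x) x)" for x
 have M'Mz: "M' x = Mz z x" if "z : sphere 0 t" "x : ball z rho" for x z
  using Mz(2)[OF that] agree[OF _ that(1) _ that(2)] c[of x] sub[OF that(1)] that(2) by (auto simp: M'_def)
 have M'M: "M' x = M x" if "x : ball 0 t" for x using that by (simp add: M'_def)
 have cover: "ball (0::complex) (t + rho) = ball 0 t \<union> (\<Union>z\<in>sphere 0 t. ball z rho)"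
 proof (rule subset_antisym)
  show "ball (0::complex) (t + rho) <= ball 0 t \<union> (\<Union>z\<in>sphere 0 t. ball z rho)"
  proof
   fix x :: complex assume x: "x : ball 0 (t + rho)"
   show "x : ball 0 t \<union> (\<Union>z\<in>sphere 0 t. ball z rho)"
   proof (cases "x : ball 0 t")
    case False
    from c[OF x this] show ?thesis by (intro UnI2 UN_I)
   next
    case True
    thus ?thesis by (rule UnI1)
   qed
  qed
  have "ball 0 t <= ball (0::complex) (t + rho)" using t by (intro subset_ball) simp
  thus "ball 0 t \<union> (\<Union>z\<in>sphere 0 t. ball z rho) <= ball (0::complex) (t + rho)" using sub by blast
 qed
 have "conormal_lift (ball 0 (t + rho)) N M'"
  unfolding conormal_lift_def
 proof (intro conjI allI ballI)
  fix i
  have "hol M i (ball 0 t)" using lift unfolding conormal_lift_def by blast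
  hence h1: "hol M' i (ball 0 t)"
   by (rule holomorphic_transform) (simp only: M'M)
  have h2: "hol M' i (ball z rho)" if z: "z : sphere 0 t" for z
  proof -
   have "hol (Mz z) i (ball z rho)" using Mz(1)[OF z] unfolding conormal_lift_def by blast
   thus ?thesis by (rule holomorphic_transform) (simp only: M'Mz[OF z])
  qed
  show "hol M' i (ball 0 (t + rho))"
   unfolding cover by (intro holomorphic_on_Un holomorphic_on_UN_open h1 h2 open_UN ballI open_ball)
 next
  fix x :: complex assume x: "x : ball 0 (t + rho)"
  show "EX k::real. k > 0 & (ALL i. M' x $ i = of_real k * cnj (N x $ i))"
  proof (cases "x : ball 0 t")
   case True
   hence "EX k::real. k > 0 & (ALL i. M x $ i = of_real k * cnj (N x $ i))"
    using lift unfolding conormal_lift_def by blast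
   thus ?thesis unfolding M'M[OF True] .
  next
   case False
   have "EX k::real. k > 0 & (ALL i. Mz (c x) x $ i = of_real k * cnj (N x $ i))"
    using Mz(1)[OF c(1)[OF x False]] c(2)[OF x False] unfolding conormal_lift_def by blast
   thus ?thesis unfolding M'Mz[OF c[OF x False]] .
  qed
 qed
 thus ?thesis by blast
qed

text \<open>A Lebesgue number gives one radius for all local lifts, and then finitely many extensions reach the required disc.\<close>
lemma conormal_lift_global:
 fixes N :: "complex => complex ^ 'm"
 assumes loc: "!!z. z : unit_disc ==> EX rho>0. EX M. conormal_lift (ball z rho) N M"
  and N: "!!z. z : unit_disc ==> N z ~= 0" and r: "0 < r" "r < 1"
 shows "EX M. conormal_lift (ball 0 r) N M"
proof -
 obtain R where R: "!!z. z : unit_disc ==> R z > 0" "!!z. z : unit_disc ==> EX M. conormal_lift (ball z (R z)) N M"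
  using loc by metis
 have K: "cball 0 r <= unit_disc" using r by auto
 obtain rho0 where rho0: "rho0 > 0" "!!z. z : cball 0 r ==> EX w:cball 0 r. ball z rho0 <= ball w (R w)"
 proof -
  have "cball 0 r <= \<Union>((%w. ball w (R w)) ` cball 0 r)" using R(1) K by force
  then obtain e where e: "e > 0" "!!x. x : cball 0 r ==> EX G:(%w. ball w (R w)) ` cball 0 r. ball x e <= G"
   by (rule Heine_Borel_lemma[OF compact_cball]) auto
  show ?thesis by (rule that[OF e(1)]) (use e(2) in blast)
 qed
 define rho where "rho = min rho0 (1 - r)"
 have rho: "rho > 0" "rho <= rho0" "r + rho <= 1" using rho0(1) r by (auto simp: rho_def)
 have loc': "EX M. conormal_lift (ball z rho) N M" if zr: "z : cball 0 r" for z
 proof -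
  obtain w where "w : cball 0 r" "ball z rho0 <= ball w (R w)" using rho0(2)[OF zr] by blast
  moreover have "ball z rho <= ball z rho0" using rho(2) by (rule subset_ball)
  ultimately show ?thesis using R(2)[of w] K conormal_lift_subset[of "ball w (R w)"] by (meson subset_iff subset_trans)
 qed
 have "EX M. conormal_lift (ball 0 (min r ((real n + 1) * rho))) N M" for n
 proof (induction n)
  case 0
  obtain M where "conormal_lift (ball 0 rho) N M" using loc'[of 0] r by auto
  moreover have "ball 0 (min r ((real 0 + 1) * rho)) <= ball (0::complex) rho" by (intro subset_ball) simp
  ultimately show ?case using conormal_lift_subset by blast
 next
  case (Suc n)
  define t where "t = min r ((real n + 1) * rho)"
  obtain M where M: "conormal_lift (ball 0 t) N M" using Suc by (auto simp: t_def)
  have t: "t > 0" "t <= r" using r rho(1) by (auto simp: t_def)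
  have "EX M. conormal_lift (ball 0 (t + rho)) N M"
  proof (rule conormal_lift_extend[OF M t(1) rho(1)])
   show "EX M. conormal_lift (ball z rho) N M" if "z : sphere 0 t" for z using loc'[of z] t that by auto
   show "N z ~= 0" if "z : ball 0 (t + rho)" for z using N[of z] t rho(3) that by simp
  qed
  moreover have "min r ((real (Suc n) + 1) * rho) <= t + rho"
   using rho(1) r by (auto simp: t_def min_def algebra_simps)
  ultimately show ?case using conormal_lift_subset[of "ball 0 (t + rho)"] subset_ball[of "min r ((real (Suc n) + 1) * rho)" "t + rho" 0] by blast
 qed
 moreover obtain n where "r / rho <= real n" using real_arch_simple by blast
 hence "min r ((real n + 1) * rho) = r" using rho(1) r by (simp add: min_def field_simps)
 ultimately show ?thesis by metis
qed

section \<open>Discs in the boundary of a taut domain\<close>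

locale taut_dom =
 fixes D :: "(complex ^ 'm) set"
 assumes dom: "domain D" and bdd: "bounded D" and taut: "taut D" and C11: "C11_boundary D"
begin

abbreviation N :: "complex ^ 'm => complex ^ 'm" where "N \<equiv> inward D"

abbreviation bdry where "bdry \<equiv> frontier D"

abbreviation kob where "kob \<equiv> kobayashi D"

lemma open_D: "open D"
 using dom by (simp add: domain_def)

lemma frontier_cl: "a : bdry ==> a : closure D"
 by (simp add: frontier_def)

lemma frontier_notin: "a : bdry ==> a \<notin> D"
 using open_D by (simp add: frontier_def interior_open)

lemma frontier_chart:
 assumes "a : bdry"
 obtains d r g L where "chart D a d r g L" "!!x. x : bdry ==> dist x a < d ==> N x = - (g x /\<^sub>R norm (g x))"
proof -
 obtain d r g L where ch: "chart D a d r g L" using C11_boundary_chart[OF C11 assms] .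
 show ?thesis
  by (rule that[OF ch]) (use inward_chart[OF ch open_D] in \<open>simp add: dist_commute\<close>)
qed

lemma inward_norm:
 assumes "a : bdry"
 shows "norm (N a) = 1"
proof -
 obtain d r g L where ch: "chart D a d r g L" "!!x. x : bdry ==> dist x a < d ==> N x = - (g x /\<^sub>R norm (g x))"
  using frontier_chart[OF assms] by blast
 have "g a ~= 0" using chartD(1)[OF ch(1)] chartD(5)[OF ch(1)] by simp
 thus ?thesis using ch(2)[OF assms] chartD(1)[OF ch(1)] by simp
qed

lemma inward_into:
 assumes a: "a : bdry" and w: "w \<bullet> N a > 0"
 shows "EX e>0. ALL x w' s. x : closure D --> dist x a < e --> dist w' w < e --> 0 < s --> s < e --> x + s *R w' : D"
proof -
 obtain d r g L where ch: "chart D a d r g L" "!!x. x : bdry ==> dist x a < d ==> N x = - (g x /\<^sub>R norm (g x))"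
  using frontier_chart[OF a] by blast
 have g: "g a ~= 0" using chartD(1)[OF ch(1)] chartD(5)[OF ch(1)] by simp
 have "N a = - (g a /\<^sub>R norm (g a))" using ch(2)[OF a] chartD(1)[OF ch(1)] by simp
 hence "w \<bullet> g a = - (norm (g a) * (w \<bullet> N a))" using g by simp
 hence "w \<bullet> g a < 0" using w g by simp
 from chart_inside[OF ch(1) this] show ?thesis by metis
qed

lemma inward_out:
 assumes a: "a : bdry" and w: "w \<bullet> N a < 0"
 shows "EX e>0. ALL s. 0 < s --> s < e --> a + s *R w \<notin> closure D"
proof -
 obtain d r g L where ch: "chart D a d r g L" "!!x. x : bdry ==> dist x a < d ==> N x = - (g x /\<^sub>R norm (g x))"
  using frontier_chart[OF a] by blast
 have g: "g a ~= 0" using chartD(1)[OF ch(1)] chartD(5)[OF ch(1)] by simp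
 have "N a = - (g a /\<^sub>R norm (g a))" using ch(2)[OF a] chartD(1)[OF ch(1)] by simp
 hence "w \<bullet> g a = - (norm (g a) * (w \<bullet> N a))" using g by simp
 hence "w \<bullet> g a > 0" using w g by (simp add: mult_pos_neg)
 from chart_outside[OF ch(1) this a open_D] show ?thesis by metis
qed

lemma inward_continuous_on: "continuous_on (bdry) N"
 unfolding continuous_on_eq_continuous_within
proof
 fix a assume a: "a : bdry"
 obtain d r g L where ch: "chart D a d r g L" "!!x. x : bdry ==> dist x a < d ==> N x = - (g x /\<^sub>R norm (g x))"
  using frontier_chart[OF a] by blast
 have d: "d > 0" using chartD(1)[OF ch(1)] .
 hence g: "g a ~= 0" using chartD(5)[OF ch(1)] by simp
 have "isCont g a"
  using chart_continuous[OF ch(1)] d by (simp add: continuous_on_eq_continuous_at)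
 hence "continuous (at a within bdry) g" by (rule continuous_at_imp_continuous_at_within)
 hence "continuous (at a within bdry) (%x. - (g x /\<^sub>R norm (g x)))"
  using g by (intro continuous_intros) auto
 thus "continuous (at a within bdry) N"
  by (rule continuous_transform_within[OF _ d a]) (simp add: ch(2))
qed

text \<open>Pushing along inward directions is possible with one size of step on a compact set of base points and directions.\<close>
lemma inward_into_compact:
 assumes C: "compact C" "!!a w. (a, w) : C ==> a : bdry & w \<bullet> N a > 0"
 obtains e where "e > 0" "!!a w x w' s. (a, w) : C ==> x : closure D ==> dist x a < e ==> dist w' w < e ==> 0 < s ==> s < e ==> x + s *R w' : D"
proof -
 have "EX e>0. ALL a w x w' s. (a, w) : C --> x : closure D --> dist x a < e --> dist w' w < e --> 0 < s --> s < e --> x + s *R w' : D"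
 proof (rule ccontr)
  assume neg: "\<not> ?thesis"
  have "EX p x w' s. p : C & x : closure D & dist x (fst p) < 1 / (real n + 1) & dist w' (snd p) < 1 / (real n + 1) & 0 < s & s < 1 / (real n + 1) & x + s *R w' \<notin> D" for n
  proof -
   have "EX a w x w' s. (a, w) : C & x : closure D & dist x a < 1 / (real n + 1) & dist w' w < 1 / (real n + 1) & 0 < s & s < 1 / (real n + 1) & x + s *R w' \<notin> D"
    using neg[unfolded not_ex, THEN spec, of "1 / (real n + 1)"] by auto
   thus ?thesis by (metis fst_conv snd_conv)
  qed
  then obtain p x w' s where bad: "!!n. p n : C" "!!n. x n : closure D" "!!n. dist (x n) (fst (p n)) < 1 / (real n + 1)"
   "!!n. dist (w' n) (snd (p n)) < 1 / (real n + 1)" "!!n. 0 < s n" "!!n. s n < 1 / (real n + 1)" "!!n. x n + s n *R w' n \<notin> D"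
   by metis
  obtain q j where q: "q : C" and j: "strict_mono (j :: nat => nat)" "(p \<circ> j) ----> q"
   using C(1) bad(1) unfolding compact_def by meson
  obtain e where e: "e > 0" "!!x w' s. x : closure D ==> dist x (fst q) < e ==> dist w' (snd q) < e ==> 0 < s ==> s < e ==> x + s *R w' : D"
   using inward_into[of "fst q" "snd q"] C(2)[of "fst q" "snd q"] q by auto
  have "EVS n. dist (p (j n)) q < e / 2"
   using tendstoD[OF j(2), of "e/2"] e(1) by (simp add: o_def)
  moreover have "(%n. 1 / (real n + 1)) ----> 0" by real_asymp
  hence "(%n. 1 / (real (j n) + 1)) ----> 0" using LIMSEQ_subseq_LIMSEQ[OF _ j(1)] by (fastforce simp: o_def)
  hence "EVS n. 1 / (real (j n) + 1) < e / 2" using e(1) by (intro order_tendstoD(2)) auto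
  ultimately have "EVS n. False"
  proof eventually_elim
   case (elim n)
   have "dist (x (j n)) (fst q) < e"
    using bad(3)[of "j n"] dist_fst_le[of "p (j n)" q] dist_triangle[of "x (j n)" "fst q" "fst (p (j n))"] elim by linarith
   moreover have "dist (w' (j n)) (snd q) < e"
    using bad(4)[of "j n"] dist_snd_le[of "p (j n)" q] dist_triangle[of "w' (j n)" "snd q" "snd (p (j n))"] elim by linarith
   moreover have "s (j n) < e" using bad(6)[of "j n"] elim e(1) by linarith
   ultimately show False using e(2) bad(2,5,7) by blast
  qed
  thus False by simp
 qed
 thus ?thesis using that by metis
qed

text \<open>The second alternative of the dichotomy for discs in the closure.\<close>
definition bdiscs :: "(complex => complex ^ 'm) set" where
 "bdiscs = {phi : cl_discs D. phi ` unit_disc <= bdry}"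

lemma bdiscsD:
 assumes "phi : bdiscs"
 shows "phi : cl_discs D" "z : unit_disc ==> phi z : bdry" "hol phi i unit_disc"
  "continuous_on unit_disc phi" "continuous_on unit_disc (%z. N (phi z))"
proof -
 show 1: "phi : cl_discs D" "z : unit_disc ==> phi z : bdry" for z
  using assms by (auto simp: bdiscs_def)
 show 2: "hol phi i unit_disc" "continuous_on unit_disc phi" using cl_discsD[OF 1(1)] by blast+
 show "continuous_on unit_disc (%z. N (phi z))"
  using 1(2) by (intro continuous_on_compose2[OF inward_continuous_on 2(2)]) blast
qed

lemma bdiscs_affine:
 assumes "phi : bdiscs" "cball c rho <= unit_disc" "rho >= 0"
 shows "(%u. phi (c + of_real rho * u)) : bdiscs"
proof -
 have "c + of_real rho * u : unit_disc" if "u : unit_disc" for u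
 proof -
  have "rho * cmod u <= rho" using assms(3) that by (simp add: mult_left_le)
  hence "c + of_real rho * u : cball c rho" using assms(3) by (simp add: dist_norm norm_mult)
  thus ?thesis using assms(2) by blast
 qed
 thus ?thesis
  using cl_discs_affine[OF bdiscsD(1)[OF assms(1)] assms(2,3)] bdiscsD(2)[OF assms(1)] unfolding bdiscs_def by blast
qed

lemma bdisc_dichotomy:
 assumes "phi : cl_discs D" "phi 0 : bdry"
 shows "phi : bdiscs"
proof -
 have "\<not> phi ` unit_disc <= D" using assms(2) frontier_notin by (metis centre_in_ball image_subset_iff zero_less_one)
 thus ?thesis using taut_cl_disc_dichotomy[OF open_D taut C11 assms(1)] assms(1) by (auto simp: bdiscs_def)
qed

text \<open>If psi points inwards on the circle, so does (1 - t) psi + t e for t in [0,1]. For small s the circles of phi + s ((1 - t) psi + t e) thus lie in D, and for t = 1 so does the whole disc. By the continuity principle the disc for t = 0 lies in D, so psi cannot point outwards inside.\<close>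
lemma bdisc_cone_property:
 assumes phi: "phi : bdiscs" and r: "0 < r" "r < 1"
  and e: "!!z::complex. z : cball 0 r ==> e \<bullet> N (phi z) > 0"
  and S: "open S" "cball 0 r <= S" and psi: "!!i. hol psi i S"
  and pos: "!!z. z : sphere 0 r ==> psi z \<bullet> N (phi z) > 0" and z: "z : cball 0 r"
 shows "psi z \<bullet> N (phi z) >= 0"
proof (rule ccontr)
 assume "\<not> ?thesis"
 hence neg: "psi z \<bullet> N (phi z) < 0" by simp
 have cr: "cball 0 r <= unit_disc" using r by auto
 have zu: "z : unit_disc" using z cr by blast
 obtain e0 where e0: "e0 > 0" "!!s. 0 < s ==> s < e0 ==> phi z + s *R psi z \<notin> closure D"
  using inward_out[OF bdiscsD(2)[OF phi zu] neg] by blast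
 have cphi: "continuous_on (cball 0 r) phi" using continuous_on_subset[OF bdiscsD(4)[OF phi] cr] .
 have cpsi: "continuous_on (cball 0 r) psi" using continuous_on_subset[OF holomorphic_vec_imp_continuous_on[OF psi] S(2)] .
 define C1 where "C1 = (%z. (phi z, e)) ` cball 0 r"
 define C2 where "C2 = (%(t, z). (phi z, (1 - t) *R psi z + t *R e)) ` ({0..1::real} \<times> sphere 0 r)"
 have "compact C1" unfolding C1_def
  by (intro compact_continuous_image continuous_intros cphi compact_cball)
 moreover have "compact C2" unfolding C2_def
 proof (rule compact_continuous_image)
  have sub: "snd ` ({0..1::real} \<times> sphere (0::complex) r) <= cball 0 r" by auto
  have "continuous_on ({0..1::real} \<times> sphere 0 r) (%p. phi (snd p))" "continuous_on ({0..1::real} \<times> sphere 0 r) (%p. psi (snd p))"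
   using continuous_on_compose2[OF cphi continuous_on_snd[OF continuous_on_id] sub]
    continuous_on_compose2[OF cpsi continuous_on_snd[OF continuous_on_id] sub] by simp_all
  thus "continuous_on ({0..1::real} \<times> sphere 0 r) (%(t, z). (phi z, (1 - t) *R psi z + t *R e))"
   unfolding case_prod_unfold by (intro continuous_intros)
  show "compact ({0..1::real} \<times> sphere (0::complex) r)" by (intro compact_Times compact_Icc compact_sphere)
 qed
 ultimately have "compact (C1 \<union> C2)" by (rule compact_Un)
 moreover have "a : bdry & w \<bullet> N a > 0" if "(a, w) : C1 \<union> C2" for a w
  using that
 proof
  assume "(a, w) : C1"
  then obtain z where z: "z : cball 0 r" "a = phi z" "w = e" by (auto simp: C1_def)
  have "z : unit_disc" using z(1) cr by blast
  thus ?thesis using z e[OF z(1)] bdiscsD(2)[OF phi] by simp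
 next
  assume "(a, w) : C2"
  then obtain t z where tz: "0 <= t" "t <= (1::real)" "z : sphere 0 r" "a = phi z" "w = (1 - t) *R psi z + t *R e"
   by (auto simp: C2_def)
  have zc: "z : cball 0 r" using tz(3) by simp
  hence "z : unit_disc" using cr by blast
  have "0 < (1 - t) * (psi z \<bullet> N (phi z)) + t * (e \<bullet> N (phi z))"
  proof (cases "t = 0")
   case False
   thus ?thesis using tz(1,2) pos[OF tz(3)] e[OF zc] by (intro add_nonneg_pos) auto
  qed (use pos[OF tz(3)] in simp)
  thus ?thesis using tz bdiscsD(2)[OF phi \<open>z : unit_disc\<close>] by (simp add: inner_add_left)
 qed
 ultimately obtain e1 where e1: "e1 > 0"
  "!!a w x w' s. (a, w) : C1 \<union> C2 ==> x : closure D ==> dist x a < e1 ==> dist w' w < e1 ==> 0 < s ==> s < e1 ==> x + s *R w' : D"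
  by (rule inward_into_compact) auto
 have into: "a + s *R w : D" if "(a, w) : C1 \<union> C2" "a : closure D" "0 < s" "s < e1" for a w s
  using e1(2)[OF that(1,2) _ _ that(3,4), of w] e1(1) by simp
 define s where "s = min e0 e1 / 2"
 have s: "0 < s" "s < e0" "s < e1" using e0(1) e1(1) by (auto simp: s_def)
 define F where "F t u = phi (of_real r * u) + s *R ((1 - t) *R psi (of_real r * u) + t *R e)" for t :: real and u
 have ru: "of_real r * u : cball 0 r" if "u : cball 0 1" for u :: complex
  using that r by (simp add: norm_mult mult_left_le)
 have rs: "of_real r * u : sphere 0 r" if "u : sphere 0 1" for u :: complex
  using that r by (simp add: norm_mult)
 have ruS: "of_real r * u : S \<inter> unit_disc" if "u : cball 0 1" for u :: complex
  using ru[OF that] S(2) cr by blast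
 have "F 0 (z / of_real r) : D"
 proof (rule taut_continuity_principle[OF open_D taut])
  have sub: "(%p. of_real r * snd p) ` ({0..1::real} \<times> cball (0::complex) 1) <= cball 0 r"
   using ru by force
  have "continuous_on ({0..1::real} \<times> cball (0::complex) 1) (%p. of_real r * snd p)" by (intro continuous_intros)
  from continuous_on_compose2[OF cphi this sub] continuous_on_compose2[OF cpsi this sub]
  show "continuous_on ({0..1} \<times> cball 0 1) (%(t, z). F t z)"
   unfolding F_def case_prod_unfold by (intro continuous_intros)
  have img: "(%u. of_real r * u) ` ball 0 1 <= S \<inter> unit_disc" using ruS by force
  have h: "(%u::complex. of_real r * u) holomorphic_on ball 0 1" by (intro holomorphic_intros)
  show "hol (F t) i (ball 0 1)" for t i
  proof -
   have "(%u. phi (of_real r * u) $ i) holomorphic_on ball 0 1" "(%u. psi (of_real r * u) $ i) holomorphic_on ball 0 1"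
    using holomorphic_on_compose_gen[OF h bdiscsD(3)[OF phi, of i]] holomorphic_on_compose_gen[OF h psi[of i]] img
    by (auto simp: o_def)
   thus ?thesis unfolding F_def by (auto simp: scaleR_conv_of_real intro!: holomorphic_intros)
  qed
  show "F t u : D" if "t : {0..1}" "u : sphere 0 1" for t u
  proof -
   have "(phi (of_real r * u), (1 - t) *R psi (of_real r * u) + t *R e) : C1 \<union> C2"
    using that(1) rs[OF that(2)] unfolding C2_def by (intro UnI2 image_eqI[of _ _ "(t, of_real r * u)"]) auto
   moreover have "of_real r * u : unit_disc" using rs[OF that(2)] r by simp
   ultimately show ?thesis unfolding F_def using frontier_cl[OF bdiscsD(2)[OF phi]] s by (intro into) auto
  qed
  show "F 1 u : D" if "u : cball 0 1" for u
  proof -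
   have "(phi (of_real r * u), (1 - 1) *R psi (of_real r * u) + 1 *R e) : C1 \<union> C2"
    using ru[OF that] unfolding C1_def by (intro UnI1 image_eqI[of _ _ "of_real r * u"]) auto
   moreover have "of_real r * u : unit_disc" using ruS[OF that] by blast
   ultimately show ?thesis unfolding F_def using frontier_cl[OF bdiscsD(2)[OF phi]] s by (intro into) auto
  qed
  show "z / of_real r : cball 0 1" using z r by (simp add: norm_divide)
 qed
 hence "phi z + s *R psi z : D" using r by (simp add: F_def)
 thus False using e0(2)[OF s(1,2)] closure_subset by blast
qed

lemma bdisc_local_conormal:
 assumes phi: "phi : bdiscs" and z0: "z0 : unit_disc"
 shows "EX rho>0. EX M. conormal_lift (ball z0 rho) (%z. N (phi z)) M"
proof -
 define e where "e = N (phi z0)"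
 have ne: "e \<bullet> N (phi z0) > 0"
  using inward_norm[OF bdiscsD(2)[OF phi z0]] by (simp add: e_def norm_eq_1)
 have "continuous_on unit_disc (%z. e \<bullet> N (phi z))" by (intro continuous_intros bdiscsD(5)[OF phi])
 hence "open (unit_disc \<inter> (%z. e \<bullet> N (phi z)) -` {0<..})" by (intro continuous_open_preimage) auto
 moreover have "z0 : unit_disc \<inter> (%z. e \<bullet> N (phi z)) -` {0<..}" using z0 ne by simp
 ultimately obtain rho where rho: "rho > 0" "cball z0 rho <= unit_disc \<inter> (%z. e \<bullet> N (phi z)) -` {0<..}"
  using open_contains_cball by meson
 have sub: "cball z0 rho <= unit_disc" using rho(2) by blast
 define f where "f = (%u. phi (z0 + of_real rho * u))"
 have f: "f : bdiscs" unfolding f_def using bdiscs_affine[OF phi sub] rho(1) by simp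
 have mem: "z0 + of_real rho * u : cball z0 rho" if "u : cball 0 1" for u
  using that rho(1) by (simp add: dist_norm norm_mult mult_left_le)
 have epos: "N (f u) \<bullet> e > 0" if "u : cball 0 1" for u
  using mem[OF that] rho(2) by (auto simp: f_def inner_commute)
 have cont: "continuous_on (cball 0 1) (%u. N (f u))"
  unfolding f_def
  by (rule continuous_on_compose2[OF bdiscsD(5)[OF phi]]) (use mem sub in \<open>auto intro!: continuous_intros\<close>)
 obtain M k where M: "!!i. hol M i (ball 0 (1/2))"
  "!!z. z : ball 0 (1/2) ==> k z > (0::real)"
  "!!z i. z : ball 0 (1/2) ==> M z $ i = of_real (k z) * cnj (N (f z) $ i)"
 proof (rule conormal_holomorphic_local[OF cont epos])
  fix r :: real and S :: "complex set" and psi :: "complex => complex ^ 'm" and z :: complex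
  assume r: "0 < r" "r < 1" and S: "open S" "cball 0 r <= S" and psi: "!!i. hol psi i S"
   and pos: "!!z. z : sphere 0 r ==> N (f z) \<bullet> psi z > 0" and z: "z : cball 0 r"
  have "psi z \<bullet> N (f z) >= 0"
  proof (rule bdisc_cone_property[OF f r _ S psi _ z])
   show "e \<bullet> N (f z) > 0" if "z : cball 0 r" for z
    using epos[of z] that r by (simp add: inner_commute)
   show "psi z \<bullet> N (f z) > 0" if "z : sphere 0 r" for z using pos[OF that] by (simp add: inner_commute)
  qed
  thus "N (f z) \<bullet> psi z >= 0" by (simp add: inner_commute)
 qed (assumption | rule that)+
 have img: "(%z. (z - z0) / of_real rho) ` ball z0 (rho/2) <= ball 0 (1/2)"
  using rho(1) by (auto simp: norm_divide dist_norm norm_minus_commute field_simps)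
 have "conormal_lift (ball z0 (rho/2)) (%z. N (phi z)) (%z. M ((z - z0) / of_real rho))"
  unfolding conormal_lift_def
 proof (intro conjI allI ballI)
  have "(%z. (z - z0) / of_real rho) holomorphic_on ball z0 (rho/2)" using rho(1) by (intro holomorphic_intros) auto
  from holomorphic_on_compose_gen[OF this M(1) img]
  show "(%z. M ((z - z0) / of_real rho) $ i) holomorphic_on ball z0 (rho/2)" for i by (simp add: o_def)
  fix z assume "z : ball z0 (rho/2)"
  hence "(z - z0) / of_real rho : ball 0 (1/2)" using img by blast
  from M(2,3)[OF this] show "EX k::real. k > 0 & (ALL i. M ((z - z0) / of_real rho) $ i = of_real k * cnj (N (phi z) $ i))"
   using rho(1) by (auto simp: f_def)
 qed
 thus ?thesis using rho(1) by (intro exI[of _ "rho/2"]) auto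
qed

lemma bdisc_conormal:
 assumes phi: "phi : bdiscs" and r: "0 < r" "r < 1"
 shows "EX M. conormal_lift (ball 0 r) (%z. N (phi z)) M"
proof (rule conormal_lift_global[OF bdisc_local_conormal[OF phi] _ r])
 show "N (phi z) ~= 0" if "z : unit_disc" for z
  using inward_norm[OF bdiscsD(2)[OF phi that]] by auto
qed

lemma bil_conormal:
 assumes "ALL i. v $ i = of_real k * cnj (n $ i)"
 shows "bil v w = of_real k * herm n w"
 using assms by (simp add: bil_def herm_def sum_distrib_left mult.assoc)

text \<open>The conormal does not vanish, so the Bezout equation produces a holomorphic field transversal to the boundary.\<close>
lemma bdisc_transversal:
 assumes phi: "phi : bdiscs" and r: "0 < r" "r < 1"
 obtains M psi where "conormal_lift (ball 0 r) (%z. N (phi z)) M" "!!i. hol psi i (ball 0 r)"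
  "!!z. z : ball 0 r ==> bil (M z) (psi z) = 1"
proof -
 define R where "R = (1 + r) / 2"
 have R: "0 < R" "R < 1" "r < R" using r by (auto simp: R_def)
 obtain M where M: "conormal_lift (ball 0 R) (%z. N (phi z)) M" using bdisc_conormal[OF phi R(1,2)] by blast
 define M1 where "M1 z = M (of_real R * z)" for z
 have img: "(%z::complex. of_real R * z) ` unit_disc <= ball 0 R" using R by (auto simp: norm_mult)
 have M1hol: "hol M1 i unit_disc" for i
 proof -
  have "(%z. of_real R * z) holomorphic_on unit_disc" by (intro holomorphic_intros)
  moreover have "hol M i (ball 0 R)" using M unfolding conormal_lift_def by blast
  ultimately show ?thesis unfolding M1_def using holomorphic_on_compose_gen[OF _ _ img] by (simp add: o_def)
 qed
 have M1nz: "M1 z ~= 0" if z: "z : unit_disc" for z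
 proof -
  have zR: "of_real R * z : ball 0 R" using img z by blast
  then obtain k :: real where k: "k > 0" "ALL i. M1 z $ i = of_real k * cnj (N (phi (of_real R * z)) $ i)"
   using M unfolding conormal_lift_def M1_def by blast
  have "of_real R * z : unit_disc" using zR R(2) by simp
  hence "N (phi (of_real R * z)) ~= 0" using inward_norm[OF bdiscsD(2)[OF phi]] by force
  thus ?thesis using k by (auto simp: vec_eq_iff)
 qed
 have rR: "0 < r / R" "r / R < 1" using R r by auto
 obtain psi where psi: "!!i. hol psi i (ball 0 (r/R))" "!!z. z : ball 0 (r/R) ==> bil (M1 z) (psi z) = 1"
  using bezout_holomorphic[OF M1hol M1nz rR] by blast
 have img2: "(%z::complex. z / of_real R) ` ball 0 r <= ball 0 (r/R)" using R by (auto simp: norm_divide divide_strict_right_mono)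
 show ?thesis
 proof (rule that[of M "%z. psi (z / of_real R)"])
  show "conormal_lift (ball 0 r) (%z. N (phi z)) M"
   by (rule conormal_lift_subset[OF M]) (use R in \<open>auto intro!: subset_ball\<close>)
  have "(%z. z / of_real R) holomorphic_on ball 0 r" using R by (intro holomorphic_intros) auto
  from holomorphic_on_compose_gen[OF this psi(1) img2]
  show "(%z. psi (z / of_real R) $ i) holomorphic_on ball 0 r" for i by (simp add: o_def)
  show "bil (M z) (psi (z / of_real R)) = 1" if "z : ball 0 r" for z
  proof -
   have "z / of_real R : ball 0 (r/R)" using img2 that by blast
   from psi(2)[OF this] show ?thesis using R by (simp add: M1_def)
  qed
 qed
qed

end

section \<open>Kobayashi chains and infinitesimal rates\<close>

lemma norm_smult: "norm (c *s x) = norm c * norm (x :: complex ^ 'm)"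
 by (simp add: norm_vec_def L2_set_def norm_mult power_mult_distrib sum_distrib_left[symmetric] real_sqrt_mult)

lemma lempert_nonneg:
 assumes "domain D" "z : D" "w : D"
 shows "0 <= lempert D z w"
proof -
 obtain phi t where "phi : discs_in D" "phi 0 = z" "phi t = w" "t : unit_disc" using domain_disc_through[OF assms] .
 hence "{hyp_dist 0 t | t. t : unit_disc & (EX phi : discs_in D. phi 0 = z & phi t = w)} ~= {}" by blast
 thus ?thesis unfolding lempert_def
  by (rule cInf_greatest) (use hyp_dist_zero_nonneg in blast)
qed

definition chain_len :: "(complex ^ 'm) set => nat => (nat => complex ^ 'm) => real" where
 "chain_len D n p = (\<Sum>j=1..n. lempert D (p (j - 1)) (p j))"

definition chain :: "(complex ^ 'm) set => nat => (nat => complex ^ 'm) => complex ^ 'm => complex ^ 'm => bool" where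
 "chain D n p z w \<longleftrightarrow> n >= 1 & (ALL j<=n. p j : D) & p 0 = z & p n = w"

lemma kobayashi_eq: "kobayashi D z w = Inf {chain_len D n p | n p. chain D n p z w}"
 unfolding kobayashi_def chain_len_def chain_def by simp

lemma chain_len_nonneg:
 assumes "domain D" "chain D n p z w"
 shows "0 <= chain_len D n p"
 unfolding chain_len_def
 by (intro sum_nonneg lempert_nonneg[OF assms(1)]) (use assms(2) in \<open>auto simp: chain_def\<close>)

lemma kobayashi_le_chain:
 assumes "domain D" "chain D n p z w"
 shows "kobayashi D z w <= chain_len D n p"
proof -
 have "bdd_below {chain_len D n p | n p. chain D n p z w}"
  using chain_len_nonneg[OF assms(1)] by (intro bdd_belowI[of _ 0]) blast
 thus ?thesis unfolding kobayashi_eq by (intro cInf_lower) (use assms(2) in blast)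
qed

lemma chain_one: "z : D ==> w : D ==> chain D 1 (%j. if j = 0 then z else w) z w"
 by (simp add: chain_def)

lemma kobayashi_approx:
 assumes "domain D" "z : D" "w : D" "kobayashi D z w < c"
 obtains n p where "chain D n p z w" "chain_len D n p < c"
proof -
 have "{chain_len D n p | n p. chain D n p z w} ~= {}" using chain_one[OF assms(2,3)] by blast
 from cInf_lessD[OF this assms(4)[unfolded kobayashi_eq]] show ?thesis using that by blast
qed

lemma kobayashi_nonneg:
 assumes "domain D" "z : D" "w : D"
 shows "0 <= kobayashi D z w"
 unfolding kobayashi_eq
proof (rule cInf_greatest)
 show "{chain_len D n p | n p. chain D n p z w} ~= {}" using chain_one[OF assms(2,3)] by blast
qed (use chain_len_nonneg[OF assms(1)] in blast)

lemma kobayashi_le_lempert: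
 assumes "domain D" "z : D" "w : D"
 shows "kobayashi D z w <= lempert D z w"
 using kobayashi_le_chain[OF assms(1) chain_one[OF assms(2,3)]] by (simp add: chain_len_def)

lemma kobayashi_le_disc:
 assumes "domain D" "f : discs_in D" "f 0 = z" "f t = w" "t : unit_disc"
 shows "kobayashi D z w <= hyp_dist 0 t"
proof -
 have "z : D" "w : D" using discs_inD(2)[OF assms(2), of 0] discs_inD(2)[OF assms(2,5)] assms(3,4) by auto
 thus ?thesis using kobayashi_le_lempert[OF assms(1)] lempert_le[OF assms(2-5)] by (meson order_trans)
qed

lemma kobayashi_refl:
 assumes "domain D" "z : D"
 shows "kobayashi D z z = 0"
proof -
 have "(%_. z) : discs_in D" using assms(2) by (auto simp: discs_in_def)
 from kobayashi_le_disc[OF assms(1) this refl refl, of 0] have "kobayashi D z z <= 0" by (simp add: hyp_dist_zero_left)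
 thus ?thesis using kobayashi_nonneg[OF assms(1,2,2)] by simp
qed

text \<open>Chains are concatenated.\<close>
lemma kobayashi_triangle:
 assumes D: "domain D" and "z : D" "y : D" "w : D"
 shows "kobayashi D z w <= kobayashi D z y + kobayashi D y w"
proof (rule field_le_epsilon)
 fix e :: real assume "e > 0"
 obtain n p where p: "chain D n p z y" "chain_len D n p < kobayashi D z y + e / 2"
  by (rule kobayashi_approx[OF D assms(2,3), of "kobayashi D z y + e / 2"]) (use \<open>e > 0\<close> in auto)
 obtain k q where q: "chain D k q y w" "chain_len D k q < kobayashi D y w + e / 2"
  by (rule kobayashi_approx[OF D assms(3,4), of "kobayashi D y w + e / 2"]) (use \<open>e > 0\<close> in auto)
 define c where "c j = (if j <= n then p j else q (j - n))" for j
 have "chain D (n + k) c z w" unfolding chain_def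
 proof (intro conjI allI impI)
  fix j assume "j <= n + k"
  thus "c j : D" using p(1) q(1) by (cases "j <= n") (simp_all add: c_def chain_def)
 qed (use p(1) q(1) in \<open>auto simp: c_def chain_def\<close>)
 moreover have "chain_len D (n + k) c = chain_len D n p + chain_len D k q"
 proof -
  have "chain_len D (n + k) c = (\<Sum>j=1..n. lempert D (c (j - 1)) (c j)) + (\<Sum>j=n+1..n+k. lempert D (c (j - 1)) (c j))"
   unfolding chain_len_def by (rule sum.ub_add_nat) simp
  also have "(\<Sum>j=1..n. lempert D (c (j - 1)) (c j)) = chain_len D n p"
   unfolding chain_len_def by (rule sum.cong) (auto simp: c_def)
  also have "(\<Sum>j=n+1..n+k. lempert D (c (j - 1)) (c j)) = (\<Sum>j=1..k. lempert D (c (j + n - 1)) (c (j + n)))"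
   using sum.shift_bounds_cl_nat_ivl[of "%j. lempert D (c (j - 1)) (c j)" 1 n k] by (simp add: add.commute)
  also have "... = chain_len D k q"
   unfolding chain_len_def
  proof (rule sum.cong)
   fix j assume j: "j : {1..k}"
   have "c (j + n - 1) = q (j - 1)"
    using j p(1) q(1) by (cases "j = 1") (auto simp: c_def chain_def)
   moreover have "c (j + n) = q j" using j by (auto simp: c_def)
   ultimately show "lempert D (c (j + n - 1)) (c (j + n)) = lempert D (q (j - 1)) (q j)" by simp
  qed simp
  finally show ?thesis .
 qed
 ultimately have "kobayashi D z w <= chain_len D n p + chain_len D k q" using kobayashi_le_chain[OF D] by metis
 thus "kobayashi D z w <= kobayashi D z y + kobayashi D y w + e" using p(2) q(2) by linarith
qed

lemma artanh_le_near_zero: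
 fixes e :: real
 assumes "e > 0"
 obtains d where "0 < d" "d < 1" "!!t. 0 <= t ==> t < d ==> artanh t <= (1 + e) * t"
proof -
 have "(artanh has_field_derivative 1) (at (0::real))"
  using artanh_real_has_field_derivative[of 0 UNIV] by simp
 hence "((%t. artanh t / t) \<longlongrightarrow> 1) (at (0::real))"
  by (simp add: has_field_derivative_iff)
 hence "\<forall>\<^sub>F t in at (0::real). artanh t / t < 1 + e" using assms by (intro order_tendstoD(2)) auto
 then obtain d0 where d0: "d0 > 0" "!!t. t ~= 0 ==> dist t 0 < d0 ==> artanh t / t < 1 + e"
  unfolding eventually_at by blast
 show ?thesis
 proof (rule that[of "min d0 (1/2)"])
  fix t :: real assume t: "0 <= t" "t < min d0 (1/2)"
  show "artanh t <= (1 + e) * t"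
  proof (cases "t = 0")
   case False
   hence "artanh t / t < 1 + e" using d0(2)[of t] t by simp
   thus ?thesis using t False by (simp add: divide_less_eq)
  qed simp
 qed (use d0(1) in auto)
qed

text \<open>Points in a ball are joined by discs that are affine in the parameter.\<close>
lemma kobayashi_locally_lipschitz:
 assumes D: "domain D" and x: "x : D"
 obtains d C where "d > 0" "C >= 0" "ball x d <= D" "!!y y'. y : ball x d ==> y' : ball x d ==> kobayashi D y y' <= C * norm (y' - y)"
proof -
 have "open D" using D by (simp add: domain_def)
 then obtain q where q: "q > 0" "ball x q <= D" using x openE by blast
 obtain d0 where d0: "0 < d0" "d0 < 1" "!!t::real. 0 <= t ==> t < d0 ==> artanh t <= (1 + 1) * t"
  using artanh_le_near_zero[of 1] by auto
 define rho where "rho = q / 2"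
 define d where "d = d0 * rho / 2"
 have d: "0 < d" "d <= rho" "2 * d <= d0 * rho" "rho > 0"
  using q(1) d0 by (auto simp: d_def rho_def)
 show ?thesis
 proof (rule that[of d "2 / rho"])
  show "ball x d <= D" using q d by (intro order_trans[OF subset_ball q(2)]) (auto simp: rho_def)
  fix y y' assume y: "y : ball x d" "y' : ball x d"
  show "kobayashi D y y' <= 2 / rho * norm (y' - y)"
  proof (cases "y = y'")
   case True
   thus ?thesis using kobayashi_refl[OF D] y(1) \<open>ball x d <= D\<close> by auto
  next
   case False
   define l where "l = norm (y' - y)"
   have l: "l > 0" "l < 2 * d"
    using False dist_triangle_less_add[of y x d y' d] y by (auto simp: l_def dist_norm norm_minus_commute)
   define f where "f u = y + (u * of_real (rho / l)) *s (y' - y)" for u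
   have nf: "norm (f u - y) = norm u * rho" for u
   proof -
    have "f u - y = (u * of_real (rho / l)) *s (y' - y)" by (simp add: f_def)
    also have "norm ... = norm (u * of_real (rho / l)) * norm (y' - y)" by (rule norm_smult)
    finally show ?thesis using l(1) d(4) by (simp add: norm_mult norm_divide l_def)
   qed
   have fD: "f u : D" if "u : unit_disc" for u
   proof -
    have "norm (f u - y) < rho" using that d(4) by (simp add: nf)
    hence "dist x (f u) < q"
     using y(1) d(2) dist_triangle[of x "f u" y] by (simp add: dist_norm norm_minus_commute rho_def)
    thus ?thesis using q(2) by auto
   qed
   have "hol f i unit_disc" for i
    unfolding f_def by (auto intro!: holomorphic_intros)
   hence f: "f : discs_in D" using fD unfolding discs_in_def by blast
   define t where "t = (of_real (l / rho) :: complex)"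
   have lr: "0 <= l / rho" "l / rho < d0" using l d by (auto simp: divide_less_eq)
   have "t * of_real (rho / l) = of_real (l / rho * (rho / l))" unfolding t_def by (rule of_real_mult[symmetric])
   also have "l / rho * (rho / l) = 1" using l(1) d(4) by simp
   finally have tt: "t * of_real (rho / l) = 1" by simp
   have fty: "f t = y'" unfolding f_def tt by simp
   have nt: "norm t = \<bar>l / rho\<bar>" unfolding t_def by (rule norm_of_real)
   have "kobayashi D y y' <= hyp_dist 0 t"
   proof (rule kobayashi_le_disc[OF D f _ fty])
    show "f 0 = y" by (simp add: f_def)
    show "t : unit_disc" using nt lr d0(2) by simp
   qed
   also have "... = artanh (l / rho)" using nt abs_of_nonneg[OF lr(1)] by (simp only: hyp_dist_zero_left)
   also have "... <= 2 * (l / rho)" using d0(3)[OF lr] by simp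
   finally show ?thesis by (simp add: l_def)
  qed
 qed (use d in auto)
qed

lemma kobayashi_continuous_at:
 assumes D: "domain D" and z: "z : D" and x: "x : D" "(f \<longlongrightarrow> x) F"
 shows "((%n. kobayashi D z (f n)) \<longlongrightarrow> kobayashi D z x) F"
proof -
 obtain d C where d: "d > 0" "C >= 0" "ball x d <= D" "!!y y'. y : ball x d ==> y' : ball x d ==> kobayashi D y y' <= C * norm (y' - y)"
  using kobayashi_locally_lipschitz[OF D x(1)] by blast
 have "\<forall>\<^sub>F n in F. norm (kobayashi D z (f n) - kobayashi D z x) <= C * norm (f n - x)"
  using tendstoD[OF x(2) d(1)]
 proof eventually_elim
  case (elim n)
  hence fb: "f n : ball x d" "x : ball x d" using d(1) by (auto simp: dist_commute)
  hence fD: "f n : D" using d(3) by blast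
  show ?case
   using kobayashi_triangle[OF D z x(1) fD] kobayashi_triangle[OF D z fD x(1)] d(4)[OF fb] d(4)[OF fb(2,1)]
   by (simp add: norm_minus_commute abs_le_iff)
 qed
 moreover have "((%n. C * norm (f n - x)) \<longlongrightarrow> 0) F"
  using tendsto_mult_right_zero[OF tendsto_norm_zero[OF LIM_zero[OF x(2)]]] by blast
 ultimately show ?thesis by (rule LIM_zero_cancel[OF Lim_null_comparison])
qed

text \<open>An upper bound l for the infinitesimal Kobayashi metric at x in direction v, made uniform in the base point so that rates in different directions can be added by moving in one direction after the other.\<close>
definition rate :: "(complex ^ 'm) set => complex ^ 'm => complex ^ 'm => real => bool" where
 "rate D x v l \<longleftrightarrow> (ALL l'>l. EX d>0. ALL y:ball x d. ALL h. 0 < h --> h < d -->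
   y : D & y + h *R v : D & kobayashi D y (y + h *R v) <= l' * h)"

lemma rateD:
 assumes "rate D x v l" "l < l'"
 obtains d where "d > 0" "!!y h. y : ball x d ==> 0 < h ==> h < d ==> y : D & y + h *R v : D & kobayashi D y (y + h *R v) <= l' * h"
 using assms unfolding rate_def by blast

text \<open>Move first along v, then along w; the triangle inequality adds the costs.\<close>
lemma rate_add:
 assumes D: "domain D" and v: "rate D x v l" and w: "rate D x w k"
 shows "rate D x (v + w) (l + k)"
 unfolding rate_def
proof (intro allI impI)
 fix l' assume "l + k < l'"
 define c where "c = (l' - l - k) / 2"
 have c: "c > 0" "l' = (l + c) + (k + c)" using \<open>l + k < l'\<close> by (simp_all add: c_def field_simps)
 obtain d1 where d1: "d1 > 0" "!!y h. y : ball x d1 ==> 0 < h ==> h < d1 ==> y : D & y + h *R v : D & kobayashi D y (y + h *R v) <= (l + c) * h"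
  by (rule rateD[OF v, of "l + c"]) (use c in auto)
 obtain d2 where d2: "d2 > 0" "!!y h. y : ball x d2 ==> 0 < h ==> h < d2 ==> y : D & y + h *R w : D & kobayashi D y (y + h *R w) <= (k + c) * h"
  by (rule rateD[OF w, of "k + c"]) (use c in auto)
 define d where "d = min d1 (d2 / (2 + norm v))"
 have nv: "2 + norm v > 0" by (simp add: add_pos_nonneg)
 have "d <= d2 / (2 + norm v)" by (simp add: d_def)
 hence "d * (2 + norm v) <= d2" using nv by (simp add: pos_le_divide_eq)
 moreover have "d > 0" "d <= d1" using d1(1) d2(1) nv by (simp_all add: d_def)
 ultimately have d: "d > 0" "d <= d1" "d * (2 + norm v) <= d2" by blast+
 show "EX d>0. ALL y:ball x d. ALL h. 0 < h --> h < d -->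
   y : D & y + h *R (v + w) : D & kobayashi D y (y + h *R (v + w)) <= l' * h"
 proof (intro exI[of _ d] conjI[OF d(1)] ballI allI impI)
  fix y h assume y: "y : ball x d" and h: "0 < h" "h < d"
  have "h * norm v <= d * norm v" using h by (intro mult_right_mono) auto
  hence "dist x (y + h *R v) < d + d * norm v"
   using dist_triangle[of x "y + h *R v" y] y h by (simp add: dist_norm)
  hence b2: "y + h *R v : ball x d2" using d(1,3) by (simp add: algebra_simps)
  have hd: "h < d2"
  proof -
   have "d * 1 <= d * (2 + norm v)" using d(1) by (intro mult_left_mono) auto
   thus ?thesis using h d(3) by linarith
  qed
  have 1: "y : D" "y + h *R v : D" "kobayashi D y (y + h *R v) <= (l + c) * h"
   using d1(2)[of y h] y h d(2) by auto
  have 2: "y + h *R v + h *R w : D" "kobayashi D (y + h *R v) (y + h *R v + h *R w) <= (k + c) * h"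
   using d2(2)[OF b2 h(1) hd] by auto
  have eq: "y + h *R (v + w) = y + h *R v + h *R w" by (simp add: algebra_simps)
  show "y : D & y + h *R (v + w) : D & kobayashi D y (y + h *R (v + w)) <= l' * h"
   unfolding eq c(2) using kobayashi_triangle[OF D 1(1,2) 2(1)] 1 2 by (simp add: algebra_simps)
 qed
qed

lemma rate_scaleR:
 assumes D: "domain D" and x: "x : D" and v: "rate D x v l" and c: "c >= 0"
 shows "rate D x (c *R v) (c * l)"
proof (cases "c = 0")
 case True
 have "open D" using D by (simp add: domain_def)
 then obtain q where q: "q > 0" "ball x q <= D" using x openE by blast
 have "y : D & y + h *R (c *R v) : D & kobayashi D y (y + h *R (c *R v)) <= l' * h"
  if "c * l < l'" "y : ball x q" "0 < h" "h < q" for l' y h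
 proof -
  have "y : D" using that(2) q(2) by blast
  thus ?thesis using True that kobayashi_refl[OF D] by simp
 qed
 thus ?thesis using q(1) unfolding rate_def by blast
next
 case False
 hence c: "c > 0" using c by simp
 show ?thesis unfolding rate_def
 proof (intro allI impI)
  fix l' assume "c * l < l'"
  hence "l < l' / c" using c by (simp add: field_simps)
  then obtain d where d: "d > 0" "!!y h. y : ball x d ==> 0 < h ==> h < d ==> y : D & y + h *R v : D & kobayashi D y (y + h *R v) <= l' / c * h"
   using rateD[OF v] by blast
  define d' where "d' = min d (d / c)"
  have d': "d' > 0" "d' <= d" "d' <= d / c" using d(1) c by (auto simp: d'_def)
  show "EX d>0. ALL y:ball x d. ALL h. 0 < h --> h < d -->
   y : D & y + h *R (c *R v) : D & kobayashi D y (y + h *R (c *R v)) <= l' * h"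
  proof (intro exI[of _ d'] conjI[OF d'(1)] ballI allI impI)
   fix y h assume y: "y : ball x d'" and h: "0 < h" "h < d'"
   have "h < d / c" using h d'(3) by linarith
   hence "0 < h * c" "h * c < d" using h c by (simp_all add: field_simps)
   moreover have "y : ball x d" using y d'(2) by simp
   ultimately show "y : D & y + h *R (c *R v) : D & kobayashi D y (y + h *R (c *R v)) <= l' * h"
    using d(2)[of y "h * c"] c by simp
  qed
 qed
qed

text \<open>This convexity is what makes the Kobayashi distance, unlike the Lempert function, compatible with convex combinations of directions.\<close>
lemma rate_convex:
 assumes D: "domain D" and x: "x : D"
 shows "convex {v. rate D x v l}"
proof (rule convexI)
 fix v w and a b :: real assume "v : {v. rate D x v l}" "w : {v. rate D x v l}" and ab: "0 <= a" "0 <= b" "a + b = 1"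
 hence "rate D x (a *R v + b *R w) (a * l + b * l)"
  by (intro rate_add[OF D] rate_scaleR[OF D x]) auto
 moreover have "a * l + b * l = l" using ab(3) by (metis distrib_right mult_1)
 ultimately show "a *R v + b *R w : {v. rate D x v l}" by simp
qed

definition vder :: "(complex => complex ^ 'm) => complex ^ 'm" where
 "vder f = (\<chi> i. deriv (%z. f z $ i) 0)"

text \<open>Small perturbations of f lie, on a slightly smaller disc, still in the domain.\<close>
lemma rate_disc:
 assumes D: "domain D" and r: "r > 0" and hol: "!!i. hol f i (ball 0 r)" and fD: "f ` ball 0 r <= D"
 shows "rate D (f 0) (vder f) (1 / r)"
 unfolding rate_def
proof (intro allI impI)
 fix l' assume l': "1 / r < l'"
 have l0: "l' > 0" using l' r by (meson less_trans zero_less_divide_1_iff)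
 define r' where "r' = (1 / l' + r) / 2"
 have il: "1 / l' < r" using l' l0 r by (simp add: field_simps)
 have r': "0 < r'" "r' < r" "1 / l' < r'" using il l0 r by (simp_all add: r'_def add_pos_pos)
 define e where "e = l' * r' - 1"
 have e: "e > 0" using r'(3) l0 by (simp add: e_def field_simps)
 obtain d0 where d0: "0 < d0" "d0 < 1" "!!t::real. 0 <= t ==> t < d0 ==> artanh t <= (1 + e) * t"
  using artanh_le_near_zero[OF e] by blast
 have cr: "cball 0 r' <= ball 0 r" using r' by auto
 have cf: "continuous_on (ball 0 r) f" using holomorphic_vec_imp_continuous_on[OF hol] .
 have "compact (f ` cball 0 r')" by (intro compact_continuous_image continuous_on_subset[OF cf cr] compact_cball)
 moreover have "open D" using D by (simp add: domain_def)
 moreover have "f ` cball 0 r' <= D" using fD cr by blast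
 ultimately obtain q where q: "q > 0" "(\<Union>x\<in>f ` cball 0 r'. ball x q) <= D"
  using compact_subset_open_imp_ball_epsilon_subset by metis
 have fq: "f u + y : D" if "u : cball 0 r'" "norm y < q" for u y
  using q(2) that by (force simp: dist_norm)
 define E where "E h = (f (of_real h) - f 0 - h *R vder f) /\<^sub>R h" for h :: real
 have "((%h. E h) \<longlongrightarrow> 0) (at 0)"
 proof (rule vec_tendstoI)
  fix i
  have "((%z. f z $ i) has_field_derivative deriv (%z. f z $ i) 0) (at 0)"
   using holomorphic_derivI[OF hol open_ball] r by simp
  hence "((%h. (f h $ i - f 0 $ i) / h) \<longlongrightarrow> deriv (%z. f z $ i) 0) (at 0)"
   by (simp add: has_field_derivative_iff)
  moreover have "filterlim (%h::real. complex_of_real h) (at 0) (at 0)"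
   unfolding filterlim_at by (auto intro!: tendsto_eq_intros simp: eventually_at_filter)
  ultimately have "((%h::real. (f (of_real h) $ i - f 0 $ i) / of_real h) \<longlongrightarrow> deriv (%z. f z $ i) 0) (at 0)"
   by (rule filterlim_compose)
  from LIM_zero[OF this] have "((%h::real. (f (of_real h) $ i - f 0 $ i) / of_real h - deriv (%z. f z $ i) 0) \<longlongrightarrow> 0) (at 0)" .
  moreover have "\<forall>\<^sub>F h in at 0. (f (of_real h) $ i - f 0 $ i) / of_real h - deriv (%z. f z $ i) 0 = E h $ i"
   unfolding eventually_at_filter
   by (rule always_eventually) (auto simp: E_def vder_def scaleR_complex field_simps)
  ultimately show "((%h. E h $ i) \<longlongrightarrow> 0 $ i) (at 0)" by (simp add: tendsto_cong)
 qed
 hence "\<forall>\<^sub>F h in at 0. norm (E h) < q / (2 * r')"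
  using q(1) r'(1) tendstoD[of E 0 "at 0" "q / (2 * r')"] by simp
 then obtain d1 where d1: "d1 > 0" "!!h. h ~= 0 ==> \<bar>h\<bar> < d1 ==> norm (E h) < q / (2 * r')"
  unfolding eventually_at by (auto simp: dist_norm)
 define d where "d = Min {d1, d0 * r', q / 2}"
 have d: "d > 0" "d <= d1" "d <= d0 * r'" "d <= q / 2" using d1(1) d0(1) r'(1) q(1) by (auto simp: d_def)
 show "EX d>0. ALL y:ball (f 0) d. ALL h. 0 < h --> h < d -->
   y : D & y + h *R vder f : D & kobayashi D y (y + h *R vder f) <= l' * h"
 proof (intro exI[of _ d] conjI[OF d(1)] ballI allI impI)
  fix y h assume y: "y : ball (f 0) d" and h: "0 < h" "h < d"
  have Eh: "norm (E h) < q / (2 * r')" using d1(2)[of h] h d(2) by simp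
  define g where "g u = f (of_real r' * u) + ((y - f 0) - (u * of_real r') *s E h)" for u
  have ru: "of_real r' * u : cball 0 r'" if "u : unit_disc" for u :: complex
   using that r'(1) by (simp add: norm_mult mult_left_le)
  have gD: "g u : D" if u: "u : unit_disc" for u
  proof -
   have "norm ((u * of_real r') *s E h) = norm (u * of_real r') * norm (E h)" by (rule norm_smult)
   also have "... <= r' * norm (E h)" using u r'(1) by (intro mult_right_mono) (auto simp: norm_mult mult_left_le_one_le)
   also have "... < r' * (q / (2 * r'))" using Eh r'(1) by (intro mult_strict_left_mono)
   also have "... = q / 2" using r'(1) by simp
   finally have "norm ((u * of_real r') *s E h) < q / 2" .
   moreover have "norm (y - f 0) < q / 2" using y d(4) by (simp add: dist_norm norm_minus_commute)
   ultimately have "norm ((y - f 0) - (u * of_real r') *s E h) < q"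
    using norm_triangle_ineq4[of "y - f 0" "(u * of_real r') *s E h"] by linarith
   thus ?thesis unfolding g_def using fq[OF ru[OF u]] by simp
  qed
  have "hol g i unit_disc" for i
  proof -
   have img: "(%u. of_real r' * u) ` unit_disc <= ball 0 r" using ru cr by blast
   have "(%u::complex. of_real r' * u) holomorphic_on unit_disc" by (intro holomorphic_intros)
   from holomorphic_on_compose_gen[OF this hol[of i] img] have "(%u. f (of_real r' * u) $ i) holomorphic_on unit_disc"
    by (simp add: o_def)
   thus ?thesis unfolding g_def by (auto intro!: holomorphic_intros)
  qed
  hence g: "g : discs_in D" using gD unfolding discs_in_def by blast
  define t where "t = (of_real (h / r') :: complex)"
  have hr: "0 <= h / r'" "h / r' < d0" using h d(3) r'(1) by (auto simp: divide_less_eq)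
  have nt: "norm t = \<bar>h / r'\<bar>" unfolding t_def by (rule norm_of_real)
  hence tu: "t : unit_disc" using hr d0(2) by simp
  have g0: "g 0 = y" by (simp add: g_def)
  have tr: "t * of_real r' = of_real h" "of_real r' * t = of_real h"
   using r'(1) by (simp_all add: t_def)
  have "of_real h *s E h = f (of_real h) - f 0 - h *R vder f"
   using h(1) by (simp add: E_def vec_eq_iff scaleR_complex)
  hence gt: "g t = y + h *R vder f" unfolding g_def tr by simp
  have "kobayashi D y (y + h *R vder f) <= hyp_dist 0 t"
   by (rule kobayashi_le_disc[OF D g g0 gt tu])
  also have "... = artanh (h / r')" using nt abs_of_nonneg[OF hr(1)] by (simp only: hyp_dist_zero_left)
  also have "... <= (1 + e) * (h / r')" by (rule d0(3)[OF hr])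
  also have "... = l' * h" using r'(1) by (simp add: e_def)
  finally show "y : D & y + h *R vder f : D & kobayashi D y (y + h *R vder f) <= l' * h"
   using gD[of 0] gD[OF tu] g0 gt by simp
 qed
qed

text \<open>Continuous induction on the endpoint: the set of times reached at cost at most l' times the elapsed time, with the invariant, is closed by continuity and can always be prolonged by the progress assumption.\<close>
lemma transport:
 fixes gam :: "real => complex ^ 'm" and Inv :: "real => complex ^ 'm => bool"
 assumes D: "domain D" and t: "t1 <= t2" and l: "l < l'" "0 <= l'"
  and cont: "continuous_on {t1..t2} gam"
  and closed: "!!T U t u. (!!n. T n : {t1..t2}) ==> (!!n. Inv (T n) (U n)) ==> T ----> t ==> U ----> u ==> Inv t u"
  and bounded: "!!t u. t : {t1..t2} ==> Inv t u ==> norm u <= B"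
  and inD: "!!t u. t : {t1..t2} ==> Inv t u ==> gam t + s *R u : D"
  and progress: "!!t u e. t1 <= t ==> t < t2 ==> Inv t u ==> 0 < e ==>
   EX v w. rate D (gam t + s *R u) (v + s *R w) l &
    (ALL d>0. EX h. 0 < h & h < d & t + h <= t2 & norm (gam (t + h) - gam t - h *R v) <= e * h & Inv (t + h) (u + h *R w))"
  and start: "Inv t1 u1"
 shows "EX u2. Inv t2 u2 & kobayashi D (gam t1 + s *R u1) (gam t2 + s *R u2) <= l' * (t2 - t1)"
proof -
 define x1 where "x1 = gam t1 + s *R u1"
 have x1: "x1 : D" unfolding x1_def using inD[OF _ start] t by simp
 define S where "S = {t:{t1..t2}. EX u. Inv t u & kobayashi D x1 (gam t + s *R u) <= l' * (t - t1)}"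
 have t1S: "t1 : S" unfolding S_def
  using start t kobayashi_refl[OF D x1] by (intro CollectI conjI exI[of _ u1]) (simp_all add: x1_def)
 have "closed S"
  unfolding closed_sequential_limits
 proof (intro allI impI)
  fix T t assume "(ALL n. T n : S) & T ----> t"
  hence T: "!!n. T n : S" and lim: "T ----> t" by auto
  have T12: "T n : {t1..t2}" for n using T[of n] by (simp add: S_def)
  hence t12: "t : {t1..t2}" using closed_sequentially[OF closed_atLeastAtMost _ lim] by blast
  have "EX u. Inv (T n) u & kobayashi D x1 (gam (T n) + s *R u) <= l' * (T n - t1)" for n using T[of n] by (simp add: S_def)
  then obtain U where U: "!!n. Inv (T n) (U n)" "!!n. kobayashi D x1 (gam (T n) + s *R U n) <= l' * (T n - t1)" by metis
  have "U n : cball 0 B" for n using bounded[OF T12 U(1)] by simp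
  then obtain u j where j: "strict_mono (j :: nat => nat)" "(U \<circ> j) ----> u"
   using compact_cball[of "0::complex^'m" B] unfolding compact_def by metis
  have Tj: "(%n. T (j n)) ----> t" using LIMSEQ_subseq_LIMSEQ[OF lim j(1)] by (simp add: o_def)
  have Uj: "(%n. U (j n)) ----> u" using j(2) by (simp add: o_def)
  have inv: "Inv t u" by (rule closed[of "%n. T (j n)" "%n. U (j n)", OF T12 U(1) Tj Uj])
  have xD: "gam t + s *R u : D" using inD[OF t12 inv] .
  have "(%n. gam (T (j n))) ----> gam t"
   using continuous_on_tendsto_compose[OF cont Tj t12] T12 by simp
  hence "(%n. gam (T (j n)) + s *R U (j n)) ----> gam t + s *R u"
   by (intro tendsto_intros Uj)
  from kobayashi_continuous_at[OF D x1 xD this]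
  have "kobayashi D x1 (gam t + s *R u) <= l' * (t - t1)"
  proof (rule LIMSEQ_le)
   show "(%n. l' * (T (j n) - t1)) ----> l' * (t - t1)" by (intro tendsto_intros Tj)
  qed (use U(2) in blast)
  thus "t : S" using t12 inv by (auto simp: S_def)
 qed
 have "bdd_above S" by (rule bdd_aboveI[of _ t2]) (simp add: S_def)
 moreover have "S ~= {}" using t1S by blast
 ultimately have bS: "bdd_above S" "S ~= {}" .
 define t where "t = Sup S"
 have tS: "t : S" unfolding t_def by (rule closed_contains_Sup[OF bS(2,1) \<open>closed S\<close>])
 then obtain u where u: "Inv t u" "kobayashi D x1 (gam t + s *R u) <= l' * (t - t1)" and t12: "t1 <= t" "t <= t2"
  by (auto simp: S_def)
 have "t = t2"
 proof (rule ccontr)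
  assume "t ~= t2"
  hence tl: "t < t2" using t12 by simp
  define x where "x = gam t + s *R u"
  have x: "x : D" unfolding x_def using inD[OF _ u(1)] t12 by simp
  obtain d C where d: "d > 0" "C >= 0" "ball x d <= D" "!!y y'. y : ball x d ==> y' : ball x d ==> kobayashi D y y' <= C * norm (y' - y)"
   using kobayashi_locally_lipschitz[OF D x] by blast
  define e where "e = (l' - l) / (2 * (C + 1))"
  have e: "e > 0" "C * e <= (l' - l) / 2"
  proof -
   show "e > 0" using l d(2) by (simp add: e_def)
   have "C * (l' - l) <= (C + 1) * (l' - l)" using l(1) by (intro mult_right_mono) auto
   thus "C * e <= (l' - l) / 2" using d(2) by (simp add: e_def field_simps)
  qed
  obtain v w where vw: "rate D x (v + s *R w) l"
   "!!d. d > 0 ==> EX h. 0 < h & h < d & t + h <= t2 & norm (gam (t + h) - gam t - h *R v) <= e * h & Inv (t + h) (u + h *R w)"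
   using progress[OF t12(1) tl u(1) e(1)] unfolding x_def by blast
  have "l < (l + l') / 2" using l(1) by simp
  then obtain d1 where d1: "d1 > 0" "!!y h. y : ball x d1 ==> 0 < h ==> h < d1 ==> y : D & y + h *R (v + s *R w) : D & kobayashi D y (y + h *R (v + s *R w)) <= (l + l') / 2 * h"
   using rateD[OF vw(1)] by blast
  define V where "V = norm (v + s *R w) + e + 1"
  have V: "V > 0" using e(1) by (simp add: V_def add_nonneg_pos)
  define d2 where "d2 = min d1 (d / V)"
  have "d2 <= d / V" by (simp add: d2_def)
  hence "d2 * V <= d" using V by (simp add: pos_le_divide_eq)
  moreover have "d2 > 0" "d2 <= d1" using d1(1) d(1) V by (simp_all add: d2_def)
  ultimately have d2: "d2 > 0" "d2 <= d1" "d2 * V <= d" by blast+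
  obtain h where h: "0 < h" "h < d2" "t + h <= t2" "norm (gam (t + h) - gam t - h *R v) <= e * h" "Inv (t + h) (u + h *R w)"
   using vw(2)[OF d2(1)] by blast
  define y where "y = x + h *R (v + s *R w)"
  define y' where "y' = gam (t + h) + s *R (u + h *R w)"
  have k1: "y : D" "kobayashi D x y <= (l + l') / 2 * h"
   using d1(2)[of x h] h d1(1) d2(2) by (auto simp: y_def)
  have yy: "y' - y = gam (t + h) - gam t - h *R v"
   by (simp add: y_def y'_def x_def algebra_simps)
  hence ny: "norm (y' - y) <= e * h" using h(4) by simp
  have hV: "h * V < d" using h(1,2) d2(3) V by (meson less_le_trans mult_strict_right_mono)
  have "norm (y - x) = h * norm (v + s *R w)" using h(1) by (simp add: y_def)
  moreover have "h * norm (v + s *R w) + e * h <= h * V" using h(1) by (simp add: V_def algebra_simps)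
  ultimately have "norm (y - x) < d" "norm (y - x) + norm (y' - y) < d"
   using hV ny e(1) h(1) mult_pos_pos[OF e(1) h(1)] by linarith+
  hence "y : ball x d" "y' : ball x d"
   using norm_triangle_ineq[of "y - x" "y' - y"] by (auto simp: dist_norm norm_minus_commute)
  hence k2: "kobayashi D y y' <= C * (e * h)" "y' : D"
   using d(4)[of y y'] mult_left_mono[OF ny d(2)] d(3) by auto
  have "kobayashi D x1 y' <= kobayashi D x1 x + (kobayashi D x y + kobayashi D y y')"
   using kobayashi_triangle[OF D x1 x k2(2)] kobayashi_triangle[OF D x k1(1) k2(2)] by linarith
  also have "... <= l' * (t - t1) + ((l + l') / 2 * h + (l' - l) / 2 * h)"
  proof -
   have "C * (e * h) <= (l' - l) / 2 * h" using mult_right_mono[OF e(2), of h] h(1) by (simp add: mult.assoc)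
   thus ?thesis using u(2)[folded x_def] k1(2) k2(1) by linarith
  qed
  also have "... = l' * (t + h - t1)" by (simp add: field_simps)
  finally have "t + h : S" using h t12 by (auto simp: S_def y'_def)
  hence "t + h <= t" unfolding t_def using bS(1) cSup_upper by blast
  thus False using h(1) by simp
 qed
 thus ?thesis using u unfolding x1_def by blast
qed

section \<open>Pushing discs and paths off the boundary\<close>

lemma vder_component:
 assumes "hol f i S" "open S" "0 : S"
 shows "((%z. f z $ i) has_field_derivative vder f $ i) (at 0)"
 using holomorphic_derivI[OF assms] by (simp add: vder_def)

lemma vder_affine:
 assumes "!!i. hol f i S" "!!i. hol g i S" "open S" "0 : S"
 shows "vder (%z. f z + s *R (g z + c)) = vder f + s *R vder g"
proof -
 have "((%z. (f z + s *R (g z + c)) $ i) has_field_derivative (vder f + s *R vder g) $ i) (at 0)" for i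
 proof -
  have "((%z. f z $ i + of_real s * (g z $ i + c $ i)) has_field_derivative vder f $ i + of_real s * (vder g $ i + 0)) (at 0)"
   by (rule DERIV_add[OF vder_component[OF assms(1,3,4)] DERIV_cmult[OF DERIV_add[OF vder_component[OF assms(2,3,4)] DERIV_const]]])
  thus ?thesis by (simp add: scaleR_complex)
 qed
 hence "vder (%z. f z + s *R (g z + c)) $ i = (vder f + s *R vder g) $ i" for i
  unfolding vder_def[of "%z. f z + s *R (g z + c)"] by (simp add: DERIV_imp_deriv)
 thus ?thesis by (simp add: vec_eq_iff)
qed

text \<open>The unique correction of the constant field u along psi whose pairing with M is constant, provided that M . psi = 1.\<close>
definition lift_field :: "(complex => complex ^ 'm) => (complex => complex ^ 'm) => complex ^ 'm => complex => complex ^ 'm" where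
 "lift_field M psi u z = u - (bil (M z) u - bil (M 0) u) *s psi z"

lemma lift_field_props:
 shows "lift_field M psi u 0 = u"
  "bil (M z) (psi z) = 1 ==> bil (M z) (lift_field M psi u z) = bil (M 0) u"
  "(!!i. hol M i S) ==> (!!i. hol psi i S) ==> (%z. lift_field M psi u z $ i) holomorphic_on S"
 by (auto simp: lift_field_def bil_simps intro!: holomorphic_intros)

context taut_dom begin

lemma cl_discs_compact:
 assumes "!!n. f n : cl_discs D"
 obtains g s where "g : cl_discs D" "strict_mono (s :: nat => nat)"
  "!!K. compact K ==> K <= unit_disc ==> uniform_limit K (%n. f (s n)) g sequentially"
proof -
 obtain B where B: "!!y. y : closure D ==> norm y <= B"
  using bounded_closure[OF bdd] bounded_iff by metis
 obtain g s where gs: "!!i. hol g i unit_disc" "strict_mono (s :: nat => nat)"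
  "!!K. compact K ==> K <= unit_disc ==> uniform_limit K (%n. f (s n)) g sequentially"
  by (rule Montel_vec[of unit_disc f B]) (use cl_discsD[OF assms] B in auto)
 have "g t : closure D" if t: "t : unit_disc" for t
 proof -
  have "(%n. f (s n) t) ----> g t"
   using uniform_limit_imp_tendsto_at[OF gs(3)[of "{t}"], of t] t by auto
  thus ?thesis by (rule closed_sequentially[OF closed_closure, rotated]) (use cl_discsD(2)[OF assms t] in blast)
 qed
 hence "g : cl_discs D" using gs(1) unfolding cl_discs_def by blast
 thus ?thesis using that gs(2,3) by blast
qed

lemma lift_field_transversal:
 assumes M: "conormal_lift (ball 0 r) (%z. N (phi z)) M" and psi: "!!z. z : ball 0 r ==> bil (M z) (psi z) = 1"
  and z: "z : ball 0 r" and r: "r > 0"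
 obtains k where "k > 0" "herm (N (phi z)) (lift_field M psi u z) = of_real k * herm (N (phi 0)) u"
proof -
 obtain k :: real where k: "k > 0" "ALL i. M z $ i = of_real k * cnj (N (phi z) $ i)"
  using M z unfolding conormal_lift_def by blast
 have "0 : ball 0 r" using r by simp
 then obtain k0 :: real where k0: "k0 > 0" "ALL i. M 0 $ i = of_real k0 * cnj (N (phi 0) $ i)"
  using M unfolding conormal_lift_def by blast
 have "of_real k * herm (N (phi z)) (lift_field M psi u z) = of_real k0 * herm (N (phi 0)) u"
  using lift_field_props(2)[of M z psi u, OF psi[OF z]] unfolding bil_conormal[OF k(2)] bil_conormal[OF k0(2)] .
 hence "herm (N (phi z)) (lift_field M psi u z) = of_real (k0 / k) * herm (N (phi 0)) u"
  using k(1) by (simp add: field_simps)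
 thus ?thesis using that k(1) k0(1) by (meson divide_pos_pos)
qed

text \<open>By contradiction: discs without such a field converge to a boundary disc through a, whose own transversal field, being inward on a compact set, also works for the discs close to it.\<close>
lemma boundary_push:
 assumes a: "a : bdry" and r: "0 < r" "r < 1"
 obtains d C where "d > 0" "C >= 0" "!!phi. phi : cl_discs D ==> dist (phi 0) a < d ==>
  EX psi. (ALL i. hol psi i (ball 0 r)) & psi 0 = N a & norm (vder psi) <= C &
   (ALL u s z. dist u (N a) < d --> 0 < s --> s < d --> z : ball 0 r --> phi z + s *R (psi z + (u - N a)) : D)"
proof -
 define good where "good d C phi psi \<longleftrightarrow> (ALL i. hol psi i (ball 0 r)) & psi 0 = N a & norm (vder psi) <= C &
   (ALL u s z. dist u (N a) < d --> 0 < s --> s < d --> z : ball 0 r --> phi z + s *R (psi z + (u - N a)) : D)"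
  for d C :: real and phi psi :: "complex => complex ^ 'm"
 have "EX d>0. EX C>=0. ALL phi. phi : cl_discs D --> dist (phi 0) a < d --> (EX psi. good d C phi psi)"
 proof (rule ccontr)
  assume neg: "\<not> ?thesis"
  have "EX phi. phi : cl_discs D & dist (phi 0) a < 1 / (real n + 1) & (ALL psi. \<not> good (1 / (real n + 1)) (real n) phi psi)" (is "EX phi. ?Q n phi") for n
  proof (rule ccontr)
   assume h: "\<not> ?thesis"
   have "EX d>0. EX C>=0. ALL phi. phi : cl_discs D --> dist (phi 0) a < d --> (EX psi. good d C phi psi)"
    by (intro exI[of _ "1 / (real n + 1)"] conjI exI[of _ "real n"]) (use h in auto)
   thus False using neg by blast
  qed
  hence "ALL n. EX phi. ?Q n phi" by blast
  from choice[OF this] obtain f where f0: "ALL n. ?Q n (f n)" by blast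
  have f: "f n : cl_discs D" "dist (f n 0) a < 1 / (real n + 1)" "\<not> good (1 / (real n + 1)) (real n) (f n) psi" for n psi
   using conjunct1[OF spec[OF f0, of n]] conjunct1[OF conjunct2[OF spec[OF f0, of n]]]
    spec[OF conjunct2[OF conjunct2[OF spec[OF f0, of n]]], of psi] by this
  obtain phi j where phi: "phi : cl_discs D" and j: "strict_mono (j :: nat => nat)" and
   ul: "!!K. compact K ==> K <= unit_disc ==> uniform_limit K (%n. f (j n)) phi sequentially"
   by (rule cl_discs_compact[of f, OF f(1)]) (rule that)
  have inv0: "(%n. 1 / (real n + 1)) ----> 0" by real_asymp
  have invj: "(%n. 1 / (real (j n) + 1)) ----> 0" using LIMSEQ_subseq_LIMSEQ[OF inv0 j] by (simp add: o_def)
  have "(%n. f (j n) 0) ----> phi 0" using uniform_limit_imp_tendsto_at[OF ul[of "{0}"], of 0] by simp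
  moreover have "(%n. f (j n) 0) ----> a"
  proof (rule metric_tendsto_imp_tendsto[OF invj])
   show "EVS n. dist (f (j n) 0) a <= dist (1 / (real (j n) + 1)) 0"
    using f(2) by (intro always_eventually) (simp add: less_imp_le)
  qed
  ultimately have phi0: "phi 0 = a" by (rule LIMSEQ_unique)
  hence phib: "phi : bdiscs" using bdisc_dichotomy[OF phi] a by simp
  define r1 where "r1 = (1 + r) / 2"
  have r1: "0 < r1" "r1 < 1" "r < r1" using r by (auto simp: r1_def)
  obtain M psi0 where M: "conormal_lift (ball 0 r1) (%z. N (phi z)) M" "!!i. hol psi0 i (ball 0 r1)"
   "!!z. z : ball 0 r1 ==> bil (M z) (psi0 z) = 1" using bdisc_transversal[OF phib r1(1,2)] by blast
  define psi where "psi = lift_field M psi0 (N a)"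
  have Mhol: "hol M i (ball 0 r1)" for i using M(1) unfolding conormal_lift_def by blast
  have psih: "hol psi i (ball 0 r1)" for i
   unfolding psi_def by (rule lift_field_props(3)[OF Mhol M(2)])
  have sub: "cball 0 r <= ball 0 r1" "ball 0 r <= ball 0 r1" "cball 0 r <= unit_disc" using r1(3) r by auto
  have pos: "psi z \<bullet> N (phi z) > 0" if z: "z : ball 0 r1" for z
  proof -
   obtain k where k: "k > 0" "herm (N (phi z)) (psi z) = of_real k * herm (N (phi 0)) (N a)"
    using lift_field_transversal[OF M(1,3) z r1(1)] unfolding psi_def by blast
   have "herm (N (phi 0)) (N a) = 1" using inward_norm[OF a] by (simp add: phi0 herm_self)
   hence "N (phi z) \<bullet> psi z = k" using k(2) by (simp flip: Re_herm)
   thus ?thesis using k(1) by (simp add: inner_commute)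
  qed
  define C where "C = (%z. (phi z, psi z)) ` cball 0 r"
  have "compact C" unfolding C_def
   by (intro compact_continuous_image continuous_on_Pair compact_cball continuous_on_subset[OF cl_discsD(3)[OF phi] sub(3)]
     continuous_on_subset[OF holomorphic_vec_imp_continuous_on[OF psih] sub(1)])
  then obtain e where e: "e > 0" "!!a w x w' s. (a, w) : C ==> x : closure D ==> dist x a < e ==> dist w' w < e ==> 0 < s ==> s < e ==> x + s *R w' : D"
  proof (rule inward_into_compact)
   fix b w assume "(b, w) : C"
   then obtain z where z: "z : cball 0 r" "b = phi z" "w = psi z" by (auto simp: C_def)
   have "z : unit_disc" "z : ball 0 r1" using z(1) sub by blast+
   thus "b : bdry & w \<bullet> N b > 0" using z bdiscsD(2)[OF phib] pos by simp
  qed (rule that)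
  have "EVS n. ALL z:cball 0 r. dist (f (j n) z) (phi z) < e"
   using uniform_limitD[OF ul[OF compact_cball sub(3)] e(1)] .
  moreover have "EVS n. 1 / (real (j n) + 1) < e" using invj e(1) by (rule order_tendstoD(2))
  moreover have "EVS n. norm (vder psi) <= real (j n)"
  proof -
   obtain n0 where n0: "norm (vder psi) <= real n0" using real_arch_simple by blast
   have "norm (vder psi) <= real (j n)" if "n >= n0" for n
    using n0 that seq_suble[OF j, of n] by linarith
   thus ?thesis by (auto simp: eventually_sequentially)
  qed
  ultimately have "EVS n. False"
  proof eventually_elim
   case (elim n)
   have "good (1 / (real (j n) + 1)) (real (j n)) (f (j n)) psi"
    unfolding good_def
   proof (intro conjI allI impI)
    show "hol psi i (ball 0 r)" for i using holomorphic_on_subset[OF psih sub(2)] .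
    show "psi 0 = N a" by (simp add: psi_def lift_field_props(1))
    show "norm (vder psi) <= real (j n)" using elim by blast
    fix u s and z :: complex
    assume u: "dist u (N a) < 1 / (real (j n) + 1)" and s: "0 < s" "s < 1 / (real (j n) + 1)" and z: "z : ball 0 r"
    have zc: "z : cball 0 r" using z by simp
    hence zu: "z : unit_disc" using sub(3) by blast
    show "f (j n) z + s *R (psi z + (u - N a)) : D"
    proof (rule e(2)[of "phi z" "psi z"])
     show "(phi z, psi z) : C" using zc by (auto simp: C_def)
     show "f (j n) z : closure D" by (rule cl_discsD(2)[OF f(1) zu])
     show "dist (f (j n) z) (phi z) < e" using elim(1) zc by blast
     show "dist (psi z + (u - N a)) (psi z) < e" using u elim(2) by (simp add: dist_norm)
     show "s < e" using s elim(2) by linarith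
    qed (use s in auto)
   qed
   thus False using f(3) by blast
  qed
  thus False by simp
 qed
 thus ?thesis using that unfolding good_def by blast
qed

text \<open>The possible velocities of limits of paths of discs.\<close>
definition dirs :: "complex ^ 'm => (complex ^ 'm) set" where
 "dirs x = {vder phi | phi. phi : cl_discs D & phi 0 = x}"

end

text \<open>A path parametrised by hyperbolic length. Velocities are only frequently attained, which is all that continuous induction needs, and lie in a convex hull because the discs of a limiting sequence may alternate ever faster.\<close>
locale lim_path = taut_dom D for D :: "(complex ^ 'm) set" +
 fixes gam :: "real => complex ^ 'm" and L :: real
 assumes path_cont: "continuous_on {0..L} gam"
  and path_cl: "t : {0..L} ==> gam t : closure D"
  and path_dirs: "0 <= t ==> t < L ==> e > 0 ==> EX v:convex hull (dirs (gam t)). ALL d>0. EX h. 0 < h & h < d & norm (gam (t + h) - gam t - h *R v) <= e * h"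
begin

abbreviation lifted :: "real => real => complex => complex ^ 'm" where
 "lifted t s q \<equiv> gam t + s *R (q *s N (gam t))"

abbreviation carried :: "real => real => real => complex ^ 'm => real => complex ^ 'm => bool" where
 "carried l' s t1 u1 t2 u2 \<equiv> gam t1 + s *R u1 : D & gam t2 + s *R u2 : D &
  kob (gam t1 + s *R u1) (gam t2 + s *R u2) <= l' * (t2 - t1)"

abbreviation pushed :: "real => real => complex ^ 'm => real => real => complex ^ 'm => real => bool" where
 "pushed l' \<eta> n s t1 u1 t2 \<equiv> EX u2. norm (u2 - n) < \<eta> & (gam t2 : bdry --> norm (u2 - N (gam t2)) < \<eta>) &
  carried l' s t1 u1 t2 u2"

text \<open>A displacement of phase q1 at time t1 is taken to time t2 with small loss; the height may change by a factor 2.\<close>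
abbreviation slid :: "real => real => real => real => real => complex => bool" where
 "slid l' eps t1 t2 s q1 \<equiv> EX q2 s'. cmod q2 = 1 & cmod (q2 - q1) <= eps & s / 2 <= s' & s' <= 2 * s &
  lifted t1 s q1 : D & lifted t2 s' q2 : D & kob (lifted t1 s q1) (lifted t2 s' q2) <= l' * (t2 - t1) + eps"

lemma convex_hull_dirs_lift:
 assumes v: "v : convex hull (dirs x)" and P: "convex P" and "!!phi. phi : cl_discs D ==> phi 0 = x ==> EX w. (vder phi, w) : P"
 obtains w where "(v, w) : P"
proof -
 have "dirs x <= fst ` P" using assms(3) by (force simp: dirs_def)
 moreover have "convex (fst ` P)" by (rule convex_linear_image[OF linear_fst P])
 ultimately have "convex hull (dirs x) <= fst ` P" by (rule hull_minimal)
 thus ?thesis using v that by force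
qed

lemma convex_rate_pairs:
 assumes "x : D"
 shows "convex {(v, w). rate D x (v + s *R w) l}"
proof -
 have "linear (%p. fst p + s *R snd p :: complex ^ 'm)" by (intro linearI) (simp_all add: algebra_simps)
 from convex_linear_vimage[OF this rate_convex[OF dom assms, of l]]
 show ?thesis by (simp add: vimage_def case_prod_unfold)
qed

text \<open>Near a boundary point all discs, in D or in the boundary, are pushed inwards by fields of bounded derivative, so the displacement u drifts at bounded speed only.\<close>
lemma transport_near_frontier:
 assumes t0: "t0 : {0..L}" "gam t0 : bdry" and r: "0 < r" "r < 1" and l': "1 / r < l'" and \<eta>: "\<eta> > 0"
 obtains d where "d > 0" "!!t1 t2 s u1. t1 : {0..L} ==> t2 : {0..L} ==> t1 <= t2 ==> \<bar>t1 - t0\<bar> < d ==> \<bar>t2 - t0\<bar> < d ==>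
  dist u1 (N (gam t0)) < d ==> 0 < s ==> s < d ==>
  EX u2. dist u2 (N (gam t0)) < \<eta> & carried l' s t1 u1 t2 u2"
proof -
 define n where "n = N (gam t0)"
 obtain d0 C where d0: "d0 > 0" "C >= 0" "!!phi. phi : cl_discs D ==> dist (phi 0) (gam t0) < d0 ==>
  EX psi. (ALL i. hol psi i (ball 0 r)) & psi 0 = n & norm (vder psi) <= C &
   (ALL u s z. dist u n < d0 --> 0 < s --> s < d0 --> z : ball 0 r --> phi z + s *R (psi z + (u - n)) : D)"
  using boundary_push[OF t0(2) r] unfolding n_def by metis
 obtain d1 where d1: "d1 > 0" "!!t. t : {0..L} ==> \<bar>t - t0\<bar> < d1 ==> dist (gam t) (gam t0) < d0"
  using path_cont t0(1) d0(1) unfolding continuous_on_iff dist_real_def by metis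
 define c where "c = min \<eta> d0 / 2"
 have c: "c > 0" "c < \<eta>" "c < d0" using \<eta> d0(1) by (auto simp: c_def)
 define d where "d = Min {d0, d1, c / 2, c / (4 * (C + 1))}"
 have d: "d > 0" "d <= d0" "d <= d1" "d <= c / 2" "d <= c / (4 * (C + 1))"
  subgoal using d0 d1(1) c(1) by (simp add: d_def)
  unfolding d_def by (intro Min_le; simp)+
 have "d * (4 * (C + 1)) <= c" using d(5) d0(2) by (simp add: pos_le_divide_eq)
 hence Cd: "C * (2 * d) <= c / 2" using d(1) by (simp add: algebra_simps)
 show ?thesis
 proof (rule that[OF d(1)])
  fix t1 t2 s :: real and u1
  assume t: "t1 : {0..L}" "t2 : {0..L}" "t1 <= t2" "\<bar>t1 - t0\<bar> < d" "\<bar>t2 - t0\<bar> < d"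
   and u1: "dist u1 (N (gam t0)) < d" and s: "0 < s" "s < d"
  have mid: "t : {0..L}" "\<bar>t - t0\<bar> < d" "t - t1 <= 2 * d" if "t : {t1..t2}" for t using that t by auto
  define Inv where "Inv t u \<longleftrightarrow> dist u n <= c / 2 + C * (t - t1)" for t :: real and u
  have Invc: "dist u n <= c" if "t : {t1..t2}" "Inv t u" for t u
  proof -
   have "C * (t - t1) <= C * (2 * d)" using mid[OF that(1)] d0(2) by (intro mult_left_mono) auto
   thus ?thesis using that(2) Cd by (simp add: Inv_def)
  qed
  have push: "EX psi. (ALL i. hol psi i (ball 0 r)) & psi 0 = n & norm (vder psi) <= C &
    (ALL z:ball 0 r. phi z + s *R (psi z + (u - n)) : D)"
   if "t : {t1..t2}" "Inv t u" "phi : cl_discs D" "phi 0 = gam t" for t u phi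
  proof -
   have "dist (phi 0) (gam t0) < d0" using d1(2)[of t] mid[OF that(1)] d(3) that(4) by simp
   from d0(3)[OF that(3) this] obtain psi where psi: "ALL i. hol psi i (ball 0 r)" "psi 0 = n" "norm (vder psi) <= C"
    "ALL u s z. dist u n < d0 --> 0 < s --> s < d0 --> z : ball 0 r --> phi z + s *R (psi z + (u - n)) : D"
    by (elim exE conjE) (rule that)
   have "dist u n < d0" "s < d0" using Invc[OF that(1,2)] c(3) s d(2) by linarith+
   thus ?thesis using psi s(1) by (intro exI[of _ psi]) blast
  qed
  have inD: "gam t + s *R u : D" if "t : {t1..t2}" "Inv t u" for t u
  proof -
   have "(%_. gam t) : cl_discs D" using path_cl[OF mid(1)[OF that(1)]] unfolding cl_discs_def by auto
   from push[OF that this refl] obtain psi where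
    "(ALL i. hol psi i (ball 0 r)) & psi 0 = n & norm (vder psi) <= C & (ALL z:ball 0 r. gam t + s *R (psi z + (u - n)) : D)"
    by (rule exE)
   hence "psi 0 = n" "ALL z:ball 0 r. gam t + s *R (psi z + (u - n)) : D" by blast+
   thus ?thesis using r(1) by (metis add_diff_cancel_left' add.commute centre_in_ball diff_add_cancel)
  qed
  have "EX u2. Inv t2 u2 & kob (gam t1 + s *R u1) (gam t2 + s *R u2) <= l' * (t2 - t1)"
  proof (rule transport[OF dom t(3) l'])
   show "0 <= l'" using l' r by (meson less_imp_le less_trans zero_less_divide_1_iff)
   show "continuous_on {t1..t2} gam" by (rule continuous_on_subset[OF path_cont]) (use mid in auto)
   show "Inv t u" if "!!n. Inv (T n) (U n)" "T ----> t" "U ----> u" for T U t u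
    unfolding Inv_def
   proof (rule LIMSEQ_le)
    show "(%k. dist (U k) n) ----> dist u n" "(%k. c / 2 + C * (T k - t1)) ----> c / 2 + C * (t - t1)"
     by (intro tendsto_intros that)+
   qed (use that(1) in \<open>auto simp: Inv_def\<close>)
   show "norm u <= norm n + c" if "t : {t1..t2}" "Inv t u" for t u
    using Invc[OF that] norm_triangle_ineq2[of u n] by (simp add: dist_norm)
   show "Inv t1 u1" using u1 d(4) by (simp add: Inv_def n_def)
   fix t u and e :: real
   assume tt: "t1 <= t" "t < t2" and inv: "Inv t u" and e: "0 < e"
   have t12: "t : {t1..t2}" using tt by simp
   have x: "gam t + s *R u : D" using inD[OF t12 inv] .
   obtain v where v: "v : convex hull (dirs (gam t))" "!!d. d > 0 ==> EX h. 0 < h & h < d & norm (gam (t + h) - gam t - h *R v) <= e * h"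
    using path_dirs[of t e] mid[OF t12] tt e t(2) by force
   define P where "P = {(v, w). rate D (gam t + s *R u) (v + s *R w) (1 / r)} \<inter> UNIV \<times> cball 0 C"
   have "convex P" unfolding P_def by (intro convex_Int convex_rate_pairs[OF x] convex_Times convex_UNIV convex_cball)
   then obtain w where w: "(v, w) : P"
   proof (rule convex_hull_dirs_lift[OF v(1)])
    fix phi assume phi: "phi : cl_discs D" "phi 0 = gam t"
    obtain psi where psi: "!!i. hol psi i (ball 0 r)" "psi 0 = n" "norm (vder psi) <= C"
     "!!z. z : ball 0 r ==> phi z + s *R (psi z + (u - n)) : D" using push[OF t12 inv phi] by blast
    have sub: "ball 0 r <= unit_disc" using r by (intro subset_ball) simp
    have ph: "hol phi i (ball 0 r)" for i using holomorphic_on_subset[OF cl_discsD(1)[OF phi(1)] sub] .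
    define F where "F z = phi z + s *R (psi z + (u - n))" for z
    have "rate D (F 0) (vder F) (1 / r)"
    proof (rule rate_disc[OF dom r(1)])
     show "hol F i (ball 0 r)" for i
      unfolding F_def by (auto simp: scaleR_complex intro!: holomorphic_intros ph psi(1))
     show "F ` ball 0 r <= D" unfolding F_def using psi(4) by blast
    qed
    moreover have "F 0 = gam t + s *R u" by (simp add: F_def psi(2) phi(2))
    moreover have "vder F = vder phi + s *R vder psi"
     unfolding F_def by (rule vder_affine[OF ph psi(1) open_ball]) (use r in simp)
    ultimately show "EX w. (vder phi, w) : P" using psi(3) by (auto simp: P_def)
   qed (rule that)
   hence w': "rate D (gam t + s *R u) (v + s *R w) (1 / r)" "norm w <= C" by (auto simp: P_def)
   show "EX v w. rate D (gam t + s *R u) (v + s *R w) (1 / r) &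
    (ALL d>0. EX h. 0 < h & h < d & t + h <= t2 & norm (gam (t + h) - gam t - h *R v) <= e * h & Inv (t + h) (u + h *R w))"
   proof (rule exI[of _ v], rule exI[of _ w], intro conjI w'(1) allI impI)
    fix d :: real assume "d > 0"
    hence "min d (t2 - t) > 0" using tt by simp
    then obtain h where h: "0 < h" "h < min d (t2 - t)" "norm (gam (t + h) - gam t - h *R v) <= e * h" using v(2) by blast
    have "dist (u + h *R w) n <= dist u n + h * norm w"
     using norm_triangle_ineq[of "u - n" "h *R w"] h(1) by (simp add: dist_norm algebra_simps)
    also have "... <= c / 2 + C * (t - t1) + h * C"
     using inv w'(2) h(1) by (intro add_mono mult_left_mono) (auto simp: Inv_def)
    finally have "Inv (t + h) (u + h *R w)" by (simp add: Inv_def algebra_simps)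
    thus "EX h>0. h < d & t + h <= t2 & norm (gam (t + h) - gam t - h *R v) <= e * h & Inv (t + h) (u + h *R w)"
     using h by (intro exI[of _ h]) auto
   qed
  qed (use inD in blast)+
  then obtain u2 where u2: "Inv t2 u2" "kob (gam t1 + s *R u1) (gam t2 + s *R u2) <= l' * (t2 - t1)" by blast
  have i1: "Inv t1 u1" using u1 d(4) by (simp add: Inv_def n_def)
  have m12: "t1 : {t1..t2}" "t2 : {t1..t2}" using t(3) by auto
  show "EX u2. dist u2 (N (gam t0)) < \<eta> & carried l' s t1 u1 t2 u2"
   using Invc[OF m12(2) u2(1)] c(2) inD[OF m12(1) i1] inD[OF m12(2) u2(1)] u2(2) unfolding n_def
   by (intro exI[of _ u2] conjI) auto
 qed
qed

text \<open>Discs in the closure that pass through a point of D lie in D, so velocities have rate 1.\<close>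
lemma transport_inside:
 assumes t0: "t0 : {0..L}" "gam t0 : D" and l': "1 < l'"
 obtains d where "d > 0" "!!t1 t2. t1 : {0..L} ==> t2 : {0..L} ==> t1 <= t2 ==> \<bar>t1 - t0\<bar> < d ==> \<bar>t2 - t0\<bar> < d ==>
  gam t1 : D & gam t2 : D & kob (gam t1) (gam t2) <= l' * (t2 - t1)"
proof -
 obtain q where q: "q > 0" "ball (gam t0) q <= D" using open_D t0(2) openE by blast
 obtain d where d: "d > 0" "!!t. t : {0..L} ==> \<bar>t - t0\<bar> < d ==> dist (gam t) (gam t0) < q"
  using path_cont t0(1) q(1) unfolding continuous_on_iff dist_real_def by metis
 have inD: "gam t : D" if "t : {0..L}" "\<bar>t - t0\<bar> < d" for t
  using d(2)[OF that] q(2) by (auto simp: dist_commute)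
 show ?thesis
 proof (rule that[OF d(1)])
  fix t1 t2 :: real
  assume t: "t1 : {0..L}" "t2 : {0..L}" "t1 <= t2" "\<bar>t1 - t0\<bar> < d" "\<bar>t2 - t0\<bar> < d"
  have mid: "t : {0..L}" "\<bar>t - t0\<bar> < d" if "t : {t1..t2}" for t using that t by auto
  have "EX u2. u2 = (0 :: complex ^ 'm) & kob (gam t1 + 0 *R 0) (gam t2 + 0 *R u2) <= l' * (t2 - t1)"
  proof (rule transport[OF dom t(3) l', where Inv = "%t u. u = 0" and B = 0])
   show "0 <= l'" using l' by simp
   show "continuous_on {t1..t2} gam" by (rule continuous_on_subset[OF path_cont]) (use mid in auto)
   show "u = 0" if "!!n. U n = 0" "U ----> u" for U :: "nat => complex ^ 'm" and u
   proof -
    have "U = (%_. 0)" using that(1) by auto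
    thus ?thesis using that(2) by (simp add: LIMSEQ_const_iff)
   qed
   show "gam t + 0 *R u : D" if "t : {t1..t2}" for t and u :: "complex ^ 'm" using inD[OF mid[OF that]] by simp
   fix t and u :: "complex ^ 'm" and e :: real
   assume tt: "t1 <= t" "t < t2" and u: "u = 0" and e: "0 < e"
   have t12: "t : {t1..t2}" using tt by simp
   have x: "gam t : D" using inD[OF mid[OF t12]] .
   obtain v where v: "v : convex hull (dirs (gam t))" "!!d. d > 0 ==> EX h. 0 < h & h < d & norm (gam (t + h) - gam t - h *R v) <= e * h"
    using path_dirs[of t e] mid[OF t12] tt e t(2) by force
   have "dirs (gam t) <= {v. rate D (gam t) v 1}"
   proof
    fix y assume "y : dirs (gam t)"
    then obtain phi where phi: "phi : cl_discs D" "phi 0 = gam t" "y = vder phi" by (auto simp: dirs_def)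
    have "\<not> phi ` unit_disc <= bdry" using phi(2) x frontier_notin by (metis centre_in_ball image_subset_iff zero_less_one)
    hence "phi ` unit_disc <= D" using taut_cl_disc_dichotomy[OF open_D taut C11 phi(1)] by blast
    from rate_disc[OF dom zero_less_one cl_discsD(1)[OF phi(1)] this] show "y : {v. rate D (gam t) v 1}" using phi by simp
   qed
   hence "v : {v. rate D (gam t) v 1}" using hull_minimal[where S = convex, OF _ rate_convex[OF dom x, of 1]] v(1) by blast
   hence rv: "rate D (gam t) v 1" by simp
   show "EX v w. rate D (gam t + 0 *R u) (v + 0 *R w) 1 &
    (ALL d>0. EX h. 0 < h & h < d & t + h <= t2 & norm (gam (t + h) - gam t - h *R v) <= e * h & u + h *R w = 0)"
   proof (rule exI[of _ v], rule exI[of _ 0], intro conjI allI impI)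
    show "rate D (gam t + 0 *R u) (v + 0 *R 0) 1" using rv by simp
    fix d :: real assume "d > 0"
    hence "min d (t2 - t) > 0" using tt by simp
    from v(2)[OF this] u
    show "EX h>0. h < d & t + h <= t2 & norm (gam (t + h) - gam t - h *R v) <= e * h & u + h *R 0 = 0"
     by auto
   qed
  qed auto
  thus "gam t1 : D & gam t2 : D & kob (gam t1) (gam t2) <= l' * (t2 - t1)"
   using inD t by simp
 qed
qed

end

section \<open>Second order flatness along boundary discs\<close>

text \<open>The mean value property in the parametrisation of the circle used by contour integrals.\<close>
lemma holomorphic_mean_value:
 assumes "p holomorphic_on S" "open S" "cball c R <= S" "R > 0"
 shows "((%t. p (circlepath c R t)) has_integral p c) {0..1}"
proof -
 have ne: "circlepath c R t - c ~= 0" for t using assms(4) by (simp add: circlepath)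
 have "p holomorphic_on cball c R" by (rule holomorphic_on_subset[OF assms(1,3)])
 from Cauchy_integral_circlepath_simple[OF this, of c] assms(4)
 have "((%u. p u / (u - c)) has_contour_integral (2 * of_real pi * \<i> * p c)) (circlepath c R)" by simp
 hence "((%t. p (circlepath c R t) / (circlepath c R t - c) * vector_derivative (circlepath c R) (at t within {0..1}))
   has_integral (2 * of_real pi * \<i> * p c)) {0..1}"
  by (simp add: has_contour_integral_def)
 hence "((%t. 2 * of_real pi * \<i> * p (circlepath c R t)) has_integral (2 * of_real pi * \<i> * p c)) {0..1}"
 proof (rule has_integral_eq[rotated])
  fix t :: real assume "t : {0..1}"
  hence vd: "vector_derivative (circlepath c R) (at t within {0..1}) = 2 * of_real pi * \<i> * (circlepath c R t - c)"
   by (simp add: vector_derivative_circlepath01) (simp add: circlepath)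
  show "p (circlepath c R t) / (circlepath c R t - c) * vector_derivative (circlepath c R) (at t within {0..1}) = 2 * of_real pi * \<i> * p (circlepath c R t)"
   unfolding vd using ne[of t] by simp
 qed
 from has_integral_mult_right[OF this, of "1 / (2 * of_real pi * \<i>)"] show ?thesis by simp
qed

text \<open>Comparison with real parts of holomorphic functions replaces the sub-mean value inequality; it is the form in which the continuity principle delivers subharmonicity.\<close>
definition submean :: "(complex => real) => bool" where
 "submean B \<longleftrightarrow> (ALL c R S p. 0 < R --> open S --> cball c R <= S --> p holomorphic_on S -->
   (ALL z:sphere c R. B z < Re (p z)) --> (ALL z:cball c R. B z <= Re (p z)))"

lemma submeanD:
 assumes "submean B" "0 < R" "open S" "cball c R <= S" "p holomorphic_on S" "!!z. z : sphere c R ==> B z < Re (p z)" "z : cball c R"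
 shows "B z <= Re (p z)"
 using assms unfolding submean_def by blast

text \<open>The strong maximum principle: approximate the function on the circle from above by the real part of a holomorphic function and integrate.\<close>
lemma submean_max_circle:
 assumes sub: "submean B" and cont: "continuous_on UNIV B" and R: "0 < R" and S: "open S" "cball c R <= S" and q: "q holomorphic_on S"
  and le: "!!z. z : sphere c R ==> B z - Re (q z) <= m" and m: "m <= B c - Re (q c)" and z: "z : sphere c R"
 shows "B z - Re (q z) = m"
proof -
 define v where "v z = B z - Re (q z)" for z
 define w where "w t = m - v (circlepath c R t)" for t
 have circ: "circlepath c R t : sphere c R" for t
  using R by (simp add: circlepath dist_norm norm_mult norm_exp_eq_Re)
 have sphS: "sphere c R <= S" using S(2) sphere_cball by blast
 have contv: "continuous_on (sphere c R) v"
  unfolding v_def by (intro continuous_intros continuous_on_subset[OF cont subset_UNIV]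
    continuous_on_subset[OF holomorphic_on_imp_continuous_on[OF q] sphS])
 have contw: "continuous_on {0..1} w"
  unfolding w_def by (intro continuous_intros continuous_on_compose2[OF contv])
   (use circ in \<open>auto simp: circlepath intro!: continuous_intros\<close>)
 have w0: "w t >= 0" for t using le[OF circ[of t]] by (simp add: w_def v_def)
 have "integral {0..1} w = 0"
 proof (rule ccontr)
  assume ne: "integral {0..1} w ~= 0"
  define I where "I = integral {0..1} w"
  have wI: "(w has_integral I) {0..1}" unfolding I_def using integrable_continuous_real[OF contw] by (rule integrable_integral)
  have "I >= 0" using has_integral_nonneg[OF wI] w0 by blast
  hence I: "I > 0" using ne I_def by simp
  have "continuous_on (sphere c R) (%z. v z + I / 4)" by (intro continuous_intros contv)
  then obtain p where p: "p holomorphic_on UNIV" "!!z. z : sphere c R ==> \<bar>Re (p z) - (v z + I / 4)\<bar> < I / 4"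
   using real_function_on_circle_approx[of c R "%z. v z + I / 4" "I / 4"] R I by auto
  have "B c <= Re (p c + q c)"
  proof (rule submeanD[OF sub R S])
   show "(%z. p z + q z) holomorphic_on S" by (intro holomorphic_intros holomorphic_on_subset[OF p(1)] q) auto
   show "B z < Re (p z + q z)" if "z : sphere c R" for z using p(2)[OF that] unfolding v_def plus_complex.sel abs_less_iff by linarith
  qed (use R in auto)
  hence mp: "m <= Re (p c)" using m by simp
  have "((%t. p (circlepath c R t)) has_integral p c) {0..1}"
   by (rule holomorphic_mean_value[OF p(1) open_UNIV subset_UNIV R])
  hence "((%t. Re (p (circlepath c R t))) has_integral Re (p c)) {0..1}" by (rule has_integral_Re)
  moreover have "((%t. m + I / 2 - w t) has_integral (m + I / 2 - I)) {0..1}"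
   using has_integral_diff[OF has_integral_const_real[of "m + I / 2" 0 1] wI] by simp
  ultimately have "Re (p c) <= m + I / 2 - I"
  proof (rule has_integral_le)
   fix t :: real
   show "Re (p (circlepath c R t)) <= m + I / 2 - w t" using p(2)[OF circ[of t]] unfolding w_def abs_less_iff by linarith
  qed
  thus False using mp I by simp
 qed
 hence w: "ALL t:{0..1}. w t = 0" using integral_eq_0_iff[OF contw] w0 by simp
 have "z : path_image (circlepath c R)" using z R by simp
 then obtain t where "t : {0..1}" "z = circlepath c R t" by (auto simp: path_image_def)
 thus ?thesis using w by (simp add: w_def v_def)
qed

text \<open>Liouville. Outside the unit disc compare with eps ln |z|: the difference attains its maximum over |z| \<ge> 1, and the circle about a maximum point that touches the unit circle carries the maximum to |z| = 1. With eps to 0 the supremum of B is attained on the unit circle, and the strong maximum principle on circles about that point finishes.\<close>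
lemma submean_bounded_imp_const:
 assumes sub: "submean B" and cont: "continuous_on UNIV B" and bd: "!!z. \<bar>B z\<bar> <= C"
 shows "B z = B w"
proof -
 have "EX z1:sphere 0 1. ALL z:sphere 0 1. B z <= B z1"
  by (rule continuous_attains_sup[OF compact_sphere _ continuous_on_subset[OF cont subset_UNIV]]) simp
 then obtain z1 where z1: "z1 : sphere 0 1" "!!z. z : sphere 0 1 ==> B z <= B z1" by blast
 have log_bound: "B z <= B z1 + e * ln (cmod z)" if e: "e > 0" and z: "cmod z >= 1" for e z
 proof -
  define v where "v z = B z - e * ln (cmod z)" for z
  define rho where "rho = max (cmod z) (exp ((2 * C + 1) / e))"
  define A where "A = cball (0::complex) rho - ball 0 1"
  have A: "x : A \<longleftrightarrow> 1 <= cmod x & cmod x <= rho" for x by (auto simp: A_def)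
  have "compact A" unfolding A_def by (simp add: compact_diff)
  moreover have "z : A" using z by (simp add: A rho_def)
  moreover have "continuous_on A v"
   unfolding v_def using A by (intro continuous_intros continuous_on_subset[OF cont subset_UNIV]) force
  ultimately obtain z0 where z0: "z0 : A" "!!x. x : A ==> v x <= v z0"
   using continuous_attains_sup[of A v] by blast
  have big: "v x < v z0" if "cmod x > rho" for x
  proof -
   have r: "rho > 0" by (simp add: rho_def less_max_iff_disj)
   have "(2 * C + 1) / e = ln (exp ((2 * C + 1) / e))" by simp
   also have "... <= ln (cmod x)" using that r by (subst ln_le_cancel_iff) (auto simp: rho_def)
   finally have "2 * C + 1 <= e * ln (cmod x)" using e by (simp add: field_simps)
   hence "v x < - C" using bd[of x] by (simp add: v_def abs_le_iff)
   also have "- C <= v 1" using bd[of 1] by (simp add: v_def abs_le_iff)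
   also have "v 1 <= v z0" by (rule z0(2)) (use z in \<open>auto simp: A rho_def\<close>)
   finally show ?thesis .
  qed
  have max: "v x <= v z0" if "cmod x >= 1" for x
   using z0(2)[of x] big[of x] that A by force
  have "v z0 <= B z1"
  proof (cases "cmod z0 = 1")
   case True
   thus ?thesis using z1(2)[of z0] by (simp add: v_def)
  next
   case False
   hence c0: "cmod z0 > 1" using z0(1) A by force
   \<comment> \<open>A branch of the logarithm on the disc about z0 that touches 0.\<close>
   define q where "q x = of_real e * (Ln (x / z0) + of_real (ln (cmod z0)))" for x
   have z00: "z0 ~= 0" using c0 by auto
   have half: "Re (x / z0) > 0" if "x : ball z0 (cmod z0)" for x
   proof -
    have "cmod (x / z0 - 1) < 1" using that z00 by (simp add: dist_norm norm_minus_commute norm_divide diff_divide_eq_iff)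
    thus ?thesis using abs_Re_le_cmod[of "x / z0 - 1"] by simp
   qed
   have "q holomorphic_on ball z0 (cmod z0)"
    unfolding q_def using z00 half by (intro holomorphic_intros) (auto simp: complex_nonpos_Reals_iff not_le)
   moreover have Req: "Re (q x) = e * ln (cmod x)" if "x : ball z0 (cmod z0)" for x
   proof -
    have "x / z0 ~= 0" using half[OF that] by auto
    hence "Re (Ln (x / z0)) = ln (cmod x / cmod z0)" by (simp add: norm_divide)
    also have "... = ln (cmod x) - ln (cmod z0)" using \<open>x / z0 ~= 0\<close> z00 by (subst ln_div) auto
    finally have l: "Re (Ln (x / z0)) = ln (cmod x) - ln (cmod z0)" .
    have "Re (q x) = e * (Re (Ln (x / z0)) + ln (cmod z0))" by (simp add: q_def)
    thus ?thesis unfolding l by simp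
   qed
   ultimately have eq: "B x - Re (q x) = v z0" if "x : sphere z0 (cmod z0 - 1)" for x
   proof (intro submean_max_circle[OF sub cont, of "cmod z0 - 1" "ball z0 (cmod z0)" z0 q "v z0"])
    fix y assume y: "y : sphere z0 (cmod z0 - 1)"
    have "cmod z0 <= cmod (z0 - y) + cmod y" using norm_triangle_ineq[of "z0 - y" y] by simp
    hence "cmod y >= 1" using y by (simp add: dist_norm)
    moreover have "y : ball z0 (cmod z0)" using y by simp
    ultimately show "B y - Re (q y) <= v z0" using max[of y] Req[of y] by (simp add: v_def)
   next
    show "v z0 <= B z0 - Re (q z0)" using Req[of z0] c0 z00 by (simp add: v_def)
   qed (use c0 that in auto)
   define y where "y = z0 / of_real (cmod z0)"
   have y1: "cmod y = 1" using z00 by (simp add: y_def norm_divide)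
   have "z0 - y = of_real (cmod z0 - 1) * y" using z00 by (simp add: y_def field_simps)
   hence "cmod (z0 - y) = cmod z0 - 1" using c0 y1 by (simp add: norm_mult del: of_real_diff)
   hence ys: "y : sphere z0 (cmod z0 - 1)" by (simp add: dist_norm)
   hence "y : ball z0 (cmod z0)" by simp
   hence "B y = v z0" using eq[OF ys] Req[of y] y1 by simp
   thus ?thesis using z1(2)[of y] y1 by simp
  qed
  moreover have "v z <= v z0" using z by (rule max)
  ultimately show ?thesis by (simp add: v_def)
 qed
 have outer: "B z <= B z1" if z: "cmod z >= 1" for z
 proof (rule field_le_epsilon)
  fix e :: real assume e: "e > 0"
  have l: "ln (cmod z) >= 0" using z by simp
  have "B z <= B z1 + e / (ln (cmod z) + 1) * ln (cmod z)" by (rule log_bound[OF divide_pos_pos[OF e] z]) (use l in simp)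
  also have "e / (ln (cmod z) + 1) * ln (cmod z) <= e" using e l by (simp add: field_simps)
  finally show "B z <= B z1 + e" by simp
 qed
 have top: "B z <= B z1" for z
 proof (cases "cmod z >= 1")
  case False
  show ?thesis
  proof (rule field_le_epsilon)
   fix e :: real assume e: "e > 0"
   have "B z <= Re (of_real (B z1 + e))"
   proof (rule submeanD[OF sub zero_less_one open_UNIV subset_UNIV holomorphic_on_const])
    show "B x < Re (of_real (B z1 + e))" if "x : sphere 0 1" for x using z1(2)[OF that] e by simp
    show "z : cball 0 1" using False by simp
   qed
   thus "B z <= B z1 + e" by simp
  qed
 qed (rule outer)
 have "B z = B z1" for z
 proof (cases "z = z1")
  case False
  have "B z - Re (0::complex) = B z1"
   by (rule submean_max_circle[OF sub cont, of "dist z1 z" UNIV z1 "%_. 0"]) (use False top in auto)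
  thus ?thesis by simp
 qed simp
 thus ?thesis by metis
qed

text \<open>Arzela-Ascoli on every ball, with a diagonal sequence.\<close>
lemma equilipschitz_subsequence:
 fixes F :: "nat => 'a::euclidean_space => 'b::{real_normed_vector, heine_borel}"
 assumes bd: "!!n x. norm (F n x) <= C" and lip: "!!n x y. norm (F n x - F n y) <= K * norm (x - y)"
 obtains g s where "strict_mono (s :: nat => nat)" "!!x y. norm (g x - g y) <= K * norm (x - y)"
  "!!x. norm (g x) <= C" "!!R. uniform_limit (cball 0 R) (%n. F (s n)) g sequentially"
proof -
 define P where "P i r \<longleftrightarrow> (EX g. uniform_limit (cball 0 (real i)) (%n. F (r n)) g sequentially)" for i and r :: "nat => nat"
 have "EX k. strict_mono (k :: nat => nat) & P i (r \<circ> k)" for i r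
 proof -
  have "EX d. 0 < d & (ALL n y. y : cball 0 (real i) & norm (x - y) < d --> norm (F (r n) x - F (r n) y) < e)" if "e > 0" for x e
  proof (intro exI[of _ "e / (\<bar>K\<bar> + 1)"] conjI allI impI)
   show "0 < e / (\<bar>K\<bar> + 1)" using that by (simp add: pos_add_strict)
   fix n y assume "y : cball 0 (real i) & norm (x - y) < e / (\<bar>K\<bar> + 1)"
   hence "(\<bar>K\<bar> + 1) * norm (x - y) < e" by (simp add: field_simps)
   moreover have "norm (F (r n) x - F (r n) y) <= (\<bar>K\<bar> + 1) * norm (x - y)"
    by (rule order_trans[OF lip]) (intro mult_right_mono, auto)
   ultimately show "norm (F (r n) x - F (r n) y) < e" by simp
  qed
  then obtain g k where g: "strict_mono (k :: nat => nat)"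
   "!!e. 0 < e ==> EX N. ALL n x. n >= N & x : cball 0 (real i) --> norm (F (r (k n)) x - g x) < e"
   using Arzela_Ascoli[OF compact_cball[of 0 "real i"], of "%n. F (r n)" C] bd by metis
  have "uniform_limit (cball 0 (real i)) (%n. F ((r \<circ> k) n)) g sequentially"
  proof (rule uniform_limitI)
   fix e :: real assume "e > 0"
   from g(2)[OF this] show "EVS n. ALL x:cball 0 (real i). dist (F ((r \<circ> k) n) x) (g x) < e"
    unfolding eventually_sequentially dist_norm o_def by blast
  qed
  thus ?thesis using g(1) by (auto simp: P_def)
 qed
 moreover have "P i (r \<circ> k2)" if Pk: "P i (r \<circ> k1)" and "!!j. N <= j ==> EX j'. j <= j' & k2 j = k1 j'" for i r k1 k2 N
 proof -
  obtain g where g: "uniform_limit (cball 0 (real i)) (%n. F ((r \<circ> k1) n)) g sequentially" using Pk unfolding P_def by blast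
  have "uniform_limit (cball 0 (real i)) (%n. F ((r \<circ> k2) n)) g sequentially"
  proof (rule uniform_limitI)
   fix e :: real assume "e > 0"
   from uniform_limitD[OF g this] obtain M where M: "!!n x. n >= M ==> x : cball 0 (real i) ==> dist (F ((r \<circ> k1) n) x) (g x) < e"
    unfolding eventually_sequentially by blast
   have "dist (F ((r \<circ> k2) n) x) (g x) < e" if "n >= max N M" "x : cball 0 (real i)" for n x
   proof -
    obtain j' where "n <= j'" "k2 n = k1 j'" using \<open>!!j. N <= j ==> EX j'. j <= j' & k2 j = k1 j'\<close>[of n] \<open>n >= max N M\<close> by auto
    thus ?thesis using M[of j' x] \<open>n >= max N M\<close> \<open>x : cball 0 (real i)\<close> by simp
   qed
   thus "EVS n. ALL x:cball 0 (real i). dist (F ((r \<circ> k2) n) x) (g x) < e"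
    unfolding eventually_sequentially by blast
  qed
  thus ?thesis by (auto simp: P_def)
 qed
 ultimately obtain k where k: "strict_mono (k :: nat => nat)" "!!i. P i (id \<circ> k)"
  using subsequence_diagonalization_lemma[of P id] by blast
 hence "ALL i. EX g. uniform_limit (cball 0 (real i)) (%n. F (k n)) g sequentially" by (simp add: P_def)
 from choice[OF this] obtain G where G: "!!i. uniform_limit (cball 0 (real i)) (%n. F (k n)) (G i) sequentially" by blast
 define g where "g x = lim (%n. F (k n) x)" for x
 have Gg: "G i x = g x" "(%n. F (k n) x) ----> g x" if "x : cball 0 (real i)" for i x
 proof -
  have "(%n. F (k n) x) ----> G i x" using uniform_limit_imp_tendsto_at[OF G that] .
  thus "G i x = g x" "(%n. F (k n) x) ----> g x" by (simp_all add: g_def limI)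
 qed
 have lim: "(%n. F (k n) x) ----> g x" for x
 proof -
  obtain i where "norm x <= real i" using real_arch_simple by blast
  thus ?thesis using Gg(2)[of x i] by simp
 qed
 show ?thesis
 proof (rule that[OF k(1)])
  show "norm (g x - g y) <= K * norm (x - y)" for x y
   by (rule LIMSEQ_le_const2[OF tendsto_norm[OF tendsto_diff[OF lim lim]]]) (use lip in blast)
  show "norm (g x) <= C" for x
   by (rule LIMSEQ_le_const2[OF tendsto_norm[OF lim]]) (use bd in blast)
  fix R :: real
  obtain i where i: "R <= real i" using real_arch_simple by blast
  have "uniform_limit (cball 0 (real i)) (%n. F (k n)) g sequentially"
   using G[of i] Gg(1) by (subst uniform_limit_cong'[of _ _ "%n. F (k n)" g "G i"]) auto
  thus "uniform_limit (cball 0 R) (%n. F (k n)) g sequentially"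
   by (rule uniform_limit_on_subset) (use i in auto)
 qed
qed

text \<open>Cauchy estimates bound the first two derivatives uniformly over a bounded family.\<close>
lemma holomorphic_quadratic_bound:
 assumes "rho > 0" "0 <= B"
 shows "EX K>=0. ALL f :: complex => complex ^ 'm. (ALL i. hol f i (ball 0 (2 * rho))) --> (ALL z:ball 0 (2 * rho). norm (f z) <= B) -->
  (EX f'. f' 0 = vder f & (ALL z:ball 0 rho. norm (f' z) <= K) & (ALL z:ball 0 rho. ALL w:ball 0 rho. norm (f z - f w - (z - w) *s f' w) <= K * (cmod (z - w))\<^sup>2))"
proof -
 define q where "q n = fact n * B / (rho / 2) ^ n" for n
 have q0: "q n >= 0" for n using assms by (simp add: q_def)
 have scal: "cmod ((deriv ^^ n) h z) <= q n"
  if h: "h holomorphic_on ball 0 (2 * rho)" "!!z. z : ball 0 (2 * rho) ==> cmod (h z) <= B" and z: "z : ball 0 rho" for h :: "complex => complex" and z n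
 proof -
  have sub: "cball z (rho / 2) <= ball 0 (2 * rho)"
  proof
   fix x assume "x : cball z (rho / 2)"
   hence "cmod (z - x) <= rho / 2" by (simp add: dist_norm)
   moreover have "cmod x <= cmod z + cmod (z - x)" using norm_triangle_ineq4[of z "z - x"] by simp
   ultimately show "x : ball 0 (2 * rho)" using z assms(1) by simp
  qed
  show ?thesis unfolding q_def
  proof (rule Cauchy_inequality)
   show "h holomorphic_on ball z (rho / 2)" using holomorphic_on_subset[OF h(1)] sub ball_subset_cball by blast
   show "continuous_on (cball z (rho / 2)) h" using holomorphic_on_imp_continuous_on[OF holomorphic_on_subset[OF h(1) sub]] .
   fix x assume "cmod (z - x) = rho / 2"
   hence "x : cball z (rho / 2)" by (simp add: dist_norm)
   thus "cmod (h x) <= B" using h(2) sub by blast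
  qed (use assms in simp)
 qed
 have scal2: "cmod (h z - h w - (z - w) * deriv h w) <= q 2 * (cmod (z - w))\<^sup>2"
  if h: "h holomorphic_on ball 0 (2 * rho)" "!!z. z : ball 0 (2 * rho) ==> cmod (h z) <= B" and zw: "z : ball 0 rho" "w : ball 0 rho" for h :: "complex => complex" and z w
 proof -
  have "cmod ((deriv ^^ 0) h z - (\<Sum>i\<le>1. (deriv ^^ i) h w * (z - w) ^ i / fact i)) <= q 2 * cmod (z - w) ^ Suc 1 / fact 1"
  proof (rule complex_Taylor[of "ball 0 rho" 1 "%i. (deriv ^^ i) h"])
   fix i :: nat and x :: complex assume x: "x : ball 0 rho"
   hence x2: "x : ball 0 (2 * rho)" using assms(1) by simp
   have "(deriv ^^ i) h holomorphic_on ball 0 (2 * rho)" by (rule holomorphic_higher_deriv[OF h(1) open_ball])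
   from has_field_derivative_at_within[OF holomorphic_derivI[OF this open_ball x2]]
   show "((deriv ^^ i) h has_field_derivative (deriv ^^ Suc i) h x) (at x within ball 0 rho)" by simp
  next
   show "cmod ((deriv ^^ Suc 1) h x) <= q 2" if "x : ball 0 rho" for x
    using scal[OF h that, of 2] by (simp add: numeral_2_eq_2)
  qed (use zw in auto)
  thus ?thesis by (simp add: algebra_simps power2_eq_square)
 qed
 define K where "K = of_nat CARD('m) * (q 1 + q 2)"
 show ?thesis
 proof (intro exI[of _ K] conjI allI impI)
  show "K >= 0" using q0 by (simp add: K_def)
  fix f :: "complex => complex ^ 'm"
  assume f0: "ALL i. hol f i (ball 0 (2 * rho))" "ALL z:ball 0 (2 * rho). norm (f z) <= B"
  have f: "hol f i (ball 0 (2 * rho))" for i using f0(1) by blast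
  have fB: "norm (f z) <= B" if "z : ball 0 (2 * rho)" for z using f0(2) that by blast
  have fb: "cmod (f z $ i) <= B" if "z : ball 0 (2 * rho)" for z i
   by (rule order_trans[OF Finite_Cartesian_Product.norm_nth_le fB[OF that]])
  define f' where "f' z = (\<chi> i. deriv (%z. f z $ i) z)" for z
  have sumK: "norm v <= K * x" if "!!i. cmod (v $ i) <= (q 1 + q 2) * x" for v :: "complex ^ 'm" and x
  proof -
   have "norm v <= (\<Sum>i\<in>UNIV. cmod (v $ i))" by (rule norm_vec_le_sum)
   also have "... <= of_nat CARD('m) * ((q 1 + q 2) * x)" by (rule sum_bounded_above) (rule that)
   finally show ?thesis by (simp add: K_def mult.assoc)
  qed
  have "norm (f' z) <= K * 1" if "z : ball 0 rho" for z
  proof (rule sumK)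
   fix i
   have "cmod (deriv (%z. f z $ i) z) <= q 1" using scal[OF f fb that, where n = 1] by simp
   thus "cmod (f' z $ i) <= (q 1 + q 2) * 1" using q0[of 2] by (simp add: f'_def)
  qed
  moreover have "norm (f z - f w - (z - w) *s f' w) <= K * (cmod (z - w))\<^sup>2" if "z : ball 0 rho" "w : ball 0 rho" for z w
  proof (rule sumK)
   fix i
   have "cmod ((f z - f w - (z - w) *s f' w) $ i) <= q 2 * (cmod (z - w))\<^sup>2"
    using scal2[OF f fb that, of i] by (simp only: f'_def vector_minus_component smult_nth vec_lambda_beta)
   also have "... <= (q 1 + q 2) * (cmod (z - w))\<^sup>2" using q0[of 1] by (intro mult_right_mono) auto
   finally show "cmod ((f z - f w - (z - w) *s f' w) $ i) <= (q 1 + q 2) * (cmod (z - w))\<^sup>2" .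
  qed
  moreover have "f' 0 = vder f" by (simp add: f'_def vder_def)
  ultimately show "EX f'. f' 0 = vder f & (ALL z:ball 0 rho. norm (f' z) <= K) & (ALL z:ball 0 rho. ALL w:ball 0 rho. norm (f z - f w - (z - w) *s f' w) <= K * (cmod (z - w))\<^sup>2)"
   by (intro exI[of _ f'] conjI ballI) auto
 qed
qed

lemma chart_gradient_bounds:
 fixes g :: "'a::euclidean_space => 'a"
 assumes "chart D a d r g L"
 obtains m M where "0 < m" "0 < M" "!!x. x : ball a (d / 2) ==> m <= norm (g x)" "!!x. x : ball a (d / 2) ==> norm (g x) <= M"
proof -
 have sub: "cball a (d / 2) <= ball a d" "cball a (d / 2) ~= {}" using chartD(1)[OF assms] by auto
 have c: "continuous_on (cball a (d / 2)) (%x. norm (g x))"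
  by (intro continuous_on_norm continuous_on_subset[OF chart_continuous[OF assms] sub(1)])
 obtain x1 where x1: "x1 : cball a (d / 2)" "!!x. x : cball a (d / 2) ==> norm (g x1) <= norm (g x)"
  using continuous_attains_inf[OF compact_cball sub(2) c] by blast
 obtain x2 where x2: "x2 : cball a (d / 2)" "!!x. x : cball a (d / 2) ==> norm (g x) <= norm (g x2)"
  using continuous_attains_sup[OF compact_cball sub(2) c] by blast
 have "norm (g x1) > 0" "norm (g x2) > 0" using chartD(5)[OF assms] x1(1) x2(1) sub(1) by auto
 thus ?thesis using that[of "norm (g x1)" "norm (g x2)"] x1(2) x2(2) by (meson ball_subset_cball subsetD)
qed

text \<open>Multiples of this vector have a prescribed real pairing with v, so they translate complex functions into heights above the boundary.\<close>
lemma herm_normalised_inner: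
 assumes "v ~= 0"
 shows "(c *s (v /\<^sub>R (norm v)\<^sup>2)) \<bullet> v = Re c"
proof -
 have "(c *s (v /\<^sub>R (norm v)\<^sup>2)) \<bullet> v = Re (herm v (c *s (v /\<^sub>R (norm v)\<^sup>2)))" by (simp add: Re_herm inner_commute)
 also have "... = Re (c * of_real (inverse ((norm v)\<^sup>2)) * of_real ((norm v)\<^sup>2))"
  by (simp only: herm_smult_right herm_scaleR_right herm_self mult.assoc)
 also have "... = Re c" using assms by (simp add: mult.assoc flip: of_real_mult)
 finally show ?thesis .
qed

text \<open>Rescale r along f_n by y_n in the parameter and by y_n^2 in height. The rescaled functions are bounded and, by the C^{1,1} expansion, equi-Lipschitz with quadratically controlled increments. A limit on the plane is submean by the continuity principle, hence constant, which contradicts a gradient bounded away from 0.\<close>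
lemma blow_up_gradient:
 fixes f :: "nat => complex => complex ^ 'm"
 assumes D: "open D" "taut D" and ch: "chart D a d r g L" and y: "!!n. y n > 0" "y ----> 0" "!!n. 4 * y n <= rho"
  and hol: "!!n i. hol (f n) i (ball 0 rho)" and im: "!!n z. z : ball 0 rho ==> f n z : ball a (d / 2)"
  and rb: "!!n z. z : ball 0 rho ==> \<bar>r (f n z)\<bar> <= C * (y n)\<^sup>2" and C: "0 <= C" and K: "0 <= K"
  and f'b: "!!n z. z : ball 0 rho ==> norm (f' n z) <= K"
  and tay: "!!n z w. z : ball 0 rho ==> w : ball 0 rho ==> norm (f n z - f n w - (z - w) *s f' n w) <= K * (cmod (z - w))\<^sup>2"
  and eta: "\<eta> > 0"
 shows "EX n. \<bar>f' n 0 \<bullet> g (f n 0)\<bar> <= \<eta> * y n"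
proof (rule ccontr)
 assume neg: "\<not> ?thesis"
 have rho: "rho > 0" using y(1,3)[of 0] by linarith
 have d: "d > 0" and L: "L >= 0" using chartD(1,2)[OF ch] by auto
 obtain m M where mM: "0 < m" "0 < M" "!!x. x : ball a (d / 2) ==> m <= norm (g x)" "!!x. x : ball a (d / 2) ==> norm (g x) <= M"
  using chart_gradient_bounds[OF ch] by blast
 have half: "x : ball a d" if "x : ball a (d / 2)" for x using that d by simp
 define K1 where "K1 = K * (1 + 2 * rho)"
 have K1: "K1 >= 0" using K rho by (simp add: K1_def)
 have lipf: "norm (f n z - f n w) <= K1 * cmod (z - w)" if "z : ball 0 rho" "w : ball 0 rho" for n z w
 proof -
  have "cmod (z - w) <= 2 * rho" using norm_triangle_ineq4[of z w] that by simp
  hence sq: "(cmod (z - w))\<^sup>2 <= 2 * rho * cmod (z - w)" unfolding power2_eq_square by (intro mult_right_mono) auto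
  have "norm (f n z - f n w) <= norm (f n z - f n w - (z - w) *s f' n w) + norm ((z - w) *s f' n w)"
   using norm_triangle_ineq[of "f n z - f n w - (z - w) *s f' n w" "(z - w) *s f' n w"] by simp
  also have "... <= K * (2 * rho * cmod (z - w)) + cmod (z - w) * K"
   unfolding norm_smult using tay[OF that, of n] f'b[OF that(2), of n] mult_left_mono[OF sq K]
   by (intro add_mono mult_left_mono) auto
  finally show ?thesis by (simp add: K1_def algebra_simps)
 qed
 define K2 where "K2 = K * M + L * K1\<^sup>2"
 have K2: "K2 >= 0" using K mM L by (simp add: K2_def)
 have Qr: "\<bar>r (f n z) - r (f n w) - ((z - w) *s f' n w) \<bullet> g (f n w)\<bar> <= K2 * (cmod (z - w))\<^sup>2" if "z : ball 0 rho" "w : ball 0 rho" for n z w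
 proof -
  have "\<bar>r (f n z) - r (f n w) - (f n z - f n w) \<bullet> g (f n w)\<bar> <= L * (norm (f n z - f n w))\<^sup>2"
   by (rule chart_taylor[OF ch half[OF im[OF that(2)]] half[OF im[OF that(1)]]])
  also have "... <= L * (K1 * cmod (z - w))\<^sup>2" by (intro mult_left_mono power_mono lipf that L) simp
  finally have 1: "\<bar>r (f n z) - r (f n w) - (f n z - f n w) \<bullet> g (f n w)\<bar> <= L * K1\<^sup>2 * (cmod (z - w))\<^sup>2"
   by (simp add: power_mult_distrib mult.assoc)
  have "\<bar>(f n z - f n w - (z - w) *s f' n w) \<bullet> g (f n w)\<bar> <= norm (f n z - f n w - (z - w) *s f' n w) * norm (g (f n w))"
   by (rule Cauchy_Schwarz_ineq2)
  also have "... <= K * (cmod (z - w))\<^sup>2 * M" by (intro mult_mono tay that mM(4) im) (use K in auto)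
  finally have 2: "\<bar>(f n z - f n w - (z - w) *s f' n w) \<bullet> g (f n w)\<bar> <= K * M * (cmod (z - w))\<^sup>2" by (simp add: mult_ac)
  have "(f n z - f n w - (z - w) *s f' n w) \<bullet> g (f n w) = (f n z - f n w) \<bullet> g (f n w) - ((z - w) *s f' n w) \<bullet> g (f n w)"
   by (rule inner_diff_left)
  thus ?thesis using 1 2 unfolding K2_def distrib_right abs_le_iff by linarith
 qed
 define B where "B n zeta = r (f n (of_real (y n) * zeta)) / (y n)\<^sup>2" for n zeta
 define c where "c n zeta w = ((w *s f' n (of_real (y n) * zeta)) \<bullet> g (f n (of_real (y n) * zeta))) / y n" for n zeta w
 define R where "R n = rho / (2 * y n)" for n
 have R2: "R n >= 2" for n using y(1,3)[of n] by (simp add: R_def field_simps)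
 have inball: "of_real (y n) * zeta : ball 0 rho" if "cmod zeta < 2 * R n" for n zeta
  using that y(1)[of n] by (simp add: R_def norm_mult field_simps)
 have Q: "\<bar>B n zeta - B n w - c n w (zeta - w)\<bar> <= K2 * (cmod (zeta - w))\<^sup>2" if "cmod zeta < 2 * R n" "cmod w < 2 * R n" for n zeta w
 proof -
  have yz: "of_real (y n) * zeta - of_real (y n) * w = of_real (y n) * (zeta - w)" by (simp add: algebra_simps)
  have sc: "((of_real (y n) * (zeta - w)) *s v) \<bullet> u = y n * (((zeta - w) *s v) \<bullet> u)" for v u :: "complex ^ 'm"
  proof -
   have "(of_real (y n) * (zeta - w)) *s v = y n *R ((zeta - w) *s v)" by (simp only: vec_eq_iff smult_nth vector_scaleR_component scaleR_complex mult.assoc) simp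
   thus ?thesis by simp
  qed
  define A where "A = r (f n (of_real (y n) * zeta)) - r (f n (of_real (y n) * w)) - y n * (y n * c n w (zeta - w))"
  have "y n * c n w (zeta - w) = ((zeta - w) *s f' n (of_real (y n) * w)) \<bullet> g (f n (of_real (y n) * w))"
   using y(1)[of n] by (simp add: c_def)
  hence "\<bar>A\<bar> <= K2 * (y n * cmod (zeta - w))\<^sup>2"
   using Qr[OF inball[OF that(1)] inball[OF that(2)]] y(1)[of n] unfolding yz sc A_def by (simp add: norm_mult)
  hence "\<bar>A\<bar> / (y n)\<^sup>2 <= K2 * (cmod (zeta - w))\<^sup>2"
   using y(1)[of n] by (simp add: pos_divide_le_eq power_mult_distrib mult_ac)
  moreover have "B n zeta - B n w - c n w (zeta - w) = A / (y n)\<^sup>2"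
   using y(1)[of n] by (simp add: A_def B_def field_simps power2_eq_square)
  ultimately show ?thesis by (simp add: abs_divide)
 qed
 have Bb: "\<bar>B n zeta\<bar> <= C" if "cmod zeta < 2 * R n" for n zeta
  using rb[OF inball[OF that]] y(1)[of n] by (simp add: B_def abs_divide pos_divide_le_eq)
 define \<Lambda> where "\<Lambda> = 2 * C + 2 * K2"
 have lip: "\<bar>B n zeta - B n w\<bar> <= \<Lambda> * cmod (zeta - w)" if "cmod zeta <= R n" "cmod w <= R n" for n zeta w
 proof -
  have dom: "cmod zeta < 2 * R n" "cmod w < 2 * R n" using that R2[of n] by linarith+
  show ?thesis
  proof (cases "cmod (zeta - w) <= 1 & zeta ~= w")
   case True
   define t where "t = cmod (zeta - w)"
   define e where "e = (zeta - w) / of_real t"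
   have t: "0 < t" "t <= 1" using True by (auto simp: t_def)
   have e: "cmod e = 1" "zeta - w = of_real t * e" using t by (auto simp: e_def t_def norm_divide)
   have "cmod (w + e) <= cmod w + 1" using norm_triangle_ineq[of w e] e(1) by simp
   hence we: "cmod (w + e) < 2 * R n" using that(2) R2[of n] by linarith
   have "\<bar>B n (w + e) - B n w - c n w e\<bar> <= K2" using Q[OF we dom(2)] e(1) by simp
   hence ce: "\<bar>c n w e\<bar> <= 2 * C + K2" using Bb[OF we] Bb[OF dom(2)] unfolding abs_le_iff by linarith
   have "(of_real t * e) *s v = t *R (e *s v)" for v :: "complex ^ 'm" by (simp only: vec_eq_iff smult_nth vector_scaleR_component scaleR_complex mult.assoc) simp
   hence "c n w (zeta - w) = t * c n w e" by (simp add: e(2) c_def)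
   hence "\<bar>c n w (zeta - w)\<bar> <= t * (2 * C + K2)" using ce t by (simp add: abs_mult mult_left_mono)
   moreover have "K2 * t\<^sup>2 <= t * K2"
    using mult_right_mono[OF mult_left_mono[OF t(2) K2], of t] t by (simp add: power2_eq_square mult_ac)
   ultimately show ?thesis using Q[OF dom] unfolding \<Lambda>_def t_def[symmetric] by (simp add: abs_le_iff algebra_simps)
  next
   case False
   show ?thesis
   proof (cases "zeta = w")
    case False
    hence "1 <= cmod (zeta - w)" using \<open>\<not> (cmod (zeta - w) <= 1 & zeta ~= w)\<close> by simp
    hence "\<Lambda> * 1 <= \<Lambda> * cmod (zeta - w)" using C K2 by (intro mult_left_mono) (auto simp: \<Lambda>_def)
    moreover have "\<bar>B n zeta - B n w\<bar> <= \<Lambda>" using Bb[OF dom(1)] Bb[OF dom(2)] K2 unfolding \<Lambda>_def abs_le_iff by linarith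
    ultimately show ?thesis by simp
   qed simp
  qed
 qed
 have R0: "R n >= 0" for n using R2[of n] by simp
 \<comment> \<open>Composition with the nearest point projection extends B n to the plane with the same constants.\<close>
 define Bh where "Bh n zeta = B n (closest_point (cball 0 (R n)) zeta)" for n zeta
 have cp: "cmod (closest_point (cball 0 (R n)) zeta) <= R n" for n zeta
  using closest_point_in_set[OF closed_cball, of 0 "R n" zeta] R0[of n] by simp
 have Bh_eq: "Bh n zeta = B n zeta" if "cmod zeta <= R n" for n zeta
  using closest_point_self[of zeta "cball 0 (R n)"] that by (simp add: Bh_def)
 have \<Lambda>0: "\<Lambda> >= 0" using C K2 by (simp add: \<Lambda>_def)
 have Bh_lip: "norm (Bh n zeta - Bh n w) <= \<Lambda> * norm (zeta - w)" for n zeta w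
 proof -
  have "dist (closest_point (cball 0 (R n)) zeta) (closest_point (cball 0 (R n)) w) <= dist zeta w"
   by (rule closest_point_lipschitz[OF convex_cball closed_cball]) (use R0[of n] in auto)
  hence "\<Lambda> * cmod (closest_point (cball 0 (R n)) zeta - closest_point (cball 0 (R n)) w) <= \<Lambda> * cmod (zeta - w)"
   using \<Lambda>0 by (intro mult_left_mono) (auto simp: dist_norm)
  thus ?thesis using lip[OF cp cp, of n zeta w] unfolding Bh_def real_norm_def by linarith
 qed
 have Bh_bd: "norm (Bh n zeta) <= C" for n zeta
 proof -
  have "cmod (closest_point (cball 0 (R n)) zeta) < 2 * R n" using cp[of n zeta] R2[of n] by linarith
  from Bb[OF this] show ?thesis by (simp add: Bh_def)
 qed
 obtain B0 s where s: "strict_mono (s :: nat => nat)" and B0: "!!x z. norm (B0 x - B0 z) <= \<Lambda> * norm (x - z)" "!!x. norm (B0 x) <= C"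
  and ul: "!!R. uniform_limit (cball 0 R) (%n. Bh (s n)) B0 sequentially"
  by (rule equilipschitz_subsequence[of Bh C \<Lambda>, OF Bh_bd Bh_lip]) (rule that)
 have ys: "(%n. y (s n)) ----> 0" using LIMSEQ_subseq_LIMSEQ[OF y(2) s] by (simp add: o_def)
 have "B0 zeta = B0 w" for zeta w
 proof (rule submean_bounded_imp_const)
  show "continuous_on UNIV B0"
  proof (rule lipschitz_on_continuous_on[of \<Lambda>])
   show "\<Lambda>-lipschitz_on UNIV B0" using B0(1) \<Lambda>0 by (intro lipschitz_onI) (auto simp: dist_norm)
  qed
  hence contB0: "continuous_on S B0" for S by (rule continuous_on_subset) simp
  show "\<bar>B0 z\<bar> <= C" for z using B0(2) by simp
  show "submean B0" unfolding submean_def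
  proof (intro allI impI ballI)
   fix cc z0 :: complex and Rr :: real and S p
   assume Rr: "0 < Rr" and S: "open S" "cball cc Rr <= S" and p: "p holomorphic_on S"
    and sph: "ALL z:sphere cc Rr. B0 z < Re (p z)" and z0: "z0 : cball cc Rr"
   have sphS: "sphere cc Rr <= S" using S(2) sphere_cball by blast
   have contp: "continuous_on (cball cc Rr) p" using holomorphic_on_imp_continuous_on[OF holomorphic_on_subset[OF p S(2)]] .
   have "EX \<delta>>0. ALL z:sphere cc Rr. B0 z + \<delta> <= Re (p z)"
   proof -
    have "continuous_on (sphere cc Rr) (%z. Re (p z) - B0 z)"
     by (intro continuous_intros contB0 continuous_on_subset[OF contp sphere_cball])
    moreover have "sphere cc Rr ~= {}" using Rr by simp
    ultimately obtain x where x: "x : sphere cc Rr" "!!z. z : sphere cc Rr ==> Re (p x) - B0 x <= Re (p z) - B0 z"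
     using continuous_attains_inf[OF compact_sphere, of cc Rr "%z. Re (p z) - B0 z"] by blast
    thus ?thesis using sph by (intro exI[of _ "Re (p x) - B0 x"]) force
   qed
   then obtain \<delta> where \<delta>: "\<delta> > 0" "!!z. z : sphere cc Rr ==> B0 z + \<delta> <= Re (p z)" by blast
   have "bounded (p ` cball cc Rr)" by (rule compact_imp_bounded[OF compact_continuous_image[OF contp compact_cball]])
   then obtain Pb where Pb: "Pb > 0" "!!z. z : cball cc Rr ==> cmod (p z) <= Pb"
    unfolding bounded_pos by blast
   \<comment> \<open>Lowering by y^2 T moves the whole disc into D: this is the start of the family.\<close>
   define T where "T = Pb + C + 1"
   have T: "T > 0" using Pb C by (simp add: T_def)
   define R1 where "R1 = cmod cc + Rr"
   have inR1: "cmod z <= R1" if "z : cball cc Rr" for z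
   proof -
    have "cmod z <= cmod cc + cmod (cc - z)" using norm_triangle_ineq4[of cc "cc - z"] by simp
    thus ?thesis using that by (simp add: R1_def dist_norm)
   qed
   have R1: "R1 >= 0" using Rr by (simp add: R1_def)
   define Q1 where "Q1 = (Pb + T) / m"
   have Q1: "Q1 > 0" using Pb T mM by (simp add: Q1_def)
   define E where "E y = Q1 * L * K1 * R1 * y + L * Q1\<^sup>2 * y\<^sup>2" for y :: real
   have main: "B0 z0 <= Re (p z0) + 2 * eps" if eps: "0 < eps" "eps <= 1 / 4" "4 * eps <= \<delta>" for eps
   proof -
    have "EVS n. ALL z:cball 0 R1. dist (Bh (s n) z) (B0 z) < eps" using uniform_limitD[OF ul eps(1)] .
    moreover have "(%n. E (y (s n))) ----> E 0" unfolding E_def by (intro tendsto_intros ys)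
    hence "EVS n. E (y (s n)) < eps" by (rule order_tendstoD) (use eps in \<open>simp add: E_def\<close>)
    moreover have "(%n. (y (s n))\<^sup>2 * Q1) ----> 0\<^sup>2 * Q1" by (intro tendsto_intros ys)
    hence "EVS n. (y (s n))\<^sup>2 * Q1 < d / 2" by (rule order_tendstoD) (use d in simp)
    moreover have "(%n. y (s n) * (2 * R1)) ----> 0 * (2 * R1)" by (intro tendsto_intros ys)
    hence "EVS n. y (s n) * (2 * R1) < rho" by (rule order_tendstoD) (use rho in simp)
    ultimately have "EVS n. B0 z0 <= Re (p z0) + 2 * eps"
    proof eventually_elim
     case (elim n)
     define k where "k = s n"
     define Y where "Y = y k"
     have Y: "Y > 0" using y(1) by (simp add: Y_def)
     have R1k: "R1 <= R k" using elim(4) Y by (simp add: R_def k_def[symmetric] Y_def[symmetric] field_simps)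
     have near: "\<bar>B k z - B0 z\<bar> < eps" if "z : cball cc Rr" for z
     proof -
      have "z : cball 0 R1" "cmod z <= R k" using inR1[OF that] R1k by auto
      from bspec[OF elim(1) this(1)] Bh_eq[OF this(2)] show ?thesis by (simp add: dist_real_def k_def)
     qed
     define g0 where "g0 = g (f k 0)"
     have z0b: "(0::complex) : ball 0 rho" using rho by simp
     have g0': "m <= norm g0" unfolding g0_def by (rule mM(3)[OF im[OF z0b]])
     hence g0: "g0 ~= 0" "m <= norm g0" using mM(1) by auto
     define E0 where "E0 = g0 /\<^sub>R (norm g0)\<^sup>2"
     have E0n: "norm E0 <= 1 / m"
      using g0 mM(1) by (simp add: E0_def power2_eq_square field_simps)
     define \<Delta> where "\<Delta> \<tau> z = (of_real (Y\<^sup>2) * (p z + of_real (\<tau> * T))) *s E0" for \<tau> z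
     have inner\<Delta>: "\<Delta> \<tau> z \<bullet> g0 = Y\<^sup>2 * (Re (p z) + \<tau> * T)" for \<tau> z
      unfolding \<Delta>_def E0_def herm_normalised_inner[OF g0(1)] by simp
     have n\<Delta>: "norm (\<Delta> \<tau> z) <= Y\<^sup>2 * Q1" if "\<tau> : {0..1}" "z : cball cc Rr" for \<tau> z
     proof -
      have "cmod (p z + of_real (\<tau> * T)) <= cmod (p z) + \<tau> * T"
       using norm_triangle_ineq[of "p z" "of_real (\<tau> * T)"] that(1) T by (simp add: norm_mult)
      also have "... <= Pb + T" using Pb(2)[OF that(2)] that(1) T by (intro add_mono) (auto simp: mult_left_le_one_le)
      finally have 1: "cmod (p z + of_real (\<tau> * T)) <= Pb + T" .
      have "norm (\<Delta> \<tau> z) = Y\<^sup>2 * (cmod (p z + of_real (\<tau> * T)) * norm E0)"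
       by (simp add: \<Delta>_def norm_smult norm_mult norm_power mult.assoc)
      also have "... <= Y\<^sup>2 * ((Pb + T) * (1 / m))"
       by (intro mult_left_mono mult_mono 1 E0n) (use Pb T in auto)
      finally show ?thesis by (simp add: Q1_def)
     qed
     define F where "F \<tau> z = f k (of_real Y * z) - \<Delta> \<tau> z" for \<tau> z
     have Yz: "of_real Y * z : ball 0 rho" if "z : cball cc Rr" for z
      using inball[of z k] inR1[OF that] R1k R2[of k] unfolding Y_def by fastforce
     have Fin: "F \<tau> z : ball a d" and Fr: "\<bar>r (F \<tau> z) / Y\<^sup>2 - (B k z - Re (p z) - \<tau> * T)\<bar> < eps"
      if \<tau>z: "\<tau> : {0..1}" "z : cball cc Rr" for \<tau> z
     proof -
      define x where "x = f k (of_real Y * z)"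
      have x: "x : ball a (d / 2)" using im[OF Yz[OF \<tau>z(2)]] by (simp add: x_def)
      have nd: "norm (\<Delta> \<tau> z) < d / 2" using n\<Delta>[OF \<tau>z] elim(3) unfolding k_def[symmetric] Y_def[symmetric] by linarith
      have "dist a (x - \<Delta> \<tau> z) <= dist a x + norm (\<Delta> \<tau> z)" using norm_triangle_ineq[of "a - x" "\<Delta> \<tau> z"] by (simp add: dist_norm algebra_simps)
      thus Fin: "F \<tau> z : ball a d" using x nd unfolding F_def x_def[symmetric] by simp
      have "\<bar>r (F \<tau> z) - r x - (F \<tau> z - x) \<bullet> g x\<bar> <= L * (norm (F \<tau> z - x))\<^sup>2"
       by (rule chart_taylor[OF ch half[OF x] Fin])
      moreover have Fx: "F \<tau> z - x = - \<Delta> \<tau> z" by (simp add: F_def x_def)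
      moreover have "L * (norm (- \<Delta> \<tau> z))\<^sup>2 <= L * (Y\<^sup>2 * Q1)\<^sup>2"
       using n\<Delta>[OF \<tau>z] by (intro mult_left_mono power_mono L) auto
      ultimately have 1: "\<bar>r (F \<tau> z) - r x + \<Delta> \<tau> z \<bullet> g x\<bar> <= L * (Y\<^sup>2 * Q1)\<^sup>2" by (simp del: norm_minus_cancel)
      have "\<bar>\<Delta> \<tau> z \<bullet> (g x - g0)\<bar> <= norm (\<Delta> \<tau> z) * norm (g x - g0)" by (rule Cauchy_Schwarz_ineq2)
      also have "norm (g x - g0) <= L * norm (x - f k 0)"
       unfolding g0_def by (rule chartD(4)[OF ch half[OF x] half[OF im[OF z0b]]])
      also have "norm (x - f k 0) <= K1 * (Y * R1)"
      proof -
       have "norm (x - f k 0) <= K1 * cmod (of_real Y * z - 0)" unfolding x_def by (rule lipf[OF Yz[OF \<tau>z(2)] z0b])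
       also have "... <= K1 * (Y * R1)" using Y inR1[OF \<tau>z(2)] K1 by (intro mult_left_mono) (auto simp: norm_mult)
       finally show ?thesis .
      qed
      finally have "\<bar>\<Delta> \<tau> z \<bullet> (g x - g0)\<bar> <= norm (\<Delta> \<tau> z) * (L * (K1 * (Y * R1)))" using L by (simp add: mult_left_mono)
      also have "... <= Y\<^sup>2 * Q1 * (L * (K1 * (Y * R1)))" by (intro mult_right_mono n\<Delta> \<tau>z) (use L K1 Y R1 in auto)
      finally have 2: "\<bar>\<Delta> \<tau> z \<bullet> (g x - g0)\<bar> <= Y\<^sup>2 * Q1 * (L * (K1 * (Y * R1)))" .
      have "\<bar>r (F \<tau> z) - r x + Y\<^sup>2 * (Re (p z) + \<tau> * T)\<bar> <= Y\<^sup>2 * E Y"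
       using 1 2 inner\<Delta>[of \<tau> z] unfolding E_def inner_diff_right abs_le_iff by (simp add: algebra_simps power2_eq_square)
      hence "\<bar>r (F \<tau> z) - r x + Y\<^sup>2 * (Re (p z) + \<tau> * T)\<bar> / Y\<^sup>2 <= E Y" using Y by (simp add: pos_divide_le_eq mult.commute)
      moreover have "r (F \<tau> z) / Y\<^sup>2 - (B k z - Re (p z) - \<tau> * T) = (r (F \<tau> z) - r x + Y\<^sup>2 * (Re (p z) + \<tau> * T)) / Y\<^sup>2"
      proof -
       have "B k z = r x / Y\<^sup>2" by (simp add: B_def x_def Y_def)
       thus ?thesis using Y by (simp add: field_simps)
      qed
      ultimately show "\<bar>r (F \<tau> z) / Y\<^sup>2 - (B k z - Re (p z) - \<tau> * T)\<bar> < eps"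
       using elim(2) unfolding k_def[symmetric] Y_def[symmetric] by (simp add: abs_divide)
     qed
     have inD: "F \<tau> z : D \<longleftrightarrow> r (F \<tau> z) / Y\<^sup>2 < 0" if "\<tau> : {0..1}" "z : cball cc Rr" for \<tau> z
      using chartD(6)[OF ch Fin[OF that]] Y by (simp add: divide_less_0_iff)
     define w where "w z = cc + of_real Rr * z" for z
     have wc: "w z : cball cc Rr" if "z : cball 0 1" for z using that Rr by (simp add: w_def dist_norm norm_mult)
     have ws: "w z : sphere cc Rr" if "z : sphere 0 1" for z using that Rr by (simp add: w_def dist_norm norm_mult)
     have wb: "w z : cball cc Rr" "w z : S" if "z : ball 0 1" for z using wc[of z] that S(2) by auto
     have holw: "w holomorphic_on ball 0 1" unfolding w_def by (intro holomorphic_intros)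
     define x0 where "x0 = (z0 - cc) / of_real Rr"
     have x0: "x0 : cball 0 1" "w x0 = z0" using z0 Rr by (auto simp: x0_def w_def dist_norm norm_divide norm_minus_commute)
     have "F 0 (w x0) : D"
     proof (rule taut_continuity_principle[OF D, of "%\<tau> z. F \<tau> (w z)"])
      show "continuous_on ({0..1} \<times> cball 0 1) (%(t, z). F t (w z))"
       unfolding F_def \<Delta>_def case_prod_unfold
      proof (intro continuous_intros)
       have "continuous_on (ball 0 rho) (f k)" by (rule holomorphic_vec_imp_continuous_on[OF hol])
       thus "continuous_on ({0..1} \<times> cball 0 1) (%x. f k (of_real Y * w (snd x)))"
        by (rule continuous_on_compose2) (use Yz wc in \<open>auto simp: w_def intro!: continuous_intros\<close>)
       have "continuous_on ({0..1} \<times> cball 0 1) (%x. p (w (snd x)))"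
        by (rule continuous_on_compose2[OF contp]) (use wc in \<open>auto simp: w_def intro!: continuous_intros\<close>)
       hence "continuous_on ({0..1} \<times> cball 0 1) (%x :: real \<times> complex. \<chi> i. of_real (Y\<^sup>2) * (p (w (snd x)) + of_real (fst x * T)) * E0 $ i)"
        by (intro continuous_intros)
       thus "continuous_on ({0..1} \<times> cball 0 1) (%x :: real \<times> complex. (of_real (Y\<^sup>2) * (p (w (snd x)) + of_real (fst x * T))) *s E0)"
        by (simp add: vector_scalar_mult_def)
      qed
      fix t i assume "t : {0..1::real}"
      have "(%z. f k (of_real Y * w z) $ i) holomorphic_on ball 0 1"
       by (rule holomorphic_on_compose_gen[OF _ hol, of "%z. of_real Y * w z", unfolded o_def])
        (use Yz wb in \<open>auto intro!: holomorphic_intros holw\<close>)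
      moreover have "(%z. p (w z)) holomorphic_on ball 0 1"
       by (rule holomorphic_on_compose_gen[OF holw p, unfolded o_def]) (use wb in auto)
      ultimately show "(%z. F t (w z) $ i) holomorphic_on ball 0 1"
       unfolding F_def \<Delta>_def vector_minus_component smult_nth by (intro holomorphic_intros)
     next
      fix t :: real and z :: complex assume t: "t : {0..1}" and z: "z : sphere 0 1"
      have wz: "w z : cball cc Rr" using wc[of z] z by simp
      have "t * T >= 0" using t T by simp
      thus "F t (w z) : D" using Fr[OF t wz] near[OF wz] \<delta>(2)[OF ws[OF z]] eps
       unfolding inD[OF t wz] abs_less_iff by linarith
     next
      fix z :: complex assume z: "z : cball 0 1"
      have one: "(1::real) : {0..1}" by simp
      have "cmod (w z) < 2 * R k" using inR1[OF wc[OF z]] R1k R2[of k] by linarith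
      hence "\<bar>B k (w z)\<bar> <= C" by (rule Bb)
      thus "F 1 (w z) : D" using Fr[OF one wc[OF z]] Pb(2)[OF wc[OF z]] abs_Re_le_cmod[of "p (w z)"] eps
       unfolding inD[OF one wc[OF z]] T_def abs_less_iff abs_le_iff mult_1_left by linarith
     qed (rule x0(1))
     moreover have zero: "(0::real) : {0..1}" by simp
     ultimately have "r (F 0 z0) / Y\<^sup>2 < 0" using inD[OF zero z0] x0(2) by simp
     thus ?case using Fr[OF zero z0] near[OF z0] unfolding abs_less_iff by linarith
    qed
    thus ?thesis by simp
   qed
   show "B0 z0 <= Re (p z0)"
   proof (rule field_le_epsilon)
    fix e :: real assume e: "e > 0"
    define eps where "eps = min (e / 2) (min (1 / 4) (\<delta> / 4))"
    have "0 < eps" "eps <= 1 / 4" "4 * eps <= \<delta>" "2 * eps <= e" using e \<delta>(1) by (auto simp: eps_def min_def)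
    thus "B0 z0 <= Re (p z0) + e" using main[of eps] by linarith
   qed
  qed
 qed
 hence const: "B0 (of_real h) = B0 0" for h by blast
 define h where "h = min 1 (\<eta> / (2 * K2 + 1))"
 have h: "0 < h" "h <= 1" using eta K2 by (auto simp: h_def)
 have "h <= \<eta> / (2 * K2 + 1)" by (simp add: h_def)
 hence h3: "h * (2 * K2 + 1) <= \<eta>" using K2 by (simp add: pos_le_divide_eq)
 have far: "\<bar>Bh n (of_real h) - Bh n 0\<bar> >= h * \<eta> / 2" for n
 proof -
  have ch': "cmod (of_real h) <= R n" "cmod 0 <= R n" "cmod (of_real h) < 2 * R n" "cmod 0 < 2 * R n" using h R2[of n] by auto
  have "\<not> \<bar>f' n 0 \<bullet> g (f n 0)\<bar> <= \<eta> * y n" using neg by blast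
  hence bn: "\<bar>f' n 0 \<bullet> g (f n 0) / y n\<bar> > \<eta>" using y(1)[of n] by (simp add: abs_divide pos_less_divide_eq)
  have "of_real h *s v = h *R v" for v :: "complex ^ 'm" by (simp add: vec_eq_iff scaleR_complex)
  hence "c n 0 (of_real h - 0) = h * (f' n 0 \<bullet> g (f n 0) / y n)" by (simp add: c_def)
  hence "\<bar>B n (of_real h) - B n 0 - h * (f' n 0 \<bullet> g (f n 0) / y n)\<bar> <= K2 * h\<^sup>2" using Q[OF ch'(3,4)] h by simp
  moreover have "h * \<eta> <= \<bar>h * (f' n 0 \<bullet> g (f n 0) / y n)\<bar>" 
   unfolding abs_mult[of h] abs_of_pos[OF h(1)] by (rule mult_left_mono[OF less_imp_le[OF bn] less_imp_le[OF h(1)]])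
  moreover have "K2 * h\<^sup>2 <= h * \<eta> / 2"
  proof -
   have "h * (h * (2 * K2)) <= h * \<eta>" using h h3 by (intro mult_left_mono) (auto simp: algebra_simps)
   thus ?thesis by (simp add: power2_eq_square mult_ac)
  qed
  ultimately have "\<bar>B n (of_real h) - B n 0\<bar> >= h * \<eta> / 2" by linarith
  thus ?thesis using Bh_eq[OF ch'(1)] Bh_eq[OF ch'(2)] by simp
 qed
 have "(%n. Bh (s n) (of_real h)) ----> B0 (of_real h)" "(%n. Bh (s n) 0) ----> B0 0"
  by (rule uniform_limit_imp_tendsto_at[OF ul[of 1]]; use h in simp)+
 from tendsto_rabs[OF tendsto_diff[OF this]] have "(%n. \<bar>Bh (s n) (of_real h) - Bh (s n) 0\<bar>) ----> \<bar>B0 (of_real h) - B0 0\<bar>" .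
 hence "h * \<eta> / 2 <= \<bar>B0 (of_real h) - B0 0\<bar>" by (rule LIMSEQ_le_const) (use far in blast)
 hence "h * \<eta> <= 0" using const[of h] by simp
 thus False using mult_pos_pos[OF h(1) eta] by linarith
qed

context taut_dom begin

text \<open>Since psi is tangential, r along phi + y psi is O(y^2). If the estimate failed, a sequence of violations would contradict the blow-up.\<close>
lemma second_order_flatness:
 assumes a: "a : bdry" and ch: "chart D a d r g L" and Nr: "!!x. x : bdry ==> dist x a < d ==> N x = - (g x /\<^sub>R norm (g x))"
  and r0: "r0 > 0" and C: "C >= 0" and eta: "\<eta> > 0"
 shows "EX y0>0. ALL phi:bdiscs. dist (phi 0) a < d / 8 --> (ALL psi y. (ALL i. hol psi i (ball 0 r0)) -->
  (ALL z:ball 0 r0. norm (psi z) <= C & psi z \<bullet> N (phi z) = 0) --> 0 < y --> y < y0 -->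
  \<bar>(vder phi + y *R vder psi) \<bullet> g (phi 0 + y *R psi 0)\<bar> <= \<eta> * y)"
proof -
 have d: "d > 0" and L: "L >= 0" using chartD(1,2)[OF ch] by auto
 obtain Bd where Bd: "Bd > 0" "!!x. x : closure D ==> norm x <= Bd"
  using bounded_closure[OF bdd] bounded_pos by metis
 define rho1 where "rho1 = min r0 1 / 2"
 have rho1: "rho1 > 0" "2 * rho1 <= r0" "2 * rho1 <= 1" using r0 by (auto simp: rho1_def)
 obtain K where K: "K >= 0" and Kf: "ALL f :: complex => complex ^ 'm. (ALL i. hol f i (ball 0 (2 * rho1))) --> (ALL z:ball 0 (2 * rho1). norm (f z) <= Bd + C) -->
  (EX f'. f' 0 = vder f & (ALL z:ball 0 rho1. norm (f' z) <= K) & (ALL z:ball 0 rho1. ALL w:ball 0 rho1. norm (f z - f w - (z - w) *s f' w) <= K * (cmod (z - w))\<^sup>2))"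
  using holomorphic_quadratic_bound[OF rho1(1) add_nonneg_nonneg[OF less_imp_le[OF Bd(1)] C], where 'm = 'm] by blast
 define rho where "rho = Min {rho1, 1, d / (16 * K + 1)}"
 have rho: "rho > 0" "rho <= rho1" "rho <= 1" "rho <= d / (16 * K + 1)"
  subgoal using rho1(1) d K by (simp add: rho_def)
  unfolding rho_def by (intro Min_le; simp)+
 have "rho * (16 * K + 1) <= d" using rho(4) K by (simp add: pos_le_divide_eq)
 hence rhoK: "2 * K * rho < d / 8" using rho(1) by (simp add: algebra_simps)
 define bad where "bad y phi psi \<longleftrightarrow> phi : bdiscs & dist (phi 0) a < d / 8 & (ALL i. hol psi i (ball 0 r0)) &
  (ALL z:ball 0 r0. norm (psi z) <= C & psi z \<bullet> N (phi z) = 0) & \<not> \<bar>(vder phi + y *R vder psi) \<bullet> g (phi 0 + y *R psi 0)\<bar> <= \<eta> * y" for y :: real and phi psi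
 show ?thesis
 proof (rule ccontr)
  assume neg: "\<not> ?thesis"
  define b where "b n = min (rho / 4) (min (d / (8 * (C + 1))) (1 / (real n + 1)))" for n
  have b: "b n > 0" for n using rho(1) d C by (simp add: b_def)
  have "EX p. 0 < fst p & fst p < b n & bad (fst p) (fst (snd p)) (snd (snd p))" for n
  proof (rule ccontr)
   assume "\<not> ?thesis"
   hence "\<not> (0 < y & y < b n & bad y phi psi)" for y phi psi by auto
   thus False using neg b[of n] unfolding bad_def by blast
  qed
  then obtain P where P: "!!n. 0 < fst (P n) & fst (P n) < b n & bad (fst (P n)) (fst (snd (P n))) (snd (snd (P n)))"
   by metis
  define y where "y n = fst (P n)" for n
  define phi where "phi n = fst (snd (P n))" for n
  define psi where "psi n = snd (snd (P n))" for n
  have y: "0 < y n" "y n < b n" and bad: "bad (y n) (phi n) (psi n)" for n using P[of n] by (auto simp: y_def phi_def psi_def)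
  have yb: "y n < rho / 4" "y n < d / (8 * (C + 1))" "y n < 1 / (real n + 1)" for n using y(2)[of n] by (auto simp: b_def)
  have yC: "y n * (C + 1) < d / 8" for n
  proof -
   have "y n * (8 * (C + 1)) < d" using yb(2)[of n] C by (simp add: pos_less_divide_eq)
   thus ?thesis by (simp add: algebra_simps)
  qed
  have phi: "phi n : bdiscs" "dist (phi n 0) a < d / 8" and psi: "hol (psi n) i (ball 0 r0)"
   "z : ball 0 r0 ==> norm (psi n z) <= C" "z : ball 0 r0 ==> psi n z \<bullet> N (phi n z) = 0"
   and viol: "\<not> \<bar>(vder (phi n) + y n *R vder (psi n)) \<bullet> g (phi n 0 + y n *R psi n 0)\<bar> <= \<eta> * y n" for n i z
   using bad[of n] unfolding bad_def by blast+
  have sub: "ball (0::complex) (2 * rho1) <= unit_disc" "ball (0::complex) (2 * rho1) <= ball 0 r0" "ball (0::complex) rho <= ball 0 rho1" "ball (0::complex) rho <= ball 0 (2 * rho1)"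
   using rho1 rho by (auto intro!: subset_ball)
  have pb: "norm (phi n z) <= Bd" if "z : ball 0 (2 * rho1)" for n z
   using cl_discsD(2)[OF bdiscsD(1)[OF phi(1)]] Bd(2) that sub(1) by blast
  have ph: "hol (phi n) i (ball 0 (2 * rho1))" for n i using holomorphic_on_subset[OF bdiscsD(3)[OF phi(1)] sub(1)] .
  have psh: "hol (psi n) i (ball 0 (2 * rho1))" for n i using holomorphic_on_subset[OF psi(1) sub(2)] .
  have cone: "y n <= 1" for n using yb(1)[of n] rho(3) by simp
  define f where "f n z = phi n z + y n *R (psi n z + 0)" for n z
  have fh: "hol (f n) i (ball 0 (2 * rho1))" for n i
   unfolding f_def by (auto simp: scaleR_complex intro!: holomorphic_intros ph psh)
  have fb: "norm (f n z) <= Bd + C" if z: "z : ball 0 (2 * rho1)" for n z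
  proof -
   have "norm (f n z) <= norm (phi n z) + y n * norm (psi n z)" using norm_triangle_ineq[of "phi n z" "y n *R psi n z"] y(1)[of n] by (simp add: f_def)
   also have "... <= Bd + 1 * C" using pb[OF z] psi(2)[of z n] z sub(2) cone[of n] y(1)[of n] C by (intro add_mono mult_mono) auto
   finally show ?thesis by simp
  qed
  have "ALL n. EX f'. f' 0 = vder (f n) & (ALL z:ball 0 rho1. norm (f' z) <= K) & (ALL z:ball 0 rho1. ALL w:ball 0 rho1. norm (f n z - f n w - (z - w) *s f' w) <= K * (cmod (z - w))\<^sup>2)"
  proof
   fix n
   from spec[OF Kf, of "f n"] fh fb show "EX f'. f' 0 = vder (f n) & (ALL z:ball 0 rho1. norm (f' z) <= K) & (ALL z:ball 0 rho1. ALL w:ball 0 rho1. norm (f n z - f n w - (z - w) *s f' w) <= K * (cmod (z - w))\<^sup>2)"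
    by blast
  qed
  from choice[OF this] obtain f' where f': "!!n. f' n 0 = vder (f n)" "!!n z. z : ball 0 rho1 ==> norm (f' n z) <= K"
   "!!n z w. z : ball 0 rho1 ==> w : ball 0 rho1 ==> norm (f n z - f n w - (z - w) *s f' n w) <= K * (cmod (z - w))\<^sup>2" by blast
  have lipf: "norm (f n z - f n 0) < d / 8" if z: "z : ball 0 rho" for n z
  proof -
   have z0: "0 : ball 0 rho1" "z : ball 0 rho1" using rho1(1) z sub(3) by auto
   have cz: "cmod z <= rho" "(cmod z)\<^sup>2 <= rho"
   proof -
    show "cmod z <= rho" using z by simp
    hence "cmod z * cmod z <= rho * 1" using rho by (intro mult_mono) auto
    thus "(cmod z)\<^sup>2 <= rho" by (simp add: power2_eq_square)
   qed
   have "norm (f n z - f n 0) <= norm (f n z - f n 0 - (z - 0) *s f' n 0) + norm ((z - 0) *s f' n 0)"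
    using norm_triangle_ineq[of "f n z - f n 0 - (z - 0) *s f' n 0" "(z - 0) *s f' n 0"] by simp
   also have "... <= K * (cmod (z - 0))\<^sup>2 + cmod z * K"
    unfolding norm_smult using f'(3)[OF z0(2,1), of n] f'(2)[OF z0(1), of n] by (intro add_mono) (auto intro: mult_left_mono)
   also have "... <= K * rho + rho * K" using cz K by (intro add_mono mult_left_mono mult_right_mono) auto
   also have "... < d / 8" using rhoK by (simp add: algebra_simps)
   finally show ?thesis .
  qed
  have yp: "norm (y n *R psi n z) < d / 8" if "z : ball 0 (2 * rho1)" for n z
  proof -
   have "norm (psi n z) <= C + 1" using psi(2)[of z n] that sub(2) by force
   hence "norm (y n *R psi n z) <= y n * (C + 1)" using y(1)[of n] by (simp add: mult_left_mono)
   thus ?thesis using yC[of n] by linarith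
  qed
  have tri1: "dist (x + u) b <= norm (x + u - (x' + u')) + norm u' + dist x' b" for x u x' u' b :: "complex ^ 'm" by norm
  have tri2: "dist x b <= dist (x + u) b + norm u" for x u b :: "complex ^ 'm" by norm
  have f_in: "f n z : ball a (d / 2)" "phi n z : ball a d" if z: "z : ball 0 rho" for n z
  proof -
   have z0: "0 : ball 0 (2 * rho1)" "z : ball 0 (2 * rho1)" using rho1(1) z sub(4) by auto
   have "dist (f n z) a <= norm (f n z - f n 0) + norm (y n *R psi n 0) + dist (phi n 0) a"
    unfolding f_def add_0_right by (rule tri1)
   hence 1: "dist (f n z) a < 3 * d / 8" using lipf[OF z, of n] yp[OF z0(1), of n] phi(2)[of n] by simp
   thus "f n z : ball a (d / 2)" using d by (simp add: dist_commute)
   have "dist (phi n z) a <= dist (f n z) a + norm (y n *R psi n z)" unfolding f_def add_0_right by (rule tri2)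
   thus "phi n z : ball a d" using 1 yp[OF z0(2), of n] d by (simp add: dist_commute)
  qed
  have rb: "\<bar>r (f n z)\<bar> <= L * C\<^sup>2 * (y n)\<^sup>2" if z: "z : ball 0 rho" for n z
  proof -
   have zu: "z : unit_disc" "z : ball 0 r0" using z sub(1,2,4) by blast+
   have fr: "phi n z : bdry" by (rule bdiscsD(2)[OF phi(1) zu(1)])
   have b1: "phi n z : ball a d" by (rule f_in(2)[OF z])
   have r0': "r (phi n z) = 0" using chart_frontier[OF ch open_D b1] fr by blast
   have "dist (phi n z) a < d" using b1 by (simp add: dist_commute)
   from Nr[OF fr this] have "psi n z \<bullet> g (phi n z) = 0" using psi(3)[OF zu(2), of n] chartD(5)[OF ch b1] by simp
   moreover have "\<bar>r (f n z) - r (phi n z) - (f n z - phi n z) \<bullet> g (phi n z)\<bar> <= L * (norm (f n z - phi n z))\<^sup>2"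
    by (rule chart_taylor[OF ch b1]) (use f_in(1)[OF z, of n] d in simp)
   ultimately have "\<bar>r (f n z)\<bar> <= L * (y n * norm (psi n z))\<^sup>2" using r0' y(1)[of n] by (simp add: f_def)
   also have "... <= L * (y n * C)\<^sup>2" using psi(2)[OF zu(2), of n] y(1)[of n] by (intro mult_left_mono power_mono L) auto
   finally show ?thesis by (simp add: power_mult_distrib mult_ac)
  qed
  have "EX n. \<bar>f' n 0 \<bullet> g (f n 0)\<bar> <= \<eta> * y n"
  proof (rule blow_up_gradient[OF open_D taut ch y(1)])
   show "y ----> 0"
   proof (rule real_tendsto_sandwich[of "%_. 0" y sequentially "%n. 1 / (real n + 1)"])
    show "(%n. 1 / (real n + 1)) ----> 0" by real_asymp
    show "EVS n. 0 <= y n" "EVS n. y n <= 1 / (real n + 1)"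
     using y(1) yb(3) by (auto intro!: always_eventually simp: less_imp_le)
   qed simp
   show "4 * y n <= rho" for n using yb(1)[of n] by simp
   show "hol (f n) i (ball 0 rho)" for n i using holomorphic_on_subset[OF fh sub(4)] .
   show "f n z : ball a (d / 2)" if "z : ball 0 rho" for n z using f_in(1)[OF that] .
   show "\<bar>r (f n z)\<bar> <= L * C\<^sup>2 * (y n)\<^sup>2" if "z : ball 0 rho" for n z using rb[OF that] .
   show "norm (f' n z) <= K" if "z : ball 0 rho" for n z using f'(2) sub(3) that by blast
   show "norm (f n z - f n w - (z - w) *s f' n w) <= K * (cmod (z - w))\<^sup>2" if "z : ball 0 rho" "w : ball 0 rho" for n z w
    using f'(3) sub(3) that by blast
  qed (use L K eta in auto)
  then obtain n where n: "\<bar>f' n 0 \<bullet> g (f n 0)\<bar> <= \<eta> * y n" by blast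
  have "vder (f n) = vder (phi n) + y n *R vder (psi n)"
   unfolding f_def by (rule vder_affine[OF ph psh open_ball]) (use rho1 in simp)
  thus False using n viol[of n] unfolding f'(1) f_def by simp
 qed
qed

end

section \<open>Transport along the boundary without loss of phase\<close>

lemma herm_diff_left: "herm (v - v') w = herm v w - herm v' w"
 by (simp add: herm_def algebra_simps sum_subtractf)

text \<open>Cauchy-Schwarz, from the real inner product after a rotation.\<close>
lemma herm_norm_le: "cmod (herm v w) <= norm v * norm w"
proof (cases "herm v w = 0")
 case False
 define c where "c = cnj (herm v w) / of_real (cmod (herm v w))"
 have c1: "cmod c = 1" using False by (simp add: c_def norm_divide)
 have "c * herm v w = of_real (cmod (herm v w))"
  using False by (simp add: c_def complex_norm_square[symmetric] power2_eq_square mult.commute)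
 hence "v \<bullet> (c *s w) = cmod (herm v w)" by (simp flip: Re_herm add: herm_smult_right)
 thus ?thesis using norm_cauchy_schwarz[of v "c *s w"] c1 by (simp add: norm_smult)
qed simp

lemma vder_smult:
 assumes "!!i. hol f i S" "open S" "0 : S"
 shows "vder (%z. c *s f z) = c *s vder f"
proof -
 have "((%z. (c *s f z) $ i) has_field_derivative (c *s vder f) $ i) (at 0)" for i
  unfolding smult_nth by (rule DERIV_cmult[OF vder_component[OF assms]])
 thus ?thesis by (simp add: vec_eq_iff vder_def[of "%z. c *s f z"] DERIV_imp_deriv)
qed

lemma vder_bound:
 assumes "r > 0" "0 <= B"
 shows "EX V>=0. ALL f :: complex => complex ^ 'm. (ALL i. hol f i (ball 0 r)) --> (ALL z:ball 0 r. norm (f z) <= B) --> norm (vder f) <= V"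
proof -
 have r2: "r / 2 > 0" and rr: "2 * (r / 2) = r" using assms by auto
 obtain V where V: "V >= 0" "ALL f :: complex => complex ^ 'm. (ALL i. hol f i (ball 0 r)) --> (ALL z:ball 0 r. norm (f z) <= B) -->
  (EX f'. f' 0 = vder f & (ALL z:ball 0 (r / 2). norm (f' z) <= V) & (ALL z:ball 0 (r / 2). ALL w:ball 0 (r / 2). norm (f z - f w - (z - w) *s f' w) <= V * (cmod (z - w))\<^sup>2))"
  using holomorphic_quadratic_bound[OF r2 assms(2), where 'm = 'm] unfolding rr by blast
 have "norm (vder f) <= V" if h: "ALL i. hol f i (ball 0 r)" "ALL z:ball 0 r. norm (f z) <= B" for f :: "complex => complex ^ 'm"
 proof -
  from mp[OF mp[OF spec[OF V(2), of f] h(1)] h(2)] obtain f' where f': "f' 0 = vder f & (ALL z:ball 0 (r / 2). norm (f' z) <= V) &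
   (ALL z:ball 0 (r / 2). ALL w:ball 0 (r / 2). norm (f z - f w - (z - w) *s f' w) <= V * (cmod (z - w))\<^sup>2)" by (rule exE)
  have "f' 0 = vder f" "ALL z:ball 0 (r / 2). norm (f' z) <= V" using f' by blast+
  moreover have "(0::complex) : ball 0 (r / 2)" using r2 by simp
  ultimately show ?thesis by metis
 qed
 thus ?thesis using V(1) by blast
qed

text \<open>Harnack, from the Schwarz lemma for the Cayley transform of F.\<close>
lemma harnack_Re_pos:
 fixes F :: "complex => complex"
 assumes F: "F holomorphic_on ball 0 R" and pos: "!!z. z : ball 0 R ==> Re (F z) > 0" and R: "R > 0"
  and th: "0 <= \<theta>" "\<theta> < 1" and z: "cmod z <= \<theta> * R"
 shows "(1 - \<theta>) / 2 * cmod (F 0) <= cmod (F z)" "(1 - \<theta>) / 2 * cmod (F z) <= cmod (F 0)"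
proof -
 define G where "G w = F (of_real R * w)" for w
 have im: "of_real R * w : ball 0 R" if "w : ball 0 1" for w :: complex using that R by (simp add: norm_mult)
 have G: "G holomorphic_on ball 0 1" unfolding G_def
  by (rule holomorphic_on_compose_gen[OF _ F, of "%w. of_real R * w", unfolded o_def]) (use im in \<open>auto intro!: holomorphic_intros\<close>)
 have Gp: "Re (G w) > 0" if "w : ball 0 1" for w using pos[OF im[OF that]] by (simp add: G_def)
 have G0: "Re (G 0) > 0" by (rule Gp) simp
 define h where "h w = (G w - G 0) / (G w + cnj (G 0))" for w
 have den: "G w + cnj (G 0) ~= 0" if "w : ball 0 1" for w
 proof
  assume "G w + cnj (G 0) = 0"
  hence "Re (G w + cnj (G 0)) = 0" by simp
  thus False using Gp[OF that] G0 by simp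
 qed
 have "h holomorphic_on ball 0 1" unfolding h_def using den by (intro holomorphic_intros G) auto
 moreover have "cmod (h w) < 1" if "cmod w < 1" for w
 proof -
  have w: "w : ball 0 1" using that by simp
  have "(cmod (G w - G 0))\<^sup>2 < (cmod (G w + cnj (G 0)))\<^sup>2"
   using mult_pos_pos[OF Gp[OF w] G0] unfolding cmod_power2 by (simp add: power2_eq_square algebra_simps)
  hence "cmod (G w - G 0) < cmod (G w + cnj (G 0))" using power_less_imp_less_base norm_ge_zero by blast
  thus ?thesis using den[OF w] by (simp add: h_def norm_divide)
 qed
 moreover define w where "w = z / of_real R"
 have w1: "cmod w <= \<theta>" using z R by (simp add: w_def norm_divide pos_divide_le_eq)
 hence w: "cmod w <= \<theta>" "cmod w < 1" using th by auto
 ultimately have "cmod (h w) <= cmod w" using Schwarz_Lemma(1)[of h w] by (simp add: h_def)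
 hence hw: "cmod (h w) <= \<theta>" using w by simp
 have wb: "w : ball 0 1" using w by simp
 have Gw: "G w = F z" "G 0 = F 0" using R by (simp_all add: G_def w_def)
 have diff: "F z - F 0 = h w * (F z + cnj (F 0))" using den[OF wb] Gw by (simp add: h_def)
 have "cmod (F z - F 0) <= \<theta> * (cmod (F z) + cmod (F 0))"
  unfolding diff norm_mult using hw norm_triangle_ineq[of "F z" "cnj (F 0)"] th by (intro mult_mono) auto
 moreover have "cmod (F z) - cmod (F 0) <= cmod (F z - F 0)" "cmod (F 0) - cmod (F z) <= cmod (F z - F 0)"
  using norm_triangle_ineq2[of "F z" "F 0"] norm_triangle_ineq2[of "F 0" "F z"] by (auto simp: norm_minus_commute)
 moreover have "\<theta> * cmod (F 0) <= cmod (F 0)" "\<theta> * cmod (F z) <= cmod (F z)" using th by (auto simp: mult_left_le_one_le)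
 ultimately show "(1 - \<theta>) / 2 * cmod (F 0) <= cmod (F z)" "(1 - \<theta>) / 2 * cmod (F z) <= cmod (F 0)"
  unfolding distrib_left by (auto simp: field_simps)
qed

context taut_dom begin

lemma frontier_compact: "compact (bdry)"
 using bdd by (simp add: compact_frontier_bounded)

text \<open>The fields \<Psi> u of lift_field, with bounds that are uniform over boundary discs near a point. The factor k measures how the normal component grows along phi.\<close>
definition controlled_lift :: "real => real => (complex => complex ^ 'm) => (complex ^ 'm => complex => complex ^ 'm) => (complex => real) => bool" where
 "controlled_lift r C phi \<Psi> k \<longleftrightarrow> (ALL u i. hol (\<Psi> u) i (ball 0 r)) & (ALL u. \<Psi> u 0 = u) &
   (ALL u. ALL z:ball 0 r. norm (\<Psi> u z) <= C * norm u) & (ALL c u z. \<Psi> (c *s u) z = c *s \<Psi> u z) &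
   (ALL z:ball 0 r. 1 / C <= k z & (ALL u. herm (N (phi z)) (\<Psi> u z) = of_real (k z) * herm (N (phi 0)) u))"

lemma controlled_liftD:
 assumes "controlled_lift r C phi \<Psi> k"
 shows "hol (\<Psi> u) i (ball 0 r)" "\<Psi> u 0 = u" "z : ball 0 r ==> norm (\<Psi> u z) <= C * norm u"
  "\<Psi> (c *s u) z = c *s \<Psi> u z" "z : ball 0 r ==> 1 / C <= k z"
  "z : ball 0 r ==> herm (N (phi z)) (\<Psi> u z) = of_real (k z) * herm (N (phi 0)) u"
 using assms unfolding controlled_lift_def by blast+

lemma controlled_lift_mono:
 assumes "controlled_lift r C phi \<Psi> k" "0 < C" "C <= C'"
 shows "controlled_lift r C' phi \<Psi> k"
 unfolding controlled_lift_def
proof (intro conjI allI ballI)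
 note g = controlled_liftD[OF assms(1)]
 show "hol (\<Psi> u) i (ball 0 r)" "\<Psi> u 0 = u" "\<Psi> (c *s u) z = c *s \<Psi> u z" for u i c z by (rule g)+
 fix z :: complex assume z: "z : ball 0 r"
 show "norm (\<Psi> u z) <= C' * norm u" for u
  using g(3)[OF z, of u] mult_right_mono[OF assms(3) norm_ge_zero[of u]] by linarith
 have "1 / C' <= 1 / C" using assms(2,3) by (simp add: frac_le)
 thus "1 / C' <= k z" using g(5)[OF z] by linarith
 show "herm (N (phi z)) (\<Psi> u z) = of_real (k z) * herm (N (phi 0)) u" for u by (rule g(6)[OF z])
qed

text \<open>A field transversal along one disc is transversal along nearby ones. The normal components of psi give a holomorphic function with positive real part, and Harnack bounds the variation of the conormal along the disc.\<close>
lemma controlled_lift_nearby: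
 assumes phi: "phi : bdiscs" and r: "0 < r" "r < r1" "r1 < 1" and psi: "!!i. hol psi i (ball 0 r1)"
  and c: "c > 0" "!!z. z : ball 0 r1 ==> c <= Re (herm (N (phi z)) (psi z))" and S: "!!z. z : ball 0 r1 ==> norm (psi z) <= S"
 shows "EX \<Psi> k. controlled_lift r (max (1 + 1 / c * (1 + 2 / (1 - r / r1)) * S) (2 / (1 - r / r1) * S / c)) phi \<Psi> k"
proof -
 have r1: "0 < r1" using r by linarith
 obtain M psi' where M: "conormal_lift (ball 0 r1) (%z. N (phi z)) M" by (rule bdisc_transversal[OF phi r1 r(3)]) (rule that)
 have Mhol: "hol M i (ball 0 r1)" for i using M unfolding conormal_lift_def by blast
 have "ALL z:ball 0 r1. EX k::real. k > 0 & (ALL i. M z $ i = of_real k * cnj (N (phi z) $ i))" using M unfolding conormal_lift_def by blast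
 from bchoice[OF this] obtain kap :: "complex => real" where kap: "!!z. z : ball 0 r1 ==> kap z > 0"
  "!!z. z : ball 0 r1 ==> ALL i. M z $ i = of_real (kap z) * cnj (N (phi z) $ i)" by blast
 have bilM: "bil (M z) w = of_real (kap z) * herm (N (phi z)) w" if "z : ball 0 r1" for z w by (rule bil_conormal[OF kap(2)[OF that]])
 define F where "F z = bil (M z) (psi z)" for z
 have Fhol: "F holomorphic_on ball 0 r1" unfolding F_def by (intro holomorphic_on_bil Mhol psi)
 have Fre: "Re (F z) > 0" if z: "z : ball 0 r1" for z
  unfolding F_def bilM[OF z] using kap(1)[OF z] c(1) c(2)[OF z] by simp
 have Fn: "cmod (F z) = kap z * cmod (herm (N (phi z)) (psi z))" if z: "z : ball 0 r1" for z
  unfolding F_def bilM[OF z] using kap(1)[OF z] by (simp add: norm_mult)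
 have N1: "norm (N (phi z)) = 1" if "z : ball 0 r1" for z
 proof -
  have "z : unit_disc" using that r by simp
  thus ?thesis by (intro inward_norm bdiscsD(2)[OF phi])
 qed
 have hlow: "c <= cmod (herm (N (phi z)) (psi z))" if "z : ball 0 r1" for z
  using c(2)[OF that] complex_Re_le_cmod[of "herm (N (phi z)) (psi z)"] by linarith
 have hup: "cmod (herm (N (phi z)) (psi z)) <= S" if "z : ball 0 r1" for z
  using herm_norm_le[of "N (phi z)" "psi z"] S[OF that] N1[OF that] by simp
 have zero: "0 : ball (0::complex) r1" using r1 by simp
 have Sc: "c <= S" using hlow[OF zero] hup[OF zero] by linarith
 define \<theta> where "\<theta> = r / r1"
 have th: "0 <= \<theta>" "\<theta> < 1" using r r1 by (auto simp: \<theta>_def)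
 have sub: "z : ball 0 r1" "cmod z <= \<theta> * r1" if "z : ball 0 r" for z using that r r1 by (auto simp: \<theta>_def)
 define H where "H = 2 / (1 - \<theta>)"
 have H: "H > 0" using th by (simp add: H_def)
 have har: "cmod (F 0) <= H * cmod (F z)" "cmod (F z) <= H * cmod (F 0)" if z: "z : ball 0 r" for z
  using harnack_Re_pos[OF Fhol Fre r1 th sub(2)[OF z]] th by (auto simp: H_def field_simps)
 have F0: "F z ~= 0" if "z : ball 0 r1" for z using Fre[OF that] by auto
 define C where "C = max (1 + 1 / c * (1 + H) * S) (H * S / c)"
 have C0: "C > 0" using c Sc H by (auto simp: C_def less_max_iff_disj)
 define \<Psi> where "\<Psi> = lift_field M (%z. (1 / F z) *s psi z)"
 define k where "k z = kap 0 / kap z" for z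
 have "controlled_lift r C phi \<Psi> k"
  unfolding controlled_lift_def
 proof (intro conjI allI ballI)
  fix u i
  have "hol (\<Psi> u) i (ball 0 r1)" unfolding \<Psi>_def
   by (rule lift_field_props(3)[OF Mhol]) (use F0 in \<open>auto intro!: holomorphic_intros Fhol psi\<close>)
  thus "hol (\<Psi> u) i (ball 0 r)" by (rule holomorphic_on_subset) (use sub(1) in blast)
  show "\<Psi> u 0 = u" unfolding \<Psi>_def by (rule lift_field_props(1))
 next
  fix u and z :: complex assume z: "z : ball 0 r"
  note z1 = sub(1)[OF z]
  have h1: "cmod (bil (M x) u / F x) <= norm u / c" if x: "x : ball 0 r1" for x
  proof -
   have "cmod (bil (M x) u / F x) = cmod (herm (N (phi x)) u) / cmod (herm (N (phi x)) (psi x))"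
    unfolding norm_divide Fn[OF x] bilM[OF x] norm_mult using kap(1)[OF x] by simp
   also have "... <= norm u / c" using herm_norm_le[of "N (phi x)" u] N1[OF x] hlow[OF x] c(1) by (intro frac_le) auto
   finally show ?thesis .
  qed
  have "bil (M 0) u / F z = bil (M 0) u / F 0 * (F 0 / F z)" using F0[OF zero] by simp
  hence "cmod (bil (M 0) u / F z) = cmod (bil (M 0) u / F 0) * cmod (F 0 / F z)" by (simp only: norm_mult[symmetric])
  also have "... <= norm u / c * H"
  proof (intro mult_mono h1 zero)
   show "cmod (F 0 / F z) <= H" using har(1)[OF z] F0[OF z1] by (simp add: norm_divide pos_divide_le_eq)
  qed (use c in auto)
  finally have h2: "cmod (bil (M 0) u / F z) <= norm u / c * H" .
  have eq: "\<Psi> u z = u - (bil (M z) u / F z - bil (M 0) u / F z) *s psi z"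
   unfolding \<Psi>_def lift_field_def by (simp add: vec_eq_iff diff_divide_distrib)
  have "norm (\<Psi> u z) <= norm u + cmod (bil (M z) u / F z - bil (M 0) u / F z) * norm (psi z)"
   unfolding eq norm_smult[symmetric] by (rule norm_triangle_ineq4)
  also have "... <= norm u + (norm u / c + norm u / c * H) * S"
  proof (intro add_left_mono mult_mono S z1)
   show "cmod (bil (M z) u / F z - bil (M 0) u / F z) <= norm u / c + norm u / c * H"
    using norm_triangle_ineq4[of "bil (M z) u / F z" "bil (M 0) u / F z"] h1[OF z1] h2 by linarith
  qed (use c H in auto)
  also have "... = (1 + 1 / c * (1 + H) * S) * norm u" using c by (simp add: field_simps)
  also have "... <= C * norm u" by (intro mult_right_mono) (auto simp: C_def)
  finally show "norm (\<Psi> u z) <= C * norm u" .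
 next
  fix c u and z :: complex
  show "\<Psi> (c *s u) z = c *s \<Psi> u z"
   unfolding \<Psi>_def lift_field_def bil_simps by (simp add: vec_eq_iff algebra_simps)
 next
  fix z :: complex assume z: "z : ball 0 r"
  note z1 = sub(1)[OF z]
  have "kap z * c <= cmod (F z)" unfolding Fn[OF z1] using hlow[OF z1] kap(1)[OF z1] by simp
  also have "... <= H * (kap 0 * S)"
  proof -
   have "H * (kap 0 * cmod (herm (N (phi 0)) (psi 0))) <= H * (kap 0 * S)"
    by (intro mult_left_mono hup zero) (use H kap(1)[OF zero] in auto)
   thus ?thesis using har(2)[OF z] unfolding Fn[OF zero] by linarith
  qed
  finally have "1 / (H * S / c) <= k z" using c Sc H kap(1)[OF z1] kap(1)[OF zero] by (simp add: k_def field_simps)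
  moreover have "1 / C <= 1 / (H * S / c)" using c Sc H by (intro frac_le) (auto simp: C_def)
  ultimately show "1 / C <= k z" by linarith
 next
  fix z :: complex and u assume z: "z : ball 0 r"
  note z1 = sub(1)[OF z]
  have "bil (M z) ((1 / F z) *s psi z) = 1" unfolding bil_simps F_def[symmetric] using F0[OF z1] by simp
  from lift_field_props(2)[of M z "%z. (1 / F z) *s psi z" u, OF this]
  have "of_real (kap z) * herm (N (phi z)) (\<Psi> u z) = of_real (kap 0) * herm (N (phi 0)) u"
   unfolding \<Psi>_def bilM[OF z1] bilM[OF zero] .
  thus "herm (N (phi z)) (\<Psi> u z) = of_real (k z) * herm (N (phi 0)) u"
   using kap(1)[OF z1] by (simp add: k_def field_simps)
 qed
 thus ?thesis unfolding C_def H_def \<theta>_def by blast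
qed

text \<open>By contradiction: a sequence without uniform bounds converges to a boundary disc, whose transversal field provides them.\<close>
lemma boundary_lift:
 assumes a: "a : bdry" and r: "0 < r" "r < 1"
 obtains d C where "d > 0" "C > 0" "!!phi. phi : bdiscs ==> dist (phi 0) a < d ==> EX \<Psi> k. controlled_lift r C phi \<Psi> k"
proof -
 have "EX d>0. EX C>0. ALL phi. phi : bdiscs --> dist (phi 0) a < d --> (EX \<Psi> k. controlled_lift r C phi \<Psi> k)"
 proof (rule ccontr)
  assume neg: "\<not> ?thesis"
  have "EX phi. phi : bdiscs & dist (phi 0) a < 1 / (real n + 1) & (ALL \<Psi> k. \<not> controlled_lift r (real n + 1) phi \<Psi> k)" (is "EX phi. ?Q n phi") for n
  proof (rule ccontr)
   assume h: "\<not> ?thesis"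
   have "EX d>0. EX C>0. ALL phi. phi : bdiscs --> dist (phi 0) a < d --> (EX \<Psi> k. controlled_lift r C phi \<Psi> k)"
    by (intro exI[of _ "1 / (real n + 1)"] conjI exI[of _ "real n + 1"]) (use h in auto)
   thus False using neg by blast
  qed
  hence "ALL n. EX phi. ?Q n phi" by blast
  from choice[OF this] obtain f where f0: "ALL n. ?Q n (f n)" by blast
  have f: "f n : bdiscs" "dist (f n 0) a < 1 / (real n + 1)" "\<not> controlled_lift r (real n + 1) (f n) \<Psi> k" for n \<Psi> k
   using conjunct1[OF spec[OF f0, of n]] conjunct1[OF conjunct2[OF spec[OF f0, of n]]]
    spec[OF spec[OF conjunct2[OF conjunct2[OF spec[OF f0, of n]]], of \<Psi>], of k] by this
  obtain phi j where phi: "phi : cl_discs D" and j: "strict_mono (j :: nat => nat)" and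
   ul: "!!K. compact K ==> K <= unit_disc ==> uniform_limit K (%n. f (j n)) phi sequentially"
   by (rule cl_discs_compact[of f, OF bdiscsD(1)[OF f(1)]]) (rule that)
  have inv0: "(%n. 1 / (real n + 1)) ----> 0" by real_asymp
  have invj: "(%n. 1 / (real (j n) + 1)) ----> 0" using LIMSEQ_subseq_LIMSEQ[OF inv0 j] by (simp add: o_def)
  have "(%n. f (j n) 0) ----> phi 0" using uniform_limit_imp_tendsto_at[OF ul[of "{0}"], of 0] by simp
  moreover have "(%n. f (j n) 0) ----> a"
  proof (rule metric_tendsto_imp_tendsto[OF invj])
   show "EVS n. dist (f (j n) 0) a <= dist (1 / (real (j n) + 1)) 0"
    using f(2) by (intro always_eventually) (simp add: less_imp_le)
  qed
  ultimately have phi0: "phi 0 = a" by (rule LIMSEQ_unique)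
  hence phib: "phi : bdiscs" using bdisc_dichotomy[OF phi] a by simp
  define r1 where "r1 = (1 + r) / 2"
  define r2 where "r2 = (1 + r1) / 2"
  have r1a: "0 < r1" "r1 < 1" "r < r1" using r by (auto simp: r1_def)
  hence r1: "0 < r1" "r1 < 1" "r < r1" "0 < r2" "r2 < 1" "r1 < r2" by (auto simp: r2_def)
  obtain M psi where M: "conormal_lift (ball 0 r2) (%z. N (phi z)) M" "!!i. hol psi i (ball 0 r2)"
   "!!z. z : ball 0 r2 ==> bil (M z) (psi z) = 1" using bdisc_transversal[OF phib r1(4,5)] by blast
  have sub: "cball (0::complex) r1 <= ball 0 r2" "cball (0::complex) r1 <= unit_disc" "ball (0::complex) r1 <= ball 0 r2" using r1 by auto
  have cpsi: "continuous_on (cball 0 r1) psi" by (rule continuous_on_subset[OF holomorphic_vec_imp_continuous_on[OF M(2)] sub(1)])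
  have pos: "Re (herm (N (phi z)) (psi z)) > 0" if z: "z : cball 0 r1" for z
  proof -
   have z2: "z : ball 0 r2" using z sub(1) by blast
   then obtain k :: real where k: "k > 0" "ALL i. M z $ i = of_real k * cnj (N (phi z) $ i)" using M(1) unfolding conormal_lift_def by blast
   have "of_real k * herm (N (phi z)) (psi z) = 1" using M(3)[OF z2] unfolding bil_conormal[OF k(2)] .
   from arg_cong[OF this, of Re] have "k * Re (herm (N (phi z)) (psi z)) = 1" by simp
   thus ?thesis using k(1) by (metis zero_less_mult_pos zero_less_one)
  qed
  have ch: "continuous_on (cball 0 r1) (%z. Re (herm (N (phi z)) (psi z)))"
   by (intro continuous_intros continuous_on_subset[OF bdiscsD(5)[OF phib] sub(2)] cpsi)
  have ne: "cball (0::complex) r1 ~= {}" using r1 by simp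
  obtain z1 where z1: "z1 : cball 0 r1" "!!z. z : cball 0 r1 ==> Re (herm (N (phi z1)) (psi z1)) <= Re (herm (N (phi z)) (psi z))"
   using continuous_attains_inf[OF compact_cball ne ch] by blast
  define c where "c = Re (herm (N (phi z1)) (psi z1))"
  have c: "c > 0" "!!z. z : cball 0 r1 ==> c <= Re (herm (N (phi z)) (psi z))" using pos[OF z1(1)] z1(2) by (auto simp: c_def)
  obtain S where S: "S > 0" "!!z. z : cball 0 r1 ==> norm (psi z) <= S"
   using compact_imp_bounded[OF compact_continuous_image[OF cpsi compact_cball]] unfolding bounded_pos by blast
  have "uniformly_continuous_on (bdry) N" by (rule compact_uniformly_continuous[OF inward_continuous_on frontier_compact])
  then obtain e where e: "e > 0" "!!x y. x : bdry ==> y : bdry ==> dist y x < e ==> dist (N y) (N x) < c / (2 * S)"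
   using c S unfolding uniformly_continuous_on_def by (metis divide_pos_pos mult_pos_pos zero_less_numeral)
  define C where "C = max (1 + 1 / (c / 2) * (1 + 2 / (1 - r / r1)) * S) (2 / (1 - r / r1) * S / (c / 2))"
  have Cpos: "C > 0"
  proof -
   have "2 / (1 - r / r1) > 0" using r1 by simp
   hence "2 / (1 - r / r1) * S / (c / 2) > 0" using S c by simp
   thus ?thesis by (simp add: C_def less_max_iff_disj)
  qed
  have "EVS n. ALL z:cball 0 r1. dist (f (j n) z) (phi z) < e"
   using uniform_limitD[OF ul[OF compact_cball sub(2)] e(1)] .
  moreover have "EVS n. C <= real (j n)"
  proof -
   obtain n0 where n0: "C <= real n0" using real_arch_simple by blast
   have "C <= real (j n)" if "n >= n0" for n using n0 that seq_suble[OF j, of n] by linarith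
   thus ?thesis by (auto simp: eventually_sequentially)
  qed
  ultimately have "EVS n. False"
  proof eventually_elim
   case (elim n)
   have "EX \<Psi> k. controlled_lift r C (f (j n)) \<Psi> k" unfolding C_def
   proof (rule controlled_lift_nearby[OF f(1) r(1) r1(3,2)])
    show "hol psi i (ball 0 r1)" for i by (rule holomorphic_on_subset[OF M(2) sub(3)])
    show "c / 2 > 0" using c by simp
    fix z :: complex assume "z : ball 0 r1"
    hence z: "z : cball 0 r1" by simp
    hence zu: "z : unit_disc" using sub(2) by blast
    show "norm (psi z) <= S" by (rule S(2)[OF z])
    have "dist (N (f (j n) z)) (N (phi z)) < c / (2 * S)"
     using elim(1) z by (intro e(2) bdiscsD(2)[OF phib zu] bdiscsD(2)[OF f(1) zu]) auto
    hence "norm (N (f (j n) z) - N (phi z)) * norm (psi z) <= c / (2 * S) * S"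
     using S(1) S(2)[OF z] c(1) by (intro mult_mono) (auto simp: dist_norm)
    hence "cmod (herm (N (f (j n) z) - N (phi z)) (psi z)) <= c / 2"
     using herm_norm_le[of "N (f (j n) z) - N (phi z)" "psi z"] S(1) by simp
    hence "\<bar>Re (herm (N (f (j n) z)) (psi z)) - Re (herm (N (phi z)) (psi z))\<bar> <= c / 2"
     using abs_Re_le_cmod[of "herm (N (f (j n) z) - N (phi z)) (psi z)"] unfolding herm_diff_left by simp
    thus "c / 2 <= Re (herm (N (f (j n) z)) (psi z))" using c(2)[OF z] by linarith
   qed
   then obtain \<Psi> k where "controlled_lift r C (f (j n)) \<Psi> k" by blast
   hence "controlled_lift r (real (j n) + 1) (f (j n)) \<Psi> k" by (rule controlled_lift_mono) (use Cpos elim in auto)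
   thus False using f(3) by blast
  qed
  thus False by simp
 qed
 thus ?thesis using that by blast
qed

lemma inward_cone_in:
 assumes "c > 0"
 obtains e where "e > 0" "!!x w s. x : bdry ==> norm w <= C ==> c <= w \<bullet> N x ==> 0 < s ==> s < e ==> x + s *R w : D"
proof -
 define X where "X = {p : bdry \<times> cball 0 C. c <= snd p \<bullet> N (fst p)}"
 have "compact (bdry \<times> cball (0 :: complex ^ 'm) C)" by (intro compact_Times frontier_compact compact_cball)
 moreover have "closedin (top_of_set (bdry \<times> cball 0 C)) ((bdry \<times> cball 0 C) \<inter> (%p. snd p \<bullet> N (fst p)) -` {c..})"
  by (intro continuous_closedin_preimage continuous_intros continuous_on_compose2[OF inward_continuous_on]) auto
 moreover have "X = (bdry \<times> cball 0 C) \<inter> (%p. snd p \<bullet> N (fst p)) -` {c..}" by (auto simp: X_def)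
 ultimately have "compact X" using closedin_compact by metis
 then obtain e where e: "e > 0" "!!a w x w' s. (a, w) : X ==> x : closure D ==> dist x a < e ==> dist w' w < e ==> 0 < s ==> s < e ==> x + s *R w' : D"
 proof (rule inward_into_compact)
  show "a : bdry & w \<bullet> N a > 0" if "(a, w) : X" for a w using that assms by (auto simp: X_def)
 qed (rule that)
 show ?thesis
 proof (rule that[OF e(1)])
  fix x w s assume h: "x : bdry" "norm w <= C" "c <= w \<bullet> N x" "0 < s" "s < e"
  hence "(x, w) : X" by (simp add: X_def)
  thus "x + s *R w : D" using e h frontier_cl by simp
 qed
qed

text \<open>In tangential directions the domain looks like all of space at scale s: the segment from u to its normal part extends to a disc of arbitrarily large radius inside the domain, so its endpoints are close.\<close>
lemma tangential_reset:
 assumes eps: "eps > 0"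
 obtains s0 where "s0 > 0" "!!x u s. x : bdry ==> norm u <= 2 ==> Re (herm (N x) u) >= 1 / 4 ==> 0 < s ==> s < s0 ==>
  x + s *R u : D & x + s *R (herm (N x) u *s N x) : D & kob (x + s *R u) (x + s *R (herm (N x) u *s N x)) <= eps"
proof -
 obtain d :: real where d: "0 < d" "d < 1" "!!t. 0 <= t ==> t < d ==> artanh t <= (1 + 1) * t"
  by (rule artanh_le_near_zero[OF zero_less_one]) (rule that)
 define t where "t = min (d / 2) (eps / 2)"
 have t: "0 < t" "t < d" "t < 1" "2 * t <= eps" using d eps by (auto simp: t_def)
 have art: "artanh t <= eps" using d(3)[of t] t by simp
 obtain e where e: "e > 0" "!!x w s. x : bdry ==> norm w <= 2 + 4 / t ==> 1 / 4 <= w \<bullet> N x ==> 0 < s ==> s < e ==> x + s *R w : D"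
  using inward_cone_in[of "1 / 4" "2 + 4 / t"] by auto
 show ?thesis
 proof (rule that[OF e(1)])
  fix x u s assume x: "x : bdry" and u: "norm u <= 2" "Re (herm (N x) u) >= 1 / 4" and s: "0 < s" "s < e"
  define q where "q = herm (N x) u"
  define \<tau> where "\<tau> = u - q *s N x"
  have N1: "norm (N x) = 1" by (rule inward_norm[OF x])
  have q2: "cmod q <= 2" using herm_norm_le[of "N x" u] u(1) N1 by (simp add: q_def)
  have "norm \<tau> <= norm u + cmod q * norm (N x)" unfolding \<tau>_def norm_smult[symmetric] by (rule norm_triangle_ineq4)
  hence tau: "norm \<tau> <= 4" using u(1) q2 N1 by simp
  have htau: "herm (N x) \<tau> = 0" by (simp add: \<tau>_def herm_diff_right herm_smult_right herm_self N1 q_def)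
  \<comment> \<open>At z = t the tangential part has been removed; t is small because the disc is large.\<close>
  define w where "w z = u - (z / of_real t) *s \<tau>" for z
  have wD: "x + s *R w z : D" if z: "cmod z <= 1" for z
  proof (rule e(2)[OF x _ _ s])
   have "norm (w z) <= norm u + cmod (z / of_real t) * norm \<tau>" unfolding w_def norm_smult[symmetric] by (rule norm_triangle_ineq4)
   also have "... <= 2 + (1 / t) * 4" using u(1) tau z t by (intro add_mono mult_mono) (auto simp: norm_divide divide_right_mono)
   finally show "norm (w z) <= 2 + 4 / t" by simp
   have hw: "herm (N x) (w z) = q" by (simp add: w_def herm_diff_right herm_smult_right htau q_def)
   thus "1 / 4 <= w z \<bullet> N x" using u(2) unfolding inner_commute[of "w z" "N x"] unfolding Re_herm[symmetric] hw q_def by simp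
  qed
  define f where "f z = x + s *R w z" for z
  have "hol f i unit_disc" for i
   unfolding f_def w_def using t by (auto simp: scaleR_complex intro!: holomorphic_intros)
  moreover have "f ` unit_disc <= D" using wD by (auto simp: f_def)
  ultimately have fd: "f : discs_in D" unfolding discs_in_def by blast
  have f0: "f 0 = x + s *R u" by (simp add: f_def w_def)
  have ft: "f (of_real t) = x + s *R (q *s N x)" using t by (simp add: f_def w_def \<tau>_def)
  have tu: "of_real t : unit_disc" using t by simp
  have "kob (x + s *R u) (x + s *R (q *s N x)) <= hyp_dist 0 (of_real t)"
   by (rule kobayashi_le_disc[OF dom fd f0 ft tu])
  also have "... <= eps" using art t by (simp add: hyp_dist_zero_left)
  finally show "x + s *R u : D & x + s *R (herm (N x) u *s N x) : D & kob (x + s *R u) (x + s *R (herm (N x) u *s N x)) <= eps"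
   using wD[of 0] wD[of "of_real t"] t f0 ft unfolding q_def f_def by simp
 qed
qed

end

lemma unit_normalise_close:
 assumes "3 / 4 <= Re zeta"
 shows "cmod (zeta / of_real (cmod zeta) - 1) <= 4 * \<bar>Im zeta\<bar>"
proof -
 have n: "3 / 4 <= cmod zeta" using assms complex_Re_le_cmod[of zeta] by linarith
 hence z0: "zeta ~= 0" by auto
 have "cmod zeta <= Re zeta + \<bar>Im zeta\<bar>" using cmod_le[of zeta] assms by simp
 hence "\<bar>Re (zeta - of_real (cmod zeta))\<bar> <= \<bar>Im zeta\<bar>" using complex_Re_le_cmod[of zeta] by simp
 hence 1: "cmod (zeta - of_real (cmod zeta)) <= 2 * \<bar>Im zeta\<bar>" using cmod_le[of "zeta - of_real (cmod zeta)"] by simp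
 have "zeta / of_real (cmod zeta) - 1 = (zeta - of_real (cmod zeta)) / of_real (cmod zeta)" using z0 by (simp add: diff_divide_distrib)
 hence "cmod (zeta / of_real (cmod zeta) - 1) = cmod (zeta - of_real (cmod zeta)) / cmod zeta" by (simp add: norm_divide)
 also have "... <= 2 * \<bar>Im zeta\<bar> / (1 / 2)" using 1 n by (intro frac_le) auto
 finally show ?thesis by simp
qed

context lim_path begin

text \<open>Let u start at q1 N with |q1| = 1 and put e u = -i u / q1. As long as the normal component q of u is a positive multiple of q1, the vector e u is tangential and r at gam + y e u is O(y^2); in general r / y measures the imaginary part of q / q1 up to O(y). By second order flatness its growth is at most kap plus a multiple of that imaginary part, so it stays small on a short interval whose length depends neither on kap nor on y. At the end the tangential part of u is discarded and its modulus is moved into s.\<close>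
lemma transport_along_frontier:
 assumes t0: "t0 : {0..L}" "gam t0 : bdry" and r: "0 < r" "r < 1" and l': "1 / r < l'"
 obtains d where "d > 0" "!!eps. eps > 0 ==> EX s0>0. ALL t1 t2 s q1. t1 : {0..L} --> t2 : {0..L} --> t1 <= t2 --> \<bar>t1 - t0\<bar> < d --> \<bar>t2 - t0\<bar> < d -->
  gam ` {t1..t2} <= bdry --> cmod q1 = 1 --> cmod (q1 - 1) <= 1 / 2 --> 0 < s --> s < s0 -->
  (slid l' eps t1 t2 s q1)"
proof -
 define a where "a = gam t0"
 have a: "a : bdry" using t0 by (simp add: a_def)
 obtain dc gr g \<Lambda> where ch: "chart D a dc gr g \<Lambda>" and Ng: "!!x. x : bdry ==> dist x a < dc ==> N x = - (g x /\<^sub>R norm (g x))"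
  using frontier_chart[OF a] by blast
 have dc: "dc > 0" and \<Lambda>: "\<Lambda> >= 0" using chartD(1,2)[OF ch] by auto
 obtain m M where mM: "0 < m" "0 < M" "!!x. x : ball a (dc / 2) ==> m <= norm (g x)" "!!x. x : ball a (dc / 2) ==> norm (g x) <= M"
  using chart_gradient_bounds[OF ch] by blast
 obtain dl C0 where dl: "dl > 0" "C0 > 0" and lift0: "!!phi. phi : bdiscs ==> dist (phi 0) a < dl ==> EX \<Psi> k. controlled_lift r C0 phi \<Psi> k"
  using boundary_lift[OF a r] by blast
 define C where "C = max C0 2"
 have C: "C >= 2" "C > 0" by (auto simp: C_def)
 have lift: "EX \<Psi> k. controlled_lift r C phi \<Psi> k" if pl: "phi : bdiscs" "dist (phi 0) a < dl" for phi
 proof -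
  obtain \<Psi> k where "controlled_lift r C0 phi \<Psi> k" using lift0[OF pl] by blast
  hence "controlled_lift r C phi \<Psi> k" by (rule controlled_lift_mono) (use dl in \<open>simp_all add: C_def\<close>)
  thus ?thesis by blast
 qed
 obtain Bd where Bd: "Bd > 0" "!!x. x : closure D ==> norm x <= Bd"
  using bounded_closure[OF bdd] bounded_pos by metis
 obtain V where V: "V >= 0" and vb': "ALL f :: complex => complex ^ 'm. (ALL i. hol f i (ball 0 r)) --> (ALL z:ball 0 r. norm (f z) <= max Bd (2 * C)) --> norm (vder f) <= V"
  using vder_bound[OF r(1), of "max Bd (2 * C)", where 'm = 'm] Bd(1) by fastforce
 have vb: "norm (vder f) <= V" if "!!i. hol f i (ball 0 r)" "!!z. z : ball 0 r ==> norm (f z) <= max Bd (2 * C)" for f :: "complex => complex ^ 'm"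
  using spec[OF vb', of f] that by blast
 define C4 where "C4 = 4 * \<Lambda> * (V + 4 * V) + 2 * M * V"
 have C4: "C4 >= 0" using \<Lambda> V mM by (simp add: C4_def)
 have "isCont (%x. x) a" by simp
 obtain dN where dN: "dN > 0" "!!x. x : bdry ==> dist x a < dN ==> dist (N x) (N a) < 1 / 32"
  using inward_continuous_on a unfolding continuous_on_iff by (metis zero_less_divide_1_iff zero_less_numeral)
 obtain dp where dp: "dp > 0" "!!t. t : {0..L} ==> \<bar>t - t0\<bar> < dp ==> dist (gam t) a < Min {dc / 16, dl, dN}"
 proof -
  have "Min {dc / 16, dl, dN} > 0" using dc dl dN by simp
  thus ?thesis using path_cont t0(1) that unfolding continuous_on_iff dist_real_def a_def by meson
 qed
 \<comment> \<open>Short enough for u to stay near u1 and for the feedback of the phase error on its own growth to be absorbed.\<close>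
 define d where "d = Min {dp, 1 / (32 * (V + 1)), m / (16 * (C4 + 1))}"
 have d: "d > 0" "d <= dp" "d <= 1 / (32 * (V + 1))" "d <= m / (16 * (C4 + 1))"
  subgoal using dp(1) V C4 mM(1) by (simp add: d_def)
  unfolding d_def by (intro Min_le; simp)+
 have "d * (32 * (V + 1)) <= 1" using d(3) V by (simp add: pos_le_divide_eq)
 hence dV: "V * (2 * d) <= 1 / 16" using d(1) V by (simp add: algebra_simps)
 have "d * (16 * (C4 + 1)) <= m" using d(4) C4 by (simp add: pos_le_divide_eq)
 hence dC4: "C4 * (2 * d) <= m / 8" using d(1) C4 by (simp add: algebra_simps)
 obtain ec where ec: "ec > 0" "!!x w s. x : bdry ==> norm w <= 2 * C ==> 1 / (4 * C) <= w \<bullet> N x ==> 0 < s ==> s < ec ==> x + s *R w : D"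
  using inward_cone_in[of "1 / (4 * C)" "2 * C"] C by auto
 have l0: "0 <= l'" using l' r by (meson less_imp_le less_trans zero_less_divide_1_iff)
 show ?thesis
 proof (rule that[OF d(1)])
  fix eps :: real assume eps: "eps > 0"
  define kap where "kap = eps * m / (16 * (2 * d + 1))"
  have kap: "kap > 0" using eps mM(1) d(1) by (simp add: kap_def)
  have "kap * (16 * (2 * d + 1)) = eps * m" using d(1) by (simp add: kap_def)
  hence kapd: "kap * (2 * d) <= eps * m / 16" using kap by (simp add: algebra_simps)
  obtain y0 where y0: "y0 > 0" and flat: "ALL phi:bdiscs. dist (phi 0) a < dc / 8 --> (ALL psi y. (ALL i. hol psi i (ball 0 r)) -->
   (ALL z:ball 0 r. norm (psi z) <= 2 * C & psi z \<bullet> N (phi z) = 0) --> 0 < y --> y < y0 -->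
   \<bar>(vder phi + y *R vder psi) \<bullet> g (phi 0 + y *R psi 0)\<bar> <= (kap / 4) * y)"
   using second_order_flatness[OF a ch Ng r(1), of "2 * C" "kap / 4"] C kap by auto
  \<comment> \<open>The height scale y is fixed before s; only s tends to 0.\<close>
  define y where "y = Min {y0 / 2, 1, dc / 16, kap * m / (32 * (\<Lambda> + 1) * (C4 + 1)), eps * m / (128 * (\<Lambda> + 1))}"
  have y: "y > 0" "y <= y0 / 2" "y <= 1" "y <= dc / 16" "y <= kap * m / (32 * (\<Lambda> + 1) * (C4 + 1))" "y <= eps * m / (128 * (\<Lambda> + 1))"
   subgoal using y0 dc kap mM(1) \<Lambda> C4 eps by (simp add: y_def)
   unfolding y_def by (intro Min_le; simp)+
  have "y * (32 * (\<Lambda> + 1) * (C4 + 1)) <= kap * m" using y(5) \<Lambda> C4 by (simp add: pos_le_divide_eq)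
  moreover have "C4 * (8 * \<Lambda> * y) * 4 <= y * (32 * (\<Lambda> + 1) * (C4 + 1))" using y(1) \<Lambda> C4 by (simp add: algebra_simps)
  ultimately have yC4: "C4 * (8 * \<Lambda> * y) <= kap * m / 4" by linarith
  have "y * (128 * (\<Lambda> + 1)) <= eps * m" using y(6) \<Lambda> by (simp add: pos_le_divide_eq)
  hence yL: "8 * \<Lambda> * y <= eps * m / 16" using y(1) by (simp add: algebra_simps)
  obtain sr where sr: "sr > 0" "!!x u s. x : bdry ==> norm u <= 2 ==> Re (herm (N x) u) >= 1 / 4 ==> 0 < s ==> s < sr ==>
   x + s *R u : D & x + s *R (herm (N x) u *s N x) : D & kob (x + s *R u) (x + s *R (herm (N x) u *s N x)) <= eps"
   using tangential_reset[OF eps] by blast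
  show "EX s0>0. ALL t1 t2 s q1. t1 : {0..L} --> t2 : {0..L} --> t1 <= t2 --> \<bar>t1 - t0\<bar> < d --> \<bar>t2 - t0\<bar> < d -->
   gam ` {t1..t2} <= bdry --> cmod q1 = 1 --> cmod (q1 - 1) <= 1 / 2 --> 0 < s --> s < s0 -->
   (slid l' eps t1 t2 s q1)"
  proof (rule exI[of _ "min sr ec"], intro conjI allI impI)
   show "0 < min sr ec" using sr(1) ec(1) by simp
   fix t1 t2 s :: real and q1 :: complex
   assume t: "t1 : {0..L}" "t2 : {0..L}" "t1 <= t2" "\<bar>t1 - t0\<bar> < d" "\<bar>t2 - t0\<bar> < d" and fr0: "gam ` {t1..t2} <= bdry"
    and q1: "cmod q1 = 1" "cmod (q1 - 1) <= 1 / 2" and s: "0 < s" "s < min sr ec"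
   have mid: "t : {0..L}" "\<bar>t - t0\<bar> < d" "t - t1 <= 2 * d" "0 <= t - t1" "gam t : bdry" if "t : {t1..t2}" for t using that t fr0 by auto
   have near: "dist (gam t) a < dc / 16" "dist (gam t) a < dl" "dist (gam t) a < dN" if "t : {t1..t2}" for t
    using dp(2)[OF mid(1)[OF that]] mid(2)[OF that] d(2) by auto
   have m1: "t1 : {t1..t2}" "t2 : {t1..t2}" using t(3) by auto
   have q10: "q1 ~= 0" using q1(1) by auto
   define u1 where "u1 = q1 *s N (gam t1)"
   have N1: "norm (N (gam t)) = 1" if "t : {t1..t2}" for t by (rule inward_norm[OF mid(5)[OF that]])
   have u1n: "norm u1 = 1" using N1[OF m1(1)] q1(1) by (simp add: u1_def norm_smult)
   have hu1: "herm (N (gam t1)) u1 = q1" using N1[OF m1(1)] by (simp add: u1_def herm_smult_right herm_self)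
   \<comment> \<open>Rotated so that N . e u vanishes exactly when q / q1 is real.\<close>
   define e where "e u = (- \<i> / q1) *s u" for u :: "complex ^ 'm"
   have en: "norm (e u) = norm u" for u using q1(1) by (simp add: e_def norm_smult norm_divide)
   define X where "X t u = gr (gam t + y *R e u) / y" for t u
   \<comment> \<open>The start value of X is at most 4 \<Lambda> y, not 0, because r is only quadratically small there.\<close>
   define Inv where "Inv t u \<longleftrightarrow> t : {t1..t2} & norm (u - u1) <= V * (t - t1) & \<bar>X t u\<bar> <= 4 * \<Lambda> * y + kap * (t - t1)" for t u
   have uu: "norm (u - u1) <= 1 / 16" "norm u <= 2" if "t : {t1..t2}" "norm (u - u1) <= V * (t - t1)" for t u
   proof -
    have "V * (t - t1) <= V * (2 * d)" using mid(3)[OF that(1)] V by (intro mult_left_mono) auto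
    thus 1: "norm (u - u1) <= 1 / 16" using that(2) dV by linarith
    show "norm u <= 2" using norm_triangle_ineq[of "u - u1" u1] u1n 1 by simp
   qed
   have qq: "cmod (herm (N (gam t)) u / q1 - 1) <= 1 / 4" if "t : {t1..t2}" "norm (u - u1) <= V * (t - t1)" for t u
   proof -
    have "dist (N (gam t)) (N (gam t1)) <= 1 / 16"
     using dN(2)[OF mid(5)[OF that(1)] near(3)[OF that(1)]] dN(2)[OF mid(5)[OF m1(1)] near(3)[OF m1(1)]]
      dist_triangle2[of "N (gam t)" "N (gam t1)" "N a"] by linarith
    hence "norm (N (gam t) - N (gam t1)) * norm u <= 1 / 16 * 2" using uu(2)[OF that] by (intro mult_mono) (auto simp: dist_norm)
    hence 1: "cmod (herm (N (gam t) - N (gam t1)) u) <= 1 / 8" using herm_norm_le[of "N (gam t) - N (gam t1)" u] by simp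
    have 2: "cmod (herm (N (gam t1)) (u - u1)) <= 1 / 16" using herm_norm_le[of "N (gam t1)" "u - u1"] N1[OF m1(1)] uu(1)[OF that] by simp
    have "herm (N (gam t)) u - q1 = herm (N (gam t) - N (gam t1)) u + herm (N (gam t1)) (u - u1)"
     unfolding herm_diff_left herm_diff_right hu1 by simp
    hence "cmod (herm (N (gam t)) u - q1) <= 1 / 4" using norm_triangle_ineq[of "herm (N (gam t) - N (gam t1)) u" "herm (N (gam t1)) (u - u1)"] 1 2 by simp
    moreover have "herm (N (gam t)) u / q1 - 1 = (herm (N (gam t)) u - q1) / q1" using q10 by (simp add: diff_divide_distrib)
    ultimately show ?thesis using q1(1) by (simp add: norm_divide)
   qed
   have Req1: "Re q1 >= 1 / 2" using q1(2) abs_Re_le_cmod[of "q1 - 1"] by simp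
   have Req: "1 / 4 <= Re (herm (N (gam t)) u)" if "t : {t1..t2}" "norm (u - u1) <= V * (t - t1)" for t u
   proof -
    have "herm (N (gam t)) u - q1 = q1 * (herm (N (gam t)) u / q1 - 1)" using q10 by (simp add: algebra_simps)
    hence "cmod (herm (N (gam t)) u - q1) <= 1 / 4" using qq[OF that] q1(1) by (simp add: norm_mult)
    thus ?thesis using Req1 abs_Re_le_cmod[of "herm (N (gam t)) u - q1"] by simp
   qed
   have half: "x : ball a dc" if "x : ball a (dc / 2)" for x using that dc by simp
   have bx: "gam t : ball a (dc / 2)" if "t : {t1..t2}" for t using near(1)[OF that] dc by (simp add: dist_commute)
   have bp: "gam t + y *R w : ball a (dc / 2)" if "t : {t1..t2}" "norm w <= 2" for t w
   proof -
    have "y * norm w <= dc / 16 * 2" using y(1,4) that(2) dc by (intro mult_mono) auto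
    hence "norm (y *R w) <= dc / 16 * 2" using y(1) by simp
    moreover have "dist (gam t + y *R w) a <= dist (gam t) a + norm (y *R w)"
     using norm_triangle_ineq[of "gam t - a" "y *R w"] by (simp add: dist_norm algebra_simps)
    ultimately show ?thesis using near(1)[OF that(1)] dc by (simp add: dist_commute)
   qed
   have tan_err: "\<bar>X t u + norm (g (gam t)) * Im (herm (N (gam t)) u / q1)\<bar> <= 4 * \<Lambda> * y"
    if "t : {t1..t2}" "norm u <= 2" for t u
   proof -
    have x: "gam t : ball a dc" by (rule half[OF bx[OF that(1)]])
    have r0: "gr (gam t) = 0" using chart_frontier[OF ch open_D x] mid(5)[OF that(1)] by blast
    have g0: "g (gam t) = - (norm (g (gam t)) *R N (gam t))"
     using Ng[OF mid(5)[OF that(1)]] x chartD(5)[OF ch x] by (simp add: dist_commute)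
    have "e u \<bullet> N (gam t) = Re (herm (N (gam t)) (e u))" by (simp add: Re_herm inner_commute)
    also have "herm (N (gam t)) (e u) = - \<i> * (herm (N (gam t)) u / q1)" unfolding e_def herm_smult_right by simp
    also have "Re (- \<i> * (herm (N (gam t)) u / q1)) = Im (herm (N (gam t)) u / q1)"
     unfolding mult_minus_left uminus_complex.sel times_complex.sel by simp
    finally have eN: "e u \<bullet> N (gam t) = Im (herm (N (gam t)) u / q1)" .
    have "e u \<bullet> g (gam t) = - (norm (g (gam t)) * (e u \<bullet> N (gam t)))" by (subst g0) simp
    hence ei: "(gam t + y *R e u - gam t) \<bullet> g (gam t) = - (y * (norm (g (gam t)) * Im (herm (N (gam t)) u / q1)))" unfolding eN by simp
    have "\<bar>gr (gam t + y *R e u) - gr (gam t) - (gam t + y *R e u - gam t) \<bullet> g (gam t)\<bar> <= \<Lambda> * (norm (gam t + y *R e u - gam t))\<^sup>2"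
     by (rule chart_taylor[OF ch x half[OF bp[OF that(1)]]]) (simp add: en that(2))
    also have "... <= \<Lambda> * (y * 2)\<^sup>2" using that(2) y(1) by (intro mult_left_mono power_mono \<Lambda>) (auto simp: en)
    finally have "\<bar>y * (X t u + norm (g (gam t)) * Im (herm (N (gam t)) u / q1))\<bar> <= y * (4 * \<Lambda> * y)"
     unfolding ei r0 using y(1) by (simp add: X_def power2_eq_square algebra_simps)
    thus ?thesis using y(1) by (simp add: abs_mult)
   qed
   have beta: "\<bar>Im (herm (N (gam t)) u / q1)\<bar> <= (8 * \<Lambda> * y + kap * (t - t1)) / m" if "Inv t u" for t u
   proof -
    have i: "t : {t1..t2}" "norm (u - u1) <= V * (t - t1)" "\<bar>X t u\<bar> <= 4 * \<Lambda> * y + kap * (t - t1)" using that by (auto simp: Inv_def)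
    have "m * \<bar>Im (herm (N (gam t)) u / q1)\<bar> <= norm (g (gam t)) * \<bar>Im (herm (N (gam t)) u / q1)\<bar>"
     by (intro mult_right_mono mM(3) bx i(1)) auto
    also have "... = \<bar>norm (g (gam t)) * Im (herm (N (gam t)) u / q1)\<bar>" by (simp add: abs_mult)
    also have "... <= 8 * \<Lambda> * y + kap * (t - t1)" using tan_err[OF i(1) uu(2)[OF i(1,2)]] i(3) unfolding abs_le_iff by linarith
    finally show ?thesis using mM(1) by (simp add: pos_le_divide_eq mult.commute)
   qed
   have cone_u: "x + s *R w : D" if "x : bdry" "norm w <= 2 * C" "1 / (4 * C) <= w \<bullet> N x" for x w
    using ec(2)[OF that s(1)] s(2) by simp
   have C1: "1 / (4 * C) <= 1 / 4" using C by (simp add: field_simps)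
   have inD: "gam t + s *R u : D" if i: "Inv t u" for t u
   proof (rule cone_u)
    have i': "t : {t1..t2}" "norm (u - u1) <= V * (t - t1)" using i by (auto simp: Inv_def)
    show "gam t : bdry" by (rule mid(5)[OF i'(1)])
    show "norm u <= 2 * C" using uu(2)[OF i'] C by simp
    have "u \<bullet> N (gam t) = Re (herm (N (gam t)) u)" by (simp add: Re_herm inner_commute)
    thus "1 / (4 * C) <= u \<bullet> N (gam t)" using Req[OF i'] C1 by linarith
   qed
   have "EX u2. Inv t2 u2 & kob (gam t1 + s *R u1) (gam t2 + s *R u2) <= l' * (t2 - t1)"
   proof (rule transport[OF dom t(3) l' l0])
    show cg: "continuous_on {t1..t2} gam" by (rule continuous_on_subset[OF path_cont]) (use mid in auto)
    show "Inv t u" if h: "!!n. T n : {t1..t2}" "!!n. Inv (T n) (U n)" "T ----> t" "U ----> u" for T U t u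
     unfolding Inv_def
    proof (intro conjI)
     show t12: "t : {t1..t2}" by (rule closed_sequentially[OF _ h(1,3)]) simp
     show "norm (u - u1) <= V * (t - t1)"
      by (rule LIMSEQ_le[of "%n. norm (U n - u1)" _ "%n. V * (T n - t1)"]) (intro tendsto_intros h(3,4), intro tendsto_intros h(3,4), use h(2) in \<open>auto simp: Inv_def\<close>)
     have "(%n. gam (T n)) ----> gam t" using cg t12 h(1,3) unfolding continuous_on_sequentially by (auto simp: o_def)
     hence "(%n. gam (T n) + y *R e (U n)) ----> gam t + y *R e u"
     proof (intro tendsto_intros)
      have "(%n. \<chi> i. (- \<i> / q1) * U n $ i) ----> (\<chi> i. (- \<i> / q1) * u $ i)" by (intro tendsto_intros h(4))
      thus "(%n. e (U n)) ----> e u" by (simp add: e_def vector_scalar_mult_def)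
     qed
     moreover have "isCont gr (gam t + y *R e u)"
     proof -
      have "norm (U n) <= 2" for n using h(2)[of n] unfolding Inv_def by (intro uu(2)) blast+
      hence "norm u <= 2" by (intro LIMSEQ_le_const2[OF tendsto_norm[OF h(4)]]) blast
      hence "gam t + y *R e u : ball a dc" by (intro half bp t12) (simp add: en)
      from chartD(3)[OF ch this] show ?thesis unfolding gderiv_def by (rule has_derivative_continuous)
     qed
     ultimately have "(%n. X (T n) (U n)) ----> X t u" unfolding X_def using y(1)
      by (intro tendsto_divide isCont_tendsto_compose[of _ gr] tendsto_const) auto
     thus "\<bar>X t u\<bar> <= 4 * \<Lambda> * y + kap * (t - t1)"
      by (intro LIMSEQ_le[of "%n. \<bar>X (T n) (U n)\<bar>" _ "%n. 4 * \<Lambda> * y + kap * (T n - t1)"] tendsto_rabs)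
       (assumption, intro tendsto_intros h(3), use h(2) in \<open>auto simp: Inv_def\<close>)
    qed
    show "norm u <= 2" if "t : {t1..t2}" "Inv t u" for t u using uu(2) that(2) by (auto simp: Inv_def)
    show "gam t + s *R u : D" if "t : {t1..t2}" "Inv t u" for t u by (rule inD[OF that(2)])
    have "\<bar>X t1 u1\<bar> <= 4 * \<Lambda> * y" using tan_err[OF m1(1), of u1] u1n hu1 q10 by simp
    thus "Inv t1 u1" using m1 by (simp add: Inv_def)
    fix t u and eps1 :: real
    assume tt: "t1 <= t" "t < t2" and inv: "Inv t u" and e1: "0 < eps1"
    have t12: "t : {t1..t2}" using tt by simp
    have i: "norm (u - u1) <= V * (t - t1)" "\<bar>X t u\<bar> <= 4 * \<Lambda> * y + kap * (t - t1)" using inv by (auto simp: Inv_def)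
    have u2: "norm u <= 2" by (rule uu(2)[OF t12 i(1)])
    define x where "x = gam t"
    have x: "x : bdry" "dist x a < dc / 16" "dist x a < dl" using mid(5)[OF t12] near[OF t12] by (auto simp: x_def)
    have xs: "x + s *R u : D" using inD[OF inv] by (simp add: x_def)
    define q where "q = herm (N x) u"
    define \<alpha> where "\<alpha> = Re (q / q1)"
    define \<beta> where "\<beta> = Im (q / q1)"
    have ab: "q / q1 = of_real \<alpha> + \<i> * of_real \<beta>" unfolding \<alpha>_def \<beta>_def by (rule complex_eq)
    have qq1: "cmod (q / q1 - 1) <= 1 / 4" using qq[OF t12 i(1)] by (simp add: q_def x_def)
    have \<alpha>: "3 / 4 <= \<alpha>" "\<alpha> <= 5 / 4" using abs_Re_le_cmod[of "q / q1 - 1"] qq1 by (auto simp: \<alpha>_def)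
    have cq: "cmod (q / q1) = cmod q" using q1(1) by (simp add: norm_divide)
    have \<alpha>q: "\<bar>\<alpha>\<bar> <= cmod q" using abs_Re_le_cmod[of "q / q1"] cq by (simp add: \<alpha>_def)
    have \<beta>q: "\<bar>\<beta>\<bar> <= cmod q" using abs_Im_le_cmod[of "q / q1"] cq by (simp add: \<beta>_def)
    have q34: "3 / 4 <= cmod q" using \<alpha>q \<alpha>(1) by linarith
    hence q0: "q ~= 0" by auto
    have Rq: "1 / 4 <= Re q" using Req[OF t12 i(1)] by (simp add: q_def x_def)
    have \<beta>b: "\<bar>\<beta>\<bar> <= (8 * \<Lambda> * y + kap * (t - t1)) / m" using beta[OF inv] by (simp add: \<beta>_def q_def x_def)
    define c where "c = of_real \<alpha> * (- \<i> / q)"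
    have cn: "cmod c <= 1" using \<alpha>q q0 by (simp add: c_def norm_mult norm_divide pos_divide_le_eq)
    have eq_c: "- \<i> / q1 = c + of_real \<beta> * (1 / q)"
    proof -
     have "- \<i> / q1 = (q / q1) * (- \<i> / q)" using q0 by simp
     also have "... = c + \<i> * of_real \<beta> * (- \<i> / q)" unfolding ab c_def by (simp add: algebra_simps)
     also have "\<i> * of_real \<beta> * (- \<i> / q) = of_real \<beta> * (1 / q)" by (simp add: mult_ac)
     finally show ?thesis .
    qed
    \<comment> \<open>The tangential part of e u has coefficient c; the rest is of size \<beta> and enters as an error.\<close>
    have e_split: "e w = c *s w + \<beta> *R ((1 / q) *s w)" for w
     unfolding e_def eq_c by (simp add: vec_eq_iff algebra_simps scaleR_complex)
    have iq: "norm ((1 / q) *s w) <= 2 * norm w" for w :: "complex ^ 'm"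
    proof -
     have "1 / cmod q <= 1 / (1 / 2)" using q34 by (intro frac_le) auto
     hence "cmod (1 / q) <= 2" by (simp add: norm_divide)
     thus ?thesis unfolding norm_smult by (intro mult_right_mono) auto
    qed
    define p0 where "p0 = x + y *R (c *s u)"
    define p where "p = x + y *R e u"
    define K where "K = V + V + V + 1"
    \<comment> \<open>Velocities must be attained more precisely than required, since the error is divided by y.\<close>
    define eps2 where "eps2 = min eps1 (min 1 (kap * y / (8 * M)))"
    have eps2: "eps2 > 0" "eps2 <= eps1" "eps2 <= 1" "eps2 <= kap * y / (8 * M)" using e1 kap y(1) mM(2) by (auto simp: eps2_def)
    have eps2M: "M * eps2 <= kap * y / 8" using eps2(4) mM(2) by (simp add: field_simps)
    obtain v where v: "v : convex hull (dirs x)" "!!d. d > 0 ==> EX h. 0 < h & h < d & norm (gam (t + h) - gam t - h *R v) <= eps2 * h"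
     using path_dirs[of t eps2] mid[OF t12] tt eps2(1) t(2) unfolding x_def by force
    define lin where "lin = (%p :: (complex ^ 'm) \<times> (complex ^ 'm). (fst p + y *R (c *s snd p)) \<bullet> g p0)"
    define P where "P = {(v, w). rate D (x + s *R u) (v + s *R w) (1 / r)} \<inter> cball 0 V \<times> cball 0 V \<inter> lin -` {- (kap / 4 * y)..kap / 4 * y}"
    have linl: "linear lin" unfolding lin_def
    proof (rule linearI)
     have sa: "c *s (w + w') = c *s w + c *s w'" for w w' :: "complex ^ 'm" by (simp add: vec_eq_iff algebra_simps)
     have ss: "c *s (k *R w) = k *R (c *s w)" for k and w :: "complex ^ 'm" by (simp add: vec_eq_iff)
     show "(fst (a + b) + y *R (c *s snd (a + b))) \<bullet> g p0 = (fst a + y *R (c *s snd a)) \<bullet> g p0 + (fst b + y *R (c *s snd b)) \<bullet> g p0" for a b :: "(complex ^ 'm) \<times> (complex ^ 'm)"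
      by (simp add: sa inner_add_left algebra_simps)
     show "(fst (k *R a) + y *R (c *s snd (k *R a))) \<bullet> g p0 = k *R ((fst a + y *R (c *s snd a)) \<bullet> g p0)" for k and a :: "(complex ^ 'm) \<times> (complex ^ 'm)"
      by (simp add: ss inner_add_left algebra_simps)
    qed
    have "convex P" unfolding P_def
     by (intro convex_Int convex_rate_pairs[OF xs] convex_Times convex_cball convex_linear_vimage[OF linl] convex_real_interval)
    then obtain w where w: "(v, w) : P"
    proof (rule convex_hull_dirs_lift[OF v(1)])
     fix phi assume phi: "phi : cl_discs D" "phi 0 = x"
     have phib: "phi : bdiscs" using bdisc_dichotomy[OF phi(1)] phi(2) x(1) by simp
     obtain \<Psi> k where \<Psi>: "controlled_lift r C phi \<Psi> k" using lift[OF phib] phi(2) x(3) by auto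
     note Psi = controlled_liftD[OF \<Psi>]
     have sub: "ball 0 r <= unit_disc" using r by (intro subset_ball) simp
     have ph: "hol phi i (ball 0 r)" for i using holomorphic_on_subset[OF cl_discsD(1)[OF phi(1)] sub] .
     have frz: "phi z : bdry" if "z : ball 0 r" for z using bdiscsD(2)[OF phib] sub that by blast
     have Pn: "norm (\<Psi> u' z) <= 2 * C" if "z : ball 0 r" "norm u' <= 2" for z u'
     proof -
      have "C * norm u' <= C * 2" using that(2) C(2) by (intro mult_left_mono) auto
      thus ?thesis using Psi(3)[OF that(1), of u'] by linarith
     qed
     have v1: "norm (vder phi) <= V"
     proof (rule vb[OF ph])
      fix z :: complex assume "z : ball 0 r"
      hence "phi z : closure D" using frz frontier_cl by blast
      thus "norm (phi z) <= max Bd (2 * C)" using Bd(2) by (simp add: le_max_iff_disj)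
     qed
     have v2: "norm (vder (\<Psi> u)) <= V" by (rule vb[OF Psi(1)]) (use Pn u2 in \<open>simp add: le_max_iff_disj\<close>)
     define F where "F z = phi z + s *R (\<Psi> u z + 0)" for z
     have "rate D (F 0) (vder F) (1 / r)"
     proof (rule rate_disc[OF dom r(1)])
      show "hol F i (ball 0 r)" for i
       unfolding F_def by (auto simp: scaleR_complex intro!: holomorphic_intros ph Psi(1))
      have "phi z + s *R \<Psi> u z : D" if z: "z : ball 0 r" for z
      proof (rule cone_u[OF frz[OF z] Pn[OF z u2]])
       have "\<Psi> u z \<bullet> N (phi z) = Re (herm (N (phi z)) (\<Psi> u z))" by (simp add: Re_herm inner_commute)
       also have "... = k z * Re q" unfolding Psi(6)[OF z] phi(2) q_def by simp
       finally have "\<Psi> u z \<bullet> N (phi z) = k z * Re q" .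
       moreover have "1 / C * (1 / 4) <= k z * Re q" using Psi(5)[OF z] Rq C by (intro mult_mono) (auto intro: order_trans[of _ "1 / C"])
       ultimately show "1 / (4 * C) <= \<Psi> u z \<bullet> N (phi z)" by simp
      qed
      thus "F ` ball 0 r <= D" unfolding F_def by auto
     qed
     moreover have "F 0 = x + s *R u" by (simp add: F_def Psi(2) phi(2))
     moreover have "vder F = vder phi + s *R vder (\<Psi> u)"
      unfolding F_def by (rule vder_affine[OF ph Psi(1) open_ball]) (use r in simp)
     ultimately have rt: "rate D (x + s *R u) (vder phi + s *R vder (\<Psi> u)) (1 / r)" by simp
     have vc: "vder (\<Psi> (c *s u)) = c *s vder (\<Psi> u)"
     proof -
      have "\<Psi> (c *s u) = (%z. c *s \<Psi> u z)" using Psi(4) by blast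
      thus ?thesis using vder_smult[where f = "\<Psi> u" and c = c, OF Psi(1) open_ball] r by simp
     qed
     have cu2: "norm (c *s u) <= 2" unfolding norm_smult using cn u2 mult_mono[OF cn u2] by simp
     have "\<bar>(vder phi + y *R vder (\<Psi> (c *s u))) \<bullet> g (phi 0 + y *R \<Psi> (c *s u) 0)\<bar> <= (kap / 4) * y"
     proof (rule flat[rule_format, OF phib])
      show "dist (phi 0) a < dc / 8" using x(2) phi(2) dc by simp
      show "(%z. \<Psi> (c *s u) z $ i) holomorphic_on ball 0 r" for i by (rule Psi(1))
      fix z :: complex assume z: "z : ball 0 r"
      have "\<Psi> (c *s u) z \<bullet> N (phi z) = Re (herm (N (phi z)) (\<Psi> (c *s u) z))" by (simp add: Re_herm inner_commute)
      also have "... = Re (of_real (k z) * (c * q))" unfolding Psi(6)[OF z] phi(2) herm_smult_right q_def ..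
      also have "c * q = - \<i> * of_real \<alpha>" using q0 by (simp add: c_def)
      finally have "\<Psi> (c *s u) z \<bullet> N (phi z) = 0" by simp
      thus "norm (\<Psi> (c *s u) z) <= 2 * C & \<Psi> (c *s u) z \<bullet> N (phi z) = 0" using Pn[OF z cu2] by simp
     qed (use y y0 in auto)
     hence "\<bar>lin (vder phi, vder (\<Psi> u))\<bar> <= (kap / 4) * y" unfolding vc Psi(2) phi(2) lin_def p0_def by simp
     hence "- (kap / 4 * y) <= lin (vder phi, vder (\<Psi> u))" "lin (vder phi, vder (\<Psi> u)) <= kap / 4 * y" unfolding abs_le_iff by linarith+
     hence "(vder phi, vder (\<Psi> u)) : P" using rt v1 v2 by (simp add: P_def)
     thus "EX w. (vder phi, w) : P" ..
    qed (rule that)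
    hence w': "rate D (x + s *R u) (v + s *R w) (1 / r)" and vw: "norm v <= V" "norm w <= V"
     and lb: "- (kap / 4 * y) <= lin (v, w)" "lin (v, w) <= kap / 4 * y" by (auto simp: P_def)
    have lin': "\<bar>(v + y *R (c *s w)) \<bullet> g p0\<bar> <= kap / 4 * y" using lb unfolding lin_def fst_conv snd_conv abs_le_iff by linarith
    have cu2: "norm (c *s u) <= 2" unfolding norm_smult using mult_mono[OF cn u2] by simp
    have pb: "p : ball a (dc / 2)" "p0 : ball a (dc / 2)" unfolding p_def p0_def x_def
     by (rule bp[OF t12]; simp add: en u2 cu2)+
    have drift: "\<bar>(v + y *R e w) \<bullet> g p\<bar> <= y * (kap / 4 + \<bar>\<beta>\<bar> * C4)"
    proof -
     have ve: "v + y *R e w = (v + y *R (c *s w)) + (y * \<beta>) *R ((1 / q) *s w)" unfolding e_split by (simp add: algebra_simps)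
     have "(v + y *R e w) \<bullet> g p = (v + y *R (c *s w)) \<bullet> g p0 + (v + y *R (c *s w)) \<bullet> (g p - g p0) + (y * \<beta>) * (((1 / q) *s w) \<bullet> g p)"
      unfolding ve inner_add_left inner_diff_right by simp
     moreover have "\<bar>(v + y *R (c *s w)) \<bullet> (g p - g p0)\<bar> <= (V + 4 * V) * (\<Lambda> * (y * \<bar>\<beta>\<bar> * 4))"
     proof -
      have "norm (v + y *R (c *s w)) <= norm v + y * (cmod c * norm w)"
       using norm_triangle_ineq[of v "y *R (c *s w)"] y(1) by (simp add: norm_smult)
      also have "... <= V + 1 * (1 * V)" using vw cn y(1,3) V by (intro add_mono mult_mono) auto
      finally have 1: "norm (v + y *R (c *s w)) <= V + 4 * V" using V by simp
      have "p - p0 = (y * \<beta>) *R ((1 / q) *s u)" unfolding p_def p0_def e_split by (simp add: algebra_simps)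
      hence "norm (p - p0) = y * \<bar>\<beta>\<bar> * norm ((1 / q) *s u)" using y(1) by (simp add: abs_mult)
      also have "... <= y * \<bar>\<beta>\<bar> * 4" using iq[of u] u2 y(1) by (intro mult_left_mono) auto
      finally have "norm (g p - g p0) <= \<Lambda> * (y * \<bar>\<beta>\<bar> * 4)"
       using chartD(4)[OF ch half[OF pb(1)] half[OF pb(2)]] mult_left_mono[OF _ \<Lambda>] by (meson order_trans)
      thus ?thesis using Cauchy_Schwarz_ineq2[of "v + y *R (c *s w)" "g p - g p0"] 1 V
       by (meson mult_mono norm_ge_zero order_trans add_nonneg_nonneg mult_nonneg_nonneg zero_le_numeral)
     qed
     moreover have "\<bar>(y * \<beta>) * (((1 / q) *s w) \<bullet> g p)\<bar> <= y * \<bar>\<beta>\<bar> * (2 * V * M)"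
     proof -
      have "\<bar>((1 / q) *s w) \<bullet> g p\<bar> <= norm ((1 / q) *s w) * norm (g p)" by (rule Cauchy_Schwarz_ineq2)
      also have "... <= 2 * V * M" using iq[of w] vw(2) mM(4)[OF pb(1)] V by (intro mult_mono) auto
      finally have "\<bar>y * \<beta>\<bar> * \<bar>((1 / q) *s w) \<bullet> g p\<bar> <= \<bar>y * \<beta>\<bar> * (2 * V * M)" by (rule mult_left_mono) simp
      thus ?thesis using y(1) by (simp add: abs_mult)
     qed
     ultimately have "\<bar>(v + y *R e w) \<bullet> g p\<bar> <= kap / 4 * y + (V + 4 * V) * (\<Lambda> * (y * \<bar>\<beta>\<bar> * 4)) + y * \<bar>\<beta>\<bar> * (2 * V * M)"
      using lin' by linarith
     also have "... = y * (kap / 4 + \<bar>\<beta>\<bar> * C4)" by (simp add: C4_def algebra_simps)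
     finally show ?thesis .
    qed
    have "\<bar>\<beta>\<bar> * C4 <= (8 * \<Lambda> * y + kap * (t - t1)) / m * C4" using \<beta>b C4 by (rule mult_right_mono)
    also have "... = (C4 * (8 * \<Lambda> * y) + kap * (C4 * (t - t1))) / m" by (simp add: algebra_simps add_divide_distrib)
    also have "... <= (kap * m / 4 + kap * (m / 8)) / m"
    proof (intro divide_right_mono add_mono yC4 mult_left_mono)
     show "C4 * (t - t1) <= m / 8" using dC4 mult_left_mono[OF mid(3)[OF t12] C4] by linarith
    qed (use kap mM in auto)
    also have "... = 3 / 8 * kap" using mM(1) by (simp add: field_simps)
    finally have \<beta>C4: "\<bar>\<beta>\<bar> * C4 <= 3 / 8 * kap" .
    have drift2: "\<bar>(v + y *R e w) \<bullet> g p\<bar> <= y * (5 / 8 * kap)"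
    proof (rule order_trans[OF drift mult_left_mono])
     show "kap / 4 + \<bar>\<beta>\<bar> * C4 <= 5 / 8 * kap" using \<beta>C4 by linarith
    qed (use y(1) in simp)
    have e_add: "e (u + h *R w) = e u + h *R e w" for h unfolding e_def by (simp add: vec_eq_iff algebra_simps scaleR_complex)
    show "EX v w. rate D (gam t + s *R u) (v + s *R w) (1 / r) &
     (ALL d>0. EX h. 0 < h & h < d & t + h <= t2 & norm (gam (t + h) - gam t - h *R v) <= eps1 * h & Inv (t + h) (u + h *R w))"
    proof (rule exI[of _ v], rule exI[of _ w], intro conjI allI impI)
     show "rate D (gam t + s *R u) (v + s *R w) (1 / r)" using w' by (simp add: x_def)
     fix d' :: real assume d': "d' > 0"
     define h0 where "h0 = Min {d', t2 - t, kap * y / (8 * (\<Lambda> + 1) * K\<^sup>2)}"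
     have K1: "K >= 1" using V by (simp add: K_def)
     have K2: "K\<^sup>2 > 0" using K1 by simp
     have h0: "h0 > 0" "h0 <= d'" "h0 <= t2 - t" "h0 <= kap * y / (8 * (\<Lambda> + 1) * K\<^sup>2)"
      subgoal using d' tt kap y(1) \<Lambda> K2 by (simp add: h0_def)
      unfolding h0_def by (intro Min_le; simp)+
     obtain h where h: "0 < h" "h < h0" "norm (gam (t + h) - gam t - h *R v) <= eps2 * h" using v(2)[OF h0(1)] by blast
     have th: "t + h : {t1..t2}" using h h0 tt by auto
     have i1: "norm (u + h *R w - u1) <= V * (t + h - t1)"
     proof -
      have "norm (u + h *R w - u1) <= norm (u - u1) + h * norm w"
       using norm_triangle_ineq[of "u - u1" "h *R w"] h(1) by (simp add: algebra_simps)
      also have "... <= V * (t - t1) + h * V" using i(1) vw(2) h(1) by (intro add_mono mult_left_mono) auto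
      finally show ?thesis by (simp add: algebra_simps)
     qed
     define R where "R = gam (t + h) - gam t - h *R v"
     define p' where "p' = gam (t + h) + y *R e (u + h *R w)"
     have p'b: "p' : ball a dc" unfolding p'_def by (intro half bp th) (use uu(2)[OF th i1] en in simp)
     have pp: "p' - p = h *R (v + y *R e w) + R" unfolding p'_def p_def e_add R_def x_def by (simp add: algebra_simps)
     have npp: "norm (p' - p) <= h * K"
     proof -
      have "norm (v + y *R e w) <= norm v + y * norm w" using norm_triangle_ineq[of v "y *R e w"] y(1) by (simp add: en)
      also have "... <= V + 1 * V" using vw y V by (intro add_mono mult_mono) auto
      finally have 1: "norm (h *R (v + y *R e w)) <= h * (V + V)" using h(1) by (simp add: mult_left_mono)
      have "norm R <= 1 * h" using h(1,3) eps2(3) mult_right_mono[OF eps2(3), of h] unfolding R_def by linarith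
      hence "norm (p' - p) <= h * (V + V) + h" unfolding pp using norm_triangle_ineq[of "h *R (v + y *R e w)" R] 1 by linarith
      also have "... <= h * K" using h(1) V by (simp add: K_def algebra_simps)
      finally show ?thesis .
     qed
     have "\<bar>gr p' - gr p - (p' - p) \<bullet> g p\<bar> <= \<Lambda> * (norm (p' - p))\<^sup>2" by (rule chart_taylor[OF ch half[OF pb(1)] p'b])
     also have "... <= \<Lambda> * (h * K)\<^sup>2" by (intro mult_left_mono power_mono npp \<Lambda>) simp
     also have "... <= h * (kap * y / 8)"
     proof -
      have "h * (8 * (\<Lambda> + 1) * K\<^sup>2) <= kap * y"
      proof -
       have pos: "8 * (\<Lambda> + 1) * K\<^sup>2 > 0" using \<Lambda> K2 by simp
       have "h <= kap * y / (8 * (\<Lambda> + 1) * K\<^sup>2)" using h(2) h0(4) by linarith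
       thus ?thesis unfolding pos_le_divide_eq[OF pos] .
      qed
      moreover have "h * (8 * \<Lambda> * K\<^sup>2) <= h * (8 * (\<Lambda> + 1) * K\<^sup>2)" using h(1) K2 by (intro mult_left_mono mult_right_mono) auto
      ultimately have "h * (8 * \<Lambda> * K\<^sup>2) <= kap * y" by linarith
      hence "h * (h * (8 * \<Lambda> * K\<^sup>2)) <= h * (kap * y)" using h(1) by (intro mult_left_mono) auto
      thus ?thesis by (simp add: power2_eq_square mult_ac)
     qed
     finally have t1': "\<bar>gr p' - gr p - (p' - p) \<bullet> g p\<bar> <= h * (kap * y / 8)" .
     have "\<bar>R \<bullet> g p\<bar> <= norm R * norm (g p)" by (rule Cauchy_Schwarz_ineq2)
     also have "... <= eps2 * h * M" using h(1,3) mM(4)[OF pb(1)] eps2(1) unfolding R_def by (intro mult_mono) auto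
     also have "... <= h * (kap * y / 8)" using mult_left_mono[OF eps2M, of h] h(1) by (simp add: mult_ac)
     finally have t2': "\<bar>R \<bullet> g p\<bar> <= h * (kap * y / 8)" .
     have t3': "\<bar>h * ((v + y *R e w) \<bullet> g p)\<bar> <= h * (y * (5 / 8 * kap))"
      using mult_left_mono[OF drift2, of h] h(1) by (simp add: abs_mult)
     have "(p' - p) \<bullet> g p = h * ((v + y *R e w) \<bullet> g p) + R \<bullet> g p" by (simp add: pp inner_add_left algebra_simps)
     hence "\<bar>gr p' - gr p\<bar> <= h * (y * (5 / 8 * kap)) + h * (kap * y / 8) + h * (kap * y / 8)"
      using t1' t2' t3' by linarith
     also have "... <= y * (kap * h)" using h(1) y(1) kap by (simp add: algebra_simps)
     finally have "\<bar>gr p' - gr p\<bar> / y <= kap * h" using y(1) by (simp add: pos_divide_le_eq mult.commute)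
     moreover have "X (t + h) (u + h *R w) - X t u = (gr p' - gr p) / y" by (simp add: X_def p'_def p_def x_def diff_divide_distrib)
     ultimately have "\<bar>X (t + h) (u + h *R w) - X t u\<bar> <= kap * h" using y(1) by (simp add: abs_divide)
     hence "\<bar>X (t + h) (u + h *R w)\<bar> <= 4 * \<Lambda> * y + kap * (t - t1) + kap * h" using i(2) by linarith
     hence "Inv (t + h) (u + h *R w)" using th i1 by (simp add: Inv_def algebra_simps)
     moreover have "norm (gam (t + h) - gam t - h *R v) <= eps1 * h" using h(1,3) mult_right_mono[OF eps2(2), of h] by linarith
     ultimately show "EX h>0. h < d' & t + h <= t2 & norm (gam (t + h) - gam t - h *R v) <= eps1 * h & Inv (t + h) (u + h *R w)"
      using h h0 by (intro exI[of _ h]) auto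
    qed
   qed
   then obtain u2 where inv2: "Inv t2 u2" and kob: "kob (gam t1 + s *R u1) (gam t2 + s *R u2) <= l' * (t2 - t1)" by blast
   have i2: "norm (u2 - u1) <= V * (t2 - t1)" using inv2 by (simp add: Inv_def)
   define q where "q = herm (N (gam t2)) u2"
   have s': "s < sr" using s by simp
   note rs = sr(2)[OF mid(5)[OF m1(2)] uu(2)[OF m1(2) i2] Req[OF m1(2) i2] s(1) s', folded q_def]
   have qq2: "cmod (q / q1 - 1) <= 1 / 4" using qq[OF m1(2) i2] by (simp add: q_def)
   have Re34: "3 / 4 <= Re (q / q1)" using abs_Re_le_cmod[of "q / q1 - 1"] qq2 by simp
   have cq: "cmod (q / q1) = cmod q" using q1(1) by (simp add: norm_divide)
   have q34: "3 / 4 <= cmod q" "cmod q <= 2"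
    using complex_Re_le_cmod[of "q / q1"] Re34 cq norm_triangle_ineq2[of "q / q1" 1] qq2 by auto
   hence q0: "q ~= 0" by auto
   define q2 where "q2 = q / of_real (cmod q)"
   define s2 where "s2 = s * cmod q"
   have t1i: "Inv t1 u1" using tan_err[OF m1(1), of u1] u1n hu1 q10 m1 by (simp add: Inv_def)
   have "q2 - q1 = q1 * ((q / q1) / of_real (cmod (q / q1)) - 1)" unfolding cq q2_def using q10 q0 by (simp add: field_simps)
   hence "cmod (q2 - q1) = cmod ((q / q1) / of_real (cmod (q / q1)) - 1)" using q1(1) by (simp add: norm_mult)
   also have "... <= 4 * \<bar>Im (q / q1)\<bar>" by (rule unit_normalise_close[OF Re34])
   also have "\<bar>Im (q / q1)\<bar> <= (8 * \<Lambda> * y + kap * (t2 - t1)) / m" using beta[OF inv2] by (simp add: q_def)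
   also have "... <= (eps * m / 16 + eps * m / 16) / m"
   proof (intro divide_right_mono)
    have "kap * (t2 - t1) <= kap * (2 * d)" using mid(3)[OF m1(2)] kap by (intro mult_left_mono) auto
    thus "8 * \<Lambda> * y + kap * (t2 - t1) <= eps * m / 16 + eps * m / 16" using yL kapd by linarith
   qed (use mM(1) in simp)
   also have "... = eps / 8" using mM(1) by (simp add: field_simps)
   finally have "cmod (q2 - q1) <= eps" using eps by simp
   moreover have "cmod q2 = 1" using q0 by (simp add: q2_def norm_divide)
   moreover have "s / 2 <= s2" "s2 <= 2 * s" using q34 s(1) by (auto simp: s2_def)
   moreover have sq: "s2 *R (q2 *s n) = s *R (q *s n)" for n :: "complex ^ 'm"
    using q0 by (simp add: s2_def q2_def vec_eq_iff scaleR_complex)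
   moreover have "kob (gam t1 + s *R u1) (lifted t2 s q) <= l' * (t2 - t1) + eps"
    using kobayashi_triangle[OF dom inD[OF t1i] inD[OF inv2] conjunct1[OF conjunct2[OF rs]]] kob conjunct2[OF conjunct2[OF rs]] by linarith
   ultimately show "slid l' eps t1 t2 s q1"
    using inD[OF t1i] rs unfolding u1_def by (intro exI[of _ q2] exI[of _ s2]) auto
  qed
 qed
qed

end

section \<open>Paths of discs and their limits\<close>

lemma tanh_artanh_real:
 fixes r :: real
 assumes "0 <= r" "r < 1"
 shows "tanh (artanh r) = r"
proof -
 have "exp (- 2 * artanh r) = exp (- ln ((1 + r) / (1 - r)))" by (simp add: artanh_def)
 also have "... = inverse ((1 + r) / (1 - r))" using assms by (subst exp_minus) simp
 finally have e: "exp (- 2 * artanh r) = (1 - r) / (1 + r)" by simp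
 have "1 - (1 - r) / (1 + r) = 2 * r / (1 + r)" "1 + (1 - r) / (1 + r) = 2 / (1 + r)" using assms by (simp_all add: field_simps)
 thus ?thesis unfolding tanh_real_altdef e using assms by simp
qed

lemma cosh_real_neq_0: "cosh (x :: real) ~= 0"
 using cosh_real_pos[of x] by simp

lemma tanh_near_zero:
 assumes "e > 0"
 obtains d :: real where "d > 0" "!!h. 0 < h ==> h < d ==> \<bar>tanh h - h\<bar> <= e * h"
proof -
 have "((tanh :: real => real) has_field_derivative 1) (at 0)" by (auto intro!: derivative_eq_intros)
 hence "((%h::real. (tanh (0 + h) - tanh 0) / h) \<longlongrightarrow> 1) (at 0)" unfolding DERIV_def .
 from LIM_D[OF this assms] obtain d where d: "d > 0" "!!h::real. h ~= 0 ==> norm (h - 0) < d ==> norm ((tanh (0 + h) - tanh 0) / h - 1) < e"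
  by blast
 show ?thesis
 proof (rule that[OF d(1)])
  fix h :: real assume h: "0 < h" "h < d"
  have "\<bar>tanh h / h - 1\<bar> < e" using d(2)[of h] h by simp
  hence "\<bar>tanh h / h - 1\<bar> * h <= e * h" using h(1) by (intro mult_right_mono) auto
  moreover have "\<bar>tanh h / h - 1\<bar> * h = \<bar>(tanh h / h - 1) * h\<bar>" using h(1) by (simp add: abs_mult)
  moreover have "(tanh h / h - 1) * h = tanh h - h" using h(1) by (simp add: algebra_simps)
  ultimately show "\<bar>tanh h - h\<bar> <= e * h" by simp
 qed
qed

text \<open>At each time the path continues along a disc centred at the current point, at unit hyperbolic speed.\<close>
definition disc_path :: "(complex ^ 'm) set => real => (real => complex ^ 'm) => bool" where
 "disc_path G T gam \<longleftrightarrow> 0 <= T & continuous_on {0..T} gam & gam ` {0..T} <= G &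
   (ALL t. 0 <= t --> t < T --> (EX F:discs_in G. EX d>0. ALL h. 0 <= h --> h < d --> gam (t + h) = F (of_real (tanh h))))"

lemma disc_pathD:
 assumes "disc_path G T gam"
 shows "0 <= T" "continuous_on {0..T} gam" "t : {0..T} ==> gam t : G"
  "0 <= t ==> t < T ==> EX F:discs_in G. EX d>0. ALL h. 0 <= h --> h < d --> gam (t + h) = F (of_real (tanh h))"
 using assms unfolding disc_path_def by blast+

lemma const_disc: "x : G ==> (%_. x) : discs_in G"
 unfolding discs_in_def by auto

lemma disc_path_const: "x : G ==> 0 <= T ==> disc_path G T (%_. x)"
 unfolding disc_path_def using const_disc[of x G] by (auto intro!: bexI[of _ "%_. x"] exI[of _ 1])

text \<open>A hyperbolic geodesic ray; recentring the disc by a Moebius map is the addition theorem of tanh.\<close>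
lemma disc_path_disc:
 assumes f: "f : discs_in G" and t: "t : unit_disc"
 obtains gam where "disc_path G (artanh (cmod t)) gam" "gam 0 = f 0" "gam (artanh (cmod t)) = f t"
proof -
 define e where "e = (if t = 0 then 1 else t / of_real (cmod t))"
 have e: "cmod e = 1" "of_real (cmod t) * e = t" by (auto simp: e_def norm_divide)
 have ct: "0 <= cmod t" "cmod t < 1" using t by auto
 define gam where "gam s = f (of_real (tanh s) * e)" for s
 have fh: "hol f i unit_disc" for i using f unfolding discs_in_def by blast
 have fG: "f z : G" if "z : unit_disc" for z using f that unfolding discs_in_def by blast
 have ts: "\<bar>tanh s\<bar> < 1" for s :: real using tanh_real_bounds[of s] by auto
 have in_disc: "of_real (tanh s) * e : unit_disc" for s :: real using ts[of s] e(1) by (simp add: norm_mult)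
 have T0: "0 <= artanh (cmod t)" using hyp_dist_zero_nonneg[OF t] by (simp add: hyp_dist_zero_left)
 have "continuous_on {0..artanh (cmod t)} gam" unfolding gam_def
 proof (rule continuous_on_compose2[OF holomorphic_vec_imp_continuous_on[OF fh]])
  have "continuous_on {0..artanh (cmod t)} (tanh :: real => real)" by (intro continuous_on_tanh continuous_on_id) (simp add: cosh_real_neq_0)
  thus "continuous_on {0..artanh (cmod t)} (%s. of_real (tanh s) * e)"
   by (intro continuous_on_mult continuous_on_of_real continuous_on_const)
 qed (use in_disc in blast)
 moreover have "gam ` {0..artanh (cmod t)} <= G" unfolding gam_def using fG[OF in_disc] by blast
 moreover have "EX F:discs_in G. EX d>0. ALL h. 0 <= h --> h < d --> gam (s + h) = F (of_real (tanh h))" for s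
 proof -
  define a where "a = - complex_of_real (tanh s)"
  have a1: "cmod a < 1" using ts[of s] by (simp add: a_def)
  define F where "F z = f (Moebius_function 0 a z * e)" for z
  have mz: "Moebius_function 0 a z * e : unit_disc" if "z : unit_disc" for z
   using Moebius_function_norm_lt_1[OF a1, of z 0] that e(1) by (simp add: norm_mult)
  have "(%z. Moebius_function 0 a z * e) holomorphic_on unit_disc"
   by (intro holomorphic_intros Moebius_function_holomorphic[OF a1])
  hence "hol F i unit_disc" for i
   unfolding F_def using holomorphic_on_compose_gen[OF _ fh, of "%z. Moebius_function 0 a z * e", unfolded o_def] mz by blast
  hence "F : discs_in G" unfolding discs_in_def using fG[OF mz] unfolding F_def by blast
  moreover have "gam (s + h) = F (of_real (tanh h))" for h
  proof -
   have "tanh (s + h) = (tanh s + tanh h) / (1 + tanh s * tanh h)" by (rule tanh_add) (simp_all add: cosh_real_neq_0)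
   hence "Moebius_function 0 a (of_real (tanh h)) = of_real (tanh (s + h))"
    by (simp add: Moebius_function_simple a_def add.commute)
   thus ?thesis by (simp add: F_def gam_def)
  qed
  ultimately show ?thesis by (intro bexI[of _ F] exI[of _ 1]) auto
 qed
 ultimately have "disc_path G (artanh (cmod t)) gam" unfolding disc_path_def using T0 by blast
 moreover have "gam 0 = f 0" by (simp add: gam_def)
 moreover have "gam (artanh (cmod t)) = f t" unfolding gam_def tanh_artanh_real[OF ct] e(2) ..
 ultimately show ?thesis by (rule that)
qed

lemma disc_path_append:
 assumes 1: "disc_path G T1 gam1" and 2: "disc_path G T2 gam2" and eq: "gam1 T1 = gam2 0"
 obtains gam where "disc_path G (T1 + T2) gam" "gam 0 = gam1 0" "gam (T1 + T2) = gam2 T2"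
proof -
 note p1 = disc_pathD[OF 1] and p2 = disc_pathD[OF 2]
 define gam where "gam t = (if t <= T1 then gam1 t else gam2 (t - T1))" for t
 have late: "gam t = gam2 (t - T1)" if "t >= T1" for t using that eq by (auto simp: gam_def)
 have "continuous_on {0..T1 + T2} gam" unfolding gam_def
 proof (rule continuous_on_cases_le)
  show "continuous_on {x : {0..T1 + T2}. x <= T1} gam1" by (rule continuous_on_subset[OF p1(2)]) auto
  show "continuous_on {x : {0..T1 + T2}. T1 <= x} (%t. gam2 (t - T1))"
   by (rule continuous_on_compose2[OF p2(2)]) (auto intro!: continuous_intros)
 qed (use eq in \<open>auto intro: continuous_intros\<close>)
 moreover have "gam ` {0..T1 + T2} <= G"
 proof
  fix x assume "x : gam ` {0..T1 + T2}"
  then obtain t where t: "0 <= t" "t <= T1 + T2" "x = gam t" by auto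
  show "x : G"
  proof (cases "t <= T1")
   case True
   thus ?thesis using p1(3)[of t] t by (simp add: gam_def)
  next
   case False
   thus ?thesis using p2(3)[of "t - T1"] t by (simp add: gam_def)
  qed
 qed
 moreover have "EX F:discs_in G. EX d>0. ALL h. 0 <= h --> h < d --> gam (t + h) = F (of_real (tanh h))" if t: "0 <= t" "t < T1 + T2" for t
 proof (cases "t < T1")
  case True
  obtain F d where F: "F : discs_in G" "d > 0" "!!h. 0 <= h ==> h < d ==> gam1 (t + h) = F (of_real (tanh h))"
   using p1(4)[OF t(1) True] by blast
  thus ?thesis using True by (intro bexI[of _ F] exI[of _ "min d (T1 - t)"]) (auto simp: gam_def)
 next
  case False
  then obtain F d where F: "F : discs_in G" "d > 0" "!!h. 0 <= h ==> h < d ==> gam2 (t - T1 + h) = F (of_real (tanh h))"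
   using p2(4)[of "t - T1"] t by auto
  have "gam (t + h) = F (of_real (tanh h))" if "0 <= h" "h < d" for h
   using late[of "t + h"] F(3)[OF that] False that by (simp add: algebra_simps)
  thus ?thesis using F(1,2) by blast
 qed
 ultimately have "disc_path G (T1 + T2) gam" unfolding disc_path_def using p1(1) p2(1) by auto
 moreover have "gam 0 = gam1 0" using p1(1) by (simp add: gam_def)
 moreover have "gam (T1 + T2) = gam2 T2" using late[of "T1 + T2"] p2(1) by simp
 ultimately show ?thesis by (rule that)
qed

lemma disc_path_along_points:
 assumes G: "domain G" and p: "!!j. j <= n ==> p j : G" and c: "chain_len G n p < c"
 shows "EX gam. disc_path G c gam & gam 0 = p 0 & gam c = p n"
 using p c
proof (induction n arbitrary: c)
 case 0
 hence "0 <= c" by (simp add: chain_len_def)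
 thus ?case using disc_path_const[of "p 0" G c] 0 by auto
next
 case (Suc n)
 have len: "chain_len G (Suc n) p = chain_len G n p + lempert G (p n) (p (Suc n))" by (simp add: chain_len_def)
 define eps where "eps = (c - chain_len G (Suc n) p) / 2"
 have eps: "eps > 0" using Suc.prems(2) by (simp add: eps_def)
 define T1 where "T1 = chain_len G n p + eps"
 have "chain_len G n p < T1" using eps by (simp add: T1_def)
 then obtain gam1 where g1: "disc_path G T1 gam1" "gam1 0 = p 0" "gam1 T1 = p n" using Suc.IH[of T1] Suc.prems(1) by force
 have pn: "p n : G" "p (Suc n) : G" using Suc.prems(1) by auto
 obtain psi s where psi: "psi : discs_in G" "psi 0 = p n" "psi s = p (Suc n)" "s : unit_disc"
  by (rule domain_disc_through[OF G pn])
 have "lempert G (p n) (p (Suc n)) < lempert G (p n) (p (Suc n)) + eps" using eps by simp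
 then obtain f t where f: "f : discs_in G" "f 0 = p n" "f t = p (Suc n)" "t : unit_disc" "hyp_dist 0 t < lempert G (p n) (p (Suc n)) + eps"
  by (rule lempert_approx[OF psi])
 define T2 where "T2 = artanh (cmod t)"
 obtain gam2 where g2: "disc_path G T2 gam2" "gam2 0 = p n" "gam2 T2 = p (Suc n)"
  using disc_path_disc[OF f(1,4)] f(2,3) unfolding T2_def by metis
 have "gam1 T1 = gam2 0" using g1(3) g2(2) by simp
 then obtain gam3 where g3: "disc_path G (T1 + T2) gam3" "gam3 0 = p 0" "gam3 (T1 + T2) = p (Suc n)"
  using disc_path_append[OF g1(1) g2(1)] g1(2) g2(3) by metis
 have "T1 + T2 <= c" using f(5) unfolding T1_def T2_def eps_def len hyp_dist_zero_left by (simp add: field_simps)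
 hence "disc_path G (c - (T1 + T2)) (%_. p (Suc n))" using disc_path_const[OF pn(2)] by simp
 from disc_path_append[OF g3(1) this g3(3)] obtain gam where "disc_path G (T1 + T2 + (c - (T1 + T2))) gam" "gam 0 = gam3 0" "gam (T1 + T2 + (c - (T1 + T2))) = p (Suc n)"
  by metis
 thus ?case using g3(2) by auto
qed

lemma disc_path_kobayashi:
 assumes G: "domain G" "z : G" "w : G" and L: "kobayashi G z w < L"
 shows "EX gam. disc_path G L gam & gam 0 = z & gam L = w"
proof -
 obtain n p where p: "chain G n p z w" "chain_len G n p < L" by (rule kobayashi_approx[OF G L])
 hence "!!j. j <= n ==> p j : G" "p 0 = z" "p n = w" unfolding chain_def by auto
 thus ?thesis using disc_path_along_points[OF G(1) _ p(2)] by auto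
qed

lemma disc_path_right_derivative:
 fixes gam :: "real => complex ^ 'm"
 assumes g: "disc_path G T gam" and B: "!!x. x : G ==> norm x <= B" and t: "0 <= t" "t < T"
 obtains F where "F : discs_in G" "F 0 = gam t"
  "!!e. e > 0 ==> EX d>0. ALL h. 0 < h --> h < d --> norm (gam (t + h) - gam t - h *R vder F) <= e * h"
proof -
 obtain F d where F: "F : discs_in G" "d > 0" "!!h. 0 <= h ==> h < d ==> gam (t + h) = F (of_real (tanh h))"
  using disc_pathD(4)[OF g t] by blast
 have F0: "F 0 = gam t" using F(3)[of 0] F(2) by simp
 have Fh: "ALL i. hol F i unit_disc" and FG: "!!z. z : unit_disc ==> F z : G"
  using F(1) unfolding discs_in_def by blast+
 have "F 0 : G" using FG[of 0] by simp
 hence B0: "0 <= B" using B norm_ge_zero order_trans by blast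
 have half: "(1 / 2 :: real) > 0" and one: "2 * (1 / 2 :: real) = 1" by auto
 obtain K where K: "K >= 0" "ALL f :: complex => complex ^ 'm. (ALL i. hol f i unit_disc) --> (ALL z:unit_disc. norm (f z) <= B) -->
  (EX f'. f' 0 = vder f & (ALL z:ball 0 (1 / 2). norm (f' z) <= K) & (ALL z:ball 0 (1 / 2). ALL w:ball 0 (1 / 2). norm (f z - f w - (z - w) *s f' w) <= K * (cmod (z - w))\<^sup>2))"
  using holomorphic_quadratic_bound[OF half B0, where 'm = 'm] unfolding one by blast
 have "ALL z:unit_disc. norm (F z) <= B" using B FG by blast
 from mp[OF mp[OF spec[OF K(2), of F] Fh] this] obtain f' where f': "f' 0 = vder F & (ALL z:ball 0 (1 / 2). norm (f' z) <= K) &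
  (ALL z:ball 0 (1 / 2). ALL w:ball 0 (1 / 2). norm (F z - F w - (z - w) *s f' w) <= K * (cmod (z - w))\<^sup>2)" by (rule exE)
 have z0: "(0::complex) : ball 0 (1 / 2)" by simp
 have quad: "norm (F z - F 0 - z *s vder F) <= K * (cmod z)\<^sup>2" if "z : ball 0 (1 / 2)" for z
  using bspec[OF bspec[OF conjunct2[OF conjunct2[OF f']] that] z0] conjunct1[OF f'] by simp
 have vK: "norm (vder F) <= K" using bspec[OF conjunct1[OF conjunct2[OF f']] z0] conjunct1[OF f'] by simp
 show ?thesis
 proof (rule that[OF F(1) F0])
  fix e :: real assume e: "e > 0"
  define e1 where "e1 = min 1 (e / (2 * (K + 1)))"
  have e1: "e1 > 0" "e1 <= 1" "e1 <= e / (2 * (K + 1))" using e K(1) by (auto simp: e1_def)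
  have e1K: "e1 * K <= e / 2"
  proof -
   have "e1 * (2 * (K + 1)) <= e" using e1(3) K(1) by (simp add: pos_le_divide_eq)
   thus ?thesis using e1(1) by (simp add: algebra_simps)
  qed
  obtain d1 where d1: "d1 > 0" "!!h. 0 < h ==> h < d1 ==> \<bar>tanh h - h\<bar> <= e1 * h" by (rule tanh_near_zero[OF e1(1)]) (rule that)
  define d2 where "d2 = Min {d, d1, 1 / 8, e / (8 * (K + 1))}"
  have d2: "d2 > 0" "d2 <= d" "d2 <= d1" "d2 <= 1 / 8" "d2 <= e / (8 * (K + 1))"
   subgoal using F(2) d1(1) e K(1) by (simp add: d2_def)
   unfolding d2_def by (intro Min_le; simp)+
  show "EX d>0. ALL h. 0 < h --> h < d --> norm (gam (t + h) - gam t - h *R vder F) <= e * h"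
  proof (intro exI[of _ d2] conjI allI impI d2(1))
   fix h :: real assume h: "0 < h" "h < d2"
   have th: "\<bar>tanh h - h\<bar> <= e1 * h" using d1(2)[of h] h d2(3) by simp
   also have "... <= 1 * h" using e1(2) h(1) by (intro mult_right_mono) auto
   finally have th2: "\<bar>tanh h\<bar> <= 2 * h" by linarith
   hence tb: "complex_of_real (tanh h) : ball 0 (1 / 2)" using h(2) d2(4) by simp
   have geq: "gam (t + h) = F (of_real (tanh h))" using F(3)[of h] h d2(2) by simp
   have sc: "of_real (tanh h) *s vder F = h *R vder F + (tanh h - h) *R vder F"
    by (simp add: vec_eq_iff scaleR_complex algebra_simps)
   have "norm (gam (t + h) - gam t - h *R vder F) = norm ((F (of_real (tanh h)) - F 0 - of_real (tanh h) *s vder F) + (tanh h - h) *R vder F)"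
    unfolding geq F0[symmetric] sc by (simp add: algebra_simps)
   also have "... <= K * (cmod (of_real (tanh h)))\<^sup>2 + \<bar>tanh h - h\<bar> * norm (vder F)"
    using norm_triangle_ineq[of "F (of_real (tanh h)) - F 0 - of_real (tanh h) *s vder F" "(tanh h - h) *R vder F"] quad[OF tb] by simp
   also have "... <= K * (2 * h)\<^sup>2 + e1 * h * K"
   proof (intro add_mono mult_left_mono mult_mono th vK K(1))
    show "(cmod (of_real (tanh h)))\<^sup>2 <= (2 * h)\<^sup>2" using th2 by (intro power_mono) auto
   qed (use e1(1) h(1) in auto)
   also have "... <= e * h"
   proof -
    have "h <= e / (8 * (K + 1))" using h(2) d2(5) by linarith
    hence "h * (8 * (K + 1)) <= e" using K(1) by (simp add: pos_le_divide_eq)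
    hence "4 * K * h <= e / 2" using h(1) by (simp add: algebra_simps)
    hence "4 * K * h * h + e1 * K * h <= e / 2 * h + e / 2 * h" using e1K h(1) by (intro add_mono mult_right_mono) auto
    thus ?thesis by (simp add: power2_eq_square algebra_simps)
   qed
   finally show "norm (gam (t + h) - gam t - h *R vder F) <= e * h" .
  qed
 qed
qed

text \<open>A mean value inequality for right derivatives, by the last time up to which it holds.\<close>
lemma right_slope_bound:
 fixes f :: "real => real"
 assumes ab: "a <= b" and cont: "continuous_on {a..b} f"
  and step: "!!t e. a <= t ==> t < b ==> e > 0 ==> EX h>0. t + h <= b & f (t + h) <= f t + (c + e) * h"
 shows "f b <= f a + c * (b - a)"
proof -
 have main: "f b <= f a + (c + e) * (b - a)" if e: "e > 0" for e
 proof -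
  define S where "S = {t : {a..b}. f t - (c + e) * (t - a) <= f a}"
  have cS: "compact S" unfolding S_def
  proof (rule compact_Icc[THEN closedin_compact])
   have "continuous_on {a..b} (%t. f t - (c + e) * (t - a))" by (intro continuous_intros cont)
   from continuous_closedin_preimage[OF this closed_atMost[of "f a"]]
   show "closedin (top_of_set {a..b}) {t : {a..b}. f t - (c + e) * (t - a) <= f a}" by (simp add: vimage_def Int_def)
  qed
  have aS: "a : S" using ab by (simp add: S_def)
  obtain t where t: "t : S" "!!x. x : S ==> x <= t" using compact_attains_sup[OF cS] aS by blast
  have "t = b"
  proof (rule ccontr)
   assume "t ~= b"
   hence tt: "a <= t" "t < b" using t(1) by (auto simp: S_def)
   obtain h where h: "h > 0" "t + h <= b" "f (t + h) <= f t + (c + e) * h" using step[OF tt e] by blast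
   have "t + h : S" using h t(1) by (simp add: S_def algebra_simps)
   thus False using t(2) h(1) by force
  qed
  thus ?thesis using t(1) by (simp add: S_def)
 qed
 show ?thesis
 proof (rule field_le_epsilon)
  fix e :: real assume e: "e > 0"
  have "f b <= f a + (c + e / (b - a + 1)) * (b - a)" by (rule main) (use e ab in simp)
  also have "... = f a + c * (b - a) + e * ((b - a) / (b - a + 1))" by (simp add: algebra_simps)
  also have "e * ((b - a) / (b - a + 1)) <= e * 1" using e ab by (intro mult_left_mono) auto
  finally show "f b <= f a + c * (b - a) + e" by simp
 qed
qed

text \<open>Increments of the path in direction a are controlled by the derivatives of discs centred on it; this is used with supporting functionals of convex sets.\<close>
lemma disc_path_direction:
 fixes gam :: "real => complex ^ 'm"
 assumes g: "disc_path G T gam" and B: "!!x. x : G ==> norm x <= B" and t: "0 <= t1" "t1 <= t2" "t2 <= T"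
  and dir: "!!t F. t1 <= t ==> t < t2 ==> F : discs_in G ==> F 0 = gam t ==> a \<bullet> vder F <= b"
 shows "a \<bullet> (gam t2 - gam t1) <= b * (t2 - t1)"
proof -
 have "a \<bullet> gam t2 <= a \<bullet> gam t1 + b * (t2 - t1)"
 proof (rule right_slope_bound[OF t(2)])
  show "continuous_on {t1..t2} (%t. a \<bullet> gam t)"
   by (intro continuous_intros continuous_on_subset[OF disc_pathD(2)[OF g]]) (use t in auto)
  fix s e :: real assume s: "t1 <= s" "s < t2" and e: "e > 0"
  have s': "0 <= s" "s < T" using s t by auto
  obtain F where F: "F : discs_in G" "F 0 = gam s"
   and Fd: "!!e. e > 0 ==> EX d>0. ALL h. 0 < h --> h < d --> norm (gam (s + h) - gam s - h *R vder F) <= e * h"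
   using disc_path_right_derivative[OF g B s'] by blast
  define e1 where "e1 = e / (norm a + 1)"
  have e1: "e1 > 0" "norm a * e1 <= e" using e by (auto simp: e1_def field_simps add_pos_nonneg)
  obtain d where d: "d > 0" "!!h. 0 < h ==> h < d ==> norm (gam (s + h) - gam s - h *R vder F) <= e1 * h" using Fd[OF e1(1)] by blast
  define h where "h = min (d / 2) (t2 - s)"
  have h: "h > 0" "h < d" "s + h <= t2" using d(1) s by (auto simp: h_def)
  have "a \<bullet> (gam (s + h) - gam s - h *R vder F) <= norm a * (e1 * h)"
   by (rule order_trans[OF norm_cauchy_schwarz mult_left_mono[OF d(2)[OF h(1,2)] norm_ge_zero]])
  also have "... <= e * h" using mult_right_mono[OF e1(2), of h] h(1) by (simp add: mult.assoc)
  finally have "a \<bullet> gam (s + h) <= a \<bullet> gam s + h * (a \<bullet> vder F) + e * h" by (simp add: inner_diff_right)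
  moreover have "h * (a \<bullet> vder F) <= h * b" using dir[OF s F] h(1) by (intro mult_left_mono) auto
  ultimately have "a \<bullet> gam (s + h) <= a \<bullet> gam s + (b + e) * h" by (simp add: algebra_simps)
  thus "EX h>0. s + h <= t2 & a \<bullet> gam (s + h) <= a \<bullet> gam s + (b + e) * h" using h by blast
 qed
 thus ?thesis by (simp add: inner_diff_right)
qed

lemma disc_path_lipschitz:
 fixes gam :: "real => complex ^ 'm"
 assumes g: "disc_path G T gam" and B: "!!x. x : G ==> norm x <= B" and t: "0 <= t1" "t1 <= t2" "t2 <= T"
  and V: "!!F. F : discs_in G ==> norm (vder F) <= V"
 shows "norm (gam t2 - gam t1) <= V * (t2 - t1)"
proof (cases "gam t2 = gam t1")
 case True
 have "gam t1 : G" using disc_pathD(3)[OF g, of t1] t by simp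
 hence "0 <= V" using V[OF const_disc] norm_ge_zero order_trans by blast
 thus ?thesis using True t by simp
next
 case False
 define u where "u = gam t2 - gam t1"
 define a where "a = u /\<^sub>R norm u"
 have u0: "norm u > 0" using False by (simp add: u_def)
 have na: "norm a = 1" using u0 by (simp add: a_def)
 have "a \<bullet> u <= V * (t2 - t1)" unfolding u_def
 proof (rule disc_path_direction[OF g B t])
  fix t F assume "F : discs_in G"
  thus "a \<bullet> vder F <= V" using V[of F] norm_cauchy_schwarz[of a "vder F"] na by simp
 qed
 moreover have "a \<bullet> u = norm u" using u0 by (simp add: a_def dot_square_norm power2_eq_square)
 ultimately show ?thesis by (simp add: u_def)
qed

lemma vder_tendsto:
 fixes f :: "nat => complex => complex ^ 'm"
 assumes f: "!!n i. hol (f n) i unit_disc" and g: "!!i. hol g i unit_disc"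
  and ul: "uniform_limit (cball 0 (1 / 2)) f g sequentially"
 shows "(%n. vder (f n)) ----> vder g"
proof (rule tendstoI)
 fix e :: real assume e: "e > 0"
 obtain V where V: "V >= 0" "ALL f :: complex => complex ^ 'm. (ALL i. hol f i (ball 0 (1 / 2))) --> (ALL z:ball 0 (1 / 2). norm (f z) <= 1) --> norm (vder f) <= V"
  using vder_bound[of "1 / 2" 1, where 'm = 'm] by auto
 define d where "d = e / (V + 1)"
 have d: "d > 0" "d * V < e" using e V(1) by (auto simp: d_def field_simps)
 have sub: "ball (0::complex) (1 / 2) <= unit_disc" "ball (0::complex) (1 / 2) <= cball 0 (1 / 2)" by auto
 have "EVS n. ALL z:cball 0 (1 / 2). dist (f n z) (g z) < d" using uniform_limitD[OF ul d(1)] .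
 thus "EVS n. dist (vder (f n)) (vder g) < e"
 proof eventually_elim
  case (elim n)
  have fh: "hol (f n) i (ball 0 (1 / 2))" and gh: "hol g i (ball 0 (1 / 2))" for i
   using holomorphic_on_subset[OF f sub(1)] holomorphic_on_subset[OF g sub(1)] by blast+
  define k where "k z = f n z + (- 1) *R (g z + 0)" for z
  have kh: "hol k i (ball 0 (1 / 2))" for i
   unfolding k_def by (auto simp: scaleR_complex intro!: holomorphic_intros fh gh)
  have z0: "(0::complex) : ball 0 (1 / 2)" by simp
  have vk: "vder k = vder (f n) + (- 1) *R vder g" unfolding k_def by (rule vder_affine[OF fh gh open_ball z0])
  have kd: "norm (k z) <= d" if "z : ball 0 (1 / 2)" for z
  proof -
   have "dist (f n z) (g z) < d" using elim that sub(2) by blast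
   thus ?thesis by (simp add: k_def dist_norm)
  qed
  define c where "c = complex_of_real (1 / d)"
  have "norm (vder (%z. c *s k z)) <= V"
  proof (rule V(2)[rule_format])
   show "(%z. (c *s k z) $ i) holomorphic_on ball 0 (1 / 2)" for i by (auto intro!: holomorphic_intros kh)
   show "norm (c *s k z) <= 1" if "z : ball 0 (1 / 2)" for z
    using kd[OF that] d(1) by (simp add: c_def norm_smult norm_divide field_simps)
  qed
  moreover have "vder (%z. c *s k z) = c *s vder k" by (rule vder_smult[OF kh open_ball z0])
  ultimately have "norm (vder k) <= d * V" using d(1) by (simp add: c_def norm_smult norm_divide field_simps)
  thus ?case using d(2) unfolding vk by (simp add: dist_norm)
 qed
qed

context taut_dom begin

lemma dirs_compact: "compact (dirs x)"
 unfolding compact_def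
proof (intro allI impI)
 fix v :: "nat => complex ^ 'm" assume "ALL n. v n : dirs x"
 hence "ALL n. EX phi. phi : cl_discs D & phi 0 = x & v n = vder phi" unfolding dirs_def by blast
 from choice[OF this] obtain f where f: "ALL n. f n : cl_discs D & f n 0 = x & v n = vder (f n)" by blast
 have fc: "f n : cl_discs D" "f n 0 = x" "v n = vder (f n)" for n using f by auto
 obtain g s where g: "g : cl_discs D" "strict_mono (s :: nat => nat)"
  "!!K. compact K ==> K <= unit_disc ==> uniform_limit K (%n. f (s n)) g sequentially"
  by (rule cl_discs_compact[of f, OF fc(1)]) (rule that)
 have "(%n. f (s n) 0) ----> g 0" using uniform_limit_imp_tendsto_at[OF g(3)[of "{0}"], of 0] by simp
 hence "g 0 = x" by (simp add: fc(2) LIMSEQ_const_iff)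
 moreover have sub: "cball (0::complex) (1 / 2) <= unit_disc" by auto
 have "(%n. vder (f (s n))) ----> vder g"
  by (rule vder_tendsto[OF cl_discsD(1)[OF fc(1)] cl_discsD(1)[OF g(1)] g(3)[OF compact_cball sub]])
 ultimately show "EX l:dirs x. EX r. strict_mono r & (v \<circ> r) ----> l"
  using g(1,2) fc(3) unfolding dirs_def by (intro bexI[of _ "vder g"] exI[of _ s]) (auto simp: o_def)
qed

end

locale approx_dom = taut_dom D for D :: "(complex ^ 'm) set" +
 fixes Dn :: "nat => (complex ^ 'm) set" and B :: real
 assumes Dn_dom: "domain (Dn n)" and Dn_bdd: "bounded (Dn n)"
  and haus: "(%n. hausdorff_dist (closure (Dn n)) (closure D)) ----> 0"
  and Dn_norm: "x : Dn n ==> norm x <= B"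
begin

text \<open>Montel: derivatives at 0 of discs in D_n centred near x accumulate only at derivatives of discs in the closure centred at x.\<close>
lemma nearby_dirs:
 assumes e: "e > 0"
 obtains d n0 where "d > 0" "!!n f. n >= n0 ==> f : discs_in (Dn n) ==> dist (f 0) x < d ==> EX v:dirs x. norm (vder f - v) < e"
proof -
 define bad where "bad n d f \<longleftrightarrow> f : discs_in (Dn n) & dist (f 0) x < d & \<not> (EX v:dirs x. norm (vder f - v) < e)" for n d f
 have "EX d>0. EX n0. ALL n>=n0. ALL f. \<not> bad n d f"
 proof (rule ccontr)
  assume neg: "\<not> ?thesis"
  hence ex: "EX n>=n0. EX f. bad n d f" if "d > 0" for d n0 using that by blast
  have "EX p. ALL k. (bad (fst (p k)) (1 / (real k + 1)) (snd (p k))) & fst (p k) < fst (p (Suc k))"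
  proof (rule dependent_nat_choice)
   show "EX p. bad (fst p) (1 / (real 0 + 1)) (snd p)" using ex[of "1 / (real 0 + 1)" 0] by auto
   fix p :: "nat \<times> (complex => complex ^ 'm)" and k :: nat
   obtain n f where "n >= Suc (fst p)" "bad n (1 / (real (Suc k) + 1)) f" using ex[of "1 / (real (Suc k) + 1)" "Suc (fst p)"] by auto
   thus "EX p'. bad (fst p') (1 / (real (Suc k) + 1)) (snd p') & fst p < fst p'" by (intro exI[of _ "(n, f)"]) simp
  qed
  then obtain p where p: "!!k. bad (fst (p k)) (1 / (real k + 1)) (snd (p k))" "!!k. fst (p k) < fst (p (Suc k))" by blast
  define q where "q k = fst (p k)" for k
  define f where "f k = snd (p k)" for k
  have q: "strict_mono q" unfolding strict_mono_Suc_iff q_def using p(2) by blast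
  have f: "f k : discs_in (Dn (q k))" "dist (f k 0) x < 1 / (real k + 1)" "!!v. v : dirs x ==> \<not> norm (vder (f k) - v) < e" for k
   using p(1)[of k] unfolding bad_def q_def f_def by blast+
  have fc: "f k : cl_discs (Dn (q k))" for k using discs_in_subset_cl_discs f(1) by blast
  obtain g s where g: "g : cl_discs D" and s: "strict_mono (s :: nat => nat)"
   and ul: "!!K. compact K ==> K <= unit_disc ==> uniform_limit K (%n. f (s n)) g sequentially"
   by (rule limit_of_discs[OF dom bdd Dn_dom Dn_bdd haus q fc]) (rule that)
  have "(%n. f (s n) 0) ----> g 0" using uniform_limit_imp_tendsto_at[OF ul[of "{0}"], of 0] by simp
  moreover have "(%n. f (s n) 0) ----> x"
  proof -
   have "(%k. 1 / (real k + 1)) ----> 0" by real_asymp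
   from LIMSEQ_subseq_LIMSEQ[OF this s] have "(%n. 1 / (real (s n) + 1)) ----> 0" by (simp add: o_def)
   thus ?thesis
    by (rule metric_tendsto_imp_tendsto) (use f(2) in \<open>auto intro!: always_eventually simp: less_imp_le\<close>)
  qed
  ultimately have "g 0 = x" by (rule LIMSEQ_unique)
  hence vg: "vder g : dirs x" using g unfolding dirs_def by blast
  have sub: "cball (0::complex) (1 / 2) <= unit_disc" by auto
  have fh: "hol (f n) i unit_disc" for n i using f(1)[of n] unfolding discs_in_def by blast
  have "(%n. vder (f (s n))) ----> vder g"
   by (rule vder_tendsto[OF fh cl_discsD(1)[OF g] ul[OF compact_cball sub]])
  from tendstoD[OF this e] have "EVS n. False"
   using f(3)[OF vg] by (simp add: dist_norm)
  thus False by simp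
 qed
 then obtain d n0 where "d > 0" "ALL n>=n0. ALL f. \<not> bad n d f" by blast
 thus ?thesis using that[of d n0] unfolding bad_def by blast
qed

lemma limit_in_closure:
 assumes "!!n. x n : Dn (s n)" "strict_mono (s :: nat => nat)" "x ----> l"
 shows "l : closure D"
proof -
 have "(%_. x n) : cl_discs (Dn (s n))" for n using discs_in_subset_cl_discs const_disc[OF assms(1)] by blast
 then obtain g j where g: "g : cl_discs D" and j: "strict_mono (j :: nat => nat)"
  and ul: "!!K. compact K ==> K <= unit_disc ==> uniform_limit K (%n. (%n _. x n) (j n)) g sequentially"
  by (rule limit_of_discs[OF dom bdd Dn_dom Dn_bdd haus assms(2), of "%n _. x n"]) (rule that)
 have "(%n. x (j n)) ----> g 0" using uniform_limit_imp_tendsto_at[OF ul[of "{0}"], of 0] by simp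
 moreover have "(%n. x (j n)) ----> l" using LIMSEQ_subseq_LIMSEQ[OF assms(3) j] by (simp add: o_def)
 ultimately have "l = g 0" by (rule LIMSEQ_unique[rotated])
 thus ?thesis using cl_discsD(2)[OF g, of 0] by simp
qed

text \<open>If a difference quotient of the limit left the closed eps-neighbourhood of the convex hull, a separating hyperplane would contradict the bound for the approximating paths.\<close>
lemma limit_path_direction:
 fixes gam :: "nat => real => complex ^ 'm"
 assumes p: "!!n. disc_path (Dn n) L (gam n)" and s: "strict_mono (s :: nat => nat)"
  and lim: "uniform_limit {0..L} (%n. gam (s n)) g sequentially" and cont: "continuous_on {0..L} g"
  and t: "0 <= t" "t < L" and e: "e > 0"
 shows "EX h0>0. ALL h. 0 < h --> h <= h0 --> (EX v:convex hull (dirs (g t)). norm (g (t + h) - g t - h *R v) <= e * h)"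
proof -
 obtain d n0 where d: "d > 0" "!!n f. n >= n0 ==> f : discs_in (Dn n) ==> dist (f 0) (g t) < d ==> EX v:dirs (g t). norm (vder f - v) < e"
  using nearby_dirs[OF e, of "g t"] by blast
 have tL: "t : {0..L}" using t by simp
 have d2: "d / 2 > 0" using d(1) by simp
 obtain h1 where h1: "h1 > 0" "!!x. x : {0..L} ==> dist x t < h1 ==> dist (g x) (g t) < d / 2"
  using cont tL d2 unfolding continuous_on_iff by meson
 define h0 where "h0 = min (h1 / 2) (L - t)"
 have h0: "h0 > 0" "h0 < h1" "t + h0 <= L" using h1(1) t by (auto simp: h0_def)
 define A where "A = (\<Union>x\<in>convex hull (dirs (g t)). \<Union>y\<in>cball 0 e. {x + y})"
 have A: "convex A" "closed A" unfolding A_def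
  by (intro convex_sums convex_convex_hull convex_cball)
   (intro compact_imp_closed compact_sums' compact_convex_hull dirs_compact compact_cball)
 show ?thesis
 proof (intro exI[of _ h0] conjI allI impI h0(1))
  fix h :: real assume h: "0 < h" "h <= h0"
  define P where "P = (g (t + h) - g t) /\<^sub>R h"
  have thL: "t + h : {0..L}" using t h h0 by auto
  have "P : A"
  proof (rule ccontr)
   assume "P \<notin> A"
   then obtain a b where ab: "a \<bullet> P < b" "!!x. x : A ==> a \<bullet> x > b" using separating_hyperplane_closed_point[OF A] by blast
   have "EVS n. ALL x:{0..L}. dist (gam (s n) x) (g x) < d / 2" using uniform_limitD[OF lim d2] .
   moreover have "EVS n. n >= n0" by (rule eventually_ge_at_top)
   ultimately have "EVS n. (- a) \<bullet> (gam (s n) (t + h) - gam (s n) t) <= (- b) * (t + h - t)"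
   proof eventually_elim
    case (elim n)
    have sn: "s n >= n0" using seq_suble[OF s, of n] elim(2) by linarith
    show ?case
    proof (rule disc_path_direction[OF p Dn_norm])
     fix \<tau> F assume \<tau>: "t <= \<tau>" "\<tau> < t + h" and F: "F : discs_in (Dn (s n))" "F 0 = gam (s n) \<tau>"
     have \<tau>L: "\<tau> : {0..L}" "dist \<tau> t < h1" using \<tau> t h h0 by (auto simp: dist_real_def)
     have "dist (F 0) (g t) < d" using bspec[OF elim(1) \<tau>L(1)] h1(2)[OF \<tau>L] dist_triangle[of "gam (s n) \<tau>" "g t" "g \<tau>"] F(2) by simp
     then obtain v where v: "v : dirs (g t)" "norm (vder F - v) < e" using d(2)[OF sn F(1)] by blast
     have "vder F : A" unfolding A_def using v hull_inc[of v "dirs (g t)" convex]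
      by (intro UN_I[of v] UN_I[of "vder F - v"]) auto
     thus "- a \<bullet> vder F <= - b" using ab(2)[of "vder F"] by simp
    qed (use t h h0 in auto)
   qed
   moreover have "(%n. (- a) \<bullet> (gam (s n) (t + h) - gam (s n) t)) ----> (- a) \<bullet> (g (t + h) - g t)"
    by (intro tendsto_intros uniform_limit_imp_tendsto_at[OF lim] thL tL)
   ultimately have "(- a) \<bullet> (g (t + h) - g t) <= (- b) * (t + h - t)"
    using tendsto_upperbound[OF _ _ sequentially_bot] by blast
   hence "b * h <= a \<bullet> (g (t + h) - g t)" by simp
   moreover have "a \<bullet> (g (t + h) - g t) = h * (a \<bullet> P)" using h(1) by (simp add: P_def)
   ultimately show False using ab(1) h(1) by (simp add: mult.commute)
  qed
  then obtain v y where v: "v : convex hull (dirs (g t))" "norm y <= e" "P = v + y" by (auto simp: A_def)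
  have "g (t + h) - g t = h *R P" using h(1) by (simp add: P_def)
  hence "g (t + h) - g t - h *R v = h *R y" by (simp add: v(3) algebra_simps)
  hence "norm (g (t + h) - g t - h *R v) <= e * h" using v(2) h(1) by (simp add: mult.commute mult_left_mono)
  thus "EX v:convex hull (dirs (g t)). norm (g (t + h) - g t - h *R v) <= e * h" using v(1) by blast
 qed
qed

text \<open>Arzela-Ascoli gives the limit; compactness of the convex hull turns nearby velocities for small times into one velocity that is frequently attained.\<close>
lemma limit_path_exists:
 assumes L: "L > 0" and p: "!!n. disc_path (Dn n) L (gam n)" "!!n. gam n 0 = z" "!!n. gam n L = w"
 shows "EX g. lim_path D g L & g 0 = z & g L = w"
proof -
 have zD: "z : Dn 0" using disc_pathD(3)[OF p(1), of 0 0] p(2)[of 0] L by simp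
 have B0: "B >= 0" using Dn_norm[OF zD] norm_ge_zero[of z] by linarith
 obtain V where V: "V >= 0" "ALL f :: complex => complex ^ 'm. (ALL i. hol f i unit_disc) --> (ALL z:unit_disc. norm (f z) <= B) --> norm (vder f) <= V"
  using vder_bound[OF zero_less_one B0, where 'm = 'm] by blast
 have vd: "norm (vder F) <= V" if "F : discs_in (Dn n)" for F n
 proof (rule V(2)[rule_format])
  show "hol F i unit_disc" for i using that unfolding discs_in_def by blast
  fix x assume "x : unit_disc"
  hence "F x : Dn n" using that unfolding discs_in_def by blast
  thus "norm (F x) <= B" by (rule Dn_norm)
 qed
 define cl where "cl t = max 0 (min L t)" for t
 have cl: "cl t : {0..L}" "\<bar>cl t - cl t'\<bar> <= \<bar>t - t'\<bar>" for t t' using L by (auto simp: cl_def max_def min_def)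
 have cl_id: "cl t = t" if "t : {0..L}" for t using that by (auto simp: cl_def)
 define F where "F n t = gam n (cl t)" for n t
 have lip0: "norm (gam n t2 - gam n t1) <= V * (t2 - t1)" if "0 <= t1" "t1 <= t2" "t2 <= L" for n t1 t2
  by (rule disc_path_lipschitz[OF p(1) Dn_norm that vd])
 have lip1: "norm (gam n t2 - gam n t1) <= V * \<bar>t2 - t1\<bar>" if "t1 : {0..L}" "t2 : {0..L}" for n t1 t2
  using lip0[of t1 t2 n] lip0[of t2 t1 n] that by (cases "t1 <= t2") (auto simp: norm_minus_commute)
 have lip: "norm (F n x - F n y) <= V * norm (x - y)" for n x y
  unfolding F_def real_norm_def by (rule order_trans[OF lip1[OF cl(1) cl(1)] mult_left_mono[OF cl(2) V(1)]])
 have bd: "norm (F n x) <= B" for n x unfolding F_def by (rule Dn_norm[OF disc_pathD(3)[OF p(1) cl(1)]])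
 obtain g s where s: "strict_mono (s :: nat => nat)" and gl: "!!x y. norm (g x - g y) <= V * norm (x - y)"
  and ul: "!!R. uniform_limit (cball 0 R) (%n. F (s n)) g sequentially"
  by (rule equilipschitz_subsequence[of F B V, OF bd lip]) (rule that)
 have sub: "{0..L} <= cball 0 L" by auto
 have ul2: "uniform_limit {0..L} (%n. gam (s n)) g sequentially"
 proof (rule uniform_limitI)
  fix e :: real assume "e > 0"
  from uniform_limitD[OF ul this, of L] show "EVS n. ALL x:{0..L}. dist (gam (s n) x) (g x) < e"
  proof eventually_elim
   case (elim n)
   show ?case
   proof
    fix x assume x: "x : {0..L}"
    hence "dist (F (s n) x) (g x) < e" using elim sub by blast
    thus "dist (gam (s n) x) (g x) < e" using cl_id[OF x] by (simp add: F_def)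
   qed
  qed
 qed
 have cont: "continuous_on {0..L} g"
 proof (rule lipschitz_on_continuous_on[of V])
  show "V-lipschitz_on {0..L} g" using gl V(1) by (intro lipschitz_onI) (auto simp: dist_norm)
 qed
 have pt: "(%n. gam (s n) t) ----> g t" if "t : {0..L}" for t by (rule uniform_limit_imp_tendsto_at[OF ul2 that])
 have "lim_path D g L"
 proof
  show "continuous_on {0..L} g" by (rule cont)
  show "g t : closure D" if t: "t : {0..L}" for t
   by (rule limit_in_closure[OF disc_pathD(3)[OF p(1) t] s pt[OF t]])
  fix t e :: real assume t: "0 <= t" "t < L" and e: "e > 0"
  have e2: "e / 2 > 0" using e by simp
  obtain h0 where h0: "h0 > 0" "!!h. 0 < h ==> h <= h0 ==> EX v:convex hull (dirs (g t)). norm (g (t + h) - g t - h *R v) <= e / 2 * h"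
   using limit_path_direction[OF p(1) s ul2 cont t e2] by blast
  define h where "h k = h0 / (real k + 1)" for k :: nat
  have h: "0 < h k" "h k <= h0" for k using h0(1) by (auto simp: h_def field_simps)
  have hl: "h ----> 0" unfolding h_def by real_asymp
  have "ALL k. EX v. v : convex hull (dirs (g t)) & norm (g (t + h k) - g t - h k *R v) <= e / 2 * h k"
   using h0(2)[OF h] by blast
  from choice[OF this] obtain v where v: "ALL k. v k : convex hull (dirs (g t)) & norm (g (t + h k) - g t - h k *R v k) <= e / 2 * h k" by blast
  have cc: "compact (convex hull (dirs (g t)))" by (intro compact_convex_hull dirs_compact)
  obtain l r where l: "l : convex hull (dirs (g t))" "strict_mono (r :: nat => nat)" "(v \<circ> r) ----> l"
   using cc v unfolding compact_def by blast
  have "EX h. 0 < h & h < d & norm (g (t + h) - g t - h *R l) <= e * h" if d: "d > 0" for d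
  proof -
   have "(%k. h (r k)) ----> 0" using LIMSEQ_subseq_LIMSEQ[OF hl l(2)] by (simp add: o_def)
   hence "EVS k. h (r k) < d" using d by (rule order_tendstoD)
   moreover have "EVS k. dist ((v \<circ> r) k) l < e / 2" by (rule tendstoD[OF l(3) e2])
   ultimately have "EVS k. h (r k) < d & dist (v (r k)) l < e / 2" by eventually_elim simp
   then obtain k where k: "h (r k) < d" "dist (v (r k)) l < e / 2" unfolding eventually_sequentially by blast
   define H where "H = h (r k)"
   have H: "H > 0" using h by (simp add: H_def)
   have 1: "norm (g (t + H) - g t - H *R v (r k)) <= e / 2 * H" using v by (simp add: H_def)
   have 2: "norm (H *R (v (r k) - l)) <= e / 2 * H" using k(2) H by (simp add: dist_norm mult.commute mult_left_mono)
   have "g (t + H) - g t - H *R l = (g (t + H) - g t - H *R v (r k)) + H *R (v (r k) - l)" by (simp add: algebra_simps)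
   hence "norm (g (t + H) - g t - H *R l) <= norm (g (t + H) - g t - H *R v (r k)) + norm (H *R (v (r k) - l))"
    using norm_triangle_ineq[of "g (t + H) - g t - H *R v (r k)" "H *R (v (r k) - l)"] by metis
   also have "... <= e / 2 * H + e / 2 * H" by (rule add_mono[OF 1 2])
   finally have "norm (g (t + H) - g t - H *R l) <= e * H" by (simp add: mult.commute)
   thus ?thesis using H k(1)[folded H_def] by blast
  qed
  thus "EX v:convex hull (dirs (g t)). ALL d>0. EX h. 0 < h & h < d & norm (g (t + h) - g t - h *R v) <= e * h"
   using l(1) by blast
 qed
 moreover have "g 0 = z" using pt[of 0] L p(2) by (simp add: LIMSEQ_const_iff)
 moreover have "g L = w" using pt[of L] L p(3) by (simp add: LIMSEQ_const_iff)
 ultimately show ?thesis by blast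
qed

end

section \<open>The Kobayashi length of a limit path\<close>

text \<open>Lebesgue numbers for properties of pairs of parameters.\<close>
lemma local_to_short_intervals:
 fixes Q :: "real => real => real => bool"
 assumes local: "!!t0. t0 : {0..L} ==> EX d>0. ALL t1:{0..L}. ALL t2:{0..L}. t1 <= t2 --> \<bar>t1 - t0\<bar> < d --> \<bar>t2 - t0\<bar> < d --> Q d t1 t2"
  and anti: "!!d d' t1 t2. Q d t1 t2 ==> 0 < d' ==> d' <= d ==> Q d' t1 t2"
 shows "EX \<mu>>0. ALL t1:{0..L}. ALL t2:{0..L}. t1 <= t2 --> t2 - t1 < \<mu> --> Q \<mu> t1 t2"
proof (rule ccontr)
 assume neg: "\<not> ?thesis"
 have "ALL n. EX p. fst p : {0..L} & snd p : {0..L} & fst p <= snd p & snd p - fst p < 1 / (real n + 1) & \<not> Q (1 / (real n + 1)) (fst p) (snd p)"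
 proof
  fix n
  have "0 < 1 / (real n + 1)" by simp
  then obtain t1 t2 where "t1 : {0..L}" "t2 : {0..L}" "t1 <= t2" "t2 - t1 < 1 / (real n + 1)" "\<not> Q (1 / (real n + 1)) t1 t2"
   using neg by blast
  thus "EX p. fst p : {0..L} & snd p : {0..L} & fst p <= snd p & snd p - fst p < 1 / (real n + 1) & \<not> Q (1 / (real n + 1)) (fst p) (snd p)"
   by (intro exI[of _ "(t1, t2)"]) simp
 qed
 from choice[OF this] obtain p where p0: "ALL n. fst (p n) : {0..L} & snd (p n) : {0..L} & fst (p n) <= snd (p n) & snd (p n) - fst (p n) < 1 / (real n + 1) & \<not> Q (1 / (real n + 1)) (fst (p n)) (snd (p n))"
  by blast
 have p: "fst (p n) : {0..L}" "snd (p n) : {0..L}" "fst (p n) <= snd (p n)" "snd (p n) - fst (p n) < 1 / (real n + 1)"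
  "\<not> Q (1 / (real n + 1)) (fst (p n)) (snd (p n))" for n
  using spec[OF p0, of n] by blast+
 have "ALL n. fst (p n) : {0..L}" using p(1) by blast
 then obtain t0 r where t0: "t0 : {0..L}" and r: "strict_mono (r :: nat => nat)" and lim: "((%n. fst (p n)) \<circ> r) ----> t0"
  using compact_Icc[of 0 L] unfolding compact_def by meson
 obtain d where d: "d > 0" "!!t1 t2. t1 : {0..L} ==> t2 : {0..L} ==> t1 <= t2 ==> \<bar>t1 - t0\<bar> < d ==> \<bar>t2 - t0\<bar> < d ==> Q d t1 t2"
  using local[OF t0] by blast
 have d2: "d / 2 > 0" using d(1) by simp
 have "(%n. 1 / (real n + 1)) ----> 0" by real_asymp
 from LIMSEQ_subseq_LIMSEQ[OF this r] have "(%n. 1 / (real (r n) + 1)) ----> 0" by (simp add: o_def)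
 hence "EVS n. 1 / (real (r n) + 1) < d / 2" using d2 by (rule order_tendstoD)
 moreover have "EVS n. dist (((%n. fst (p n)) \<circ> r) n) t0 < d / 2" by (rule tendstoD[OF lim d2])
 ultimately have "EVS n. False"
 proof eventually_elim
  case (elim n)
  define k where "k = r n"
  have e: "1 / (real k + 1) < d / 2" "\<bar>fst (p k) - t0\<bar> < d / 2" using elim by (simp_all add: k_def dist_real_def)
  have "\<bar>fst (p k) - t0\<bar> < d" "\<bar>snd (p k) - t0\<bar> < d" using e p(3)[of k] p(4)[of k] d2 by linarith+
  from d(2)[OF p(1-3) this] have "Q d (fst (p k)) (snd (p k))" .
  hence "Q (1 / (real k + 1)) (fst (p k)) (snd (p k))" by (rule anti) (use e d2 in auto)
  thus False using p(5) by blast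
 qed
 thus False by simp
qed

lemma kobayashi_small_near:
 assumes D: "domain D" and x: "x : D" and e: "e > 0"
 obtains d where "d > 0" "!!y. dist y x < d ==> y : D & kobayashi D x y <= e & kobayashi D y x <= e"
proof -
 obtain d C where d: "d > 0" "C >= 0" "ball x d <= D" "!!y y'. y : ball x d ==> y' : ball x d ==> kobayashi D y y' <= C * norm (y' - y)"
  by (rule kobayashi_locally_lipschitz[OF D x]) (rule that)
 define d' where "d' = min d (e / (C + 1))"
 have d': "d' > 0" "d' <= d" "d' <= e / (C + 1)" using d(1,2) e by (auto simp: d'_def)
 have "d' * (C + 1) <= e" using d'(3) d(2) by (simp add: pos_le_divide_eq)
 hence Cd: "C * d' <= e" using d'(1) by (simp add: algebra_simps)
 show ?thesis
 proof (rule that[OF d'(1)])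
  fix y assume y: "dist y x < d'"
  have yb: "y : ball x d" "x : ball x d" using y d'(2) d(1) by (auto simp: dist_commute)
  have "C * norm (y - x) <= C * d'" using y d(2) by (intro mult_left_mono) (auto simp: dist_norm)
  thus "y : D & kobayashi D x y <= e & kobayashi D y x <= e"
   using d(3) d(4)[OF yb] d(4)[OF yb(2,1)] yb(1) Cd by (auto simp: norm_minus_commute)
 qed
qed

context lim_path begin

lemma path_near:
 assumes "t0 : {0..L}" "e > 0"
 obtains d where "d > 0" "!!t. t : {0..L} ==> \<bar>t - t0\<bar> < d ==> dist (gam t) (gam t0) < e"
 using path_cont assms unfolding continuous_on_iff dist_real_def by meson

lemma path_frontier_or_in: "t : {0..L} ==> gam t : D \<or> gam t : bdry"
 using path_cl[of t] open_D by (auto simp: frontier_def interior_open)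

text \<open>Either the piece of path is estimated inside D, or it can be displaced by s u for all u near a common direction n, with error \<eta> at the end. The threshold d bounds both the scale and the admissible deviation.\<close>
definition pushes :: "real => real => real => real => real => bool" where
 "pushes l' \<eta> d t1 t2 \<longleftrightarrow> (gam t1 : D & gam t2 : D & kob (gam t1) (gam t2) <= l' * (t2 - t1)) \<or>
   (EX n. norm n <= 1 & (ALL u1 s. norm (u1 - n) < d \<or> gam t1 : bdry & norm (u1 - N (gam t1)) < d --> 0 < s --> s < d -->
    (pushed l' \<eta> n s t1 u1 t2)))"

lemma pushes_anti:
 assumes "pushes l' \<eta> d t1 t2" "d' <= d"
 shows "pushes l' \<eta> d' t1 t2"
 using assms(1) unfolding pushes_def
proof (elim disjE exE)
 fix n assume n: "norm n <= 1 & (ALL u1 s. norm (u1 - n) < d \<or> gam t1 : bdry & norm (u1 - N (gam t1)) < d --> 0 < s --> s < d -->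
    (pushed l' \<eta> n s t1 u1 t2))"
 show "gam t1 : D & gam t2 : D & kob (gam t1) (gam t2) <= l' * (t2 - t1) \<or>
   (EX n. norm n <= 1 & (ALL u1 s. norm (u1 - n) < d' \<or> gam t1 : bdry & norm (u1 - N (gam t1)) < d' --> 0 < s --> s < d' -->
    (pushed l' \<eta> n s t1 u1 t2)))"
 proof (rule disjI2, rule exI[of _ n], intro conjI allI impI)
  show "norm n <= 1" using n by (rule conjunct1)
  fix u1 s assume h: "norm (u1 - n) < d' \<or> gam t1 : bdry & norm (u1 - N (gam t1)) < d'" and s: "0 < s" "s < d'"
  have h': "norm (u1 - n) < d \<or> gam t1 : bdry & norm (u1 - N (gam t1)) < d" using h assms(2) by force
  have s': "s < d" using s assms(2) by linarith
  from conjunct2[OF n, rule_format, OF h' s(1) s']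
  show "pushed l' \<eta> n s t1 u1 t2" .
 qed
qed blast

lemma pushes_locally:
 assumes t0: "t0 : {0..L}" and r: "0 < r" "r < 1" and l': "1 / r < l'" and \<eta>: "\<eta> > 0"
 shows "EX d>0. ALL t1:{0..L}. ALL t2:{0..L}. t1 <= t2 --> \<bar>t1 - t0\<bar> < d --> \<bar>t2 - t0\<bar> < d --> pushes l' \<eta> d t1 t2"
proof (cases "gam t0 : D")
 case True
 have "1 < 1 / r" using r by simp
 hence "1 < l'" using l' by linarith
 then obtain d where d: "d > 0" "!!t1 t2. t1 : {0..L} ==> t2 : {0..L} ==> t1 <= t2 ==> \<bar>t1 - t0\<bar> < d ==> \<bar>t2 - t0\<bar> < d ==>
  gam t1 : D & gam t2 : D & kob (gam t1) (gam t2) <= l' * (t2 - t1)"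
  using transport_inside[OF t0 True] by blast
 thus ?thesis unfolding pushes_def by blast
next
 case False
 hence fr: "gam t0 : bdry" using path_frontier_or_in[OF t0] by blast
 have \<eta>2: "\<eta> / 2 > 0" using \<eta> by simp
 define n where "n = N (gam t0)"
 obtain d where d: "d > 0" "!!t1 t2 s u1. t1 : {0..L} ==> t2 : {0..L} ==> t1 <= t2 ==> \<bar>t1 - t0\<bar> < d ==> \<bar>t2 - t0\<bar> < d ==>
  dist u1 n < d ==> 0 < s ==> s < d ==>
  EX u2. dist u2 n < \<eta> / 2 & carried l' s t1 u1 t2 u2"
  by (rule transport_near_frontier[OF t0 fr r l' \<eta>2, folded n_def]) (rule that)
 have pos: "min (d / 2) (\<eta> / 2) > 0" using d(1) \<eta> by simp
 obtain e where e: "e > 0" "!!x. x : bdry ==> dist x (gam t0) < e ==> dist (N x) n < min (d / 2) (\<eta> / 2)"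
  using inward_continuous_on fr pos unfolding continuous_on_iff n_def by meson
 obtain d1 where d1: "d1 > 0" "!!t. t : {0..L} ==> \<bar>t - t0\<bar> < d1 ==> dist (gam t) (gam t0) < e" using path_near[OF t0 e(1)] by blast
 define d2 where "d2 = min d1 (d / 2)"
 have d2: "d2 > 0" "d2 <= d1" "d2 <= d / 2" using d(1) d1(1) by (auto simp: d2_def)
 have Nn: "norm (N (gam t) - n) < d / 2" "norm (N (gam t) - n) < \<eta> / 2" if "t : {0..L}" "\<bar>t - t0\<bar> < d2" "gam t : bdry" for t
  using e(2)[OF that(3) d1(2)[OF that(1)]] that(2) d2(2) by (auto simp: dist_norm)
 show ?thesis
 proof (intro exI[of _ d2] conjI ballI impI d2(1))
  fix t1 t2 assume t: "t1 : {0..L}" "t2 : {0..L}" "t1 <= t2" "\<bar>t1 - t0\<bar> < d2" "\<bar>t2 - t0\<bar> < d2"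
  have td: "\<bar>t1 - t0\<bar> < d" "\<bar>t2 - t0\<bar> < d" using t d2(3) d(1) by linarith+
  show "pushes l' \<eta> d2 t1 t2" unfolding pushes_def
  proof (rule disjI2, rule exI[of _ n], intro conjI allI impI)
   show "norm n <= 1" using inward_norm[OF fr] by (simp add: n_def)
   fix u1 s assume h: "norm (u1 - n) < d2 \<or> gam t1 : bdry & norm (u1 - N (gam t1)) < d2" and s: "0 < s" "s < d2"
   have "norm (u1 - n) < d"
   proof (cases "norm (u1 - n) < d2")
    case True
    thus ?thesis using d2(3) d(1) by linarith
   next
    case False
    hence "gam t1 : bdry" "norm (u1 - N (gam t1)) < d2" using h by auto
    thus ?thesis using norm_triangle_ineq[of "u1 - N (gam t1)" "N (gam t1) - n"] Nn(1)[OF t(1,4)] d2(3) by simp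
   qed
   hence ud: "dist u1 n < d" by (simp add: dist_norm)
   have sd: "s < d" using s d2(3) d(1) by linarith
   obtain u2 where u2: "dist u2 n < \<eta> / 2 & carried l' s t1 u1 t2 u2"
    using d(2)[OF t(1-3) td ud s(1) sd] by (rule exE)
   hence un: "norm (u2 - n) < \<eta> / 2" by (simp add: dist_norm)
   have "norm (u2 - N (gam t2)) < \<eta>" if "gam t2 : bdry"
    using norm_triangle_ineq4[of "u2 - n" "N (gam t2) - n"] un Nn(2)[OF t(2,5) that] by simp
   thus "pushed l' \<eta> n s t1 u1 t2"
    using u2 un \<eta> by (intro exI[of _ u2] conjI impI) auto
  qed
 qed
qed

text \<open>The phase is preserved up to eps on a piece of path in the boundary, at scales s small depending on eps.\<close>
definition slides :: "real => real => real => bool" where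
 "slides l' t1 t2 \<longleftrightarrow> (gam ` {t1..t2} <= bdry --> (ALL eps>0. EX s0>0. ALL s q1. cmod q1 = 1 --> cmod (q1 - 1) <= 1 / 2 --> 0 < s --> s < s0 -->
  (slid l' eps t1 t2 s q1)))"

lemma slides_locally:
 assumes t0: "t0 : {0..L}" and r: "0 < r" "r < 1" and l': "1 / r < l'"
 shows "EX d>0. ALL t1:{0..L}. ALL t2:{0..L}. t1 <= t2 --> \<bar>t1 - t0\<bar> < d --> \<bar>t2 - t0\<bar> < d --> slides l' t1 t2"
proof (cases "gam t0 : D")
 case True
 obtain e where e: "e > 0" "ball (gam t0) e <= D" using open_D True openE by blast
 obtain d where d: "d > 0" "!!t. t : {0..L} ==> \<bar>t - t0\<bar> < d ==> dist (gam t) (gam t0) < e" using path_near[OF t0 e(1)] by blast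
 have "slides l' t1 t2" if "t1 : {0..L}" "t1 <= t2" "\<bar>t1 - t0\<bar> < d" for t1 t2
 proof -
  have "gam t1 : D" using d(2)[OF that(1,3)] e(2) by (auto simp: dist_commute)
  moreover have "gam t1 : gam ` {t1..t2}" using that(2) by simp
  ultimately have "\<not> gam ` {t1..t2} <= bdry" using frontier_notin by blast
  thus ?thesis unfolding slides_def by blast
 qed
 thus ?thesis using d(1) by blast
next
 case False
 hence fr: "gam t0 : bdry" using path_frontier_or_in[OF t0] by blast
 obtain d where d: "d > 0" "!!eps. eps > 0 ==> EX s0>0. ALL t1 t2 s q1. t1 : {0..L} --> t2 : {0..L} --> t1 <= t2 --> \<bar>t1 - t0\<bar> < d --> \<bar>t2 - t0\<bar> < d -->
  gam ` {t1..t2} <= bdry --> cmod q1 = 1 --> cmod (q1 - 1) <= 1 / 2 --> 0 < s --> s < s0 -->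
  (slid l' eps t1 t2 s q1)"
  by (rule transport_along_frontier[OF t0 fr r l']) (rule that)
 show ?thesis
 proof (intro exI[of _ d] conjI ballI impI d(1))
  fix t1 t2 assume t: "t1 : {0..L}" "t2 : {0..L}" "t1 <= t2" "\<bar>t1 - t0\<bar> < d" "\<bar>t2 - t0\<bar> < d"
  show "slides l' t1 t2" unfolding slides_def
  proof (intro impI allI)
   fix eps :: real assume fr: "gam ` {t1..t2} <= bdry" and "eps > 0"
   from d(2)[OF this(2)] obtain s0 where s0: "s0 > 0 & (ALL t1 t2 s q1. t1 : {0..L} --> t2 : {0..L} --> t1 <= t2 --> \<bar>t1 - t0\<bar> < d --> \<bar>t2 - t0\<bar> < d -->
    gam ` {t1..t2} <= bdry --> cmod q1 = 1 --> cmod (q1 - 1) <= 1 / 2 --> 0 < s --> s < s0 -->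
    (slid l' eps t1 t2 s q1))" by (rule exE)
   show "EX s0>0. ALL s q1. cmod q1 = 1 --> cmod (q1 - 1) <= 1 / 2 --> 0 < s --> s < s0 -->
    (slid l' eps t1 t2 s q1)"
    by (rule exI[of _ s0], rule conjI[OF conjunct1[OF s0]], intro allI impI, rule conjunct2[OF s0, rule_format, OF t fr])
  qed
 qed
qed

text \<open>The estimate up to time t. At boundary points it concerns points at arbitrarily small height, displaced with a phase error of at most kap, an error made on entering the boundary that does not accumulate.\<close>
definition reach :: "real => real => complex ^ 'm => real => bool" where
 "reach l' kap z t \<longleftrightarrow> (gam t : D --> kob z (gam t) <= l' * t) &
   (gam t : bdry --> (ALL eps>0. ALL \<sigma>>0. EX s q. 0 < s & s < \<sigma> & cmod q = 1 & cmod (q - 1) <= kap + eps &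
    lifted t s q : D & kob z (lifted t s q) <= l' * t + eps))"

lemma reach_inI:
 assumes "gam t : D" "!!eps. eps > 0 ==> kob z (gam t) <= l' * t + eps"
 shows "reach l' kap z t"
proof -
 have "kob z (gam t) <= l' * t" by (rule field_le_epsilon) (rule assms(2))
 thus ?thesis using assms(1) frontier_notin unfolding reach_def by blast
qed

text \<open>From a point of D the displacement may start exactly in the common direction n, so on arrival at the boundary its phase error is of order \<eta>.\<close>
lemma reach_from_inside:
 assumes z: "z : D" and t: "t1 : {0..L}" "t2 : {0..L}" "t1 <= t2" and p: "pushes l' \<eta> d t1 t2" "d > 0"
  and \<eta>: "0 < \<eta>" "\<eta> <= 1 / 8" "4 * \<eta> <= kap" and r1: "reach l' kap z t1" and i1: "gam t1 : D"
 shows "reach l' kap z t2"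
proof -
 have k1: "kob z (gam t1) <= l' * t1" using r1 i1 unfolding reach_def by blast
 consider (inner) "gam t2 : D" "kob (gam t1) (gam t2) <= l' * (t2 - t1)"
  | (push) n where "norm n <= 1" "!!u1 s. norm (u1 - n) < d ==> 0 < s ==> s < d ==>
    (pushed l' \<eta> n s t1 u1 t2)"
  using p(1) unfolding pushes_def by blast
 thus ?thesis
 proof cases
  case inner
  show ?thesis
  proof (rule reach_inI[OF inner(1)])
   fix eps :: real assume "eps > 0"
   thus "kob z (gam t2) <= l' * t2 + eps"
    using kobayashi_triangle[OF dom z i1 inner(1)] k1 inner(2) by (simp add: algebra_simps)
  qed
 next
  case push
  have step: "EX s0>0. ALL s. 0 < s --> s < s0 --> (EX u2. norm (u2 - n) < \<eta> & (gam t2 : bdry --> norm (u2 - N (gam t2)) < \<eta>) &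
     gam t2 + s *R u2 : D & kob z (gam t2 + s *R u2) <= l' * t2 + eps)" if e: "eps > 0" for eps
  proof -
   obtain d1 where d1: "d1 > 0" "!!y. dist y (gam t1) < d1 ==> y : D & kob (gam t1) y <= eps & kob y (gam t1) <= eps"
    using kobayashi_small_near[OF dom i1 e] by blast
   have "EX u2. norm (u2 - n) < \<eta> & (gam t2 : bdry --> norm (u2 - N (gam t2)) < \<eta>) &
     gam t2 + s *R u2 : D & kob z (gam t2 + s *R u2) <= l' * t2 + eps" if s: "0 < s" "s < min d d1" for s
   proof -
    have sd: "s < d" using s by simp
    have "norm (n - n) < d" using p(2) by simp
    from push(2)[OF this s(1) sd] obtain u2 where u2: "norm (u2 - n) < \<eta> & (gam t2 : bdry --> norm (u2 - N (gam t2)) < \<eta>) &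
     carried l' s t1 n t2 u2" by (rule exE)
    have "s * norm n <= s" using mult_left_mono[OF push(1), of s] s(1) by simp
    moreover have "dist (gam t1 + s *R n) (gam t1) = s * norm n" using s(1) by (simp add: dist_norm)
    ultimately have "dist (gam t1 + s *R n) (gam t1) < d1" using s by linarith
    hence "kob (gam t1) (gam t1 + s *R n) <= eps" using d1(2) by blast
    moreover have "gam t1 + s *R n : D" "gam t2 + s *R u2 : D" using u2 by blast+
    ultimately have "kob z (gam t2 + s *R u2) <= l' * t1 + eps + l' * (t2 - t1)"
     using kobayashi_triangle[OF dom z i1, of "gam t1 + s *R n"] kobayashi_triangle[OF dom z, of "gam t1 + s *R n" "gam t2 + s *R u2"] k1 u2 by linarith
    thus ?thesis using u2 by (intro exI[of _ u2] conjI) (auto simp: algebra_simps)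
   qed
   thus ?thesis using p(2) d1(1) by (intro exI[of _ "min d d1"]) simp
  qed
  show ?thesis
  proof (cases "gam t2 : D")
   case True
   show ?thesis
   proof (rule reach_inI[OF True])
    fix eps :: real assume "eps > 0"
    hence e2: "eps / 2 > 0" by simp
    obtain s0 where s0: "s0 > 0" "!!s. 0 < s ==> s < s0 ==> (EX u2. norm (u2 - n) < \<eta> & (gam t2 : bdry --> norm (u2 - N (gam t2)) < \<eta>) &
     gam t2 + s *R u2 : D & kob z (gam t2 + s *R u2) <= l' * t2 + eps / 2)" using step[OF e2] by blast
    obtain d1 where d1: "d1 > 0" "!!y. dist y (gam t2) < d1 ==> y : D & kob (gam t2) y <= eps / 2 & kob y (gam t2) <= eps / 2"
     using kobayashi_small_near[OF dom True e2] by blast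
    define s where "s = min s0 d1 / 4"
    have s: "0 < s" "s < s0" "s * 2 < d1" using s0(1) d1(1) by (auto simp: s_def)
    from s0(2)[OF s(1,2)] obtain u2 where u2: "norm (u2 - n) < \<eta> & (gam t2 : bdry --> norm (u2 - N (gam t2)) < \<eta>) &
     gam t2 + s *R u2 : D & kob z (gam t2 + s *R u2) <= l' * t2 + eps / 2" by (rule exE)
    have "norm u2 <= 2" using norm_triangle_ineq[of "u2 - n" n] push(1) u2 \<eta>(2) by simp
    hence "s * norm u2 <= s * 2" using s(1) by (intro mult_left_mono) auto
    moreover have "dist (gam t2 + s *R u2) (gam t2) = s * norm u2" using s(1) by (simp add: dist_norm)
    ultimately have "dist (gam t2 + s *R u2) (gam t2) < d1" using s(3) by linarith
    hence "kob (gam t2 + s *R u2) (gam t2) <= eps / 2" using d1(2) by blast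
    moreover have "gam t2 + s *R u2 : D" "kob z (gam t2 + s *R u2) <= l' * t2 + eps / 2" using u2 by blast+
    ultimately show "kob z (gam t2) <= l' * t2 + eps"
     using kobayashi_triangle[OF dom z _ True, of "gam t2 + s *R u2"] by simp
   qed
  next
   case False
   hence fr: "gam t2 : bdry" using path_frontier_or_in[OF t(2)] by blast
   have N1: "norm (N (gam t2)) = 1" by (rule inward_norm[OF fr])
   have "EX s q. 0 < s & s < \<sigma> & cmod q = 1 & cmod (q - 1) <= kap + eps &
    lifted t2 s q : D & kob z (lifted t2 s q) <= l' * t2 + eps" if e: "eps > 0" and \<sigma>: "\<sigma> > 0" for eps \<sigma>
   proof -
    have e2: "eps / 2 > 0" using e by simp
    obtain s0 where s0: "s0 > 0" "!!s. 0 < s ==> s < s0 ==> (EX u2. norm (u2 - n) < \<eta> & (gam t2 : bdry --> norm (u2 - N (gam t2)) < \<eta>) &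
     gam t2 + s *R u2 : D & kob z (gam t2 + s *R u2) <= l' * t2 + eps / 2)" using step[OF e2] by blast
    obtain sr where sr: "sr > 0" "!!x u s. x : bdry ==> norm u <= 2 ==> Re (herm (N x) u) >= 1 / 4 ==> 0 < s ==> s < sr ==>
     x + s *R u : D & x + s *R (herm (N x) u *s N x) : D & kob (x + s *R u) (x + s *R (herm (N x) u *s N x)) <= eps / 2"
     using tangential_reset[OF e2] by blast
    define s where "s = Min {s0, sr, \<sigma>} / 4"
    have s: "0 < s" "s < s0" "s < sr" "2 * s < \<sigma>" using s0(1) sr(1) \<sigma> by (auto simp: s_def min_def)
    from s0(2)[OF s(1,2)] obtain u2 where u2: "norm (u2 - n) < \<eta> & (gam t2 : bdry --> norm (u2 - N (gam t2)) < \<eta>) &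
     gam t2 + s *R u2 : D & kob z (gam t2 + s *R u2) <= l' * t2 + eps / 2" by (rule exE)
    have uN: "norm (u2 - N (gam t2)) < \<eta>" using u2 fr by blast
    define q where "q = herm (N (gam t2)) u2"
    have "cmod (q - 1) <= \<eta>"
    proof -
     have "q - 1 = herm (N (gam t2)) (u2 - N (gam t2))" using N1 by (simp add: q_def herm_diff_right herm_self)
     thus ?thesis using herm_norm_le[of "N (gam t2)" "u2 - N (gam t2)"] N1 uN by simp
    qed
    hence q: "Re q >= 3 / 4" "\<bar>Im q\<bar> <= \<eta>" "cmod q <= 2"
     using abs_Re_le_cmod[of "q - 1"] abs_Im_le_cmod[of "q - 1"] norm_triangle_ineq2[of q 1] \<eta>(2) by auto
    have q0: "q ~= 0" using q(1) by auto
    have n2: "norm u2 <= 2" using norm_triangle_ineq[of "u2 - N (gam t2)" "N (gam t2)"] N1 uN \<eta>(2) by simp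
    have q14: "1 / 4 <= Re (herm (N (gam t2)) u2)" using q(1) by (simp add: q_def)
    note rs = sr(2)[OF fr n2 q14 s(1,3), folded q_def]
    define q2 where "q2 = q / of_real (cmod q)"
    define s2 where "s2 = s * cmod q"
    have "s * cmod q <= s * 2" using q(3) s(1) by (intro mult_left_mono) auto
    hence "s2 < \<sigma>" using s(4) unfolding s2_def by linarith
    moreover have "0 < s2" using s(1) q0 by (simp add: s2_def)
    moreover have "cmod q2 = 1" using q0 by (simp add: q2_def norm_divide)
    moreover have "cmod (q2 - 1) <= kap + eps" using unit_normalise_close[OF q(1)] q(2) \<eta>(3) e by (simp add: q2_def)
    moreover have "s2 *R (q2 *s N (gam t2)) = s *R (q *s N (gam t2))"
     using q0 by (simp add: s2_def q2_def vec_eq_iff scaleR_complex)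
    moreover have "kob z (lifted t2 s q) <= l' * t2 + eps"
     using kobayashi_triangle[OF dom z conjunct1[OF rs] conjunct1[OF conjunct2[OF rs]]] conjunct2[OF conjunct2[OF rs]] u2 by simp
    ultimately show ?thesis using rs by (intro exI[of _ s2] exI[of _ q2]) simp
   qed
   thus ?thesis using False unfolding reach_def by blast
  qed
 qed
qed

text \<open>Leaving the boundary requires only that the phase error is below the threshold for error 1 at the end, since at small height the end point is close to the path.\<close>
lemma reach_exit:
 assumes z: "z : D" and p: "pushes l' 1 d t1 t2" "d > 0" and kap: "0 <= kap" "kap <= d / 2"
  and r1: "reach l' kap z t1" and fr: "gam t1 : bdry" and i2: "gam t2 : D"
 shows "reach l' kap z t2"
proof (rule reach_inI[OF i2])
 fix eps :: real assume e: "eps > 0"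
 hence e2: "eps / 2 > 0" by simp
 have N1: "norm (N (gam t1)) = 1" by (rule inward_norm[OF fr])
 have "gam t1 \<notin> D" using fr frontier_notin by blast
 then obtain n where n: "norm n <= 1" "!!u1 s. norm (u1 - N (gam t1)) < d ==> 0 < s ==> s < d ==>
    (pushed l' 1 n s t1 u1 t2)"
  using p(1) fr unfolding pushes_def by blast
 obtain d1 where d1: "d1 > 0" "!!y. dist y (gam t2) < d1 ==> y : D & kob (gam t2) y <= eps / 2 & kob y (gam t2) <= eps / 2"
  using kobayashi_small_near[OF dom i2 e2] by blast
 define eps1 where "eps1 = min (eps / 2) (d / 4)"
 have e1: "eps1 > 0" "eps1 <= eps / 2" "eps1 <= d / 4" using e p(2) by (auto simp: eps1_def)
 have \<sigma>: "min d (d1 / 4) > 0" using p(2) d1(1) by simp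
 obtain s q where sq: "0 < s" "s < min d (d1 / 4)" "cmod q = 1" "cmod (q - 1) <= kap + eps1" "lifted t1 s q : D"
  "kob z (lifted t1 s q) <= l' * t1 + eps1"
  using r1 fr e1(1) \<sigma> unfolding reach_def by blast
 have "q *s N (gam t1) - N (gam t1) = (q - 1) *s N (gam t1)" by (simp add: vec_eq_iff algebra_simps)
 hence "norm (q *s N (gam t1) - N (gam t1)) = cmod (q - 1)" by (simp only: norm_smult N1 mult_1_right)
 hence ud: "norm (q *s N (gam t1) - N (gam t1)) < d" using sq(4) kap e1(3) p(2) by simp
 have sd: "s < d" "s * 2 < d1" using sq(1,2) by auto
 from n(2)[OF ud sq(1) sd(1)] obtain u2 where u2: "norm (u2 - n) < 1 & (gam t2 : bdry --> norm (u2 - N (gam t2)) < 1) &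
   lifted t1 s q : D & gam t2 + s *R u2 : D & kob (lifted t1 s q) (gam t2 + s *R u2) <= l' * (t2 - t1)" by (rule exE)
 have "norm u2 <= 2" using norm_triangle_ineq[of "u2 - n" n] n(1) u2 by simp
 hence "s * norm u2 <= s * 2" using sq(1) by (intro mult_left_mono) auto
 moreover have "dist (gam t2 + s *R u2) (gam t2) = s * norm u2" using sq(1) by (simp add: dist_norm)
 ultimately have "dist (gam t2 + s *R u2) (gam t2) < d1" using sd(2) by linarith
 hence k3: "kob (gam t2 + s *R u2) (gam t2) <= eps / 2" using d1(2) by blast
 have m: "gam t2 + s *R u2 : D" and k2: "kob (lifted t1 s q) (gam t2 + s *R u2) <= l' * (t2 - t1)" using u2 by blast+
 have "kob z (gam t2) <= (l' * t1 + eps1) + l' * (t2 - t1) + eps / 2"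
  using kobayashi_triangle[OF dom z sq(5) m] kobayashi_triangle[OF dom z m i2] k2 k3 sq(6) by linarith
 also have "... <= l' * t2 + eps" using e1(2) by (simp add: algebra_simps)
 finally show "kob z (gam t2) <= l' * t2 + eps" .
qed

text \<open>Along the boundary phase errors add only eps.\<close>
lemma reach_run:
 assumes z: "z : D" and t: "t1 <= t2" and sl: "slides l' t1 t2" and kap: "0 <= kap" "kap <= 1 / 4"
  and r1: "reach l' kap z t1" and fr: "gam ` {t1..t2} <= bdry"
 shows "reach l' kap z t2"
proof -
 have fr12: "gam t1 : bdry" "gam t2 : bdry" using fr t by auto
 have "EX s q. 0 < s & s < \<sigma> & cmod q = 1 & cmod (q - 1) <= kap + eps &
  lifted t2 s q : D & kob z (lifted t2 s q) <= l' * t2 + eps" if e: "eps > 0" and \<sigma>: "\<sigma> > 0" for eps \<sigma>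
 proof -
  define eps1 where "eps1 = min (eps / 2) (1 / 4)"
  have e1: "eps1 > 0" "2 * eps1 <= eps" "eps1 <= 1 / 4" using e by (auto simp: eps1_def)
  from mp[OF spec[OF mp[OF sl[unfolded slides_def] fr], of eps1] e1(1)] obtain s0 where s0: "s0 > 0 & (ALL s q1. cmod q1 = 1 --> cmod (q1 - 1) <= 1 / 2 --> 0 < s --> s < s0 -->
  (slid l' eps1 t1 t2 s q1))" by (rule exE)
  have pos: "min s0 (\<sigma> / 2) > 0" using s0 \<sigma> by simp
  obtain s q where sq: "0 < s" "s < min s0 (\<sigma> / 2)" "cmod q = 1" "cmod (q - 1) <= kap + eps1" "lifted t1 s q : D"
   "kob z (lifted t1 s q) <= l' * t1 + eps1"
   using r1 fr12(1) e1(1) pos unfolding reach_def by blast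
  have q12: "cmod (q - 1) <= 1 / 2" and ss: "s < s0" using sq(2,4) kap e1(3) by auto
  from conjunct2[OF s0, rule_format, OF sq(3) q12 sq(1) ss] obtain q2 s' where
   q2c: "cmod q2 = 1 & cmod (q2 - q) <= eps1 & s / 2 <= s' & s' <= 2 * s &
   lifted t1 s q : D & lifted t2 s' q2 : D &
   kob (lifted t1 s q) (lifted t2 s' q2) <= l' * (t2 - t1) + eps1" by (elim exE) (rule that)
  have q2: "cmod q2 = 1" "cmod (q2 - q) <= eps1" "s / 2 <= s'" "s' <= 2 * s" "lifted t2 s' q2 : D"
   "kob (lifted t1 s q) (lifted t2 s' q2) <= l' * (t2 - t1) + eps1"
   using q2c by blast+
  have "0 < s'" "s' < \<sigma>" using sq(1,2) q2(3,4) by auto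
  moreover have "cmod (q2 - 1) <= kap + eps" using norm_triangle_ineq[of "q2 - q" "q - 1"] q2(2) sq(4) e1(2) by simp
  moreover have "kob z (lifted t2 s' q2) <= l' * t2 + eps"
   using kobayashi_triangle[OF dom z sq(5) q2(5)] q2(6) sq(6) e1(2) by (simp add: algebra_simps)
  ultimately show ?thesis using q2(1,5) by blast
 qed
 thus ?thesis using fr12(2) frontier_notin unfolding reach_def by blast
qed

text \<open>Fix the threshold for leaving the boundary first, then the error \<eta> on entering, then a step length that suits both; a step that meets D and the boundary is split at a point of D.\<close>
lemma reach_end:
 assumes z: "gam 0 : D" and w: "gam L : D" and L: "0 <= L" and l': "1 < l'"
 shows "kob (gam 0) (gam L) <= l' * L"
proof -
 \<comment> \<open>Any radius below 1 with 1 / r < l' serves.\<close>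
 define r where "r = 2 / (1 + l')"
 have r: "0 < r" "r < 1" "1 / r < l'" using l' by (auto simp: r_def field_simps)
 have short: "EX \<mu>>0. ALL t1:{0..L}. ALL t2:{0..L}. t1 <= t2 --> t2 - t1 < \<mu> --> pushes l' \<eta> \<mu> t1 t2" if "\<eta> > 0" for \<eta>
 proof (rule local_to_short_intervals[of L "pushes l' \<eta>"])
  show "pushes l' \<eta> d' t1 t2" if "pushes l' \<eta> d t1 t2" "d' <= d" for d d' t1 t2 by (rule pushes_anti[OF that])
 qed (rule pushes_locally[OF _ r that])
 obtain \<mu>1 where \<mu>1: "\<mu>1 > 0" "!!t1 t2. t1 : {0..L} ==> t2 : {0..L} ==> t1 <= t2 ==> t2 - t1 < \<mu>1 ==> pushes l' 1 \<mu>1 t1 t2"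
  using short[OF zero_less_one] by blast
 define \<eta> where "\<eta> = min (\<mu>1 / 8) (1 / 16)"
 define kap where "kap = 4 * \<eta>"
 have \<eta>: "0 < \<eta>" "\<eta> <= 1 / 8" "4 * \<eta> <= kap" "0 <= kap" "kap <= \<mu>1 / 2" "kap <= 1 / 4" using \<mu>1(1) by (auto simp: \<eta>_def kap_def min_def)
 obtain \<mu>2 where \<mu>2: "\<mu>2 > 0" "!!t1 t2. t1 : {0..L} ==> t2 : {0..L} ==> t1 <= t2 ==> t2 - t1 < \<mu>2 ==> pushes l' \<eta> \<mu>2 t1 t2"
  using short[OF \<eta>(1)] by blast
 obtain \<mu>3 where \<mu>3: "\<mu>3 > 0" "!!t1 t2. t1 : {0..L} ==> t2 : {0..L} ==> t1 <= t2 ==> t2 - t1 < \<mu>3 ==> slides l' t1 t2"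
 proof -
  have "EX \<mu>>0. ALL t1:{0..L}. ALL t2:{0..L}. t1 <= t2 --> t2 - t1 < \<mu> --> slides l' t1 t2"
   by (rule local_to_short_intervals[of L "%_. slides l'"]) (rule slides_locally[OF _ r])
  thus thesis using that by blast
 qed
 define \<mu> where "\<mu> = Min {\<mu>1, \<mu>2, \<mu>3}"
 have \<mu>: "\<mu> > 0" "\<mu> <= \<mu>1" "\<mu> <= \<mu>2" "\<mu> <= \<mu>3"
  subgoal using \<mu>1(1) \<mu>2(1) \<mu>3(1) by (simp add: \<mu>_def)
  unfolding \<mu>_def by (intro Min_le; simp)+
 have step: "reach l' kap (gam 0) t2" if t: "t1 : {0..L}" "t2 : {0..L}" "t1 <= t2" "t2 - t1 < \<mu>" and r1: "reach l' kap (gam 0) t1" for t1 t2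
 proof -
  have from_in: "reach l' kap (gam 0) t2" if "t : {t1..t2}" "reach l' kap (gam 0) t" "gam t : D" for t
  proof -
   have tt: "t : {0..L}" "t <= t2" "t2 - t < \<mu>2" using that(1) t \<mu>(3) by auto
   show ?thesis by (rule reach_from_inside[OF z tt(1) t(2) tt(2) \<mu>2(2)[OF tt(1) t(2) tt(2,3)] \<mu>2(1) \<eta>(1-3) that(2,3)])
  qed
  show ?thesis
  proof (cases "gam t1 : D")
   case True
   thus ?thesis using from_in[of t1] r1 t(3) by simp
  next
   case False
   hence fr: "gam t1 : bdry" using path_frontier_or_in[OF t(1)] by blast
   show ?thesis
   proof (cases "gam ` {t1..t2} <= bdry")
    case True
    show ?thesis by (rule reach_run[OF z t(3) \<mu>3(2)[OF t(1-3) less_le_trans[OF t(4) \<mu>(4)]] \<eta>(4,6) r1 True])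
   next
    case False
    then obtain t where tt: "t : {t1..t2}" "gam t \<notin> bdry" by blast
    have tL: "t : {0..L}" "t1 <= t" "t - t1 < \<mu>1" using tt(1) t \<mu>(2) by auto
    have i: "gam t : D" using path_frontier_or_in[OF tL(1)] tt(2) by blast
    have "reach l' kap (gam 0) t" by (rule reach_exit[OF z \<mu>1(2)[OF t(1) tL] \<mu>1(1) \<eta>(4,5) r1 fr i])
    thus ?thesis using from_in[OF tt(1)] i by blast
   qed
  qed
 qed
 have r0: "reach l' kap (gam 0) 0" by (rule reach_inI[OF z]) (simp add: kobayashi_refl[OF dom z])
 obtain n where n: "L < real n * \<mu>" using \<mu>(1) reals_Archimedean3 by blast
 have "real n > 0" using n L \<mu>(1) by (metis gr_zeroI less_le_not_le mult_zero_left of_nat_0 of_nat_0_less_iff)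
 define T where "T k = L * real k / real n" for k :: nat
 have Tin: "T k : {0..L}" if "k <= n" for k
  using that \<open>real n > 0\<close> L mult_left_mono[of "real k" "real n" L] by (simp add: T_def pos_divide_le_eq)
 have "reach l' kap (gam 0) (T k)" if "k <= n" for k
  using that
 proof (induction k)
  case 0
  thus ?case using r0 by (simp add: T_def)
 next
  case (Suc k)
  have diff: "T (Suc k) - T k = L / real n" by (simp add: T_def algebra_simps add_divide_distrib)
  have "L / real n < \<mu>" using n \<open>real n > 0\<close> by (simp add: pos_divide_less_eq mult.commute)
  moreover have "0 <= L / real n" using L by simp
  ultimately have tt: "T k <= T (Suc k)" "T (Suc k) - T k < \<mu>" using diff by linarith+
  have k: "k <= n" using Suc.prems by simp
  show ?case by (rule step[OF Tin[OF k] Tin[OF Suc.prems] tt Suc.IH[OF k]])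
 qed
 from this[of n] have "reach l' kap (gam 0) L" using \<open>real n > 0\<close> by (simp add: T_def)
 thus ?thesis using w unfolding reach_def by blast
qed

lemma kobayashi_le_path_length:
 assumes "gam 0 : D" "gam L : D" "0 <= L"
 shows "kob (gam 0) (gam L) <= L"
proof (rule field_le_epsilon)
 fix e :: real assume e: "e > 0"
 have "kob (gam 0) (gam L) <= (1 + e / (L + 1)) * L" by (rule reach_end[OF assms]) (use e assms(3) in simp)
 also have "... = L + e * (L / (L + 1))" by (simp add: algebra_simps)
 also have "e * (L / (L + 1)) <= e * 1" using e assms(3) by (intro mult_left_mono) auto
 finally show "kob (gam 0) (gam L) <= L + e" by simp
qed

end

text \<open>The links of a nearly optimal chain are finitely many, and each is estimated by the Lempert half.\<close>
lemma kobayashi_eventually_less: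
 assumes D: "domain D" "z : D" "w : D" and c: "kobayashi D z w < c" and Dn: "!!n. domain (Dn n)"
  and exh: "!!K. compact K ==> K <= D ==> EX n0. ALL n>=n0. K <= Dn n"
 shows "EVS n. kobayashi (Dn n) z w < c"
proof -
 obtain m p where p: "chain D m p z w" "chain_len D m p < c" by (rule kobayashi_approx[OF D c])
 have m: "m >= 1" and pD: "!!j. j <= m ==> p j : D" and ends: "p 0 = z" "p m = w" using p(1) unfolding chain_def by auto
 define eps where "eps = (c - chain_len D m p) / (2 * real m)"
 have eps: "eps > 0" "real m * eps < c - chain_len D m p" using p(2) m by (simp_all add: eps_def)
 have "EVS n. ALL j:{1..m}. lempert (Dn n) (p (j - 1)) (p j) < lempert D (p (j - 1)) (p j) + eps"
 proof (rule eventually_ball_finite)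
  show "ALL j:{1..m}. EVS n. lempert (Dn n) (p (j - 1)) (p j) < lempert D (p (j - 1)) (p j) + eps"
  proof
   fix j assume j: "j : {1..m}"
   show "EVS n. lempert (Dn n) (p (j - 1)) (p j) < lempert D (p (j - 1)) (p j) + eps"
    by (rule lempert_eventually_less[OF D(1) _ _ _ exh]) (use j pD eps(1) in auto)
  qed
 qed simp
 moreover have "EVS n. p ` {..m} <= Dn n"
 proof -
  have "EX n0. ALL n>=n0. p ` {..m} <= Dn n" by (rule exh) (use pD in \<open>auto intro: finite_imp_compact\<close>)
  thus ?thesis unfolding eventually_sequentially .
 qed
 ultimately show ?thesis
 proof eventually_elim
  case (elim n)
  have "chain (Dn n) m p z w" using m elim(2) ends unfolding chain_def by auto
  hence "kobayashi (Dn n) z w <= chain_len (Dn n) m p" by (rule kobayashi_le_chain[OF Dn])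
  also have "... <= (\<Sum>j=1..m. lempert D (p (j - 1)) (p j) + eps)"
   unfolding chain_len_def by (rule sum_mono) (use elim(1) in \<open>auto intro: less_imp_le\<close>)
  also have "... = chain_len D m p + real m * eps" by (simp add: chain_len_def sum.distrib)
  also have "... < c" using eps(2) by simp
  finally show ?case .
 qed
qed

text \<open>Shorter chains in infinitely many D_n would give a limit path from z to w in the closure of D that is shorter than the Kobayashi distance.\<close>
lemma (in taut_dom) kobayashi_eventually_greater:
 fixes Dn :: "nat => (complex ^ 'm) set"
 assumes Dn: "!!n. domain (Dn n)" "!!n. bounded (Dn n)"
  and haus: "(%n. hausdorff_dist (closure (Dn n)) (closure D)) ----> 0"
  and exh: "!!K. compact K ==> K <= D ==> EX n0. ALL n>=n0. K <= Dn n"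
  and zw: "z : D" "w : D" and c: "c < kob z w"
 shows "EVS n. c < kobayashi (Dn n) z w"
proof -
 have "EX n0. ALL n>=n0. {z, w} <= Dn n" by (rule exh) (use zw in auto)
 hence ev_zw: "EVS n. {z, w} <= Dn n" unfolding eventually_sequentially .
 show ?thesis
 proof (cases "c < 0")
  case True
  from ev_zw show ?thesis
  proof eventually_elim
   case (elim n)
   hence "0 <= kobayashi (Dn n) z w" by (intro kobayashi_nonneg Dn) auto
   thus ?case using True by simp
  qed
 next
  case False
  obtain B where B: "!!x. x : closure D ==> norm x <= B"
   using bounded_closure[OF bdd] bounded_iff by metis
  define L where "L = (c + kob z w) / 2"
  have L: "L > 0" "c < L" "L < kob z w" using False c by (auto simp: L_def)
  have "closure D ~= {}" using zw(1) closure_subset by fastforce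
  have ev_h: "EVS n. hausdorff_dist (closure (Dn n)) (closure D) < 1"
   by (rule order_tendstoD(2)[OF haus]) simp
  show ?thesis
  proof (rule ccontr)
   assume neg: "\<not> ?thesis"
   define good where "good n \<longleftrightarrow> \<not> (c < kobayashi (Dn n) z w) & {z, w} <= Dn n & hausdorff_dist (closure (Dn n)) (closure D) < 1" for n
   have "\<not> (EVS n. \<not> good n)"
   proof
    assume "EVS n. \<not> good n"
    hence "EVS n. c < kobayashi (Dn n) z w" using ev_zw ev_h
     by eventually_elim (auto simp: good_def)
    thus False using neg by blast
   qed
   from not_eventually_sequentiallyD[OF this] obtain r :: "nat => nat" where r0: "strict_mono r & (ALL n. \<not> \<not> good (r n))" by (rule exE)
   hence r: "strict_mono r" "good (r n)" for n by auto
   have g: "\<not> c < kobayashi (Dn (r n)) z w" "z : Dn (r n)" "w : Dn (r n)" "hausdorff_dist (closure (Dn (r n))) (closure D) < 1" for n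
    using r(2)[of n] unfolding good_def by auto
   have nB: "norm x <= B + 1" if x: "x : Dn (r n)" for x n
   proof -
    have xc: "x : closure (Dn (r n))" using x closure_subset by blast
    have ne: "closure (Dn (r n)) ~= {}"
    proof
     assume "closure (Dn (r n)) = {}"
     thus False using xc by simp
    qed
    obtain y where y: "y : closure D" "dist x y < 1"
     by (rule hausdorff_dist_lessD[OF g(4) ne \<open>closure D ~= {}\<close> bounded_closure[OF Dn(2)] bounded_closure[OF bdd] xc])
    have "norm x <= norm y + dist x y" using norm_triangle_ineq[of y "x - y"] by (simp add: dist_norm)
    thus ?thesis using B[OF y(1)] y(2) by linarith
   qed
   have ad: "approx_dom D (%n. Dn (r n)) (B + 1)"
   proof (intro approx_dom.intro taut_dom_axioms approx_dom_axioms.intro)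
    show "(%n. hausdorff_dist (closure (Dn (r n))) (closure D)) ----> 0"
     using LIMSEQ_subseq_LIMSEQ[OF haus r(1)] by (simp add: o_def)
   qed (use Dn nB in auto)
   have "EX gam. disc_path (Dn (r n)) L gam & gam 0 = z & gam L = w" for n
    by (rule disc_path_kobayashi[OF Dn(1) g(2,3)]) (use g(1)[of n] L(2) in linarith)
   hence "ALL n. EX gam. disc_path (Dn (r n)) L gam & gam 0 = z & gam L = w" by blast
   from choice[OF this] obtain gam where gam: "ALL n. disc_path (Dn (r n)) L (gam n) & gam n 0 = z & gam n L = w" by blast
   obtain \<delta> where \<delta>: "lim_path D \<delta> L" "\<delta> 0 = z" "\<delta> L = w"
    using approx_dom.limit_path_exists[OF ad L(1), of gam z w] gam by blast
   have "kob (\<delta> 0) (\<delta> L) <= L"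
    by (rule lim_path.kobayashi_le_path_length[OF \<delta>(1)]) (use \<delta>(2,3) zw L(1) in auto)
   thus False using \<delta>(2,3) L(3) by simp
  qed
 qed
qed

theorem corollary2p3:
  fixes D :: "(complex ^ 'm) set" and Dn :: "nat \<Rightarrow> (complex ^ 'm) set"
    and z w :: "complex ^ 'm"
  assumes "domain D" and "bounded D" and "taut D" and "C11_boundary D"
    and "\<And>n. domain (Dn n)" and "\<And>n. bounded (Dn n)"
    and "(\<lambda>n. hausdorff_dist (closure (Dn n)) (closure D)) \<longlonglongrightarrow> 0"
    and "\<And>K. compact K \<Longrightarrow> K \<subseteq> D \<Longrightarrow> \<exists>n0. \<forall>n\<ge>n0. K \<subseteq> Dn n"
    and "z \<in> D" and "w \<in> D"
  shows "(\<lambda>n. kobayashi (Dn n) z w) \<longlonglongrightarrow> kobayashi D z w \<and>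
    (\<lambda>n. lempert (Dn n) z w) \<longlonglongrightarrow> lempert D z w"
proof -
  interpret taut_dom D using assms(1-4) by unfold_locales
  show ?thesis
  proof (intro conjI order_tendstoI)
    show "\<forall>\<^sub>F n in sequentially. c < kobayashi (Dn n) z w" if "c < kobayashi D z w" for c
      by (rule kobayashi_eventually_greater[OF assms(5-10) that])
    show "\<forall>\<^sub>F n in sequentially. kobayashi (Dn n) z w < c" if "kobayashi D z w < c" for c
      by (rule kobayashi_eventually_less[OF assms(1,9,10) that assms(5,8)])
    show "\<forall>\<^sub>F n in sequentially. c < lempert (Dn n) z w" if "c < lempert D z w" for c
      by (rule lempert_eventually_greater[OF assms(1-10) that])
    show "\<forall>\<^sub>F n in sequentially. lempert (Dn n) z w < c" if "lempert D z w < c" for c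
      by (rule lempert_eventually_less[OF assms(1,9,10) that assms(8)])
  qed
qed

end
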